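(* There exist absolute constants such that the following holds for every connected unweighted undirected graph $G$ on $n$ nodes and every $\mathcal{D}>0$: there exists a $\mathcal{D}$-preserving distance labeling scheme based on hub sets such that: (i) when $\mathcal{D}\leq \sqrt n / (\ln n \ln \ln n)$, the hub sets of all nodes are of size $O(n/\mathcal{D})$, which corresponds to distance labels of size $O(n \log \mathcal{D}/\mathcal{D})$ bits per node; (ii) for any $\mathcal{D}>0$, the hub sets of all nodes are of size $O(\log \mathcal{D} + n \log \log \mathcal{D}/\mathcal{D})$, which corresponds to distance labels of size $O(\log^2 \mathcal{D} + n \log \mathcal{D} \log \log \mathcal{D}/\mathcal{D})$ bits per node; (iii) for any $\mathcal{D}>0$, the average size of a hub set, taken over all nodes, is $O(n/\mathcal{D})$, which corresponds to distance labels of average size $O(n \log \mathcal{D} /\mathcal{D})$ bits per node. Furthermore, the corresponding labels can be constructed in expected polynomial time.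
   Context: $G=(V,E)$ is a connected unweighted undirected graph with $n=|V|$ nodes and shortest-path distance $d(\cdot,\cdot)$. A hub labeling assigns to each node $u$ a set $S(u)\subseteq V$ (its hub set); the label of $u$ stores $S(u)$ together with the distances $d(u,w)$ for $w\in S(u)$, and the decoder, given the labels of $u$ and $v$, returns $d'(u,v)=\min_{w\in S(u)\cap S(v)} \big(d(u,w)+d(w,v)\big)$. The scheme is $\mathcal{D}$-preserving if $d'(u,v)=d(u,v)$ for every pair of nodes $u,v$ with $d(u,v)>\mathcal{D}$. *)

theory Defs
  imports "HOL-Probability.SPMF" "HOL-Library.Extended_Nat"
begin

section \<open>Graphs and hub labelings\<close>

text \<open>
  A finite simple graph on \<open>n\<close> nodes has node set \<open>{..<n}\<close>; its undirected edges are given as a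
  symmetric irreflexive relation.
\<close>

definition connected_graph :: "nat \<Rightarrow> (nat \<times> nat) set \<Rightarrow> bool" where
  "connected_graph n E \<longleftrightarrow>
     n > 0 \<and> E \<subseteq> {..<n} \<times> {..<n} \<and> sym E \<and> irrefl E \<and> (\<forall>u<n. \<forall>v<n. (u, v) \<in> E\<^sup>*)"

text \<open>Shortest-path distance (meaningful for nodes of the same connected component).\<close>

definition gdist :: "(nat \<times> nat) set \<Rightarrow> nat \<Rightarrow> nat \<Rightarrow> nat" where
  "gdist E u v = (LEAST k. (u, v) \<in> E ^^ k)"

text \<open>The decoded distance \<open>d'\<close>; it is \<open>\<infinity>\<close> if the two hub sets are disjoint.\<close>

definition hub_dist :: "(nat \<times> nat) set \<Rightarrow> (nat \<Rightarrow> nat set) \<Rightarrow> nat \<Rightarrow> nat \<Rightarrow> enat" where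
  "hub_dist E S u v = (INF w \<in> S u \<inter> S v. enat (gdist E u w + gdist E w v))"

definition D_preserving :: "nat \<Rightarrow> (nat \<times> nat) set \<Rightarrow> real \<Rightarrow> (nat \<Rightarrow> nat set) \<Rightarrow> bool" where
  "D_preserving n E D S \<longleftrightarrow>
     (\<forall>u<n. \<forall>v<n. real (gdist E u v) > D \<longrightarrow> hub_dist E S u v = enat (gdist E u v))"

text \<open>
  The information carried by the label of \<open>u\<close>: the hubs of \<open>u\<close> together with their distances from
  \<open>u\<close>. Nodes are referred to by the identifiers \<open>\<nu> w\<close>, which a labeling scheme may choose.
\<close>

definition hub_table ::
  "(nat \<times> nat) set \<Rightarrow> (nat \<Rightarrow> nat) \<Rightarrow> (nat \<Rightarrow> nat set) \<Rightarrow> nat \<Rightarrow> (nat \<times> nat) set" where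
  "hub_table E \<nu> S u = (\<lambda>w. (\<nu> w, gdist E u w)) ` S u"

text \<open>
  \<open>rd\<close> reads the hub table off a bit string. It sees nothing but that string; where it is used it
  is one function for all graphs and all thresholds.
\<close>

definition stores_hubs ::
  "(bool list \<Rightarrow> (nat \<times> nat) set) \<Rightarrow> nat \<Rightarrow> (nat \<times> nat) set \<Rightarrow> (nat \<Rightarrow> nat set) \<Rightarrow>
     (nat \<Rightarrow> bool list) \<Rightarrow> bool" where
  "stores_hubs rd n E S L \<longleftrightarrow>
     (\<exists>\<nu>. bij_betw \<nu> {..<n} {..<n} \<and> (\<forall>u<n. rd (L u) = hub_table E \<nu> S u))"

text \<open>The distance decoder, working on two labels.\<close>

definition decode ::
  "(bool list \<Rightarrow> (nat \<times> nat) set) \<Rightarrow> bool list \<Rightarrow> bool list \<Rightarrow> enat" where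
  "decode rd l l' = Inf {enat (a + b) | i a b. (i, a) \<in> rd l \<and> (i, b) \<in> rd l'}"

lemma relpow_sym: "sym E \<Longrightarrow> sym (E ^^ k)"
proof (induction k)
  case 0
  then show ?case by (auto simp: sym_def)
next
  case (Suc k)
  have "(x, z) \<in> E ^^ Suc k \<Longrightarrow> (z, x) \<in> E ^^ Suc k" for x z
    using Suc by (metis relpow_Suc_E relpow_Suc_I2 symE)
  then show ?case by (auto simp: sym_def)
qed

lemma gdist_commute: "sym E \<Longrightarrow> gdist E u v = gdist E v u"
  unfolding gdist_def by (metis relpow_sym symE)

lemma decode_eq_hub_dist:
  assumes "connected_graph n E" "\<forall>u<n. S u \<subseteq> {..<n}" "stores_hubs rd n E S L" "u < n" "v < n"
  shows "decode rd (L u) (L v) = hub_dist E S u v"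
proof -
  obtain \<nu> where \<nu>: "bij_betw \<nu> {..<n} {..<n}" "\<forall>u<n. rd (L u) = hub_table E \<nu> S u"
    using assms(3) unfolding stores_hubs_def by blast
  have inj: "\<nu> x = \<nu> y \<Longrightarrow> x \<in> S u \<Longrightarrow> y \<in> S v \<Longrightarrow> x = y" for x y
    using \<nu>(1) assms(2,4,5) unfolding bij_betw_def inj_on_def by blast
  have comm: "gdist E v w = gdist E w v" for w
    using gdist_commute assms(1) unfolding connected_graph_def by blast
  have ru: "rd (L u) = hub_table E \<nu> S u" and rv: "rd (L v) = hub_table E \<nu> S v"
    using \<nu>(2) assms(4,5) by auto
  have "{enat (a + b) | i a b. (i, a) \<in> rd (L u) \<and> (i, b) \<in> rd (L v)} =
        (\<lambda>w. enat (gdist E u w + gdist E w v)) ` (S u \<inter> S v)" (is "?A = ?B")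
  proof
    show "?A \<subseteq> ?B"
    proof
      fix x assume "x \<in> ?A"
      then obtain w w' where w: "w \<in> S u" "w' \<in> S v" "\<nu> w = \<nu> w'"
        "x = enat (gdist E u w + gdist E v w')"
        unfolding ru rv hub_table_def by auto
      have "w = w'" using inj[OF w(3,1,2)] .
      then show "x \<in> ?B" using w comm by auto
    qed
    show "?B \<subseteq> ?A"
    proof
      fix x assume "x \<in> ?B"
      then obtain w where w: "w \<in> S u" "w \<in> S v" "x = enat (gdist E u w + gdist E v w)"
        using comm by auto
      then have "(\<nu> w, gdist E u w) \<in> rd (L u)" "(\<nu> w, gdist E v w) \<in> rd (L v)"
        unfolding ru rv hub_table_def by auto
      then show "x \<in> ?A" using w(3) by blast
    qed
  qed
  then show ?thesis unfolding decode_def hub_dist_def by simp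
qed

section \<open>The size bounds\<close>

text \<open>
  Logarithms inside the bounds are truncated from below at 1, so that the bounds make sense for all
  \<open>D > 0\<close>; for \<open>D\<close> large enough this changes nothing.
\<close>

definition lg :: "real \<Rightarrow> real" where
  "lg x = max 1 (log 2 x)"

definition sizes_small ::
  "real \<Rightarrow> nat \<Rightarrow> real \<Rightarrow> (nat \<Rightarrow> nat set) \<Rightarrow> (nat \<Rightarrow> bool list) \<Rightarrow> bool" where
  "sizes_small C n D S L \<longleftrightarrow>
     (D \<le> sqrt (real n) / (ln (real n) * ln (ln (real n))) \<longrightarrow>
        (\<forall>u<n. real (card (S u)) \<le> C * (real n / D) \<and>
               real (length (L u)) \<le> C * (real n * lg D / D))) \<and>
     (\<forall>u<n. real (card (S u)) \<le> C * (lg D + real n * lg (lg D) / D) \<and>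
            real (length (L u)) \<le> C * ((lg D)\<^sup>2 + real n * lg D * lg (lg D) / D)) \<and>
     (\<Sum>u<n. real (card (S u))) / real n \<le> C * (real n / D) \<and>
     (\<Sum>u<n. real (length (L u))) / real n \<le> C * (real n * lg D / D)"

definition hub_labeling ::
  "real \<Rightarrow> (bool list \<Rightarrow> (nat \<times> nat) set) \<Rightarrow> nat \<Rightarrow> (nat \<times> nat) set \<Rightarrow> real \<Rightarrow>
     (nat \<Rightarrow> nat set) \<Rightarrow> (nat \<Rightarrow> bool list) \<Rightarrow> bool" where
  "hub_labeling C rd n E D S L \<longleftrightarrow>
     (\<forall>u<n. S u \<subseteq> {..<n}) \<and> D_preserving n E D S \<and> stores_hubs rd n E S L \<and> sizes_small C n D S L"

section \<open>Randomized programs and their running time\<close>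

text \<open>
  Randomized random-access programs at unit cost. The memory consists of named, zero-initialized
  two-dimensional arrays of natural numbers, a scalar being an array entry at a fixed position.
  Since \<open>+\<close> and truncated \<open>-\<close> are the only arithmetic operations, a number computed in \<open>t\<close> steps has
  \<open>O(t)\<close> bits more than the input numbers, so that unit cost is a reasonable measure for polynomial
  time. Expressions are part of the program text, hence of constant size.
\<close>

type_synonym vname = string
type_synonym mem = "vname \<Rightarrow> nat \<Rightarrow> nat \<Rightarrow> nat"

datatype aexp = N nat | Get vname aexp aexp | Plus aexp aexp | Minus aexp aexp

datatype bexp = Less aexp aexp | Not bexp | And bexp bexp

datatype com =
    Skip
  | Assign vname aexp aexp aexp  \<comment> \<open>\<open>Assign x i j e\<close> is \<open>x[i, j] := e\<close>\<close>
  | Flip vname aexp aexp         \<comment> \<open>\<open>x[i, j]\<close> becomes a fair random bit\<close>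
  | Seq com com
  | If bexp com com
  | While bexp com

primrec aval :: "aexp \<Rightarrow> mem \<Rightarrow> nat" where
  "aval (N k) s = k"
| "aval (Get x i j) s = s x (aval i s) (aval j s)"
| "aval (Plus a b) s = aval a s + aval b s"
| "aval (Minus a b) s = aval a s - aval b s"

primrec bval :: "bexp \<Rightarrow> mem \<Rightarrow> bool" where
  "bval (Less a b) s = (aval a s < aval b s)"
| "bval (Not b) s = (\<not> bval b s)"
| "bval (And b c) s = (bval b s \<and> bval c s)"

definition upd :: "mem \<Rightarrow> vname \<Rightarrow> nat \<Rightarrow> nat \<Rightarrow> nat \<Rightarrow> mem" where
  "upd s x i j k = s(x := (s x)(i := (s x i)(j := k)))"

partial_function (spmf) loop ::
  "(mem \<Rightarrow> bool) \<Rightarrow> (mem \<Rightarrow> (mem \<times> nat) spmf) \<Rightarrow> mem \<Rightarrow> (mem \<times> nat) spmf" where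
  "loop b f s =
     (if b s
      then bind_spmf (f s) (\<lambda>(s1, t1).
             bind_spmf (loop b f s1) (\<lambda>(s2, t2). return_spmf (s2, Suc (t1 + t2))))
      else return_spmf (s, 1))"

text \<open>
  Distribution of the pair (final memory, number of steps). The missing probability mass is the
  probability of divergence.
\<close>

primrec run :: "com \<Rightarrow> mem \<Rightarrow> (mem \<times> nat) spmf" where
  "run Skip s = return_spmf (s, 1)"
| "run (Assign x i j e) s = return_spmf (upd s x (aval i s) (aval j s) (aval e s), 1)"
| "run (Flip x i j) s =
     map_spmf (\<lambda>c. (upd s x (aval i s) (aval j s) (of_bool c), 1)) coin_spmf"
| "run (Seq c d) s =
     bind_spmf (run c s) (\<lambda>(s1, t1).
       bind_spmf (run d s1) (\<lambda>(s2, t2). return_spmf (s2, t1 + t2)))"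
| "run (If b c d) s = map_spmf (\<lambda>(s1, t1). (s1, Suc t1)) (if bval b s then run c s else run d s)"
| "run (While b c) s = loop (bval b) (run c) s"

definition expected_time :: "com \<Rightarrow> mem \<Rightarrow> ennreal" where
  "expected_time c s =
     (if lossless_spmf (run c s)
      then \<integral>\<^sup>+ (s', t). ennreal (real t) \<partial>measure_spmf (run c s) else \<infinity>)"

text \<open>
  The input is the adjacency matrix of the graph, the number of its nodes, and \<open>\<lfloor>D\<rfloor>\<close>; as distances
  are integers, \<open>D\<close> and \<open>\<lfloor>D\<rfloor>\<close> define the same pairs at distance greater than \<open>D\<close>.
\<close>

definition input :: "nat \<Rightarrow> (nat \<times> nat) set \<Rightarrow> real \<Rightarrow> mem" where
  "input n E D = (\<lambda>x i j.
     if x = ''n'' \<and> i = 0 \<and> j = 0 then n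
     else if x = ''D'' \<and> i = 0 \<and> j = 0 then nat \<lfloor>D\<rfloor>
     else if x = ''adj'' \<and> (i, j) \<in> E then 1
     else 0)"

definition out_labels :: "mem \<Rightarrow> nat \<Rightarrow> bool list" where
  "out_labels s u = map (\<lambda>k. s ''bit'' u k \<noteq> 0) [0..<s ''len'' u 0]"

end

theory Submission
  imports Defs "HOL-Library.Nat_Bijection"
begin

text \<open>
  Ties between shortest paths are broken by edge weights, so that there is one path \<open>P u v\<close> for each
  pair, symmetric and closed under subpaths. Take the nodes in a random order and let \<open>w\<close> be a
  hub of \<open>u\<close> if \<open>w\<close> comes first on \<open>P u w\<close>, or on \<open>P u x\<close> for some \<open>x\<close> at the smallest of the levels from
  \<open>8 j\<close> to \<open>16 j\<close>, which has at most \<open>n / (8 j)\<close> nodes, where \<open>j = D div 32\<close>. If \<open>d u v > D\<close>, then the first node of \<open>P u v\<close> is a common hub of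
  \<open>u\<close> and \<open>v\<close>. Levels below \<open>8 j\<close> may be ignored, so a hub of the first kind has to come first among at
  least \<open>8 j\<close> nodes, which leaves \<open>O(n/D)\<close> hubs on average.

  For bounds that hold at every node, the number of targets which one pick can cover has to be small.
  A node \<open>y\<close> is called heavy for \<open>u\<close> if it lies on \<open>P u w\<close> for at least \<open>n / l\<close> nodes \<open>w\<close>, where \<open>n\<close> has \<open>l\<close>
  bits; there are at most \<open>l\<close> such nodes on each level. If \<open>(8 j l)\<^sup>2 \<le> n\<close>, heavy nodes at distance less
  than \<open>8 j l\<close> become hubs outright and are left out of all paths, while the longer paths are hit by
  one small global set \<open>X\<close>. Leaving out heavy nodes may spoil the comparison of the two ends of \<open>P u v\<close>,
  which is repaired by a second observer at each node that sees only distances of at least \<open>16 j\<close>.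
  Otherwise \<open>X\<close> hits all paths of length \<open>2 j\<close>, and the heavy paths of length \<open>2 j\<close> that start in \<open>X\<close> are hit
  by the early nodes of the order.

  The random order is derandomized: each node is picked so as to minimize a potential whose
  average over all candidates does not increase. The resulting algorithm is deterministic and consists of
  for-loops with bounds polynomial in \<open>n\<close>.

  For the label lengths, the nodes are numbered such that consecutive ones have total distance at most
  \<open>2 n\<close>. Along this numbering the differences of identifiers and of distances from \<open>u\<close> sum up to
  \<open>O(n)\<close>, and the hubs of \<open>u\<close> are stored by these differences in \<open>O(log D)\<close> bits per hub and
  \<open>O(n/D)\<close> further bits.
\<close>

section \<open>Loop programs\<close>

text \<open>A bound per node needs more than averages. The hubs \<open>c\<close> of one observer
  with \<open>Z\<close> alive targets are controlled through \<open>p ^ (Z + j * c)\<close>, where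
  \<open>p = 1 + 1 / k\<close>: a pick that kills \<open>x\<close> targets helps in proportion to
  \<open>x\<close> only up to about \<open>x = k\<close>, hence the limit on targets that share a
  node. With \<open>k\<close> near \<open>2 * n / l + 8 * j\<close> the start value
  \<open>p ^ n\<close> is at most \<open>2 * n\<close>, and logarithms give
  \<open>j * c = O(n + j * l)\<close>.

  The condition \<open>(8 * j * l)\<^sup>2 \<le> n\<close> makes the heavy nodes on
  \<open>8 * j * l\<close> levels fit into \<open>O(n / j)\<close> hubs. Without it
  \<open>l = O(log D)\<close>, but \<open>O(n * l * l / j)\<close> heavy pieces must be hit. Their
  number falls to \<open>O(n / j)\<close> in \<open>log (l * l)\<close> rounds of about
  \<open>n / e\<close> picks, whence \<open>log log D\<close>; the rest takes one pick each.

  The multiples of \<open>j\<close> form a chain: cutting \<open>4 * j\<close> possibly heavy levels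
  off a target with \<open>8 * j\<close> nodes leaves \<open>4 * j = 2 * e\<close>; a segment needs
  \<open>16 * j\<close> nodes to offer \<open>8 * j\<close> levels to choose from, and a path needs
  \<open>32 * j\<close> nodes so that \<open>16 * j\<close> of them remain for the second
  observer.\<close>

text \<open>
  The bound of a loop \<open>For v b p\<close> is a variable that \<open>p\<close> does not change. So programs terminate, and \<open>tmb\<close>
  reads a polynomial bound for the number of steps off the text.
\<close>

datatype lp =
    Skp
  | Asg vname aexp aexp aexp
  | Sq lp lp (infixr \<open>;;\<close> 60)
  | Cnd bexp lp lp
  | For vname vname lp

abbreviation V :: "vname \<Rightarrow> aexp" where "V x \<equiv> Get x (N 0) (N 0)"
abbreviation Set1 :: "vname \<Rightarrow> aexp \<Rightarrow> lp" (infix \<open>::=\<close> 65) where "x ::= e \<equiv> Asg x (N 0) (N 0) e"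
abbreviation setv :: "mem \<Rightarrow> vname \<Rightarrow> nat \<Rightarrow> mem" where "setv s x k \<equiv> upd s x 0 0 k"

text \<open>The number of rounds is read once, before the loop. This agrees with the while loop that
  \<open>cpl\<close> produces because \<open>ok\<close> forbids the body to touch the counter or the
  bound.\<close>

primrec exec :: "lp \<Rightarrow> mem \<Rightarrow> mem" where
  "exec Skp s = s"
| "exec (Asg x i j e) s = upd s x (aval i s) (aval j s) (aval e s)"
| "exec (p ;; q) s = exec q (exec p s)"
| "exec (Cnd b p q) s = (if bval b s then exec p s else exec q s)"
| "exec (For v b p) s =
     ((\<lambda>s. let s' = exec p s in setv s' v (Suc (s' v 0 0))) ^^ (s b 0 0)) (setv s v 0)"

primrec cpl :: "lp \<Rightarrow> com" where
  "cpl Skp = Skip"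
| "cpl (Asg x i j e) = Assign x i j e"
| "cpl (p ;; q) = Seq (cpl p) (cpl q)"
| "cpl (Cnd b p q) = If b (cpl p) (cpl q)"
| "cpl (For v b p) = Seq (Assign v (N 0) (N 0) (N 0))
     (While (Less (V v) (V b)) (Seq (cpl p) (Assign v (N 0) (N 0) (Plus (V v) (N 1)))))"

primrec mods :: "lp \<Rightarrow> vname set" where
  "mods Skp = {}"
| "mods (Asg x i j e) = {x}"
| "mods (p ;; q) = mods p \<union> mods q"
| "mods (Cnd b p q) = mods p \<union> mods q"
| "mods (For v b p) = insert v (mods p)"

primrec bnds :: "lp \<Rightarrow> vname set" where
  "bnds Skp = {}"
| "bnds (Asg x i j e) = {}"
| "bnds (p ;; q) = bnds p \<union> bnds q"
| "bnds (Cnd b p q) = bnds p \<union> bnds q"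
| "bnds (For v b p) = insert b (bnds p)"

primrec ok :: "lp \<Rightarrow> bool" where
  "ok Skp = True"
| "ok (Asg x i j e) = True"
| "ok (p ;; q) = (ok p \<and> ok q)"
| "ok (Cnd b p q) = (ok p \<and> ok q)"
| "ok (For v b p) = (ok p \<and> v \<notin> mods p \<and> b \<notin> mods p \<and> v \<noteq> b)"

text \<open>\<open>M\<close> bounds all loop bounds. A round costs two steps beyond its body, the
  increment and the loop test; the initialization and the last test give the summand 2.\<close>

primrec tmb :: "lp \<Rightarrow> nat \<Rightarrow> nat" where
  "tmb Skp M = 1"
| "tmb (Asg x i j e) M = 1"
| "tmb (p ;; q) M = tmb p M + tmb q M"
| "tmb (Cnd b p q) M = Suc (tmb p M + tmb q M)"
| "tmb (For v b p) M = 2 + M * (tmb p M + 2)"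

lemma upd_apply: "upd s x i j k y a b = (if y = x \<and> a = i \<and> b = j then k else s y a b)"
  by (auto simp: upd_def)

lemma upd_other [simp]: "y \<noteq> x \<Longrightarrow> upd s x i j k y = s y"
  by (auto simp: upd_def)

lemma upd_same [simp]: "upd s x i j k x i j = k"
  by (auto simp: upd_def)

lemma exec_frame: "x \<notin> mods p \<Longrightarrow> exec p s x = s x"
proof (induction p arbitrary: s)
  case (For v b p)
  have "((\<lambda>s. let s' = exec p s in setv s' v (Suc (s' v 0 0))) ^^ m) s x = s x" for m s
    using For by (induction m) (auto simp: Let_def)
  then show ?case using For.prems by simp
qed auto

text \<open>Everything outside \<open>mods p\<close> except the counter is handed to the step as
  unchanged, so that an invariant only has to speak about what the body writes.\<close>

lemma For_inv:
  assumes "ok (For v b p)" and init: "I 0 (setv s v 0)"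
    and step: "\<And>k s'. k < s b 0 0 \<Longrightarrow> I k s' \<Longrightarrow> s' v 0 0 = k \<Longrightarrow>
      (\<And>x. x \<noteq> v \<Longrightarrow> x \<notin> mods p \<Longrightarrow> s' x = s x) \<Longrightarrow> I (Suc k) (setv (exec p s') v (Suc k))"
  shows "I (s b 0 0) (exec (For v b p) s)"
proof -
  let ?f = "\<lambda>s. let s' = exec p s in setv s' v (Suc (s' v 0 0))"
  have "m \<le> s b 0 0 \<Longrightarrow> I m ((?f ^^ m) (setv s v 0)) \<and> (?f ^^ m) (setv s v 0) v 0 0 = m \<and>
     (\<forall>x. x \<noteq> v \<longrightarrow> x \<notin> mods p \<longrightarrow> (?f ^^ m) (setv s v 0) x = s x)" for m
  proof (induction m)
    case 0
    then show ?case using init by simp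
  next
    case (Suc m)
    let ?s = "(?f ^^ m) (setv s v 0)"
    have v: "v \<notin> mods p" using assms(1) by simp
    have IH: "I m ?s" "?s v 0 0 = m" "\<And>x. x \<noteq> v \<Longrightarrow> x \<notin> mods p \<Longrightarrow> ?s x = s x"
      using Suc by auto
    have *: "?f ?s = setv (exec p ?s) v (Suc m)"
      using IH(2) v by (simp add: Let_def exec_frame)
    have "I (Suc m) (?f ?s)" unfolding * using Suc.prems IH by (intro step) auto
    then show ?case using * IH(3) by (simp add: exec_frame)
  qed
  then show ?thesis by simp
qed

text \<open>Loop bounds are never written, so their initial values bound the length of every loop
  met during the run, and without coin flips the distribution is a single point.\<close>

lemma run_cpl:
  assumes "ok p" "bnds p \<inter> mods p = {}" "\<And>b. b \<in> bnds p \<Longrightarrow> s b 0 0 \<le> M"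
  shows "\<exists>t \<le> tmb p M. run (cpl p) s = return_spmf (exec p s, t)"
  using assms
proof (induction p arbitrary: s)
  case Skp
  then show ?case by auto
next
  case (Asg x i j e)
  then show ?case by auto
next
  case (Sq p q)
  obtain t1 where t1: "t1 \<le> tmb p M" "run (cpl p) s = return_spmf (exec p s, t1)"
    using Sq.IH(1)[of s] Sq.prems by auto
  have "exec p s b 0 0 \<le> M" if "b \<in> bnds q" for b
  proof -
    have "b \<notin> mods p" using that Sq.prems(2) by auto
    then show ?thesis using that Sq.prems(3)[of b] by (simp add: exec_frame)
  qed
  then obtain t2 where t2: "t2 \<le> tmb q M" "run (cpl q) (exec p s) = return_spmf (exec q (exec p s), t2)"
    using Sq.IH(2)[of "exec p s"] Sq.prems by auto
  show ?case using t1 t2 by auto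
next
  case (Cnd b p q)
  obtain t1 where t1: "t1 \<le> tmb p M" "run (cpl p) s = return_spmf (exec p s, t1)"
    using Cnd.IH(1)[of s] Cnd.prems by auto
  obtain t2 where t2: "t2 \<le> tmb q M" "run (cpl q) s = return_spmf (exec q s, t2)"
    using Cnd.IH(2)[of s] Cnd.prems by auto
  show ?case using t1 t2 by auto
next
  case (For v b p)
  let ?f = "\<lambda>s. let s' = exec p s in setv s' v (Suc (s' v 0 0))"
  let ?b = "Less (V v) (V b)"
  let ?c = "Seq (cpl p) (Assign v (N 0) (N 0) (Plus (V v) (N 1)))"
  have vp: "v \<notin> mods p" "b \<notin> mods p" "v \<noteq> b" using For.prems by auto
  \<comment> \<open>Generalized to a loop entered in the middle: \<open>m\<close> is the number of
    rounds left.\<close>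
  have L: "\<exists>t \<le> 1 + m * (tmb p M + 2).
      loop (bval ?b) (run ?c) s = return_spmf ((?f ^^ m) s, t)"
    if "s b 0 0 = s v 0 0 + m" "\<And>x. x \<in> bnds (For v b p) \<Longrightarrow> s x 0 0 \<le> M" for m s
    using that
  proof (induction m arbitrary: s)
    case 0
    then show ?case by (subst loop.simps) simp
  next
    case (Suc m)
    obtain t1 where t1: "t1 \<le> tmb p M" "run (cpl p) s = return_spmf (exec p s, t1)"
      using For.IH[of s] Suc.prems For.prems by auto
    have fr: "?f s x = s x" if "x \<noteq> v" "x \<notin> mods p" for x
      using that by (simp add: Let_def exec_frame)
    have fv: "?f s v 0 0 = Suc (s v 0 0)" using vp by (simp add: Let_def exec_frame)
    have bf: "?f s x 0 0 \<le> M" if "x \<in> bnds (For v b p)" for x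
    proof -
      have "?f s x = s x" using that For.prems(2) by (intro fr) auto
      then show ?thesis using Suc.prems(2)[OF that] by (simp only:)
    qed
    have "?f s b 0 0 = ?f s v 0 0 + m" using fv fr[of b] vp Suc.prems(1) by simp
    from Suc.IH[of "?f s", OF this bf] obtain t where
      t: "t \<le> 1 + m * (tmb p M + 2)" "loop (bval ?b) (run ?c) (?f s) = return_spmf ((?f ^^ m) (?f s), t)"
      by blast
    have r: "run ?c s = return_spmf (?f s, t1 + 1)"
      using t1 by (simp add: Let_def)
    have "loop (bval ?b) (run ?c) s = return_spmf ((?f ^^ Suc m) s, Suc (t1 + 1 + t))"
      using Suc.prems(1) r t(2) by (subst loop.simps) (simp add: funpow_Suc_right del: funpow.simps)
    moreover have "Suc (t1 + 1 + t) \<le> 1 + Suc m * (tmb p M + 2)" using t1 t by simp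
    ultimately show ?case by blast
  qed
  have "\<exists>t \<le> 1 + s b 0 0 * (tmb p M + 2).
      loop (bval ?b) (run ?c) (setv s v 0) = return_spmf ((?f ^^ s b 0 0) (setv s v 0), t)"
  proof (rule L)
    show "setv s v 0 b 0 0 = setv s v 0 v 0 0 + s b 0 0" using vp by simp
    show "setv s v 0 x 0 0 \<le> M" if "x \<in> bnds (For v b p)" for x
      using For.prems(3)[OF that] by (auto simp: upd_apply)
  qed
  then obtain t where t: "t \<le> 1 + s b 0 0 * (tmb p M + 2)"
     "loop (bval ?b) (run ?c) (setv s v 0) = return_spmf ((?f ^^ s b 0 0) (setv s v 0), t)"
    by blast
  have "1 + s b 0 0 * (tmb p M + 2) \<le> 1 + M * (tmb p M + 2)"
    using mult_le_mono1[OF For.prems(3)[of b], of "tmb p M + 2"] by simp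
  then have "1 + t \<le> tmb (For v b p) M" using t(1) by simp
  moreover have "run (cpl (For v b p)) s = return_spmf (exec (For v b p) s, 1 + t)"
    using t(2) by simp
  ultimately show ?case by blast
qed

text \<open>Exponents of sequential parts are added instead of maximized, which spares case
  distinctions; a loop raises the exponent by one.\<close>

lemma tmb_poly: "\<exists>c k. \<forall>M. tmb p M \<le> c * (M + 1) ^ k"
proof (induction p)
  case (Sq p q)
  then obtain c1 k1 c2 k2 where h: "\<And>M. tmb p M \<le> c1 * (M + 1) ^ k1" "\<And>M. tmb q M \<le> c2 * (M + 1) ^ k2"
    by metis
  have "tmb (p ;; q) M \<le> (c1 + c2) * (M + 1) ^ (k1 + k2)" for M
  proof -
    have "(M + 1) ^ k1 \<le> (M + 1) ^ (k1 + k2)" "(M + 1) ^ k2 \<le> (M + 1) ^ (k1 + k2)"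
      by (auto intro: power_increasing)
    then have "c1 * (M + 1) ^ k1 \<le> c1 * (M + 1) ^ (k1 + k2)" "c2 * (M + 1) ^ k2 \<le> c2 * (M + 1) ^ (k1 + k2)"
      by (auto intro: mult_le_mono)
    then show ?thesis using h(1)[of M] h(2)[of M] unfolding tmb.simps add_mult_distrib by linarith
  qed
  then show ?case by blast
next
  case (Cnd b p q)
  then obtain c1 k1 c2 k2 where h: "\<And>M. tmb p M \<le> c1 * (M + 1) ^ k1" "\<And>M. tmb q M \<le> c2 * (M + 1) ^ k2"
    by metis
  have "tmb (Cnd b p q) M \<le> (c1 + c2 + 1) * (M + 1) ^ (k1 + k2)" for M
  proof -
    have "(M + 1) ^ k1 \<le> (M + 1) ^ (k1 + k2)" "(M + 1) ^ k2 \<le> (M + 1) ^ (k1 + k2)"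
      by (auto intro: power_increasing)
    then have "c1 * (M + 1) ^ k1 \<le> c1 * (M + 1) ^ (k1 + k2)" "c2 * (M + 1) ^ k2 \<le> c2 * (M + 1) ^ (k1 + k2)"
      by (auto intro: mult_le_mono)
    moreover have "1 \<le> (M + 1) ^ (k1 + k2)" by simp
    ultimately show ?thesis using h(1)[of M] h(2)[of M] unfolding tmb.simps add_mult_distrib by linarith
  qed
  then show ?case by blast
next
  case (For v b p)
  then obtain c k where h: "\<And>M. tmb p M \<le> c * (M + 1) ^ k" by metis
  have "tmb (For v b p) M \<le> (c + 4) * (M + 1) ^ (k + 1)" for M
  proof -
    have "1 \<le> (M + 1) ^ k" by simp
    then have "tmb p M + 2 \<le> (c + 2) * (M + 1) ^ k" using h[of M] unfolding add_mult_distrib by linarith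
    then have "M * (tmb p M + 2) \<le> (M + 1) * ((c + 2) * (M + 1) ^ k)" by (intro mult_le_mono) auto
    moreover have "2 \<le> 2 * (M + 1) ^ (k + 1)"
      using one_le_power[of "M + 1" "k + 1"] by linarith
    ultimately show ?thesis unfolding tmb.simps by (simp add: algebra_simps)
  qed
  then show ?case by blast
qed (auto intro: exI[of _ 1] exI[of _ 0])

section \<open>Unique shortest paths\<close>

text \<open>The properties of tie-broken shortest paths on which the hub construction rests; weights
  do not occur in it. \<open>P_lev\<close> and \<open>P_uniq\<close> together give one node per
  distance level, so path lengths can be counted as cardinalities.\<close>

locale paths =
  fixes n :: nat and d :: "nat \<Rightarrow> nat \<Rightarrow> nat" and P :: "nat \<Rightarrow> nat \<Rightarrow> nat set"
  assumes n_pos: "n > 0"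
    and d_sym: "u < n \<Longrightarrow> v < n \<Longrightarrow> d u v = d v u"
    and d_self: "d u u = 0"
    and d_less: "u < n \<Longrightarrow> v < n \<Longrightarrow> d u v < n"
    and P_sub: "P u v \<subseteq> {..<n}"
    and P_sym: "u < n \<Longrightarrow> v < n \<Longrightarrow> P u v = P v u"
    and P_d: "u < n \<Longrightarrow> v < n \<Longrightarrow> x \<in> P u v \<Longrightarrow> d u x + d x v = d u v"
    and P_lev: "u < n \<Longrightarrow> v < n \<Longrightarrow> k \<le> d u v \<Longrightarrow> \<exists>x \<in> P u v. d u x = k"
    and P_end: "u < n \<Longrightarrow> v < n \<Longrightarrow> v \<in> P u v"
    and d_tri: "u < n \<Longrightarrow> v < n \<Longrightarrow> x < n \<Longrightarrow> d u v \<le> d u x + d x v"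
    and P_uniq: "u < n \<Longrightarrow> v < n \<Longrightarrow> x \<in> P u v \<Longrightarrow> y \<in> P u v \<Longrightarrow> d u x = d u y \<Longrightarrow> x = y"
    and P_trans: "u < n \<Longrightarrow> v < n \<Longrightarrow> x \<in> P u v \<Longrightarrow> y \<in> P u x \<Longrightarrow> y \<in> P u v"

section \<open>Tie-breaking weights and lightest walks\<close>

context
  fixes n :: nat and E :: "(nat \<times> nat) set"
begin

text \<open>
  Along a path from \<open>u\<close> to \<open>v\<close> with node set \<open>A\<close> and \<open>k\<close> edges, the weights add up to
  \<open>2 ^ (n + 2) * k + 2 * set_encode A - 2 ^ u - 2 ^ v\<close>. So a lightest path is a shortest one, and its
  weight determines \<open>A\<close>.
\<close>

definition wt :: "nat \<Rightarrow> nat \<Rightarrow> nat" where "wt x y = 2 ^ (n + 2) + 2 ^ x + 2 ^ y"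

inductive walk :: "nat \<Rightarrow> nat \<Rightarrow> nat \<Rightarrow> nat set \<Rightarrow> nat \<Rightarrow> bool" for u where
  walk0: "walk u u 0 {u} 0"
| walkS: "walk u x k A c \<Longrightarrow> (x, v) \<in> E \<Longrightarrow> walk u v (Suc k) (insert v A) (c + wt x v)"

definition wdist :: "nat \<Rightarrow> nat \<Rightarrow> nat" where
  "wdist u v = (LEAST c. \<exists>k A. walk u v k A c)"

text \<open>A betweenness test in the weighted metric. It needs nothing but a distance table, so the
  program never stores a path.\<close>

definition geo :: "nat \<Rightarrow> nat \<Rightarrow> nat set" where
  "geo u v = {x. x < n \<and> wdist u x + wdist x v = wdist u v}"

lemma walk_relpow: "walk u v k A c \<Longrightarrow> (u, v) \<in> E ^^ k"
  by (induction rule: walk.induct) auto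

lemma relpow_walk: "(u, v) \<in> E ^^ k \<Longrightarrow> \<exists>A c. walk u v k A c"
proof (induction k arbitrary: v)
  case 0
  then show ?case using walk0 by auto
next
  case (Suc k)
  then show ?case using walkS by (metis relpow_Suc_E)
qed

lemma walk_app: "walk x v k' A' c' \<Longrightarrow> walk u x k A c \<Longrightarrow> walk u v (k + k') (A \<union> A') (c + c')"
proof (induction rule: walk.induct)
  case walk0
  have "x \<in> A" using walk0 by (cases rule: walk.cases) auto
  then show ?case using walk0 by (simp add: insert_absorb)
next
  case (walkS y k' A' c' v)
  from walk.walkS[OF walkS.IH[OF walkS.prems] walkS.hyps(2)] show ?case
    by (simp add: add.assoc)
qed

context
  assumes G: "connected_graph n E"
begin

lemma symE: "(x, y) \<in> E \<Longrightarrow> (y, x) \<in> E"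
  using G by (auto simp: connected_graph_def sym_def)

lemma E_less: "(x, y) \<in> E \<Longrightarrow> x < n \<and> y < n"
  using G by (auto simp: connected_graph_def)

lemma walk_rev: "walk u v k A c \<Longrightarrow> walk v u k A c"
proof (induction rule: walk.induct)
  case walk0
  show ?case by (rule walk.walk0)
next
  case (walkS x k A c v)
  have "walk v x 1 {v, x} (wt v x)"
    using walk.walkS[OF walk.walk0[of v] symE[OF walkS.hyps(2)]] by (simp add: insert_commute)
  from walk_app[OF walkS.IH this] have "walk v u (1 + k) ({v, x} \<union> A) (wt v x + c)" .
  moreover have "x \<in> A" using walkS.hyps(1) by (cases rule: walk.cases) auto
  then have "{v, x} \<union> A = insert v A" by auto
  ultimately show ?case by (simp add: wt_def algebra_simps)
qed

lemma gdist_walk: "u < n \<Longrightarrow> v < n \<Longrightarrow> \<exists>A c. walk u v (gdist E u v) A c"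
proof -
  assume "u < n" "v < n"
  then have "(u, v) \<in> E\<^sup>*" using G by (auto simp: connected_graph_def)
  then obtain k where "(u, v) \<in> E ^^ k" by (meson rtrancl_imp_relpow)
  then have "(u, v) \<in> E ^^ gdist E u v" unfolding gdist_def by (rule LeastI)
  then show ?thesis by (rule relpow_walk)
qed

lemma gdist_le: "walk u v k A c \<Longrightarrow> gdist E u v \<le> k"
  unfolding gdist_def by (auto intro: Least_le dest: walk_relpow)

lemma gdist_self [simp]: "gdist E u u = 0"
  using gdist_le[OF walk0] by simp

lemma gdist_tri:
  assumes "u < n" "v < n" "x < n"
  shows "gdist E u v \<le> gdist E u x + gdist E x v"
proof -
  obtain A c A' c' where "walk u x (gdist E u x) A c" "walk x v (gdist E x v) A' c'"
    using gdist_walk assms by metis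
  from walk_app[OF this(2,1)] show ?thesis by (rule gdist_le)
qed

lemma walk_less: "walk u v k A c \<Longrightarrow> u < n \<Longrightarrow> v < n \<and> A \<subseteq> {..<n}"
  by (induction rule: walk.induct) (auto dest: E_less)

lemma walk_fin: "walk u v k A c \<Longrightarrow> finite A"
  by (induction rule: walk.induct) auto

lemma walk_split:
  "walk u v k A c \<Longrightarrow> y \<in> A \<Longrightarrow>
     \<exists>k1 k2 A1 A2 c1 c2. walk u y k1 A1 c1 \<and> walk y v k2 A2 c2 \<and> k1 + k2 = k \<and> c1 + c2 = c"
proof (induction rule: walk.induct)
  case walk0
  then show ?case using walk.walk0[of u] by force
next
  case (walkS x k A c v)
  show ?case
  proof (cases "y \<in> A")
    case True
    from walkS.IH[OF this] obtain k1 k2 A1 A2 c1 c2 where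
      h: "walk u y k1 A1 c1" "walk y x k2 A2 c2" "k1 + k2 = k" "c1 + c2 = c" by blast
    from walk.walkS[OF h(2) walkS.hyps(2)] h show ?thesis by (metis add_Suc_right add.assoc)
  next
    case False
    then have "y = v" using walkS.prems by simp
    then show ?thesis using walk.walkS[OF walkS.hyps(1,2)] walk.walk0[of v] by (metis add_0_right)
  qed
qed

text \<open>A prefix of a walk with the fewest edges has the fewest edges too. So distances from
  \<open>u\<close> grow by one per step, nodes never repeat, and each inner node contributes its
  power of two exactly twice, each end once.\<close>

lemma short_walk:
  assumes "walk u v k A c" "u < n" "k = gdist E u v"
  shows "c + 2 ^ u + 2 ^ v = 2 ^ (n + 2) * k + 2 * set_encode A \<and>
    (\<forall>y \<in> A. gdist E u y \<le> k) \<and> (\<forall>y \<in> A. \<forall>z \<in> A. gdist E u y = gdist E u z \<longrightarrow> y = z) \<and>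
    (\<forall>i \<le> k. \<exists>y \<in> A. gdist E u y = i)"
  using assms
proof (induction rule: walk.induct)
  case walk0
  then show ?case by (simp add: set_encode_def)
next
  case (walkS x k A c v)
  have x: "x < n" "v < n" using E_less walkS.hyps by auto
  have "gdist E x v \<le> 1" using gdist_le[OF walk.walkS[OF walk.walk0 walkS.hyps(2)]] by simp
  then have "gdist E u v \<le> gdist E u x + 1" using gdist_tri[of u v x] x walkS.prems by simp
  then have kx: "k = gdist E u x" using gdist_le[OF walkS.hyps(1)] walkS.prems by simp
  note IH = walkS.IH[OF walkS.prems(1) kx]
  have vA: "v \<notin> A" using IH walkS.prems by auto
  have "set_encode (insert v A) = 2 ^ v + set_encode A"
    using walk_fin[OF walkS.hyps(1)] vA by simp
  then have 1: "c + wt x v + 2 ^ u + 2 ^ v = 2 ^ (n + 2) * Suc k + 2 * set_encode (insert v A)"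
    using IH unfolding wt_def by (simp add: algebra_simps)
  have 2: "\<forall>y \<in> insert v A. gdist E u y \<le> Suc k" using IH walkS.prems by auto
  have 3: "\<forall>y \<in> insert v A. \<forall>z \<in> insert v A. gdist E u y = gdist E u z \<longrightarrow> y = z"
  proof (intro ballI impI)
    fix y z assume "y \<in> insert v A" "z \<in> insert v A" "gdist E u y = gdist E u z"
    moreover have "gdist E u a \<noteq> gdist E u v" if "a \<in> A" for a
      using IH that walkS.prems(2) by force
    ultimately show "y = z" using IH by (metis insert_iff)
  qed
  have 4: "\<forall>i \<le> Suc k. \<exists>y \<in> insert v A. gdist E u y = i"
    using IH walkS.prems(2) by (metis insert_iff le_Suc_eq)
  show ?case using 1 2 3 4 by blast
qed

lemma sum_pow2_less: "(\<Sum>i<m. 2 ^ i) < (2::nat) ^ m"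
  by (induction m) auto

lemma set_encode_less: "A \<subseteq> {..<n} \<Longrightarrow> set_encode A < 2 ^ n"
proof -
  assume "A \<subseteq> {..<n}"
  then have "set_encode A \<le> (\<Sum>i<n. 2 ^ i)" unfolding set_encode_def by (intro sum_mono2) auto
  also have "\<dots> < 2 ^ n" by (rule sum_pow2_less)
  finally show ?thesis .
qed

lemma gdist_less:
  assumes "u < n" "v < n" shows "gdist E u v < n"
proof -
  obtain A c where w: "walk u v (gdist E u v) A c" using gdist_walk assms by blast
  have "{..gdist E u v} \<subseteq> gdist E u ` A" using short_walk[OF w assms(1) refl] by (auto simp: image_iff)
  then have "card {..gdist E u v} \<le> card A"
    using walk_fin[OF w] by (meson card_image_le card_mono finite_imageI le_trans)
  also have "\<dots> \<le> n" using walk_less[OF w assms(1)] by (metis card_lessThan card_mono finite_lessThan)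
  finally show ?thesis by simp
qed

lemma walk_lower: "walk u v k A c \<Longrightarrow> 2 ^ (n + 2) * k \<le> c"
  by (induction rule: walk.induct) (auto simp: wt_def)

text \<open>Along a shortest path the powers of two sum up to less than \<open>2 ^ (n + 2)\<close>,
  the price of one more edge. Hence a lightest walk also has the fewest edges.\<close>

lemma wdist_walk:
  assumes "u < n" "v < n"
  shows "\<exists>A. walk u v (gdist E u v) A (wdist u v)"
proof -
  obtain A0 c0 where w0: "walk u v (gdist E u v) A0 c0" using gdist_walk assms by blast
  then have "\<exists>c k A. walk u v k A c" by blast
  then have "\<exists>k A. walk u v k A (wdist u v)" unfolding wdist_def by (rule LeastI_ex)
  then obtain k A where w: "walk u v k A (wdist u v)" by blast
  have le: "wdist u v \<le> c0" unfolding wdist_def by (rule Least_le) (use w0 in blast)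
  have "set_encode A0 < 2 ^ n" using walk_less[OF w0 assms(1)] by (intro set_encode_less) auto
  then have "c0 < 2 ^ (n + 2) * (gdist E u v + 1)"
    using short_walk[OF w0 assms(1) refl] by (simp add: algebra_simps)
  then have "2 ^ (n + 2) * k < 2 ^ (n + 2) * (gdist E u v + 1)"
    using walk_lower[OF w] le by linarith
  then have "k < gdist E u v + 1" using mult_less_cancel1 by blast
  then have "k = gdist E u v" using gdist_le[OF w] by simp
  then show ?thesis using w by blast
qed

lemma wdist_le: "walk u v k A c \<Longrightarrow> wdist u v \<le> c"
  unfolding wdist_def by (rule Least_le) blast

lemma wdist_min: "walk u v k A (wdist u v) \<Longrightarrow> u < n \<Longrightarrow> v < n \<Longrightarrow> k = gdist E u v"
proof -
  assume w: "walk u v k A (wdist u v)" and uv: "u < n" "v < n"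
  obtain A0 where w0: "walk u v (gdist E u v) A0 (wdist u v)" using wdist_walk uv by blast
  have "set_encode A0 < 2 ^ n" using walk_less[OF w0 uv(1)] by (intro set_encode_less) auto
  then have "wdist u v < 2 ^ (n + 2) * (gdist E u v + 1)"
    using short_walk[OF w0 uv(1) refl] by (simp add: algebra_simps)
  then have "2 ^ (n + 2) * k < 2 ^ (n + 2) * (gdist E u v + 1)"
    using walk_lower[OF w] by linarith
  then have "k < gdist E u v + 1" using mult_less_cancel1 by blast
  then show ?thesis using gdist_le[OF w] by simp
qed

text \<open>Provides a finite number that can stand for infinity when lightest weights are
  computed.\<close>

lemma wdist_bound: "u < n \<Longrightarrow> v < n \<Longrightarrow> wdist u v < n * 2 ^ (n + 3)"
proof -
  assume uv: "u < n" "v < n"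
  obtain A0 where w0: "walk u v (gdist E u v) A0 (wdist u v)" using wdist_walk uv by blast
  have "set_encode A0 < 2 ^ n" using walk_less[OF w0 uv(1)] by (intro set_encode_less) auto
  then have "wdist u v < 2 ^ (n + 2) * (gdist E u v + 1)"
    using short_walk[OF w0 uv(1) refl] by (simp add: algebra_simps)
  also have "\<dots> \<le> 2 ^ (n + 2) * n" using gdist_less[OF uv] by (intro mult_le_mono) auto
  also have "\<dots> \<le> n * 2 ^ (n + 3)" by (simp add: power_add)
  finally show ?thesis .
qed

lemma wdist_sym: "wdist u v = wdist v u"
  unfolding wdist_def using walk_rev by metis

lemma wdist_tri:
  assumes "u < n" "v < n" "x < n"
  shows "wdist u v \<le> wdist u x + wdist x v"
  using wdist_walk[of u x] wdist_walk[of x v] walk_app wdist_le assms by metis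

lemma geo_walk:
  assumes "u < n" "v < n" "x \<in> geo u v"
  shows "\<exists>A. walk u v (gdist E u v) A (wdist u v) \<and> x \<in> A"
    and "gdist E u x + gdist E x v = gdist E u v"
proof -
  have x: "x < n" "wdist u x + wdist x v = wdist u v" using assms by (auto simp: geo_def)
  obtain A A' where w: "walk u x (gdist E u x) A (wdist u x)" "walk x v (gdist E x v) A' (wdist x v)"
    using wdist_walk assms x by meson
  from walk_app[OF w(2,1)] have
    w': "walk u v (gdist E u x + gdist E x v) (A \<union> A') (wdist u v)" using x by simp
  from wdist_min[OF this assms(1,2)] show "gdist E u x + gdist E x v = gdist E u v" .
  moreover have "x \<in> A" using w(1) by (cases rule: walk.cases) auto
  ultimately show "\<exists>A. walk u v (gdist E u v) A (wdist u v) \<and> x \<in> A"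
    using w' by auto
qed

lemma walk_geo:
  assumes "u < n" "v < n" "walk u v k A (wdist u v)" "x \<in> A"
  shows "x \<in> geo u v"
proof -
  obtain k1 k2 A1 A2 c1 c2 where
    w: "walk u x k1 A1 c1" "walk x v k2 A2 c2" "c1 + c2 = wdist u v"
    using walk_split[OF assms(3,4)] by blast
  have x: "x < n" using walk_less[OF assms(3,1)] assms(4) by auto
  have "wdist u x \<le> c1" "wdist x v \<le> c2" using w wdist_le by auto
  then show ?thesis using w(3) wdist_tri[OF assms(1,2) x] x by (auto simp: geo_def)
qed

lemma paths_geo: "paths n (gdist E) geo"
proof
  show "n > 0" using G by (simp add: connected_graph_def)
  show "gdist E u v = gdist E v u" for u v
    using G by (intro gdist_commute) (simp add: connected_graph_def)
  show "gdist E u u = 0" for u by simp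
  show "geo u v \<subseteq> {..<n}" for u v by (auto simp: geo_def)
  fix u v assume uv: "u < n" "v < n"
  show "gdist E u v < n" using gdist_less uv .
  have "wdist v v = 0" using wdist_le[OF walk0] by simp
  then show "v \<in> geo u v" using uv by (auto simp: geo_def)
  show "gdist E u v \<le> gdist E u x + gdist E x v" if "x < n" for x
    using gdist_tri uv that by blast
  show "geo u v = geo v u" unfolding geo_def by (simp add: wdist_sym add.commute)
  show "\<exists>x\<in>geo u v. gdist E u x = k" if "k \<le> gdist E u v" for k
  proof -
    obtain A where w: "walk u v (gdist E u v) A (wdist u v)" using wdist_walk uv by blast
    then show ?thesis using short_walk[OF w uv(1) refl] walk_geo[OF uv w] that by blast
  qed
  show "gdist E u x + gdist E x v = gdist E u v" if "x \<in> geo u v" for x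
    using geo_walk(2)[OF uv that] .
  show "x = y" if xy: "x \<in> geo u v" "y \<in> geo u v" "gdist E u x = gdist E u y" for x y
  proof -
    obtain A B where A: "walk u v (gdist E u v) A (wdist u v)" "x \<in> A"
      and B: "walk u v (gdist E u v) B (wdist u v)" "y \<in> B"
      using geo_walk(1)[OF uv] xy by meson
    \<comment> \<open>Both walks have equal weight and equally many edges, so only the binary
      encodings of their node sets are left to compare.\<close>
    have "set_encode A = set_encode B"
      using short_walk[OF A(1) uv(1) refl] short_walk[OF B(1) uv(1) refl] by simp
    then have "A = B" using walk_fin[OF A(1)] walk_fin[OF B(1)] by (simp add: set_encode_eq)
    then show ?thesis using short_walk[OF A(1) uv(1) refl] A(2) B(2) xy(3) by blast
  qed
  show "y \<in> geo u v" if xy: "x \<in> geo u v" "y \<in> geo u x" for x y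
  proof -
    have l: "x < n" "y < n" using xy by (auto simp: geo_def)
    have "wdist u x + wdist x v = wdist u v" "wdist u y + wdist y x = wdist u x"
      using xy by (auto simp: geo_def)
    then show ?thesis using wdist_tri[OF l(2) uv(2) l(1)] wdist_tri[OF uv l(2)] l(2)
      by (auto simp: geo_def)
  qed
qed

end

end

section \<open>Greedy permutations\<close>

text \<open>A node of \<open>H\<close> would leave the potential at its old value \<open>v\<close>.
  So the average may run over all \<open>n\<close> nodes although the choice is made outside
  \<open>H\<close>: if the minimum exceeded \<open>v\<close>, so would the average.\<close>

lemma min_avg:
  fixes f :: "nat \<Rightarrow> nat"
  assumes "w < n" "w \<notin> H" and min: "\<And>x. x < n \<Longrightarrow> x \<notin> H \<Longrightarrow> f w \<le> f x"
    and old: "\<And>x. x < n \<Longrightarrow> x \<in> H \<Longrightarrow> f x = v" and avg: "(\<Sum>x<n. f x) \<le> n * v"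
  shows "n * f w \<le> (\<Sum>x<n. f x)" and "f w \<le> v"
proof -
  show le: "f w \<le> v"
  proof (rule ccontr)
    assume "\<not> f w \<le> v"
    then have ge: "v \<le> f x" if "x < n" for x
      using old[of x] min[of x] that by (cases "x \<in> H") auto
    have "(\<Sum>x<n. v) < (\<Sum>x<n. f x)"
      by (rule sum_strict_mono_ex1) (use \<open>\<not> f w \<le> v\<close> assms(1) ge in \<open>auto intro!: bexI[of _ w]\<close>)
    then show False using avg by simp
  qed
  have "f w \<le> f x" if "x < n" for x
    using old[of x] min[of x] le that by (cases "x \<in> H") auto
  then have "(\<Sum>x<n. f w) \<le> (\<Sum>x<n. f x)" by (intro sum_mono) auto
  then show "n * f w \<le> (\<Sum>x<n. f x)" by simp
qed

lemma inverse_one_plus_le: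
  fixes y :: real assumes "0 \<le> y" "y \<le> 1" shows "1 / (1 + y) \<le> 1 - y / 2"
proof -
  have "y * y \<le> y * 1" using assms by (intro mult_left_mono) auto
  then have "1 \<le> (1 - y / 2) * (1 + y)" by (simp add: algebra_simps)
  then show ?thesis using assms by (simp add: pos_divide_le_eq)
qed

lemma card_as_sum: "finite A \<Longrightarrow> card {a \<in> A. Q a} = (\<Sum>a\<in>A. of_bool (Q a))"
  by (simp add: of_bool_def sum.If_cases Int_def)

lemma double_count:
  assumes "finite A" "finite B"
  shows "(\<Sum>b\<in>B. card {a \<in> A. R a b}) = (\<Sum>a\<in>A. card {b \<in> B. R a b})"
  unfolding card_as_sum[OF assms(1)] card_as_sum[OF assms(2)] by (rule sum.swap)

text \<open>A set with \<open>m\<close> elements is missed by \<open>n - m\<close> of the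
  \<open>n\<close> candidates; written as a sum to avoid truncated subtraction.\<close>

lemma sum_unhit:
  assumes "finite A" "\<And>a. a \<in> A \<Longrightarrow> F a \<subseteq> {..<n} \<and> m \<le> card (F a)"
  shows "(\<Sum>w<n. card {a \<in> A. w \<notin> F a}) + m * card A \<le> n * card A"
proof -
  have "(\<Sum>w<n. card {a \<in> A. w \<notin> F a}) + (\<Sum>w<n. card {a \<in> A. w \<in> F a}) =
      (\<Sum>w<n. card {a \<in> A. w \<notin> F a} + card {a \<in> A. w \<in> F a})" by (simp add: sum.distrib)
  also have "\<dots> = (\<Sum>w<n. card A)"
  proof (rule sum.cong[OF refl])
    fix w
    have "card {a \<in> A. w \<notin> F a} + card {a \<in> A. w \<in> F a} = card ({a \<in> A. w \<notin> F a} \<union> {a \<in> A. w \<in> F a})"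
      using assms(1) by (intro card_Un_disjoint[symmetric]) auto
    also have "{a \<in> A. w \<notin> F a} \<union> {a \<in> A. w \<in> F a} = A" by auto
    finally show "card {a \<in> A. w \<notin> F a} + card {a \<in> A. w \<in> F a} = card A" .
  qed
  also have "(\<Sum>w<n. card {a \<in> A. w \<in> F a}) = (\<Sum>a\<in>A. card {w \<in> {..<n}. w \<in> F a})"
    using double_count[OF assms(1), of "{..<n}" "\<lambda>a w. w \<in> F a"] by simp
  also have "\<dots> = (\<Sum>a\<in>A. card (F a))"
    using assms(2) by (intro sum.cong refl arg_cong[where f = card]) auto
  finally have "(\<Sum>w<n. card {a \<in> A. w \<notin> F a}) + (\<Sum>a\<in>A. card (F a)) = n * card A" by simp
  moreover have "(\<Sum>a\<in>A. m) \<le> (\<Sum>a\<in>A. card (F a))" using assms(2) by (intro sum_mono) auto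
  ultimately show ?thesis by (simp add: mult.commute)
qed

text \<open>
  Each node has two observers, numbered by \<open>r < 2 * n\<close> altogether. Observer \<open>r\<close> has targets \<open>x\<close> with \<open>W r x\<close>, each of
  which stays alive until a node of \<open>seg r x\<close> is picked; the hubs to be counted are the nodes picked while
  being alive targets. In a first stage all sets \<open>T a\<close> with \<open>a \<in> M\<close> have to be hit; from then on every node lies
  on at most \<open>k\<close> of the shrunken segments \<open>sg x\<close> of alive targets (assumption \<open>light\<close>).
\<close>

locale greedy =
  fixes n :: nat and W :: "nat \<Rightarrow> nat \<Rightarrow> bool" and seg :: "nat \<Rightarrow> nat \<Rightarrow> nat set"
    and M :: "'a set" and T :: "'a \<Rightarrow> nat set"
    and dl e j k N Q :: nat
  assumes n_pos: "n > 0" and j_pos: "j \<ge> 1" and e_def: "e = 2 * j" and dl_def: "dl = 8 * j"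
    and k_ge: "8 * j \<le> k" and Q_pos: "Q \<ge> 1" and N_ge: "n + j * (n + 1) \<le> N"
    and seg_sub: "seg r x \<subseteq> {..<n}" and W_seg: "W r x \<Longrightarrow> x < n \<and> x \<in> seg r x \<and> dl \<le> card (seg r x)"
    and M_fin: "finite M" and T_sub: "a \<in> M \<Longrightarrow> T a \<subseteq> {..<n} \<and> e \<le> card (T a)"
    and light: "(\<And>a. a \<in> M \<Longrightarrow> T a \<inter> H \<noteq> {}) \<Longrightarrow> r < 2 * n \<Longrightarrow>
      \<exists>sg. (\<forall>x. W r x \<and> seg r x \<inter> H = {} \<longrightarrow> sg x \<subseteq> seg r x \<and> 2 * e \<le> card (sg x)) \<and>
        (\<forall>y. card {x. W r x \<and> seg r x \<inter> H = {} \<and> y \<in> sg x} \<le> k)"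
begin

section \<open>Quantities of a greedy run and their averages over the next pick\<close>

definition alive where "alive H r x \<longleftrightarrow> W r x \<and> seg r x \<inter> H = {}"
definition Zc where "Zc H r = card {x. alive H r x}"
definition Ut where "Ut H = (\<Sum>r<2*n. Zc H r)"
definition am where "am H = card {a \<in> M. T a \<inter> H = {}}"
text \<open>The number of observers that gain \<open>w\<close> as a counted hub if it is picked
  now.\<close>

definition new where "new H w = card {r. r < 2*n \<and> alive H r w}"
definition AQ where "AQ = n * e * Q"
definition pw where "pw x = (k + 1) ^ x * k ^ (N - x)"
text \<open>
  The potential of the first stage, with a factor \<open>A\<close> which doubles every \<open>n / e\<close> steps: as the number \<open>am\<close> of
  unhit sets decreases by a factor of about \<open>1 - e / n\<close> per step, its product with \<open>A\<close> need not increase.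
  From \<open>A = AQ\<close> on, at most \<open>F0\<close> sets are left and one is hit at each step.
  In the second stage, \<open>pw\<close> is \<open>(1 + 1 / k) ^ x\<close>, scaled by \<open>k ^ N\<close> to be a natural number; these
  terms bound the number of hubs of each single observer.
\<close>

definition scoreY where
  "scoreY A H w = (if AQ \<le> A then am (insert w H)
     else A * am (insert w H) + Q * (Ut (insert w H) + dl * new H w))"
definition scoreZ where
  "scoreZ c H w = k ^ N * (Ut (insert w H) + dl * new H w) +
     (\<Sum>r<2*n. pw (Zc (insert w H) r + j * (c r + of_bool (alive H r w))))"

text \<open>Runs of the greedy choice with ties left open. \<open>pc\<close> grows by
  \<open>e\<close> per pick and triggers the doubling of \<open>A\<close> when it reaches
  \<open>n\<close>. \<open>c\<close> counts hubs of the second stage only, as these are the ones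
  governed by the exponential terms.\<close>

inductive reach :: "nat list \<Rightarrow> nat \<Rightarrow> nat \<Rightarrow> (nat \<Rightarrow> nat) \<Rightarrow> bool" where
  reach_init: "reach [] (n * e) 0 (\<lambda>_. 0)"
| reach_Y: "reach hs A pc c \<Longrightarrow> w < n \<Longrightarrow> w \<notin> set hs \<Longrightarrow> am (set hs) > 0 \<Longrightarrow>
    (\<And>x. x < n \<Longrightarrow> x \<notin> set hs \<Longrightarrow> scoreY A (set hs) w \<le> scoreY A (set hs) x) \<Longrightarrow>
    A' = (if A < AQ \<and> n \<le> pc + e then 2 * A else A) \<Longrightarrow>
    pc' = (if A < AQ then if n \<le> pc + e then 0 else pc + e else pc) \<Longrightarrow>
    reach (hs @ [w]) A' pc' c"
| reach_Z: "reach hs A pc c \<Longrightarrow> w < n \<Longrightarrow> w \<notin> set hs \<Longrightarrow> am (set hs) = 0 \<Longrightarrow>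
    (\<And>x. x < n \<Longrightarrow> x \<notin> set hs \<Longrightarrow> scoreZ c (set hs) w \<le> scoreZ c (set hs) x) \<Longrightarrow>
    c' = (\<lambda>r. c r + of_bool (r < 2*n \<and> alive (set hs) r w)) \<Longrightarrow>
    reach (hs @ [w]) A pc c'"

definition cnt where "cnt r hs = card {i. i < length hs \<and> alive (set (take i hs)) r (hs ! i)}"
text \<open>Hubs so far, each with weight \<open>dl\<close>, plus alive targets: what a target loses
  in expectation pays for the chance that it is picked itself.\<close>

definition Lp where "Lp hs = Ut (set hs) + dl * (\<Sum>r<2*n. cnt r hs)"

lemma cnt_Nil [simp]: "cnt r [] = 0" by (simp add: cnt_def)

lemma cnt_snoc: "cnt r (hs @ [w]) = cnt r hs + of_bool (alive (set hs) r w)"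
proof -
  let ?P = "\<lambda>i. alive (set (take i (hs @ [w]))) r ((hs @ [w]) ! i)"
  have "{i. i < length (hs @ [w]) \<and> ?P i} =
     {i. i < length hs \<and> alive (set (take i hs)) r (hs ! i)} \<union> (if alive (set hs) r w then {length hs} else {})"
    by (auto simp: nth_append less_Suc_eq)
  then show ?thesis unfolding cnt_def by (simp add: card_insert_if)
qed

lemma alive_less: "alive H r x \<Longrightarrow> x < n" using W_seg by (auto simp: alive_def)
lemma alive_fin [simp]: "finite {x. alive H r x}"
  by (rule finite_subset[of _ "{..<n}"]) (auto dest: alive_less)
lemma alive_self: "alive H r x \<Longrightarrow> x \<notin> H" using W_seg by (auto simp: alive_def)

lemma Zc_le: "Zc H r \<le> n"
  unfolding Zc_def by (rule order.trans[OF card_mono[of "{..<n}"]]) (auto dest: alive_less)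

lemma Zc_insert: "Zc (insert w H) r = card {x \<in> {x. alive H r x}. w \<notin> seg r x}"
  unfolding Zc_def by (rule arg_cong[where f = card]) (auto simp: alive_def)

lemma am_insert: "am (insert w H) = card {a \<in> {a \<in> M. T a \<inter> H = {}}. w \<notin> T a}"
  unfolding am_def by (rule arg_cong[where f = card]) auto

lemma Zc_insert_le: "Zc (insert w H) r \<le> Zc H r"
  unfolding Zc_def by (rule card_mono) (auto simp: alive_def)

lemma am_insert_le: "am (insert w H) \<le> am H"
  unfolding am_def using M_fin by (intro card_mono) auto

lemma new_le: "new H w \<le> 2 * n"
  unfolding new_def by (rule order.trans[OF card_mono[of "{..<2*n}"]]) auto

lemma new_sum: "new H w = (\<Sum>r<2*n. of_bool (alive H r w))"
  using card_as_sum[of "{..<2*n}" "\<lambda>r. alive H r w"] by (simp add: new_def)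

lemma Lp_snoc: "Lp (hs @ [w]) + Ut (set hs) = Lp hs + Ut (insert w (set hs)) + dl * new (set hs) w"
  by (simp add: Lp_def cnt_snoc sum.distrib new_sum distrib_left)

lemma avg_am: "(\<Sum>w<n. am (insert w H)) + e * am H \<le> n * am H"
  using sum_unhit[of "{a \<in> M. T a \<inter> H = {}}" T n e] M_fin T_sub
  unfolding am_insert by (simp add: am_def)

lemma avg_Zc: "(\<Sum>w<n. Zc (insert w H) r) + dl * Zc H r \<le> n * Zc H r"
proof -
  have "(\<Sum>w<n. card {a \<in> {x. alive H r x}. w \<notin> seg r a}) + dl * card {x. alive H r x}
      \<le> n * card {x. alive H r x}"
    using seg_sub W_seg by (intro sum_unhit alive_fin) (auto simp: alive_def)
  then show ?thesis unfolding Zc_insert unfolding Zc_def .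
qed

lemma sum_alive: "(\<Sum>w<n. of_bool (alive H r w)) = Zc H r"
proof -
  have "{w \<in> {..<n}. alive H r w} = {x. alive H r x}" by (auto dest: alive_less)
  then show ?thesis using card_as_sum[of "{..<n}" "\<lambda>w. alive H r w"] by (simp add: Zc_def)
qed

lemma sum_new: "(\<Sum>w<n. new H w) = Ut H"
proof -
  have "(\<Sum>w<n. new H w) = (\<Sum>r<2*n. \<Sum>w<n. of_bool (alive H r w))"
    unfolding new_sum by (rule sum.swap)
  also have "\<dots> = Ut H" by (simp add: Ut_def sum_alive)
  finally show ?thesis .
qed

text \<open>An alive target dies for at least \<open>dl\<close> of the \<open>n\<close> candidates
  and is itself the pick for one of them; with weight \<open>dl\<close> on a new hub, the loss
  covers the gain.\<close>

lemma avg_U: "(\<Sum>w<n. Ut (insert w H) + dl * new H w) \<le> n * Ut H"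
proof -
  have "(\<Sum>w<n. Ut (insert w H)) + dl * Ut H = (\<Sum>r<2*n. (\<Sum>w<n. Zc (insert w H) r) + dl * Zc H r)"
    unfolding Ut_def sum.distrib sum_distrib_left by (subst sum.swap) simp
  also have "\<dots> \<le> (\<Sum>r<2*n. n * Zc H r)" by (intro sum_mono avg_Zc)
  finally have "(\<Sum>w<n. Ut (insert w H)) + dl * Ut H \<le> n * Ut H" by (simp add: Ut_def sum_distrib_left)
  then show ?thesis by (simp add: sum.distrib sum_distrib_left[symmetric] sum_new)
qed

lemma new_old: "w \<in> H \<Longrightarrow> new H w = 0"
  using alive_self by (auto simp: new_def)

lemma reach_basic: "reach hs A pc c \<Longrightarrow> distinct hs \<and> set hs \<subseteq> {..<n} \<and> length hs \<le> n \<and>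
    (\<forall>r. c r \<le> length hs)"
proof (induction rule: reach.induct)
  case (reach_Y hs A pc c w A' pc')
  have "card (set (hs @ [w])) \<le> n" using reach_Y
    by (metis card_lessThan card_mono finite_lessThan insert_subset lessThan_iff list.simps(15) rotate1.simps(2) set_rotate1)
  then show ?case using reach_Y distinct_card[of "hs @ [w]"] by (auto intro: le_SucI)
next
  case (reach_Z hs A pc c w c')
  have "card (set (hs @ [w])) \<le> n" using reach_Z
    by (metis card_lessThan card_mono finite_lessThan insert_subset lessThan_iff list.simps(15) rotate1.simps(2) set_rotate1)
  then show ?case using reach_Z distinct_card[of "hs @ [w]"] by (auto intro: le_SucI)
qed simp

definition p :: real where "p = 1 + 1 / real k"

lemma k_pos: "k > 0" using k_ge j_pos by simp
lemma p_ge: "p \<ge> 1" by (simp add: p_def)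

lemma pw_real: "x \<le> N \<Longrightarrow> real (pw x) = real k ^ N * p ^ x"
proof -
  assume "x \<le> N"
  have "p = (real k + 1) / real k" using k_pos by (simp add: p_def field_simps)
  then have "real k ^ N * p ^ x = (real k + 1) ^ x * (real k ^ N / real k ^ x)"
    by (simp add: power_divide)
  also have "real k ^ N / real k ^ x = real k ^ (N - x)"
    using k_pos \<open>x \<le> N\<close> by (simp add: power_diff)
  finally show ?thesis by (simp add: pw_def add.commute)
qed

text \<open>As \<open>j\<close> is small against \<open>k\<close>, compound growth over
  \<open>j\<close> steps is at most twice the linear one.\<close>

lemma p_j: "p ^ j \<le> 1 + 2 * real j / real k"
proof -
  let ?x = "real j / real k"
  have x: "0 \<le> ?x" "?x \<le> 1 / 2"
    using k_ge k_pos by (auto simp: field_simps)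
  have x1: "?x \<le> 1" by (rule order.trans[OF x(2)]) simp
  have "p ^ j \<le> exp (1 / real k) ^ j"
    unfolding p_def by (intro power_mono exp_ge_add_one_self) auto
  also have "\<dots> = exp ?x" by (simp add: exp_of_nat_mult[symmetric])
  also have "\<dots> \<le> 1 + ?x + ?x\<^sup>2" using x(1) x1 by (rule exp_bound)
  also have "?x\<^sup>2 \<le> ?x * 1" unfolding power2_eq_square using x(1) x1 by (intro mult_left_mono) auto
  finally show ?thesis by simp
qed

text \<open>A candidate \<open>w\<close> on \<open>dr w\<close> of the sets \<open>sg x\<close>
  kills at least that many targets and multiplies the term by at most
  \<open>1 - dr w / (2 * k)\<close>; becoming a hub multiplies it by at most
  \<open>1 + 2 * j / k\<close>. Summed over \<open>w\<close>, the losses of at least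
  \<open>2 * e / (2 * k)\<close> per target match the gains \<open>2 * j / k\<close>, which is why
  \<open>e = 2 * j\<close>.\<close>

lemma avg_exp:
  assumes hit: "\<And>a. a \<in> M \<Longrightarrow> T a \<inter> H \<noteq> {}" and r: "r < 2 * n"
  shows "(\<Sum>w<n. p ^ (Zc (insert w H) r + j * (c + of_bool (alive H r w)))) \<le> n * p ^ (Zc H r + j * c)"
proof -
  obtain sg where sg: "\<And>x. alive H r x \<Longrightarrow> sg x \<subseteq> seg r x \<and> 2 * e \<le> card (sg x)"
      "\<And>y. card {x. alive H r x \<and> y \<in> sg x} \<le> k"
    using light[of H r, OF hit r] unfolding alive_def conj_assoc by blast
  define dr where "dr w = card {x. alive H r x \<and> w \<in> sg x}" for w
  have fin: "finite {x. alive H r x \<and> P x}" for P by (rule finite_subset[OF _ alive_fin]) auto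
  have pp: "p > 0" using p_ge by linarith
  have kp: "real k > 0" using k_pos by simp
  have one: "p ^ (Zc (insert w H) r + j * (c + of_bool (alive H r w))) \<le>
      p ^ (Zc H r + j * c) * (1 + 2 * real j / real k * of_bool (alive H r w) - real (dr w) / (2 * real k))" for w
  proof -
    have "dr w + Zc (insert w H) r \<le> Zc H r"
    proof -
      have "dr w + Zc (insert w H) r =
          card ({x. alive H r x \<and> w \<in> sg x} \<union> {x. alive H r x \<and> w \<notin> seg r x})"
        unfolding Zc_insert dr_def using sg(1) fin
        by (subst card_Un_disjoint) auto
      also have "\<dots> \<le> Zc H r" unfolding Zc_def by (intro card_mono) auto
      finally show ?thesis .
    qed
    then have "p ^ (dr w + Zc (insert w H) r) \<le> p ^ Zc H r" using p_ge by (intro power_increasing) auto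
    then have 1: "p ^ Zc (insert w H) r \<le> p ^ Zc H r * (1 / p ^ dr w)"
      using pp by (simp add: power_add field_simps)
    let ?y = "real (dr w) / real k"
    \<comment> \<open>Here the limit \<open>k\<close> enters: the estimate
      \<open>1 / (1 + y) \<le> 1 - y / 2\<close> holds only up to \<open>y = 1\<close>.\<close>
    have y: "0 \<le> ?y" "?y \<le> 1" using sg(2)[of w] kp by (auto simp: dr_def field_simps)
    have "1 + ?y \<le> p ^ dr w"
    proof -
      have "- 1 \<le> 1 / real k" by (rule order.trans[of _ 0]) auto
      then show ?thesis using Bernoulli_inequality[of "1 / real k" "dr w"] by (simp add: p_def)
    qed
    then have "1 / p ^ dr w \<le> 1 / (1 + ?y)" using y by (intro divide_left_mono) (auto intro!: mult_pos_pos zero_less_power pp add_pos_nonneg)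
    also have "\<dots> \<le> 1 - ?y / 2"
      using y by (rule inverse_one_plus_le)
    finally have Y: "1 / p ^ dr w \<le> 1 - ?y / 2" .
    let ?X = "p ^ (j * of_bool (alive H r w))"
    have X1: "1 \<le> ?X" using p_ge by simp
    have X2: "?X \<le> 1 + 2 * real j / real k * of_bool (alive H r w)" using p_j by simp
    have Y1: "1 / p ^ dr w \<le> 1" using p_ge by simp
    have "p ^ (Zc (insert w H) r + j * (c + of_bool (alive H r w))) =
        p ^ Zc (insert w H) r * p ^ (j * c) * ?X"
      by (simp add: power_add distrib_left)
    also have "\<dots> \<le> (p ^ Zc H r * (1 / p ^ dr w)) * p ^ (j * c) * ?X"
      using 1 X1 pp by (intro mult_right_mono) auto
    also have "\<dots> = p ^ (Zc H r + j * c) * (?X * (1 / p ^ dr w))" by (simp add: power_add)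
    also have "\<dots> \<le> p ^ (Zc H r + j * c) * (1 + 2 * real j / real k * of_bool (alive H r w) - real (dr w) / (2 * real k))"
    proof (intro mult_left_mono)
      \<comment> \<open>With \<open>?X\<close> at least 1 and the other factor at most 1, the
        product is at most the sum minus 1; no mixed term remains.\<close>
      have "0 \<le> (?X - 1) * (1 - 1 / p ^ dr w)" using X1 Y1 by (intro mult_nonneg_nonneg) auto
      then have "?X * (1 / p ^ dr w) \<le> ?X + 1 / p ^ dr w - 1" by (simp add: algebra_simps)
      then show "?X * (1 / p ^ dr w) \<le> 1 + 2 * real j / real k * of_bool (alive H r w) - real (dr w) / (2 * real k)"
        using X2 Y by (simp add: field_simps)
    qed (use pp in auto)
    finally show ?thesis .
  qed
  have s2: "2 * e * Zc H r \<le> (\<Sum>w<n. dr w)"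
  proof -
    have "(\<Sum>w<n. dr w) = (\<Sum>x\<in>{x. alive H r x}. card {w \<in> {..<n}. w \<in> sg x})"
      unfolding dr_def using double_count[of "{x. alive H r x}" "{..<n}" "\<lambda>x w. w \<in> sg x"] by simp
    also have "\<dots> = (\<Sum>x\<in>{x. alive H r x}. card (sg x))"
      using sg(1) seg_sub by (intro sum.cong refl arg_cong[where f = card]) fastforce
    also have "\<dots> \<ge> (\<Sum>x\<in>{x. alive H r x}. 2 * e)" using sg(1) by (intro sum_mono) auto
    finally show ?thesis by (simp add: Zc_def mult.commute)
  qed
  have "(\<Sum>w<n. 1 + 2 * real j / real k * of_bool (alive H r w) - real (dr w) / (2 * real k)) =
      real n + 2 * real j / real k * (\<Sum>w<n. of_bool (alive H r w)) - (\<Sum>w<n. real (dr w)) / (2 * real k)"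
  proof -
    have "(\<Sum>w<n. 1::real) = real n" by simp
    then show ?thesis
      by (simp only: sum.distrib sum_subtractf sum_distrib_left sum_divide_distrib)
  qed
  also have "(\<Sum>w<n. of_bool (alive H r w)) = real (Zc H r)" using sum_alive[of H r] by (metis (mono_tags, lifting) of_nat_of_bool of_nat_sum sum.cong)
  also have "real n + 2 * real j / real k * real (Zc H r) - (\<Sum>w<n. real (dr w)) / (2 * real k) \<le> real n"
  proof -
    have "2 * real e * real (Zc H r) \<le> (\<Sum>w<n. real (dr w))"
      using s2 by (metis of_nat_le_iff of_nat_mult of_nat_numeral of_nat_sum)
    then have "2 * real e * real (Zc H r) / (2 * real k) \<le> (\<Sum>w<n. real (dr w)) / (2 * real k)"
      using kp by (intro divide_right_mono) auto
    moreover have "2 * real e * real (Zc H r) / (2 * real k) = 2 * real j / real k * real (Zc H r)"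
      using e_def by (simp add: field_simps)
    ultimately show ?thesis by linarith
  qed
  finally have S: "(\<Sum>w<n. 1 + 2 * real j / real k * of_bool (alive H r w) - real (dr w) / (2 * real k)) \<le> real n" .
  have "(\<Sum>w<n. p ^ (Zc (insert w H) r + j * (c + of_bool (alive H r w)))) \<le>
    (\<Sum>w<n. p ^ (Zc H r + j * c) * (1 + 2 * real j / real k * of_bool (alive H r w) - real (dr w) / (2 * real k)))"
    by (intro sum_mono one)
  also have "\<dots> = p ^ (Zc H r + j * c) * (\<Sum>w<n. 1 + 2 * real j / real k * of_bool (alive H r w) - real (dr w) / (2 * real k))"
    by (simp add: sum_distrib_left)
  also have "\<dots> \<le> p ^ (Zc H r + j * c) * real n" using S pp by (intro mult_left_mono) auto
  finally show ?thesis by (simp add: mult.commute)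
qed

section \<open>Invariants of the two stages\<close>

definition F0 where "F0 B = B div (n * e)"
text \<open>The summand \<open>pc * (A * am)\<close> is the saving since the last doubling; at
  \<open>pc = n\<close> it has grown enough to pay for the next one. A round of doubling may
  overshoot \<open>n\<close> by less than \<open>e\<close>, hence \<open>n + e\<close> per
  round.\<close>

definition YN where "YN B hs A pc \<longleftrightarrow> A < AQ \<and>
  n * (A * am (set hs) + Q * Lp hs) + pc * (A * am (set hs)) \<le> n * (Q * B) \<and> pc < n \<and>
  (\<exists>i. A = n * e * 2 ^ i \<and> e * length hs \<le> i * (n + e) + pc)"
text \<open>Once \<open>A\<close> is large, every pick hits one of the at most \<open>F0 B\<close>
  remaining sets and is charged \<open>2 * n * dl\<close>, as if all observers gained a hub.\<close>

definition YF where "YF B qb hs A \<longleftrightarrow> AQ \<le> A \<and> am (set hs) \<le> F0 B \<and>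
  Lp hs + 2 * n * dl * am (set hs) \<le> B + 2 * n * dl * F0 B \<and>
  (\<exists>i \<le> qb. e * (length hs + am (set hs)) \<le> i * (n + e) + e * F0 B)"
definition Tb where "Tb B qb = qb * (n + e) + n + e * F0 B"
text \<open>In the last conjunct \<open>Tb\<close> covers all picks of the first stage, since each
  of them is charged to every observer.\<close>

definition ZI where "ZI B qb hs c \<longleftrightarrow>
  real (Lp hs) + (\<Sum>r<2*n. p ^ (Zc (set hs) r + j * c r)) \<le> real (B + 2 * n * dl * F0 B) + 2 * real n * p ^ n \<and>
  (\<forall>r. e * cnt r hs \<le> Tb B qb + e * c r)"

lemma e_pos: "e > 0" using e_def j_pos by simp

lemma Y_step:
  assumes Y: "YN B hs A pc \<or> YF B qb hs A" and qb: "Q \<le> 2 ^ qb"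
    and w: "w < n" "w \<notin> set hs" and am0: "am (set hs) > 0"
    and min: "\<And>x. x < n \<Longrightarrow> x \<notin> set hs \<Longrightarrow> scoreY A (set hs) w \<le> scoreY A (set hs) x"
    and A': "A' = (if A < AQ \<and> n \<le> pc + e then 2 * A else A)"
    and pc': "pc' = (if A < AQ then if n \<le> pc + e then 0 else pc + e else pc)"
  shows "YN B (hs @ [w]) A' pc' \<or> YF B qb (hs @ [w]) A'"
proof (cases "A < AQ")
  case True
  let ?H = "set hs"
  let ?a = "am ?H" and ?a' = "am (insert w ?H)"
  have Y: "n * (A * ?a + Q * Lp hs) + pc * (A * ?a) \<le> n * (Q * B)" "pc < n"
    and "\<exists>i. A = n * e * 2 ^ i \<and> e * length hs \<le> i * (n + e) + pc"
    using Y True by (auto simp: YN_def YF_def)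
  then obtain i where i: "A = n * e * 2 ^ i" "e * length hs \<le> i * (n + e) + pc" by blast
  let ?f = "\<lambda>x. A * am (insert x ?H) + Q * (Ut (insert x ?H) + dl * new ?H x)"
  let ?v = "A * ?a + Q * Ut ?H"
  have sumf: "(\<Sum>x<n. ?f x) + e * (A * ?a) \<le> n * ?v"
  proof -
    define S where "S = (\<Sum>x<n. am (insert x ?H))"
    define R where "R = (\<Sum>x<n. Ut (insert x ?H) + dl * new ?H x)"
    have f: "(\<Sum>x<n. ?f x) = A * S + Q * R"
      unfolding S_def R_def sum_distrib_left by (rule sum.distrib)
    have "A * S + Q * R + e * (A * ?a) = A * (S + e * ?a) + Q * R" by (simp add: algebra_simps)
    also have "\<dots> \<le> A * (n * ?a) + Q * (n * Ut ?H)"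
      unfolding S_def R_def by (intro add_mono mult_le_mono2 avg_am avg_U)
    also have "\<dots> = n * ?v" by (simp add: algebra_simps)
    finally show ?thesis unfolding f .
  qed
  have "n * ?f w \<le> (\<Sum>x<n. ?f x)"
  proof (rule min_avg(1)[of w n ?H ?f ?v])
    show "?f w \<le> ?f x" if "x < n" "x \<notin> ?H" for x using min[OF that] True by (simp add: scoreY_def)
    show "?f x = ?v" if "x < n" "x \<in> ?H" for x using that by (simp add: insert_absorb new_old)
  qed (use w sumf in auto)
  then have fw: "n * ?f w + e * (A * ?a) \<le> n * ?v" using sumf by linarith
  have "Q * (Lp (hs @ [w]) + Ut ?H) = Q * (Lp hs + Ut (insert w ?H) + dl * new ?H w)"
    by (simp add: Lp_snoc)
  then have LQ: "Q * Lp (hs @ [w]) + Q * Ut ?H = Q * Lp hs + Q * (Ut (insert w ?H) + dl * new ?H w)"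
    by (simp add: distrib_left)
  \<comment> \<open>Minimality turns the average drop \<open>e * (A * ?a)\<close> into a drop for
    the chosen \<open>w\<close>. The old term \<open>Q * Ut ?H\<close> is added on both sides,
    because \<open>Lp_snoc\<close> is an equation between sums.\<close>
  have dec: "n * (A * ?a' + Q * Lp (hs @ [w])) + e * (A * ?a) \<le> n * (A * ?a + Q * Lp hs)"
  proof -
    have "n * (A * ?a' + Q * Lp (hs @ [w])) + n * (Q * Ut ?H) =
        n * (A * ?a' + (Q * Lp (hs @ [w]) + Q * Ut ?H))" by (simp add: distrib_left)
    also have "\<dots> = n * ?f w + n * (Q * Lp hs)" unfolding LQ by (simp add: distrib_left)
    finally have "n * (A * ?a' + Q * Lp (hs @ [w])) + n * (Q * Ut ?H) = n * ?f w + n * (Q * Lp hs)" .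
    then show ?thesis using fw by (simp add: distrib_left)
  qed
  have aa: "A * ?a' \<le> A * ?a" using am_insert_le by simp
  have "(pc + e) * (A * ?a') \<le> pc * (A * ?a) + e * (A * ?a)"
    using mult_le_mono2[OF aa, of "pc + e"] by (simp add: distrib_right)
  then have pot: "n * (A * ?a' + Q * Lp (hs @ [w])) + (pc + e) * (A * ?a') \<le> n * (Q * B)"
    using dec Y(1) by linarith
  have len: "e * length (hs @ [w]) \<le> i * (n + e) + pc + e" using i(2) by simp
  show ?thesis
  proof (cases "n \<le> pc + e")
    case False
    then have "YN B (hs @ [w]) A' pc'"
      using pot True len i(1) A' pc' by (auto simp: YN_def intro!: exI[of _ i])
    then show ?thesis ..
  next
    case ge: True
    \<comment> \<open>The savings collected over a full round are at least \<open>A * ?a'\<close>,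
      so doubling \<open>A\<close> keeps the potential below its start value.\<close>
    have "n * (A * ?a') \<le> (pc + e) * (A * ?a')" using ge by (intro mult_le_mono1)
    moreover have "n * (2 * A * ?a' + Q * Lp (hs @ [w])) =
        n * (A * ?a' + Q * Lp (hs @ [w])) + n * (A * ?a')" by (simp add: distrib_left)
    ultimately have "n * (2 * A * ?a' + Q * Lp (hs @ [w])) \<le> n * (Q * B)"
      using pot by linarith
    then have pot2: "2 * A * ?a' + Q * Lp (hs @ [w]) \<le> Q * B" using n_pos by simp
    have len2: "e * length (hs @ [w]) \<le> Suc i * (n + e)" using len Y(2) by simp
    have A2: "2 * A = n * e * 2 ^ Suc i" using i(1) by simp
    have A'2: "A' = 2 * A" "pc' = 0" using A' pc' True ge by auto
    show ?thesis
    proof (cases "2 * A < AQ")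
      case True
      have "n * (2 * A * ?a' + Q * Lp (hs @ [w])) \<le> n * (Q * B)" using pot2 by (intro mult_le_mono2)
      then have "YN B (hs @ [w]) A' pc'"
        using True len2 A2 n_pos A'2 unfolding YN_def by (auto intro!: exI[of _ "Suc i"])
      then show ?thesis ..
    next
      case F: False
      \<comment> \<open>From \<open>AQ\<close> on, the summand \<open>n * e * Q * ?a'\<close> alone
        is at most \<open>Q * B\<close>, which bounds the number of unhit sets by
        \<open>F0 B\<close>.\<close>
      have "AQ * ?a' \<le> 2 * A * ?a'" using F by (intro mult_le_mono1) auto
      then have "AQ * ?a' \<le> Q * B" using pot2 by linarith
      then have "Q * (n * e * ?a') \<le> Q * B" by (simp add: AQ_def mult_ac)
      then have "n * e * ?a' \<le> B" using Q_pos by simp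
      then have aF: "?a' \<le> F0 B" unfolding F0_def using n_pos e_pos
        by (simp add: less_eq_div_iff_mult_less_eq mult_ac)
      have "Q * Lp (hs @ [w]) \<le> Q * B" using pot2 by linarith
      then have LB: "Lp (hs @ [w]) \<le> B" using Q_pos by simp
      have "n * e * 2 ^ i < n * e * Q" using True i(1) by (simp add: AQ_def)
      then have "2 ^ i < Q" by (metis mult_less_cancel1)
      then have "(2::nat) ^ i < 2 ^ qb" using qb by linarith
      then have iq: "Suc i \<le> qb" by simp
      have "YF B qb (hs @ [w]) A'"
        unfolding YF_def
      proof (intro conjI exI[of _ "Suc i"])
        show "AQ \<le> A'" using F A'2 by simp
        show "am (set (hs @ [w])) \<le> F0 B" using aF by simp
        have "2 * n * dl * ?a' \<le> 2 * n * dl * F0 B" using aF by (intro mult_le_mono2)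
        moreover have "set (hs @ [w]) = insert w ?H" by simp
        ultimately show "Lp (hs @ [w]) + 2 * n * dl * am (set (hs @ [w])) \<le> B + 2 * n * dl * F0 B"
          using LB by (metis add_mono)
        have "e * ?a' \<le> e * F0 B" using aF by (intro mult_le_mono2)
        moreover have "set (hs @ [w]) = insert w ?H" by simp
        ultimately show "e * (length (hs @ [w]) + am (set (hs @ [w]))) \<le> Suc i * (n + e) + e * F0 B"
          using len2 unfolding distrib_left by (metis add_mono)
      qed (rule iq)
      then show ?thesis ..
    qed
  qed
next
  case False
  let ?H = "set hs"
  have Y: "am ?H \<le> F0 B" "Lp hs + 2 * n * dl * am ?H \<le> B + 2 * n * dl * F0 B"
    and "\<exists>i \<le> qb. e * (length hs + am ?H) \<le> i * (n + e) + e * F0 B"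
    using Y False by (auto simp: YN_def YF_def)
  then obtain i where i: "i \<le> qb" "e * (length hs + am ?H) \<le> i * (n + e) + e * F0 B" by blast
  obtain a where a: "a \<in> M" "T a \<inter> ?H = {}" using am0 by (auto simp: am_def card_gt_0_iff)
  then have "card (T a) > 0" using T_sub[of a] e_pos by auto
  then obtain x where x: "x \<in> T a" by fastforce
  \<comment> \<open>Some candidate hits a set that is still unhit, so the minimizing one reduces the
    number at least as much.\<close>
  have "am (insert x ?H) < am ?H" unfolding am_def using a x M_fin
    by (intro psubset_card_mono) auto
  moreover have "am (insert w ?H) \<le> am (insert x ?H)"
    using min[of x] x a T_sub[of a] False by (auto simp: scoreY_def)
  ultimately have am: "am (insert w ?H) + 1 \<le> am ?H" by simp
  have "dl * new ?H w \<le> dl * (2 * n)" by (intro mult_le_mono2 new_le)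
  moreover have "Ut (insert w ?H) \<le> Ut ?H" unfolding Ut_def by (intro sum_mono Zc_insert_le)
  ultimately have "Lp (hs @ [w]) \<le> Lp hs + dl * (2 * n)" using Lp_snoc[of hs w] by linarith
  then have L: "Lp (hs @ [w]) \<le> Lp hs + 2 * n * dl" by (simp only: mult_ac)
  have "2 * n * dl * (am (insert w ?H) + 1) \<le> 2 * n * dl * am ?H" using am by (intro mult_le_mono2)
  then have L2: "Lp (hs @ [w]) + 2 * n * dl * am (insert w ?H) \<le> B + 2 * n * dl * F0 B"
    using L Y(2) by (simp add: distrib_left)
  have "e * (length hs + 1 + am (insert w ?H)) \<le> e * (length hs + am ?H)"
    using am by (intro mult_le_mono2) simp
  then have "YF B qb (hs @ [w]) A'"
    using i False L2 Y(1) am A' unfolding YF_def by (auto intro!: exI[of _ i])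
  then show ?thesis ..
qed

lemma cnt_le_length: "cnt r hs \<le> length hs"
  unfolding cnt_def by (rule order.trans[OF card_mono[of "{..<length hs}"]]) auto

text \<open>At the switch no hub of the second stage exists, so each exponential term is at most
  \<open>p ^ n\<close>.\<close>

lemma Y_Z:
  assumes Y: "YN B hs A pc \<or> YF B qb hs A" and qb: "Q \<le> 2 ^ qb"
  shows "ZI B qb hs (\<lambda>_. 0)"
proof -
  have L: "Lp hs \<le> B + 2 * n * dl * F0 B" and len: "e * length hs \<le> Tb B qb"
  proof -
    show "Lp hs \<le> B + 2 * n * dl * F0 B"
    proof (cases "A < AQ")
      case True
      then have "n * (A * am (set hs) + Q * Lp hs) + pc * (A * am (set hs)) \<le> n * (Q * B)"
        using Y by (auto simp: YN_def YF_def)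
      then have "n * (Q * Lp hs) \<le> n * (Q * B)" unfolding distrib_left by linarith
      then show ?thesis using n_pos Q_pos by simp
    qed (use Y in \<open>auto simp: YN_def YF_def\<close>)
    show "e * length hs \<le> Tb B qb"
    proof (cases "A < AQ")
      case True
      then obtain i where i: "A = n * e * 2 ^ i" "e * length hs \<le> i * (n + e) + pc" "pc < n"
        using Y by (auto simp: YN_def YF_def)
      have "n * e * 2 ^ i < n * e * Q" using True i(1) by (simp add: AQ_def)
      then have "2 ^ i < Q" by (metis mult_less_cancel1)
      then have "(2::nat) ^ i < 2 ^ qb" using qb by linarith
      then have "i \<le> qb" by simp
      then have "i * (n + e) \<le> qb * (n + e)" by (intro mult_le_mono1)
      then show ?thesis using i unfolding Tb_def by linarith
    next
      case False
      then obtain i where i: "i \<le> qb" "e * (length hs + am (set hs)) \<le> i * (n + e) + e * F0 B"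
        using Y by (auto simp: YN_def YF_def)
      have "i * (n + e) \<le> qb * (n + e)" using i by (intro mult_le_mono1)
      then show ?thesis using i(2) unfolding Tb_def distrib_left by linarith
    qed
  qed
  have "(\<Sum>r<2*n. p ^ (Zc (set hs) r + j * 0)) \<le> (\<Sum>r<2*n. p ^ n)"
    using Zc_le p_ge by (intro sum_mono power_increasing) auto
  moreover have "e * cnt r hs \<le> Tb B qb" for r
    using mult_le_mono2[OF cnt_le_length[of r hs], of e] len by linarith
  moreover have "real (Lp hs) \<le> real (B + 2 * n * dl * F0 B)" using L by linarith
  ultimately show ?thesis unfolding ZI_def by simp
qed

text \<open>Multiplied by \<open>k ^ N\<close>, the real potential becomes the natural number that
  is minimized; \<open>N_ge\<close> keeps all exponents within \<open>N\<close>, where this scaling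
  is exact.\<close>

lemma Z_step:
  assumes Z: "ZI B qb hs c" and r: "reach hs A pc c"
    and w: "w < n" "w \<notin> set hs" and am0: "am (set hs) = 0"
    and min: "\<And>x. x < n \<Longrightarrow> x \<notin> set hs \<Longrightarrow> scoreZ c (set hs) w \<le> scoreZ c (set hs) x"
    and c': "c' = (\<lambda>r. c r + of_bool (r < 2*n \<and> alive (set hs) r w))"
    and Wr: "\<And>r x. W r x \<Longrightarrow> r < 2 * n"
  shows "ZI B qb (hs @ [w]) c'"
proof -
  let ?H = "set hs"
  let ?v = "k ^ N * Ut ?H + (\<Sum>r<2*n. pw (Zc ?H r + j * c r))"
  have hit: "a \<in> M \<Longrightarrow> T a \<inter> ?H \<noteq> {}" for a using am0 M_fin by (auto simp: am_def)
  have cn: "c r \<le> n" for r using reach_basic[OF r] by (meson le_trans)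
  have N: "Zc H r + j * (c r + of_bool b) \<le> N" for H r b
  proof -
    have "j * (c r + of_bool b) \<le> j * (n + 1)" using cn[of r] by (intro mult_le_mono2) auto
    then show ?thesis using Zc_le[of H r] N_ge by linarith
  qed
  have N0: "Zc H r + j * c r \<le> N" for H r using N[of H r False] by simp
  have real_score: "real (scoreZ c ?H x) = real k ^ N * (real (Ut (insert x ?H) + dl * new ?H x) +
      (\<Sum>r<2*n. p ^ (Zc (insert x ?H) r + j * (c r + of_bool (alive ?H r x)))))" for x
    unfolding scoreZ_def of_nat_add of_nat_mult of_nat_sum of_nat_power pw_real[OF N]
    by (simp only: sum_distrib_left distrib_left)
  have real_v: "real ?v = real k ^ N * (real (Ut ?H) + (\<Sum>r<2*n. p ^ (Zc ?H r + j * c r)))"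
    by (simp add: pw_real[OF N0] sum_distrib_left[symmetric] distrib_left)
  have kp: "real k ^ N > 0" using k_pos by simp
  have s1: "(\<Sum>x<n. real (scoreZ c ?H x)) = real k ^ N * ((\<Sum>x<n. real (Ut (insert x ?H) + dl * new ?H x)) +
     (\<Sum>x<n. \<Sum>r<2*n. p ^ (Zc (insert x ?H) r + j * (c r + of_bool (alive ?H r x)))))"
    by (simp only: real_score sum_distrib_left[symmetric] sum.distrib)
  have s2: "(\<Sum>x<n. real (Ut (insert x ?H) + dl * new ?H x)) = real (\<Sum>x<n. Ut (insert x ?H) + dl * new ?H x)"
    by (simp only: of_nat_sum)
  have s3: "(\<Sum>x<n. \<Sum>r<2*n. p ^ (Zc (insert x ?H) r + j * (c r + of_bool (alive ?H r x)))) =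
     (\<Sum>r<2*n. \<Sum>x<n. p ^ (Zc (insert x ?H) r + j * (c r + of_bool (alive ?H r x))))"
    by (rule sum.swap)
  have "(\<Sum>x<n. real (scoreZ c ?H x)) = real k ^ N * (real (\<Sum>x<n. Ut (insert x ?H) + dl * new ?H x) +
     (\<Sum>r<2*n. \<Sum>x<n. p ^ (Zc (insert x ?H) r + j * (c r + of_bool (alive ?H r x)))))"
    unfolding s1 s2 s3 ..
  also have "\<dots> \<le> real k ^ N * (real (n * Ut ?H) + (\<Sum>r<2*n. real n * p ^ (Zc ?H r + j * c r)))"
    using kp by (intro mult_left_mono add_mono sum_mono avg_exp hit of_nat_mono avg_U) auto
  also have "\<dots> = real n * real ?v" unfolding real_v by (simp add: sum_distrib_left algebra_simps)
  finally have "real (\<Sum>x<n. scoreZ c ?H x) \<le> real (n * ?v)" by (simp only: of_nat_sum of_nat_mult)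
  then have avg: "(\<Sum>x<n. scoreZ c ?H x) \<le> n * ?v" by (simp only: of_nat_le_iff)
  have "scoreZ c ?H w \<le> ?v"
  proof (rule min_avg(2)[of w n ?H])
    show "scoreZ c ?H x = ?v" if "x < n" "x \<in> ?H" for x
    proof -
      have "\<not> alive ?H r x" for r using alive_self that by blast
      then show ?thesis using that by (simp add: scoreZ_def insert_absorb new_old)
    qed
  qed (use w min avg in auto)
  then have "real (scoreZ c ?H w) \<le> real ?v" by (simp only: of_nat_le_iff)
  then have D: "real (Ut (insert w ?H) + dl * new ?H w) +
      (\<Sum>r<2*n. p ^ (Zc (insert w ?H) r + j * (c r + of_bool (alive ?H r w))))
      \<le> real (Ut ?H) + (\<Sum>r<2*n. p ^ (Zc ?H r + j * c r))"
    unfolding real_score real_v using kp by (simp only: mult_le_cancel_left_pos)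
  have "(\<Sum>r<2*n. p ^ (Zc (insert w ?H) r + j * (c r + of_bool (alive ?H r w)))) =
      (\<Sum>r<2*n. p ^ (Zc (set (hs @ [w])) r + j * c' r))"
    by (intro sum.cong) (auto simp: c')
  moreover have "real (Lp (hs @ [w])) + real (Ut ?H) = real (Lp hs) + real (Ut (insert w ?H) + dl * new ?H w)"
    using Lp_snoc[of hs w] by (metis add.assoc of_nat_add)
  ultimately have "real (Lp (hs @ [w])) + (\<Sum>r<2*n. p ^ (Zc (set (hs @ [w])) r + j * c' r)) \<le>
     real (Lp hs) + (\<Sum>r<2*n. p ^ (Zc (set hs) r + j * c r))"
    using D by linarith
  moreover have "e * cnt r (hs @ [w]) \<le> Tb B qb + e * c' r" for r
  proof -
    have "alive ?H r w \<Longrightarrow> r < 2 * n" using Wr by (auto simp: alive_def)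
    moreover have "e * cnt r hs \<le> Tb B qb + e * c r" using Z by (auto simp: ZI_def)
    ultimately show ?thesis by (auto simp: cnt_snoc c' distrib_left)
  qed
  ultimately show ?thesis using Z unfolding ZI_def by (meson order_trans)
qed

text \<open>\<open>B\<close> is an upper bound for the start value of the first potential divided by
  \<open>Q\<close>.\<close>

lemma reach_inv:
  assumes "reach hs A pc c" and qb: "Q \<le> 2 ^ qb" and B: "n * e * card M + Q * Ut {} \<le> Q * B"
    and Wr: "\<And>r x. W r x \<Longrightarrow> r < 2 * n"
  shows "(am (set hs) > 0 \<longrightarrow> c = (\<lambda>_. 0) \<and> (YN B hs A pc \<or> YF B qb hs A)) \<and> (am (set hs) = 0 \<longrightarrow> ZI B qb hs c)"
  using assms(1)
proof (induction rule: reach.induct)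
  case reach_init
  have a: "am {} = card M" by (simp add: am_def)
  have L: "Lp [] = Ut {}" by (simp add: Lp_def)
  have "YN B [] (n * e) 0 \<or> YF B qb [] (n * e)"
  proof (cases "n * e < AQ")
    case True
    have "n * (n * e * card M + Q * Ut {}) \<le> n * (Q * B)" using B by (intro mult_le_mono2)
    then have "YN B [] (n * e) 0" unfolding YN_def using True n_pos a L by (auto intro!: exI[of _ 0])
    then show ?thesis ..
  next
    case False
    \<comment> \<open>This forces \<open>Q = 1\<close>, and the first stage begins in its final
      phase.\<close>
    then have "n * e * Q \<le> n * e * 1" unfolding AQ_def by (simp only: not_less mult_1_right)
    then have "Q \<le> 1" by (rule mult_left_le_imp_le) (use n_pos e_pos in simp)
    then have Q1: "Q = 1" using Q_pos by simp
    then have "card M \<le> F0 B" unfolding F0_def using B n_pos e_pos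
      by (simp add: less_eq_div_iff_mult_less_eq mult_ac)
    moreover have "Ut {} \<le> B" using B Q1 by simp
    ultimately have "YF B qb [] (n * e)" unfolding YF_def using False a L
      by (auto intro!: exI[of _ 0] add_mono mult_le_mono)
    then show ?thesis ..
  qed
  then show ?case using Y_Z[OF _ qb] by auto
next
  case (reach_Y hs A pc c w A' pc')
  then have c0: "c = (\<lambda>_. 0)" and Y: "YN B hs A pc \<or> YF B qb hs A" by auto
  have "YN B (hs @ [w]) A' pc' \<or> YF B qb (hs @ [w]) A'"
    by (rule Y_step[OF Y qb reach_Y.hyps(2-4) reach_Y.hyps(5) reach_Y.hyps(6,7)])
  then show ?case using Y_Z[OF _ qb] c0 by blast
next
  case (reach_Z hs A pc c w c')
  then have "ZI B qb hs c" by simp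
  from Z_step[OF this reach_Z.hyps(1-4) reach_Z.hyps(5) reach_Z.hyps(6) Wr]
  have "ZI B qb (hs @ [w]) c'" .
  moreover have "am (set (hs @ [w])) = 0" using am_insert_le[of w "set hs"] reach_Z.hyps(4) by simp
  ultimately show ?case by simp
qed

lemma reach_result:
  assumes "reach hs A pc c" "Q \<le> 2 ^ qb" "n * e * card M + Q * Ut {} \<le> Q * B"
    "\<And>r x. W r x \<Longrightarrow> r < 2 * n"
  shows "am (set hs) = 0 \<Longrightarrow> dl * (\<Sum>r<2*n. cnt r hs) \<le> B + 2 * n * dl * F0 B + 2 * n * p ^ n"
    and "am (set hs) = 0 \<Longrightarrow> r < 2 * n \<Longrightarrow> e * cnt r hs \<le> Tb B qb + e * c r \<and>
      p ^ (j * c r) \<le> B + 2 * n * dl * F0 B + 2 * n * p ^ n"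
proof -
  assume "am (set hs) = 0"
  then have Z: "ZI B qb hs c" using reach_inv[OF assms] by simp
  let ?S = "\<Sum>r<2*n. p ^ (Zc (set hs) r + j * c r)"
  have pp: "p \<ge> 0" using p_ge by linarith
  have Z1: "real (Lp hs) + ?S \<le> real (B + 2 * n * dl * F0 B) + 2 * real n * p ^ n"
    and Z2: "\<And>r. e * cnt r hs \<le> Tb B qb + e * c r" using Z by (auto simp: ZI_def)
  have S0: "?S \<ge> 0" using pp by (intro sum_nonneg) auto
  have "real (dl * (\<Sum>r<2*n. cnt r hs)) \<le> real (Lp hs)" unfolding Lp_def by simp
  then show "dl * (\<Sum>r<2*n. cnt r hs) \<le> B + 2 * n * dl * F0 B + 2 * n * p ^ n"
    using Z1 S0 by simp
  assume r: "r < 2 * n"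
  have "p ^ (j * c r) \<le> p ^ (Zc (set hs) r + j * c r)" using p_ge by (intro power_increasing) auto
  also have "\<dots> \<le> ?S" using r pp by (intro member_le_sum) auto
  finally have "p ^ (j * c r) \<le> ?S" .
  moreover have "real (Lp hs) \<ge> 0" by simp
  ultimately show "e * cnt r hs \<le> Tb B qb + e * c r \<and>
      p ^ (j * c r) \<le> B + 2 * n * dl * F0 B + 2 * n * p ^ n"
    using Z1 Z2 by simp
qed

end

section \<open>Heavy nodes\<close>

context paths
begin

section \<open>Subpaths and their nodes by distance\<close>

lemma P_less: "x \<in> P u v \<Longrightarrow> x < n" using P_sub by blast
lemma P_fin [simp]: "finite (P u v)" by (rule finite_subset[OF P_sub]) simp

text \<open>The node of \<open>P u x\<close> at the distance of \<open>y\<close> lies on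
  \<open>P u v\<close> as well and is \<open>y\<close> by uniqueness.\<close>

lemma P_prefix:
  assumes "u < n" "v < n" "x \<in> P u v" "y \<in> P u v" "d u y \<le> d u x"
  shows "y \<in> P u x"
proof -
  obtain z where z: "z \<in> P u x" "d u z = d u y" using P_lev[of u x "d u y"] assms P_less by blast
  then have "z \<in> P u v" using P_trans assms by blast
  then show ?thesis using P_uniq[of u v z y] z assms by auto
qed

lemma P_suffix:
  assumes "u < n" "v < n" "x \<in> P u v" "y \<in> P u v" "d u x \<le> d u y"
  shows "y \<in> P x v"
proof -
  have l: "x < n" "y < n" using assms P_less by blast+
  have "d u x + d x v = d u y + d y v" using P_d assms by metis
  then have "d v y \<le> d v x" using assms(5) d_sym l assms(1,2) by (metis add_le_cancel_left le_trans nat_add_left_cancel_le add_le_mono1 nat_le_linear le_antisym)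
  then have "y \<in> P v x" using P_prefix[of v u x y] assms P_sym by metis
  then show ?thesis using P_sym l assms by metis
qed

lemma P_trans2: "u < n \<Longrightarrow> v < n \<Longrightarrow> x \<in> P u v \<Longrightarrow> y \<in> P x v \<Longrightarrow> y \<in> P u v"
  using P_trans[of v u x y] P_sym P_less by metis

lemma P_mono: "u < n \<Longrightarrow> v < n \<Longrightarrow> x \<in> P u v \<Longrightarrow> P u x \<subseteq> P u v"
  using P_trans by blast

lemma P_dle: "u < n \<Longrightarrow> v < n \<Longrightarrow> x \<in> P u v \<Longrightarrow> d u x \<le> d u v"
  using P_d by (metis le_add1)

lemma card_P_range:
  assumes "u < n" "v < n"
  shows "card {x \<in> P u v. a \<le> d u x \<and> d u x < b} = card ({a..<b} \<inter> {..d u v})"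
proof -
  have "bij_betw (d u) {x \<in> P u v. a \<le> d u x \<and> d u x < b} ({a..<b} \<inter> {..d u v})"
    unfolding bij_betw_def
  proof
    show "inj_on (d u) {x \<in> P u v. a \<le> d u x \<and> d u x < b}"
      using P_uniq[OF assms] by (auto intro: inj_onI)
    show "d u ` {x \<in> P u v. a \<le> d u x \<and> d u x < b} = {a..<b} \<inter> {..d u v}"
    proof (intro equalityI subsetI)
      fix i assume "i \<in> {a..<b} \<inter> {..d u v}"
      then show "i \<in> d u ` {x \<in> P u v. a \<le> d u x \<and> d u x < b}"
        using P_lev[OF assms, of i] by auto
    qed (use P_dle[OF assms] in auto)
  qed
  then show ?thesis by (rule bij_betw_same_card)
qed

lemma card_P:
  assumes "u < n" "v < n" shows "card (P u v) = d u v + 1"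
proof -
  have "P u v = {x \<in> P u v. 0 \<le> d u x \<and> d u x < Suc (d u v)}"
    using P_dle[OF assms] by (auto simp: less_Suc_eq_le)
  then have "card (P u v) = card ({0..<Suc (d u v)} \<inter> {..d u v})" using card_P_range[OF assms] by metis
  also have "{0..<Suc (d u v)} \<inter> {..d u v} = {..d u v}" by auto
  finally show ?thesis by simp
qed

text \<open>The size of the subtree below \<open>y\<close> in the tree of shortest paths from
  \<open>u\<close>.\<close>

definition mass where "mass u y = card {w. w < n \<and> y \<in> P u w}"

lemma mass_mono:
  assumes "u < n" "y < n" "x \<in> P u y" shows "mass u y \<le> mass u x"
  unfolding mass_def
proof (rule card_mono)
  show "{w. w < n \<and> y \<in> P u w} \<subseteq> {w. w < n \<and> x \<in> P u w}"
    using assms P_trans[of u _ y x] by auto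
qed auto

text \<open>A path from \<open>u\<close> through \<open>z\<close> passes \<open>q\<close> and then
  \<open>y\<close>, and its part from \<open>q\<close> on is again a chosen path. So heaviness seen
  from \<open>u\<close> is inherited by pieces that start elsewhere.\<close>

lemma mass_suffix:
  assumes "u < n" "z < n" "q \<in> P u z" "y \<in> P u z" "d u q \<le> d u y"
  shows "mass u z \<le> mass q y"
  unfolding mass_def
proof (rule card_mono)
  show "{w. w < n \<and> z \<in> P u w} \<subseteq> {w. w < n \<and> y \<in> P q w}"
  proof
    fix w assume "w \<in> {w. w < n \<and> z \<in> P u w}"
    then have w: "w < n" "z \<in> P u w" by auto
    then have "q \<in> P u w" "y \<in> P u w" using P_trans assms by blast+
    then show "w \<in> {w. w < n \<and> y \<in> P q w}" using P_suffix[of u w q y] assms w by auto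
  qed
qed auto

text \<open>Subtrees below different nodes of one level are disjoint, so at most \<open>l\<close> of
  them can hold \<open>n / l\<close> nodes each.\<close>

lemma heavy_count:
  assumes "u < n"
  shows "card {y. y < n \<and> d u y = i \<and> n \<le> mass u y * l} \<le> l"
proof -
  define Y where "Y = {y. y < n \<and> d u y = i \<and> n \<le> mass u y * l}"
  have Yn: "Y \<subseteq> {..<n}" and Yi: "\<And>y. y \<in> Y \<Longrightarrow> d u y = i" and Yl: "\<And>y. y \<in> Y \<Longrightarrow> n \<le> mass u y * l"
    by (auto simp: Y_def)
  have fin: "finite Y" using Yn finite_subset by blast
  have "(\<Sum>y\<in>Y. mass u y) = card (\<Union>y\<in>Y. {w. w < n \<and> y \<in> P u w})"
    unfolding mass_def
  proof (rule card_UN_disjoint[symmetric])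
    show "\<forall>y\<in>Y. \<forall>z\<in>Y. y \<noteq> z \<longrightarrow> {w. w < n \<and> y \<in> P u w} \<inter> {w. w < n \<and> z \<in> P u w} = {}"
      using P_uniq[OF assms] Yi by fastforce
  qed (use fin in auto)
  also have "\<dots> \<le> card {..<n}" by (rule card_mono) auto
  finally have s: "(\<Sum>y\<in>Y. mass u y) \<le> n" by simp
  have "card Y * n = (\<Sum>y\<in>Y. n)" by simp
  also have "\<dots> \<le> (\<Sum>y\<in>Y. mass u y * l)" by (rule sum_mono) (use Yl in auto)
  also have "\<dots> = (\<Sum>y\<in>Y. mass u y) * l" by (simp add: sum_distrib_right)
  also have "\<dots> \<le> n * l" using s by simp
  finally have "card Y \<le> l" using n_pos by (simp add: mult.commute)
  then show ?thesis unfolding Y_def .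
qed

subsection \<open>Greedy hitting sets\<close>

definition far where "far m X = {(u, v). u < n \<and> v < n \<and> m \<le> d u v \<and> P u v \<inter> X = {}}"

lemma far_fin [simp]: "finite (far m X)"
  by (rule finite_subset[of _ "{..<n} \<times> {..<n}"]) (auto simp: far_def)

inductive hitr :: "nat \<Rightarrow> nat set \<Rightarrow> bool" for m where
  hitr_empty: "hitr m {}"
| hitr_insert: "hitr m X \<Longrightarrow> far m X \<noteq> {} \<Longrightarrow> w < n \<Longrightarrow>
    (\<And>x. x < n \<Longrightarrow> card (far m (insert w X)) \<le> card (far m (insert x X))) \<Longrightarrow> hitr m (insert w X)"

lemma far_insert: "far m (insert w X) = {a \<in> far m X. w \<notin> P (fst a) (snd a)}"
  by (auto simp: far_def)

lemma far_greedy: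
  assumes "far m X \<noteq> {}" "w < n" "\<And>x. x < n \<Longrightarrow> card (far m (insert w X)) \<le> card (far m (insert x X))"
  shows "n * card (far m (insert w X)) + m * card (far m X) \<le> n * card (far m X)"
    and "card (far m (insert w X)) < card (far m X)"
proof -
  \<comment> \<open>A path with \<open>m\<close> edges has \<open>m + 1\<close> nodes; the extra one
    makes the number drop strictly even for \<open>m = 0\<close>.\<close>
  have "(\<Sum>x<n. card (far m (insert x X))) + Suc m * card (far m X) \<le> n * card (far m X)"
    unfolding far_insert
  proof (rule sum_unhit)
    fix a assume "a \<in> far m X"
    then show "P (fst a) (snd a) \<subseteq> {..<n} \<and> Suc m \<le> card (P (fst a) (snd a))"
      using card_P P_sub by (auto simp: far_def)
  qed simp
  moreover have "(\<Sum>x<n. card (far m (insert w X))) \<le> (\<Sum>x<n. card (far m (insert x X)))"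
    by (intro sum_mono assms) auto
  ultimately have *: "n * card (far m (insert w X)) + Suc m * card (far m X) \<le> n * card (far m X)"
    by simp
  then show "n * card (far m (insert w X)) + m * card (far m X) \<le> n * card (far m X)" by simp
  have "card (far m X) > 0" using assms by (simp add: card_gt_0_iff)
  then have "n * card (far m (insert w X)) < n * card (far m X)" using * unfolding mult_Suc by linarith
  then show "card (far m (insert w X)) < card (far m X)" by simp
qed

text \<open>The last conjunct looks one step back: before the latest insertion a pair was still
  unhit. This limits the number of insertions.\<close>

lemma hitr_inv:
  assumes "hitr m X"
  shows "X \<subseteq> {..<n} \<and> real (card (far m X)) \<le> real n ^ 2 * (1 - real m / n) ^ card X \<and>
    (X \<noteq> {} \<longrightarrow> m < n \<and> 1 \<le> real n ^ 2 * (1 - real m / n) ^ (card X - 1))"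
  using assms
proof (induction rule: hitr.induct)
  case hitr_empty
  have "card (far m {}) \<le> card ({..<n} \<times> {..<n})" by (rule card_mono) (auto simp: far_def)
  then have "card (far m {}) \<le> n * n" by simp
  then have "real (card (far m {})) \<le> real (n * n)" by (simp only: of_nat_le_iff)
  then show ?case by (simp add: power2_eq_square)
next
  case (hitr_insert X w)
  note g = far_greedy[OF hitr_insert.hyps(2-3) hitr_insert.hyps(4)]
  obtain u v where uv: "(u, v) \<in> far m X" using hitr_insert.hyps(2) by auto
  then have mn: "m < n" using d_less[of u v] by (auto simp: far_def)
  have np: "real n > 0" using n_pos by simp
  have wX: "w \<notin> X" using g(2) by (auto simp: insert_absorb)
  have fX: "finite X" using hitr_insert.IH finite_subset by blast
  then have c: "card (insert w X) = Suc (card X)" using wX by simp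
  have q: "0 \<le> 1 - real m / n" using mn np by (simp add: field_simps)
  have "real n * real (card (far m (insert w X))) \<le> real n * (real (card (far m X)) * (1 - real m / n))"
  proof -
    have "real (n * card (far m (insert w X)) + m * card (far m X)) \<le> real (n * card (far m X))"
      using g(1) by (simp only: of_nat_le_iff)
    then show ?thesis using np by (simp add: algebra_simps)
  qed
  then have "real (card (far m (insert w X))) \<le> real (card (far m X)) * (1 - real m / n)"
    using np by simp
  also have "\<dots> \<le> real n ^ 2 * (1 - real m / n) ^ card X * (1 - real m / n)"
    using hitr_insert.IH q by (intro mult_right_mono) auto
  finally have 1: "real (card (far m (insert w X))) \<le> real n ^ 2 * (1 - real m / n) ^ card (insert w X)"
    by (simp add: c mult_ac)
  have "card (far m X) > 0" using hitr_insert.hyps(2) by (simp add: card_gt_0_iff)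
  then have "1 \<le> real (card (far m X))" by simp
  then have "1 \<le> real n ^ 2 * (1 - real m / n) ^ card X" using hitr_insert.IH by linarith
  then show ?case using 1 c mn hitr_insert.IH hitr_insert.hyps(3) by simp
qed

lemma hitr_card:
  assumes "hitr m X" "m > 0"
  shows "real (card X) \<le> 2 * (real n / m) * ln n + 1 \<and> (X \<noteq> {} \<longrightarrow> m < n)"
proof (cases "X = {}")
  case True
  then show ?thesis using n_pos assms(2) by simp
next
  case False
  note inv = hitr_inv[OF assms(1)]
  have mn: "m < n" using inv False by simp
  let ?t = "card X - 1"
  have np: "real n > 0" using n_pos by simp
  have "1 \<le> real n ^ 2 * (1 - real m / n) ^ ?t" using inv False by simp
  also have "\<dots> \<le> real n ^ 2 * exp (- (real m / n)) ^ ?t"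
  proof (intro mult_left_mono power_mono)
    show "1 - real m / n \<le> exp (- (real m / n))" using exp_ge_add_one_self[of "- (real m / n)"] by simp
    show "0 \<le> 1 - real m / n" using mn np by (simp add: field_simps)
  qed simp
  also have "\<dots> = exp (2 * ln n) * exp (- (real ?t * (real m / n)))"
    using np by (simp add: exp_of_nat_mult[symmetric] exp_double)
  also have "\<dots> = exp (2 * ln n - real ?t * (real m / n))" by (simp add: exp_diff exp_minus divide_inverse)
  finally have "0 \<le> 2 * ln n - real ?t * (real m / n)"
    using exp_le_cancel_iff[of 0] by (metis exp_zero)
  then have "real ?t * (real m / n) \<le> 2 * ln n" by simp
  then have "real ?t \<le> 2 * (real n / m) * ln n" using assms(2) np by (simp add: field_simps)
  then show ?thesis using mn by linarith
qed

end

section \<open>Hub sets\<close>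

text \<open>Applied to the distances on a segment, this finds the node at a prescribed
  level.\<close>

lemma ex_rank:
  fixes f :: "'a \<Rightarrow> nat"
  assumes "finite A" "inj_on f A" "0 < r" "r \<le> card A"
  shows "\<exists>y\<in>A. card {z \<in> A. f z \<le> f y} = r"
proof -
  let ?g = "\<lambda>y. card {z \<in> A. f z \<le> f y}"
  have lt: "?g y < ?g y'" if "y \<in> A" "y' \<in> A" "f y < f y'" for y y'
  proof (rule psubset_card_mono)
    have "{z \<in> A. f z \<le> f y} \<subseteq> {z \<in> A. f z \<le> f y'}" using that(3) by auto
    moreover have "y' \<in> {z \<in> A. f z \<le> f y'}" "y' \<notin> {z \<in> A. f z \<le> f y}" using that by auto
    ultimately show "{z \<in> A. f z \<le> f y} \<subset> {z \<in> A. f z \<le> f y'}" by blast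
  qed (use assms(1) in simp)
  have "inj_on ?g A"
  proof (rule inj_onI)
    fix y y' assume h: "y \<in> A" "y' \<in> A" "?g y = ?g y'"
    then have "f y = f y'" using lt[of y y'] lt[of y' y] by linarith
    then show "y = y'" using assms(2) h by (auto dest: inj_onD)
  qed
  then have "card (?g ` A) = card {1..card A}" by (simp add: card_image)
  moreover have "?g ` A \<subseteq> {1..card A}"
  proof
    fix m assume "m \<in> ?g ` A"
    then obtain y where y: "y \<in> A" "m = ?g y" by blast
    have "?g y > 0" using y assms(1) by (auto simp: card_gt_0_iff)
    moreover have "?g y \<le> card A" using assms(1) by (intro card_mono) auto
    ultimately show "m \<in> {1..card A}" using y by auto
  qed
  ultimately have "?g ` A = {1..card A}" by (intro card_subset_eq) auto
  then have "r \<in> ?g ` A" using assms(3,4) by auto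
  then show ?thesis by auto
qed

locale hub_alg = paths +
  fixes j l :: nat and md :: bool and X :: "nat set" and k N :: nat
begin

text \<open>Paths with \<open>Lam\<close> edges meet \<open>X\<close>. In the mode \<open>md\<close>
  the set is sparse enough to be given to every node as \<open>R\<close>; otherwise \<open>X\<close>
  serves to find the pieces \<open>Ms\<close>.\<close>

definition Lam where "Lam = (if md then 8 * j * l else 2 * j)"
definition R where "R = (if md then X else {})"
definition Hv where "Hv u y \<longleftrightarrow> md \<and> n \<le> mass u y * l \<and> d u y < Lam"
definition own where "own r = (if r < n then r else r - n)"
text \<open>
  Observer \<open>u < n\<close> of \<open>u\<close> skips the heavy nodes close to \<open>u\<close>; observer \<open>n + u\<close> also skips all
  nodes at distance less than \<open>16 * j\<close>.
\<close>

definition zz where "zz r x \<longleftrightarrow> x < n \<and> \<not> Hv (own r) x \<and> (r < n \<or> 16 * j \<le> d (own r) x)"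
definition seg where "seg r x = {y \<in> P (own r) x. zz r y}"
definition zd where "zd r x = card (seg r x)"
text \<open>The lower bound \<open>8 * j\<close> on the visible nodes makes a target die quickly;
  nodes of smaller rank are left to the second case of \<open>acc\<close>.\<close>

definition W where "W r x \<longleftrightarrow> r < 2 * n \<and> x < n \<and> zz r x \<and> 8 * j \<le> zd r x \<and> (r < n \<or> md) \<and> P (own r) x \<inter> R = {}"
definition Ms where "Ms = {(q, y). \<not> md \<and> q \<in> X \<and> q < n \<and> y < n \<and> d q y = 2 * j \<and> n \<le> mass q y * l}"
text \<open>A pick of small rank is no target itself. It becomes a hub through a target at the level
  \<open>lev r\<close>, and as this target dies with the pick, such hubs are at most as many as the
  targets of that level.\<close>

definition acc where
  "acc lev H r w \<longleftrightarrow> (\<exists>x. W r x \<and> seg r x \<inter> H = {} \<and> w \<in> seg r x \<and> (x = w \<or> zd r x = lev r))"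
definition hubs where
  "hubs lev hs u = R \<union> {y. y < n \<and> Hv u y} \<union>
     {w. \<exists>i < length hs. w = hs ! i \<and> (\<exists>r < 2 * n. own r = u \<and> acc lev (set (take i hs)) r w)}"

lemma Lam_md: "md \<Longrightarrow> Lam = 8 * j * l" unfolding Lam_def by simp
lemma Lam_nmd: "\<not> md \<Longrightarrow> Lam = 2 * j" unfolding Lam_def by simp
lemma R_md: "md \<Longrightarrow> R = X" unfolding R_def by simp
lemma Hv_nmd: "\<not> md \<Longrightarrow> \<not> Hv u y" unfolding Hv_def by simp
lemma seg_nmd: "\<not> md \<Longrightarrow> r < n \<Longrightarrow> seg r x = P (own r) x"
  unfolding seg_def zz_def using Hv_nmd P_sub by blast
lemma W_nmd: "\<not> md \<Longrightarrow> W r x \<Longrightarrow> r < n" unfolding W_def by blast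

lemma own_less: "r < 2 * n \<Longrightarrow> own r < n" by (auto simp: own_def)

text \<open>Mass and distance are monotone along a path, so the skipped heavy nodes form an initial
  piece of it.\<close>

lemma Hv_pre: "u < n \<Longrightarrow> y < n \<Longrightarrow> Hv u y \<Longrightarrow> x \<in> P u y \<Longrightarrow> Hv u x"
  unfolding Hv_def using mass_mono[of u y x] P_dle[of u y x]
  by (meson le_trans mult_le_mono1 order_le_less_trans)

lemma seg_sub: "seg r x \<subseteq> {..<n}" using P_sub by (auto simp: seg_def)
lemma seg_fin [simp]: "finite (seg r x)" by (rule finite_subset[OF seg_sub]) simp

lemma seg_mono: "r < 2 * n \<Longrightarrow> x < n \<Longrightarrow> y \<in> seg r x \<Longrightarrow> seg r y \<subseteq> seg r x"
  using P_trans[OF own_less] by (auto simp: seg_def)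

text \<open>So \<open>zd r y\<close> is the rank of \<open>y\<close> on every segment that contains
  it.\<close>

lemma seg_rank:
  assumes "r < 2 * n" "x < n" "y \<in> seg r x"
  shows "seg r y = {z \<in> seg r x. d (own r) z \<le> d (own r) y}"
proof -
  note o = own_less[OF assms(1)]
  have y: "y \<in> P (own r) x" "y < n" using assms(3) P_sub by (auto simp: seg_def)
  show ?thesis
    using P_prefix[OF o assms(2) y(1)] P_dle[OF o y(2)] P_trans[OF o assms(2) y(1)]
    by (auto simp: seg_def)
qed

text \<open>Let \<open>w\<close> be the first pick on the segment. If its rank is at least
  \<open>8 * j\<close>, it is an alive target; otherwise the node of rank \<open>lev r\<close> on
  the segment lies beyond \<open>w\<close> and is an alive target.\<close>

lemma first_acc:
  assumes j: "j > 0" and r: "r < 2 * n" "x < n" "r < n \<or> md" and R: "P (own r) x \<inter> R = {}"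
    and big: "16 * j \<le> zd r x" and hs: "seg r x \<subseteq> set hs" and lev: "8 * j \<le> lev r" "lev r < 16 * j"
  shows "\<exists>i < length hs. hs ! i \<in> seg r x \<and> (\<forall>i' < i. hs ! i' \<notin> seg r x) \<and>
    acc lev (set (take i hs)) r (hs ! i)"
proof -
  note o = own_less[OF r(1)]
  have "seg r x \<noteq> {}" using big j by (auto simp: zd_def)
  then have "\<exists>i. i < length hs \<and> hs ! i \<in> seg r x" using hs by (metis all_not_in_conv in_set_conv_nth subset_iff)
  then obtain i where i: "i < length hs" "hs ! i \<in> seg r x" and
    least: "\<And>i'. i' < i \<Longrightarrow> \<not> (i' < length hs \<and> hs ! i' \<in> seg r x)"
    using exists_least_iff[of "\<lambda>i. i < length hs \<and> hs ! i \<in> seg r x"] by blast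
  define w where "w = hs ! i"
  have w: "w \<in> seg r x" "w < n" using i seg_sub by (auto simp: w_def)
  have before: "seg r x \<inter> set (take i hs) = {}"
    using least i(1) by (auto simp: in_set_conv_nth)
  have al: "W r y \<and> seg r y \<inter> set (take i hs) = {}" if "y \<in> seg r x" "8 * j \<le> zd r y" for y
  proof -
    have y: "y < n" "zz r y" "y \<in> P (own r) x" using that seg_sub by (auto simp: seg_def)
    have "P (own r) y \<subseteq> P (own r) x" using P_mono[OF o r(2) y(3)] .
    then have "P (own r) y \<inter> R = {}" using R by blast
    then show ?thesis using that y r before seg_mono[OF r(1,2) that(1)] by (auto simp: W_def)
  qed
  have ws: "w \<in> seg r w" using w P_end[OF o w(2)] by (auto simp: seg_def)
  have "acc lev (set (take i hs)) r w"
  proof (cases "8 * j \<le> zd r w")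
    case True
    then show ?thesis using al[OF w(1) True] ws unfolding acc_def by blast
  next
    case False
    have inj: "inj_on (d (own r)) (seg r x)"
      using P_uniq[OF o r(2)] by (auto simp: seg_def intro: inj_onI)
    have "\<exists>y\<in>seg r x. card {z \<in> seg r x. d (own r) z \<le> d (own r) y} = lev r"
      by (rule ex_rank[OF seg_fin inj]) (use lev j big in \<open>auto simp: zd_def\<close>)
    then obtain y where y: "y \<in> seg r x" "zd r y = lev r"
      using seg_rank[OF r(1,2)] by (auto simp: zd_def)
    have "d (own r) w \<le> d (own r) y"
    proof (rule ccontr)
      assume "\<not> d (own r) w \<le> d (own r) y"
      then have "seg r y \<subseteq> seg r w" unfolding seg_rank[OF r(1,2) y(1)] seg_rank[OF r(1,2) w(1)] by auto
      then have "zd r y \<le> zd r w" unfolding zd_def by (intro card_mono) auto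
      then show False using False y(2) lev by simp
    qed
    then have "w \<in> seg r y" using seg_rank[OF r(1,2) y(1)] w(1) by auto
    moreover have "8 * j \<le> zd r y" using y(2) lev(1) by simp
    ultimately show ?thesis using al[OF y(1)] y(2) unfolding acc_def by blast
  qed
  then show ?thesis using i least w_def by (metis order_less_trans)
qed

text \<open>If both ends see at least \<open>16 * j\<close> nodes, compare their first picks: one
  that is heavy for the other end is a hub there anyway, and otherwise the picks coincide. If
  \<open>a\<close> sees fewer, all nodes at distance at least \<open>16 * j\<close> from
  \<open>b\<close> are heavy for \<open>a\<close> and thus its hubs; the second observer of
  \<open>b\<close> sees only such nodes and has one among its hubs.\<close>

lemma common_hub:
  assumes uv: "u < n" "v < n" and far: "32 * j \<le> d u v + 1" and hs: "set hs = {..<n}"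
    and lev: "\<And>r. r < 2 * n \<Longrightarrow> j > 0 \<Longrightarrow> 8 * j \<le> lev r \<and> lev r < 16 * j"
    and X: "far Lam X = {}" and md0: "j = 0 \<Longrightarrow> md"
  shows "\<exists>w \<in> P u v. w \<in> hubs lev hs u \<and> w \<in> hubs lev hs v"
proof (cases "P u v \<inter> R = {}")
  case False
  then show ?thesis by (auto simp: hubs_def)
next
  case R: True
  \<comment> \<open>For \<open>j = 0\<close> the mode is \<open>md\<close> with
    \<open>Lam = 0\<close>, so \<open>X\<close> would meet the path.\<close>
  have j: "j > 0"
  proof (rule ccontr)
    assume "\<not> j > 0"
    then have "md" using md0 by simp
    then have "Lam = 0" "R = X" using Lam_md R_md \<open>\<not> j > 0\<close> by auto
    then have "(u, v) \<in> far Lam X" using R uv by (auto simp: far_def)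
    then show False using X by simp
  qed
  have Puv: "P v u = P u v" using P_sym uv by simp
  have hubI: "hs ! i \<in> hubs lev hs a" if "i < length hs" "acc lev (set (take i hs)) r (hs ! i)" "r < 2 * n" "own r = a" for i r a
    using that by (auto simp: hubs_def)
  have HvI: "w \<in> hubs lev hs a" if "w < n" "Hv a w" for w a using that by (auto simp: hubs_def)
  have seg0: "seg a b = {z \<in> P u v. \<not> Hv a z}" if "a = u \<and> b = v \<or> a = v \<and> b = u" for a b
    using that Puv uv P_sub by (auto simp: seg_def zz_def own_def)
  have seg1: "seg (n + a) b = {z \<in> P u v. \<not> Hv a z \<and> 16 * j \<le> d a z}"
    if "a = u \<and> b = v \<or> a = v \<and> b = u" for a b
    using that Puv uv P_sub by (auto simp: seg_def zz_def own_def)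
  have ow: "own a = a" "own (n + a) = a" if "a < n" for a using that by (auto simp: own_def)
  have fa: "\<exists>i < length hs. hs ! i \<in> seg r b \<and> (\<forall>i' < i. hs ! i' \<notin> seg r b) \<and> hs ! i \<in> hubs lev hs a"
    if "a = u \<and> b = v \<or> a = v \<and> b = u" "r = a \<or> r = n + a \<and> md" "16 * j \<le> card (seg r b)" for a b r
  proof -
    have ab: "a < n" "b < n" using that uv by auto
    have r: "r < 2 * n" "own r = a" "r < n \<or> md" using that(2) ab ow by auto
    have "P (own r) b \<inter> R = {}" using r(2) that(1) R Puv by auto
    from first_acc[OF j r(1) ab(2) r(3) this] that(3) lev[OF r(1) j] hs seg_sub[of r b] hubI[OF _ _ r(1,2)]
    show ?thesis unfolding zd_def by metis
  qed
  show ?thesis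
  proof (cases "\<exists>z \<in> P u v. Hv u z \<and> Hv v z")
    case True
    then show ?thesis using HvI P_sub by blast
  next
    case sep: False
    have one: "\<exists>w \<in> P u v. w \<in> hubs lev hs a \<and> w \<in> hubs lev hs b"
      if ab: "a = u \<and> b = v \<or> a = v \<and> b = u" and small: "card (seg a b) < 16 * j" for a b
    proof -
      have abn: "a < n" "b < n" using ab uv by auto
      have Pab: "P a b = P u v" "P b a = P u v" using ab Puv by auto
      have ba: "b = u \<and> a = v \<or> b = v \<and> a = u" using ab by auto
      have dab: "d b a = d u v" "d a b = d u v" using ab d_sym uv by auto
      have md: "md"
      proof (rule ccontr)
        assume "\<not> md"
        then have "seg a b = P a b" using seg0[OF ab] Pab Hv_nmd[OF \<open>\<not> md\<close>] by blast
        then show False using small card_P[OF abn] far dab by simp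
      qed
      \<comment> \<open>If \<open>a\<close> saw such a node, it would see all later ones too, as
        heavy nodes form a prefix; up to \<open>b\<close> these are more than
        \<open>16 * j\<close>.\<close>
      have hv: "Hv a z" if z: "z \<in> P u v" "16 * j \<le> d b z" for z
      proof (rule ccontr)
        assume nh: "\<not> Hv a z"
        have zn: "z < n" using z P_sub by blast
        have "P z b \<subseteq> seg a b"
        proof
          fix y assume y: "y \<in> P z b"
          have yP: "y \<in> P a b" using P_trans2[OF abn, of z y] y z Pab by auto
          have yn: "y < n" using yP P_sub by blast
          have "\<not> Hv a y"
          proof
            assume h: "Hv a y"
            have "d a z + d z b = d a b" "d z y + d y b = d z b" "d a y + d y b = d a b"
              using P_d[OF abn] P_d[OF zn abn(2) y] z Pab yP by auto
            then have "d a z \<le> d a y" by simp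
            then have "z \<in> P a y" using P_prefix[OF abn yP, of z] z Pab by auto
            then show False using Hv_pre[OF abn(1) yn h] nh by blast
          qed
          then show "y \<in> seg a b" using seg0[OF ab] yP Pab by auto
        qed
        then have "card (P z b) \<le> card (seg a b)" by (intro card_mono) auto
        moreover have "card (P z b) = d z b + 1" using card_P[OF zn abn(2)] .
        ultimately show False using small z(2) d_sym[OF zn abn(2)] by simp
      qed
      \<comment> \<open>No node is heavy for both ends here, so the second observer of
        \<open>b\<close> skips nothing but the near nodes.\<close>
      have s: "seg (n + b) a = {z \<in> P b a. 16 * j \<le> d b z \<and> d b z < d b a + 1}"
        unfolding seg1[OF ba] Pab using sep hv P_dle[OF abn(2,1)] Pab ab by fastforce
      have "card (seg (n + b) a) = card ({16 * j..<d b a + 1} \<inter> {..d b a})"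
        unfolding s using card_P_range[OF abn(2,1)] .
      also have "{16 * j..<d b a + 1} \<inter> {..d b a} = {16 * j..<d b a + 1}" by auto
      finally have "16 * j \<le> card (seg (n + b) a)" using far dab by simp
      from fa[OF ba _ this] md obtain i where i: "i < length hs" "hs ! i \<in> seg (n + b) a" "hs ! i \<in> hubs lev hs b" by blast
      have "hs ! i \<in> P u v" "16 * j \<le> d b (hs ! i)" using i(2) s Pab by auto
      then show ?thesis using i(3) HvI[OF _ hv] P_sub by blast
    qed
    show ?thesis
    proof (cases "card (seg u v) < 16 * j \<or> card (seg v u) < 16 * j")
      case True
      then show ?thesis using one[of u v] one[of v u] by blast
    next
      case False
      then have b: "16 * j \<le> card (seg u v)" "16 * j \<le> card (seg v u)" by auto
      obtain i where i: "i < length hs" "hs ! i \<in> seg u v" "\<forall>i' < i. hs ! i' \<notin> seg u v" "hs ! i \<in> hubs lev hs u"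
        using fa[of u v u] b by blast
      obtain i2 where i2: "i2 < length hs" "hs ! i2 \<in> seg v u" "\<forall>i' < i2. hs ! i' \<notin> seg v u" "hs ! i2 \<in> hubs lev hs v"
        using fa[of v u v] b by blast
      note s = seg0[of u v] seg0[of v u]
      show ?thesis
      proof (cases "Hv v (hs ! i) \<or> Hv u (hs ! i2)")
        case True
        then show ?thesis using i i2 s HvI P_sub by blast
      next
        case False
        then have "hs ! i \<in> seg v u" "hs ! i2 \<in> seg u v" using i i2 s by auto
        then have "i = i2" using i i2 by (metis nat_neq_iff)
        then show ?thesis using i i2 s by auto
      qed
    qed
  qed
qed

end

section \<open>Few alive targets share a node\<close>

locale hub_alg_ok = hub_alg +
  assumes j_pos: "j \<ge> 1" and l_pos: "l \<ge> 1" and k_ge: "8 * j \<le> k" and kl: "2 * n \<le> k * l"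
    and N_ge: "n + j * (n + 1) \<le> N" and X_sub: "X \<subseteq> {..<n}" and X_far: "far Lam X = {}"
begin

text \<open>A visible node \<open>y\<close> is not both near and heavy, and it is near: a path of
  \<open>Lam\<close> edges to \<open>y\<close> would meet \<open>X\<close> and rule out the target.
  So \<open>y\<close> is light.\<close>

lemma light_md:
  assumes md and r: "r < 2 * n"
  shows "card {x. W r x \<and> y \<in> seg r x} \<le> k"
proof (cases "{x. W r x \<and> y \<in> seg r x} = {}")
  case False
  then obtain x0 where x0: "W r x0" "y \<in> seg r x0" by auto
  note o = own_less[OF r]
  let ?u = "own r"
  have y: "y \<in> P ?u x0" "zz r y" "y < n" "x0 < n" using x0 P_sub by (auto simp: seg_def W_def)
  have "\<not> Hv ?u y" using y by (auto simp: zz_def)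
  moreover have "d ?u y < Lam"
  proof (rule ccontr)
    assume "\<not> d ?u y < Lam"
    then have "P ?u y \<inter> X \<noteq> {}" using X_far o y(3) by (fastforce simp: far_def)
    moreover have "P ?u y \<subseteq> P ?u x0" using P_mono[OF o y(4,1)] .
    ultimately show False using x0(1) R_md[OF assms(1)] unfolding W_def by blast
  qed
  ultimately have m: "mass ?u y * l < n" using assms(1) unfolding Hv_def by (meson not_le)
  have "card {x. W r x \<and> y \<in> seg r x} \<le> mass ?u y"
    unfolding mass_def by (rule card_mono) (auto simp: W_def seg_def)
  then have "card {x. W r x \<and> y \<in> seg r x} * l < n" using m by (meson le_less_trans mult_le_mono1)
  then have "card {x. W r x \<and> y \<in> seg r x} * l < k * l" using kl by linarith
  then show ?thesis by simp
qed (simp only: card.empty)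

text \<open>Otherwise the node \<open>z\<close> at distance \<open>4 * j\<close> is heavy. The first
  \<open>2 * j\<close> edges of the path meet \<open>X\<close> in some \<open>q\<close>, and the
  next \<open>2 * j\<close> edges from \<open>q\<close> end at \<open>z\<close> or before and are
  heavy as seen from \<open>q\<close>. This piece belongs to \<open>Ms\<close>, so \<open>H\<close>
  already meets the path and the target is dead.\<close>

lemma light_trace:
  assumes "\<not> md" and hit: "\<And>a. a \<in> Ms \<Longrightarrow> P (fst a) (snd a) \<inter> H \<noteq> {}"
    and r: "r < 2 * n" and W: "W r x" "seg r x \<inter> H = {}" and y: "y \<in> P (own r) x" "4 * j \<le> d (own r) y"
  shows "mass (own r) y * l < n"
proof -
  let ?u = "own r"
  note o = own_less[OF r]
  have x: "x < n" "y < n" using W y P_sub by (auto simp: W_def)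
  have sP: "seg r x = P ?u x" by (rule seg_nmd[OF assms(1) W_nmd[OF assms(1) W(1)]])
  obtain z where z: "z \<in> P ?u x" "d ?u z = 4 * j"
    using P_lev[OF o x(1), of "4 * j"] P_dle[OF o x(1) y(1)] y(2) by auto
  have zn: "z < n" using z P_sub by auto
  have zy: "z \<in> P ?u y" using P_prefix[OF o x(1) y(1) z(1)] z(2) y(2) by simp
  have "mass ?u z * l < n"
  proof (rule ccontr)
    assume hz: "\<not> mass ?u z * l < n"
    obtain a where a: "a \<in> P ?u z" "d ?u a = 2 * j" using P_lev[OF o zn, of "2 * j"] z(2) by auto
    have an: "a < n" using a P_sub by auto
    have "Lam \<le> d ?u a" using Lam_nmd[OF assms(1)] a(2) by linarith
    then have "P ?u a \<inter> X \<noteq> {}" using X_far o an by (fastforce simp: far_def)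
    then obtain q where q: "q \<in> X" "q \<in> P ?u a" by auto
    have qz: "q \<in> P ?u z" "d ?u q \<le> 2 * j" using P_trans[OF o zn a(1) q(2)] P_dle[OF o an q(2)] a(2) by auto
    have qn: "q < n" using q X_sub by auto
    obtain b where b: "b \<in> P ?u z" "d ?u b = d ?u q + 2 * j"
      using P_lev[OF o zn, of "d ?u q + 2 * j"] z(2) qz(2) by auto
    have bn: "b < n" using b P_sub by auto
    have qb: "q \<in> P ?u b" using P_prefix[OF o zn b(1) qz(1)] b(2) by simp
    have dqb: "d q b = 2 * j" using P_d[OF o bn qb] b(2) by simp
    have "mass ?u z \<le> mass q b" using mass_suffix[OF o zn qz(1) b(1)] b(2) by simp
    then have "n \<le> mass q b * l" using hz by (meson le_trans mult_le_mono1 not_le)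
    then have "(q, b) \<in> Ms" unfolding Ms_def using assms(1) q(1) qn bn dqb by blast
    then obtain h where h: "h \<in> P q b" "h \<in> H" using hit[of "(q, b)"] by auto
    have "h \<in> P ?u b" using P_trans2[OF o bn qb h(1)] .
    then have "h \<in> P ?u x" using P_trans[OF o zn b(1)] P_trans[OF o x(1) z(1)] by blast
    then show False using W(2) sP h(2) by auto
  qed
  moreover have "mass ?u y \<le> mass ?u z" using mass_mono[OF o x(2) zy] .
  ultimately show ?thesis by (meson le_less_trans mult_le_mono1)
qed

sublocale g: greedy n W seg Ms "\<lambda>a. P (fst a) (snd a)" "8 * j" "2 * j" j k N "l * l"
proof
  show "0 < n" by (rule n_pos)
  show "1 \<le> j" by (rule j_pos)
  show "8 * j \<le> k" by (rule k_ge)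
  show "1 \<le> l * l" using l_pos by simp
  show "n + j * (n + 1) \<le> N" by (rule N_ge)
  show "seg r x \<subseteq> {..<n}" for r x by (rule seg_sub)
  show "x < n \<and> x \<in> seg r x \<and> 8 * j \<le> card (seg r x)" if "W r x" for r x
    using that P_end[OF own_less] by (auto simp: W_def zd_def seg_def)
  show "finite Ms" by (rule finite_subset[of _ "{..<n} \<times> {..<n}"]) (auto simp: Ms_def)
  show "P (fst a) (snd a) \<subseteq> {..<n} \<and> 2 * j \<le> card (P (fst a) (snd a))" if "a \<in> Ms" for a
    using that P_sub card_P by (auto simp: Ms_def)
  fix H r assume hit: "\<And>a. a \<in> Ms \<Longrightarrow> P (fst a) (snd a) \<inter> H \<noteq> {}" and r: "r < 2 * n"
  let ?u = "own r"
  note o = own_less[OF r]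
  show "\<exists>sg. (\<forall>x. W r x \<and> seg r x \<inter> H = {} \<longrightarrow> sg x \<subseteq> seg r x \<and> 2 * (2 * j) \<le> card (sg x)) \<and>
             (\<forall>y. card {x. W r x \<and> seg r x \<inter> H = {} \<and> y \<in> sg x} \<le> k)"
  proof (cases md)
    case True
    have "card {x. W r x \<and> seg r x \<inter> H = {} \<and> y \<in> seg r x} \<le> k" for y
    proof -
      have "card {x. W r x \<and> seg r x \<inter> H = {} \<and> y \<in> seg r x} \<le> card {x. W r x \<and> y \<in> seg r x}"
        by (rule card_mono[OF finite_subset[of _ "{..<n}"]]) (auto simp: W_def)
      then show ?thesis using light_md[OF True r, of y] by linarith
    qed
    then show ?thesis by (intro exI[of _ "seg r"]) (auto simp: W_def zd_def)
  next
    case False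
    \<comment> \<open>The first \<open>4 * j\<close> levels may contain heavy nodes and are cut off;
      of at least \<open>8 * j\<close> nodes this leaves \<open>4 * j\<close>, which is
      \<open>2 * e\<close>.\<close>
    let ?sg = "\<lambda>x. {y \<in> P ?u x. 4 * j \<le> d ?u y \<and> d ?u y < d ?u x + 1}"
    have 1: "?sg x \<subseteq> seg r x \<and> 2 * (2 * j) \<le> card (?sg x)" if W: "W r x" for x
    proof -
      have x: "x < n" using W by (auto simp: W_def)
      have sP: "seg r x = P ?u x" by (rule seg_nmd[OF False W_nmd[OF False W]])
      have "8 * j \<le> d ?u x + 1" using W sP card_P[OF o x] by (auto simp: W_def zd_def)
      moreover have "card (?sg x) = card ({4 * j..<d ?u x + 1} \<inter> {..d ?u x})" by (rule card_P_range[OF o x])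
      moreover have "{4 * j..<d ?u x + 1} \<inter> {..d ?u x} = {4 * j..<d ?u x + 1}" by auto
      ultimately show ?thesis using sP by auto
    qed
    have 2: "card {x. W r x \<and> seg r x \<inter> H = {} \<and> y \<in> ?sg x} \<le> k" for y
    proof (cases "{x. W r x \<and> seg r x \<inter> H = {} \<and> y \<in> ?sg x} = {}")
      case F: False
      then obtain x0 where x0: "W r x0" "seg r x0 \<inter> H = {}" "y \<in> ?sg x0" by auto
      have m: "mass ?u y * l < n" using light_trace[OF False hit r x0(1,2)] x0(3) by auto
      have "card {x. W r x \<and> seg r x \<inter> H = {} \<and> y \<in> ?sg x} \<le> mass ?u y"
        unfolding mass_def by (rule card_mono) (auto simp: W_def)
      then have "card {x. W r x \<and> seg r x \<inter> H = {} \<and> y \<in> ?sg x} * l < n"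
        using m by (meson le_less_trans mult_le_mono1)
      then have "card {x. W r x \<and> seg r x \<inter> H = {} \<and> y \<in> ?sg x} * l < k * l" using kl by linarith
      then show ?thesis by simp
    qed (simp only: card.empty)
    show ?thesis by (rule exI[of _ ?sg]) (use 1 2 in blast)
  qed
qed simp_all

text \<open>Hubs that are targets themselves are counted by \<open>cnt\<close>. Any other hub from
  the order is charged to a target of level \<open>lev r\<close> that dies with its pick, so no
  target is charged twice.\<close>

lemma hubs_card:
  assumes u: "u < n" and len: "length hs = n"
    and lev: "\<And>r. r < 2 * n \<Longrightarrow> card {x. W r x \<and> zd r x = lev r} \<le> b"
  shows "card (hubs lev hs u) \<le> card R + card {y. y < n \<and> Hv u y} + g.cnt u hs + g.cnt (n + u) hs + 2 * b"
proof -
  let ?I = "\<lambda>r. {i. i < length hs \<and> g.alive (set (take i hs)) r (hs ! i)}"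
  let ?L = "\<lambda>r i x. W r x \<and> seg r x \<inter> set (take i hs) = {} \<and> hs ! i \<in> seg r x \<and> zd r x = lev r"
  let ?J = "\<lambda>r. {i. i < length hs \<and> (\<exists>x. ?L r i x)}"
  have cJ: "card (?J r) \<le> b" if r: "r < 2 * n" for r
  proof -
    have "card (?J r) \<le> card {x. W r x \<and> zd r x = lev r}"
    proof (rule card_inj_on_le[of "\<lambda>i. SOME x. ?L r i x"])
      have L: "?L r i (SOME x. ?L r i x)" if "i \<in> ?J r" for i
        by (rule someI_ex) (use that in blast)
      have no: False if "i < i'" "i' < length hs" "?L r i x" "?L r i' x" for i i' x
      proof -
        have "hs ! i \<in> set (take i' hs)" using that(1,2) by (auto simp: in_set_conv_nth intro!: exI[of _ i])
        then show False using that by blast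
      qed
      show "inj_on (\<lambda>i. SOME x. ?L r i x) (?J r)"
      proof (rule inj_onI)
        fix i i' assume h: "i \<in> ?J r" "i' \<in> ?J r" "(SOME x. ?L r i x) = (SOME x. ?L r i' x)"
        show "i = i'"
        proof (rule ccontr)
          assume "i \<noteq> i'"
          then consider "i < i'" | "i' < i" by linarith
          then show False
          proof cases
            case 1
            then show False using no[OF 1, of "SOME x. ?L r i x"] L[OF h(1)] L[OF h(2)] h(2)
              unfolding h(3) by blast
          next
            case 2
            then show False using no[OF 2, of "SOME x. ?L r i x"] L[OF h(1)] L[OF h(2)] h(1)
              unfolding h(3) by blast
          qed
        qed
      qed
      show "(\<lambda>i. SOME x. ?L r i x) ` ?J r \<subseteq> {x. W r x \<and> zd r x = lev r}" using L by blast
      show "finite {x. W r x \<and> zd r x = lev r}"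
        by (rule finite_subset[of _ "{..<n}"]) (auto simp: W_def)
    qed
    then show ?thesis using lev[OF r] by linarith
  qed
  let ?A = "\<lambda>r. (\<lambda>i. hs ! i) ` (?I r \<union> ?J r)"
  have cA: "card (?A r) \<le> g.cnt r hs + b" if r: "r < 2 * n" for r
  proof -
    have "card (?A r) \<le> card (?I r \<union> ?J r)" by (rule card_image_le) auto
    also have "\<dots> \<le> card (?I r) + card (?J r)" by (rule card_Un_le)
    finally show ?thesis using cJ[OF r] by (simp add: g.cnt_def)
  qed
  have fA: "finite (?A r)" for r by simp
  have "hubs lev hs u \<subseteq> R \<union> {y. y < n \<and> Hv u y} \<union> (?A u \<union> ?A (n + u))"
  proof
    fix w assume "w \<in> hubs lev hs u"
    then consider "w \<in> R \<union> {y. y < n \<and> Hv u y}" |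
      i r where "i < length hs" "w = hs ! i" "r < 2 * n" "own r = u" "acc lev (set (take i hs)) r w"
      unfolding hubs_def by blast
    then show "w \<in> R \<union> {y. y < n \<and> Hv u y} \<union> (?A u \<union> ?A (n + u))"
    proof cases
      case 2
      have "r = u \<or> r = n + u" using 2(4) by (auto simp: own_def split: if_splits)
      moreover have "w \<in> ?A r"
      proof -
        from 2(5) obtain x where "W r x" "seg r x \<inter> set (take i hs) = {}" "w \<in> seg r x" "x = w \<or> zd r x = lev r"
          unfolding acc_def by blast
        then have "i \<in> ?I r \<union> ?J r" using 2(1,2) unfolding g.alive_def by blast
        then show ?thesis using 2(2) by blast
      qed
      ultimately show ?thesis by blast
    qed blast
  qed
  moreover have "finite R" unfolding R_def using X_sub finite_subset by auto
  ultimately have "card (hubs lev hs u) \<le> card (R \<union> {y. y < n \<and> Hv u y} \<union> (?A u \<union> ?A (n + u)))"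
    by (intro card_mono) auto
  also have "\<dots> \<le> card R + card {y. y < n \<and> Hv u y} + (card (?A u) + card (?A (n + u)))"
    by (intro order.trans[OF card_Un_le] add_mono card_Un_le)
  finally show ?thesis using cA[of u] cA[of "n + u"] u by simp
qed

end

section \<open>Sizes of the hub sets\<close>

lemma sum_split_lessThan: "(\<Sum>r<m+n. f r) = (\<Sum>r<m. f r) + (\<Sum>r<(n::nat). f (m + r) :: real)"
  by (induction n) auto

context greedy
begin

text \<open>Without sets to hit there is no first stage, so the mode \<open>md\<close> avoids the
  picks that are charged to every observer.\<close>

lemma cnt_eq_c: "reach hs A pc c \<Longrightarrow> M = {} \<Longrightarrow> r < 2 * n \<Longrightarrow> cnt r hs = c r"
proof (induction rule: reach.induct)
  case (reach_Y hs A pc c w A' pc')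
  have "am (set hs) = 0" unfolding am_def using reach_Y.prems(1) by simp
  with reach_Y.hyps(4) show ?case by linarith
next
  case (reach_Z hs A pc c w c')
  show ?case unfolding cnt_snoc reach_Z.hyps(6) reach_Z.IH[OF reach_Z.prems] using reach_Z.prems(2) by simp
qed simp

lemma ln_p: "1 / (real k + 1) \<le> ln p"
proof -
  have kp: "real k > 0" using k_pos by simp
  have "ln (1 / p) \<le> 1 / p - 1" using p_ge by (intro ln_le_minus_one) auto
  moreover have "ln (1 / p) = - ln p" using p_ge by (simp add: ln_div)
  moreover have "1 - 1 / p = 1 / (real k + 1)" using kp by (simp add: p_def field_simps)
  ultimately show ?thesis by linarith
qed

end

text \<open>\<open>k * l\<close> is tied to \<open>2 * n\<close> from both sides: the lower bound
  keeps \<open>p ^ n\<close> at most \<open>2 * n\<close>, the upper one turns the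
  \<open>O(k * l)\<close> of \<open>c_bound\<close> into \<open>O(n + j * l)\<close>. The exponent
  \<open>qb\<close> bounds the number of doublings of \<open>A\<close>.\<close>

locale hub_alg_fin = hub_alg_ok +
  fixes hs :: "nat list" and A pc :: nat and c lev :: "nat \<Rightarrow> nat" and b qb :: nat
  assumes l_low: "2 ^ (l - 1) \<le> n" and l_up: "n < 2 ^ l" and kl_up: "k * l \<le> 2 * n + l + 8 * j * l"
    and jn: "2 * j \<le> n" and X_hitr: "hitr Lam X" and md_iff: "md \<longleftrightarrow> (8 * j * l)\<^sup>2 \<le> n"
    and reach: "g.reach hs A pc c" and hs_len: "length hs = n"
    and lev: "r < 2 * n \<Longrightarrow> card {x. W r x \<and> zd r x = lev r} \<le> b" and b: "8 * j * b \<le> n"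
    and qb: "l * l \<le> 2 ^ qb"
begin

definition rj where "rj = real n / real j"

lemma j0: "real j > 0" using j_pos by simp
lemma j_rj: "real j * rj = real n" using j_pos by (simp add: rj_def)
lemma rj_ge: "1 \<le> rj" using jn j0 by (simp add: rj_def field_simps)

lemma ln_n: "ln (real n) \<le> real l"
proof -
  have "ln (real n) \<le> ln (2 ^ l)" using l_up n_pos
    by (intro ln_mono) (auto simp: less_imp_le simp flip: of_nat_power)
  also have "\<dots> = real l * ln 2" by (simp add: ln_realpow)
  also have "\<dots> \<le> real l * 1" using ln_2_less_1 by (intro mult_left_mono) auto
  finally show ?thesis by simp
qed

lemma two_l: "2 ^ l \<le> 2 * n"
proof -
  have "(2::nat) ^ l = 2 * 2 ^ (l - 1)" using l_pos by (cases l) auto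
  then show ?thesis using l_low by simp
qed

lemma X_card_nmd: assumes "\<not> md" shows "j * card X \<le> 2 * n * l"
proof -
  have L: "Lam = 2 * j" by (rule Lam_nmd[OF assms])
  have "real (card X) \<le> 2 * (real n / Lam) * ln n + 1" using hitr_card[OF X_hitr] L j_pos by auto
  also have "2 * (real n / Lam) * ln n = rj * ln n" using L by (simp add: rj_def)
  also have "rj * ln n \<le> rj * l" using ln_n rj_ge by (intro mult_left_mono) auto
  also have "rj * l + 1 \<le> 2 * (rj * l)"
  proof -
    have "1 * 1 \<le> rj * real l" using rj_ge l_pos by (intro mult_mono) auto
    then show ?thesis by linarith
  qed
  finally have "real j * real (card X) \<le> real j * (2 * (rj * l))" using j0 by simp
  also have "\<dots> = real (2 * n * l)" by (simp add: j_rj[symmetric])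
  finally show ?thesis by (simp only: of_nat_le_iff flip: of_nat_mult)
qed

text \<open>Each of the \<open>O(n * l / j)\<close> nodes of \<open>X\<close> starts at most
  \<open>l\<close> heavy pieces. The excess factor \<open>l * l\<close> over \<open>n / j\<close> is
  the value chosen for \<open>Q\<close>.\<close>

lemma Ms_card: "2 * j * card Ms \<le> 4 * n * (l * l)"
proof (cases md)
  case True
  then have "Ms = {}" unfolding Ms_def by blast
  then show ?thesis by simp
next
  case False
  have fX: "finite X" using X_sub finite_subset by blast
  have "Ms = (SIGMA q:X. {y. y < n \<and> d q y = 2 * j \<and> n \<le> mass q y * l})"
    unfolding Ms_def using False X_sub by blast
  then have "card Ms = (\<Sum>q\<in>X. card {y. y < n \<and> d q y = 2 * j \<and> n \<le> mass q y * l})"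
    using fX by (simp add: card_SigmaI)
  also have "\<dots> \<le> (\<Sum>q\<in>X. l)" using X_sub by (intro sum_mono heavy_count) auto
  finally have "card Ms \<le> card X * l" by simp
  then have "2 * j * card Ms \<le> 2 * j * (card X * l)" by (intro mult_le_mono2)
  also have "\<dots> = 2 * (j * card X) * l" by simp
  also have "\<dots> \<le> 2 * (2 * n * l) * l" using X_card_nmd[OF False] by (intro mult_le_mono1 mult_le_mono2)
  finally show ?thesis by (simp add: mult_ac)
qed

text \<open>Bounds the start value of the potential over \<open>Q\<close>: \<open>4 * n * n\<close>
  for the pieces to be hit and \<open>2 * n * n\<close> for the targets.\<close>

definition Bd where "Bd = 6 * n * n"

lemma potential0: "n * (2 * j) * card Ms + l * l * g.Ut {} \<le> l * l * Bd"
proof -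
  have "g.Ut {} \<le> (\<Sum>r<2*n. n)" unfolding g.Ut_def by (intro sum_mono g.Zc_le)
  then have "l * l * g.Ut {} \<le> l * l * (2 * n * n)" by (intro mult_le_mono2) simp
  moreover have "n * (2 * j * card Ms) \<le> n * (4 * n * (l * l))" by (intro mult_le_mono2 Ms_card)
  ultimately have "n * (2 * j * card Ms) + l * l * g.Ut {} \<le> n * (4 * n * (l * l)) + l * l * (2 * n * n)"
    by (intro add_mono)
  also have "\<dots> = l * l * Bd" by (simp add: Bd_def algebra_simps)
  finally show ?thesis by (simp only: mult.assoc)
qed

lemma p_n: "g.p ^ n \<le> 2 * real n"
proof -
  have kp: "real k > 0" using g.k_pos by simp
  have "g.p ^ n \<le> exp (1 / real k) ^ n"
    unfolding g.p_def by (intro power_mono exp_ge_add_one_self) auto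
  also have "\<dots> = exp (real n / real k)" by (simp add: exp_of_nat_mult[symmetric])
  also have "\<dots> \<le> exp (real l * (1/2))"
  proof -
    have "2 * real n \<le> real k * real l" using kl by (metis of_nat_le_iff of_nat_mult of_nat_numeral)
    then show ?thesis using kp by (simp add: field_simps)
  qed
  also have "\<dots> = exp (1/2) ^ l" by (simp add: exp_of_nat_mult[symmetric])
  also have "\<dots> \<le> 2 ^ l"
  proof (rule power_mono)
    have "exp (1/2::real) \<le> 1 + 1/2 + (1/2)\<^sup>2" by (rule exp_bound) auto
    also have "\<dots> \<le> 2" by (simp add: power2_eq_square)
    finally show "exp (1/2::real) \<le> 2" .
  qed simp
  also have "\<dots> \<le> 2 * real n" using two_l by (metis of_nat_le_iff of_nat_mult of_nat_numeral of_nat_power)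
  finally show ?thesis .
qed

lemma F0_le: "real j * real (g.F0 Bd) \<le> 3 * n"
proof -
  have "n * (2 * j) * g.F0 Bd \<le> Bd" unfolding g.F0_def by (simp add: mult.commute)
  then have "n * (2 * j * g.F0 Bd) \<le> n * (6 * n)" by (simp add: Bd_def mult_ac)
  then have "2 * j * g.F0 Bd \<le> 6 * n" using n_pos by simp
  then have "j * g.F0 Bd \<le> 3 * n" by linarith
  then show ?thesis by (metis of_nat_le_iff of_nat_mult of_nat_numeral)
qed

text \<open>The three summands contribute 6, 48 and 4.\<close>

lemma total_pot: "real Bd + 2 * real n * real (8 * j) * real (g.F0 Bd) + 2 * real n * g.p ^ n \<le> 58 * real n ^ 2"
proof -
  have "2 * real n * real (8 * j) * real (g.F0 Bd) = 16 * real n * (real j * real (g.F0 Bd))" by simp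
  also have "\<dots> \<le> 16 * real n * (3 * n)" using F0_le by (intro mult_left_mono) auto
  finally have 1: "2 * real n * real (8 * j) * real (g.F0 Bd) \<le> 48 * real n ^ 2" by (simp add: power2_eq_square)
  have "2 * real n * g.p ^ n \<le> 2 * real n * (2 * real n)" using p_n by (intro mult_left_mono) auto
  then have 2: "2 * real n * g.p ^ n \<le> 4 * real n ^ 2" by (simp add: power2_eq_square)
  have 3: "real Bd = 6 * real n ^ 2" by (simp add: Bd_def power2_eq_square)
  show ?thesis using 1 2 3 by linarith
qed

lemma hs_set: "set hs = {..<n}"
proof -
  have "distinct hs" "set hs \<subseteq> {..<n}" using g.reach_basic[OF reach] by auto
  then show ?thesis using hs_len distinct_card[of hs] by (intro card_subset_eq) auto
qed

lemma am0: "g.am (set hs) = 0"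
proof -
  have "P (fst a) (snd a) \<inter> set hs \<noteq> {}" if "a \<in> Ms" for a
    using that P_end[of "fst a" "snd a"] hs_set by (auto simp: Ms_def)
  then have "{a \<in> Ms. P (fst a) (snd a) \<inter> set hs = {}} = {}" by blast
  then show ?thesis by (simp only: g.am_def card.empty)
qed

lemma W_r: "W r x \<Longrightarrow> r < 2 * n" by (simp add: W_def)

lemma total_cnt: "real (\<Sum>r<2*n. g.cnt r hs) \<le> 8 * (real n * rj)"
proof -
  have "real (8 * j * (\<Sum>r<2*n. g.cnt r hs)) \<le> real Bd + 2 * real n * real (8 * j) * real (g.F0 Bd) + 2 * real n * g.p ^ n"
    using g.reach_result(1)[OF reach qb potential0 W_r am0] by simp
  also have "\<dots> \<le> 58 * real n ^ 2" by (rule total_pot)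
  finally have "8 * (real j * real (\<Sum>r<2*n. g.cnt r hs)) \<le> 58 * real n ^ 2" by simp
  moreover have "0 \<le> real n ^ 2" by simp
  ultimately have "real j * real (\<Sum>r<2*n. g.cnt r hs) \<le> 8 * real n ^ 2" by linarith
  also have "\<dots> = real j * (8 * (real n * rj))" by (simp add: j_rj[symmetric] power2_eq_square)
  finally show ?thesis using j0 by simp
qed

text \<open>The logarithm of the final potential is \<open>O(l)\<close>, and each hub of the second
  stage contributes \<open>j * ln p\<close>, about \<open>j / k\<close>, to it.\<close>

lemma c_bound: assumes "r < 2 * n" shows "real (c r) \<le> 16 * rj + 80 * l"
proof -
  have "g.p ^ (j * c r) \<le> real Bd + 2 * real n * real (8 * j) * real (g.F0 Bd) + 2 * real n * g.p ^ n"
    using g.reach_result(2)[OF reach qb potential0 W_r am0 assms] by simp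
  also have "\<dots> \<le> 58 * real n ^ 2" by (rule total_pot)
  also have "\<dots> \<le> 2 ^ 6 * real n ^ 2" by simp
  finally have "ln (g.p ^ (j * c r)) \<le> ln (2 ^ 6 * real n ^ 2)"
    using g.p_ge by (intro ln_mono) (auto intro: zero_less_power)
  moreover have "ln (2 ^ 6 * real n ^ 2) = ln (2 ^ 6) + ln (real n ^ 2)"
    using n_pos by (intro ln_mult_pos) auto
  moreover have "ln ((2::real) ^ 6) = 6 * ln 2" using ln_realpow[of 2 6] by simp
  moreover have "ln (real n ^ 2) = 2 * ln n" using n_pos by (simp add: ln_realpow)
  moreover have "ln (g.p ^ (j * c r)) = real (j * c r) * ln g.p" by (simp add: ln_realpow)
  ultimately have "real (j * c r) * ln g.p \<le> 6 * ln 2 + 2 * ln n" by linarith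
  also have "\<dots> \<le> 6 * 1 + 2 * real l" using ln_n ln_2_less_1 by linarith
  also have "\<dots> \<le> 8 * real l" using l_pos by simp
  finally have 1: "real (j * c r) * ln g.p \<le> 8 * real l" .
  have "real (j * c r) * (1 / (real k + 1)) \<le> real (j * c r) * ln g.p"
    using g.ln_p by (intro mult_left_mono) auto
  then have "real (j * c r) * (1 / (real k + 1)) \<le> 8 * real l" using 1 by linarith
  then have "real (j * c r) \<le> 8 * ((real k + 1) * real l)" by (simp add: field_simps)
  also have "(real k + 1) * real l \<le> 2 * real n + 2 * real l + 8 * real j * real l"
  proof -
    have "real (k * l) \<le> real (2 * n + l + 8 * j * l)" using kl_up by (simp only: of_nat_le_iff)
    then show ?thesis by (simp add: algebra_simps)
  qed
  also have "2 * real n + 2 * real l + 8 * real j * real l \<le> 2 * real n + 10 * real j * real l"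
  proof -
    have "1 * real l \<le> real j * real l" using j_pos by (intro mult_right_mono) auto
    then show ?thesis by simp
  qed
  finally have "real j * real (c r) \<le> 16 * real n + 80 * (real j * real l)" by simp
  also have "\<dots> = real j * (16 * rj + 80 * l)" by (simp add: j_rj[symmetric] algebra_simps)
  finally have "real j * real (c r) \<le> real j * (16 * rj + 80 * l)" .
  then show ?thesis using j0 by simp
qed

text \<open>The summand with \<open>qb\<close> stems from the first stage, the other two from
  \<open>c_bound\<close>.\<close>

lemma cnt_nmd: assumes "r < 2 * n" shows "real (g.cnt r hs) \<le> rj * (real qb + 4) + 16 * rj + 80 * l"
proof -
  have "2 * j * g.cnt r hs \<le> g.Tb Bd qb + 2 * j * c r"
    using g.reach_result(2)[OF reach qb potential0 W_r am0 assms] by simp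
  then have "real (2 * j * g.cnt r hs) \<le> real (g.Tb Bd qb + 2 * j * c r)" by (simp only: of_nat_le_iff)
  then have "2 * real j * real (g.cnt r hs) \<le> real (g.Tb Bd qb) + 2 * real j * real (c r)" by simp
  also have "real (g.Tb Bd qb) \<le> 2 * real n * real qb + 7 * real n"
  proof -
    have 1: "real (g.Tb Bd qb) = real qb * (real n + 2 * real j) + real n + 2 * (real j * real (g.F0 Bd))"
      by (simp add: g.Tb_def)
    have "2 * real j \<le> real n" using jn by (metis of_nat_le_iff of_nat_mult of_nat_numeral)
    then have "real qb * (real n + 2 * real j) \<le> real qb * (2 * real n)" by (intro mult_left_mono) auto
    then show ?thesis using 1 F0_le by (simp add: mult_ac)
  qed
  finally have "2 * real j * real (g.cnt r hs) \<le> 2 * real n * real qb + 8 * real n + 2 * real j * real (c r)"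
    by simp
  also have "\<dots> \<le> 2 * real n * real qb + 8 * real n + 2 * real j * (16 * rj + 80 * l)"
    using c_bound[OF assms] j0 by simp
  also have "\<dots> = 2 * real j * (rj * (real qb + 4) + 16 * rj + 80 * l)" by (simp add: j_rj[symmetric] algebra_simps)
  finally show ?thesis using j0 by simp
qed

lemma cnt_md: assumes md "r < 2 * n" shows "real (g.cnt r hs) \<le> 16 * rj + 80 * l"
proof -
  have "Ms = {}" unfolding Ms_def using assms(1) by blast
  then show ?thesis using g.cnt_eq_c[OF reach _ assms(2)] c_bound[OF assms(2)] by simp
qed

lemma b_le: "real b \<le> rj"
proof -
  have "real (8 * j * b) \<le> real n" using b by (simp only: of_nat_le_iff)
  then have "real j * real b \<le> real n" by simp
  then show ?thesis using j0 by (simp add: rj_def field_simps)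
qed

lemma l_md: assumes md shows "real l \<le> rj"
proof -
  have "(8 * j * l)\<^sup>2 \<le> n\<^sup>2"
    using md_iff assms n_pos by (metis le_trans power2_nat_le_imp_le power2_nat_le_eq_le le_square power2_eq_square)
  then have "8 * j * l \<le> n" by simp
  then have "real (8 * j * l) \<le> real n" by (simp only: of_nat_le_iff)
  then have "real j * real l \<le> real n" by simp
  then show ?thesis using j0 by (simp add: rj_def field_simps)
qed

text \<open>The factor \<open>l\<close> in \<open>Lam\<close> cancels the \<open>ln n\<close> in the
  size of a greedy hitting set.\<close>

lemma R_le: "real (card R) \<le> 2 * rj"
proof (cases md)
  case False
  then have "R = {}" unfolding R_def by simp
  then show ?thesis using rj_ge by simp
next
  case True
  have L: "Lam = 8 * j * l" by (rule Lam_md[OF True])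
  have l0: "real l > 0" using l_pos by simp
  have "real (card X) \<le> 2 * (real n / Lam) * ln n + 1" using hitr_card[OF X_hitr] L j_pos l_pos by auto
  also have "\<dots> \<le> 2 * (real n / Lam) * l + 1" using ln_n by (intro add_right_mono mult_left_mono) auto
  also have "2 * (real n / Lam) * l = rj / 4" using L l0 by (simp add: rj_def field_simps)
  also have "rj / 4 + 1 \<le> 2 * rj" using rj_ge by simp
  finally show ?thesis using R_md[OF True] by simp
qed

text \<open>There are at most \<open>l\<close> heavy nodes on each of \<open>8 * j * l\<close>
  levels. That these are at most \<open>n / j\<close> in number is what the condition of the mode
  \<open>md\<close> is made for.\<close>

lemma Hv_le: assumes "u < n" shows "real (card {y. y < n \<and> Hv u y}) \<le> rj"
proof (cases md)
  case False
  then have "{y. y < n \<and> Hv u y} = {}" using Hv_nmd by blast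
  then show ?thesis using rj_ge by (simp only: card.empty of_nat_0)
next
  case True
  have "{y. y < n \<and> Hv u y} \<subseteq> (\<Union>i<Lam. {y. y < n \<and> d u y = i \<and> n \<le> mass u y * l})"
    unfolding Hv_def by blast
  then have "card {y. y < n \<and> Hv u y} \<le> card (\<Union>i<Lam. {y. y < n \<and> d u y = i \<and> n \<le> mass u y * l})"
    by (intro card_mono) auto
  also have "\<dots> \<le> (\<Sum>i<Lam. card {y. y < n \<and> d u y = i \<and> n \<le> mass u y * l})"
    by (intro card_UN_le) auto
  also have "\<dots> \<le> (\<Sum>i<Lam. l)" by (intro sum_mono heavy_count assms)
  also have "\<dots> = 8 * j * l * l" using Lam_md[OF True] by simp
  finally have 1: "card {y. y < n \<and> Hv u y} \<le> 8 * j * l * l" .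
  have "j * (8 * j * l * l) \<le> (8 * j * l)\<^sup>2" by (simp add: power2_eq_square algebra_simps)
  also have "\<dots> \<le> n" using md_iff True by simp
  finally have "j * card {y. y < n \<and> Hv u y} \<le> n" using mult_le_mono2[OF 1, of j] by linarith
  then have "real j * real (card {y. y < n \<and> Hv u y}) \<le> real n" by (metis of_nat_le_iff of_nat_mult)
  then show ?thesis using j0 by (simp add: rj_def field_simps)
qed

lemma hubs_bound:
  assumes "u < n"
  shows "real (card (hubs lev hs u)) \<le> 5 * rj + real (g.cnt u hs) + real (g.cnt (n + u) hs)"
proof -
  have "real (card (hubs lev hs u)) \<le> real (card R + card {y. y < n \<and> Hv u y} + g.cnt u hs + g.cnt (n + u) hs + 2 * b)"
    using hubs_card[OF assms hs_len lev] by (simp only: of_nat_le_iff)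
  then show ?thesis using R_le Hv_le[OF assms] b_le by simp
qed

lemma size_md: "md \<Longrightarrow> u < n \<Longrightarrow> real (card (hubs lev hs u)) \<le> 200 * rj"
  using hubs_bound[of u] cnt_md[of u] cnt_md[of "n + u"] l_md rj_ge by simp

lemma size_all: "u < n \<Longrightarrow> real (card (hubs lev hs u)) \<le> 200 * (real l + rj * (real qb + 1))"
proof -
  assume u: "u < n"
  define a where "a = rj * real qb"
  have a: "0 \<le> a" using rj_ge by (simp add: a_def)
  have "real (g.cnt u hs) \<le> a + 20 * rj + 80 * real l" "real (g.cnt (n + u) hs) \<le> a + 20 * rj + 80 * real l"
    using cnt_nmd[of u] cnt_nmd[of "n + u"] u by (simp_all add: a_def distrib_left mult.commute)
  moreover have e: "rj * (real qb + 1) = a + rj" by (simp add: a_def distrib_left)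
  moreover have "0 \<le> real l" by simp
  ultimately have "real (card (hubs lev hs u)) \<le> 200 * real l + (200 * a + 200 * rj)"
    using hubs_bound[OF u] rj_ge a by linarith
  then show ?thesis unfolding e by (simp add: distrib_left)
qed

lemma size_sum: "(\<Sum>u<n. real (card (hubs lev hs u))) \<le> 200 * (real n * rj)"
proof -
  have "(\<Sum>u<n. real (card (hubs lev hs u))) \<le> (\<Sum>u<n. 5 * rj + (real (g.cnt u hs) + real (g.cnt (n + u) hs)))"
    using hubs_bound by (intro sum_mono) force
  also have "\<dots> = 5 * (real n * rj) + ((\<Sum>u<n. real (g.cnt u hs)) + (\<Sum>u<n. real (g.cnt (n + u) hs)))"
    by (simp add: sum.distrib)
  also have "(\<Sum>u<n. real (g.cnt u hs)) + (\<Sum>u<n. real (g.cnt (n + u) hs)) = (\<Sum>r<n+n. real (g.cnt r hs))"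
    by (rule sum_split_lessThan[symmetric])
  also have "(\<Sum>r<n+n. real (g.cnt r hs)) = real (\<Sum>r<2*n. g.cnt r hs)" by (simp add: mult_2)
  also have "\<dots> \<le> 8 * (real n * rj)" by (rule total_cnt)
  finally have "(\<Sum>u<n. real (card (hubs lev hs u))) \<le> 5 * (real n * rj) + 8 * (real n * rj)" by simp
  moreover have "0 \<le> real n * rj" using rj_ge by simp
  ultimately show ?thesis by linarith
qed

end

section \<open>Encoding hub tables\<close>

text \<open>Groups \<open>True, b\<close> for the binary digits \<open>b\<close>, least significant digit first, and a final \<open>False\<close>.\<close>

fun enc :: "nat \<Rightarrow> bool list" where
  "enc g = (if g = 0 then [False] else True # odd g # enc (g div 2))"

declare enc.simps [simp del]

fun dec :: "bool list \<Rightarrow> nat \<times> bool list" where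
  "dec (True # b # r) = (let (m, r') = dec r in (of_bool b + 2 * m, r'))"
| "dec (False # r) = (0, r)"
| "dec r = (0, [])"

lemma dec_enc: "dec (enc g @ r) = (g, r)"
proof (induction g rule: less_induct)
  case (less g)
  show ?case
  proof (cases "g = 0")
    case True
    then show ?thesis by (simp add: enc.simps[of 0])
  next
    case False
    then show ?thesis using less[of "g div 2"] by (subst enc.simps) (cases "even g"; simp)
  qed
qed

lemma enc_length_pos: "length (enc g) \<ge> 1"
  by (subst enc.simps) auto

text \<open>A linear substitute for the logarithm: the slope in \<open>g\<close> is
  \<open>2 / 2 ^ m\<close>, so a sum of code lengths is bounded through the sum of the numbers. With
  \<open>2 ^ m\<close> about \<open>D\<close> this means \<open>O(log D)\<close> bits per number,
  and \<open>O(n / D)\<close> further bits if the numbers sum up to \<open>O(n)\<close>.\<close>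

lemma enc_length: "2 ^ m * length (enc g) \<le> 2 ^ m * (2 * m + 1) + 2 * g"
proof (induction g arbitrary: m rule: less_induct)
  case (less g)
  show ?case
  proof (cases "g = 0")
    case True
    then show ?thesis by (simp add: enc.simps[of 0])
  next
    case False
    have l: "length (enc g) = 2 + length (enc (g div 2))" using False by (subst enc.simps) simp
    show ?thesis
    proof (cases m)
      case 0
      have "length (enc (g div 2)) \<le> 1 + 2 * (g div 2)" using less[of "g div 2" 0] False by simp
      moreover have "2 * (g div 2) + 2 \<le> 2 * g" using False by (cases "g = 1") auto
      ultimately show ?thesis using l 0 by simp
    next
      case (Suc m')
      have "2 ^ m' * length (enc (g div 2)) \<le> 2 ^ m' * (2 * m' + 1) + 2 * (g div 2)"
        using less[of "g div 2" m'] False by simp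
      moreover have "2 * (g div 2) \<le> g" by simp
      ultimately show ?thesis using l Suc by (simp add: algebra_simps)
    qed
  qed
qed

text \<open>The first argument is fuel. Every entry takes at least one bit, so the length of the
  string suffices.\<close>

fun decl :: "nat \<Rightarrow> nat \<Rightarrow> nat \<Rightarrow> bool list \<Rightarrow> (nat \<times> nat) set" where
  "decl 0 p v xs = {}"
| "decl (Suc f) p v [] = {}"
| "decl (Suc f) p v (x # xs) = (let (g, r1) = dec (x # xs); (a, r2) = dec r1; (b, r3) = dec r2;
     p' = p + g; v' = v + a - b in insert (p', v') (decl f p' v' r3))"

definition read_hubs :: "bool list \<Rightarrow> (nat \<times> nat) set" where
  "read_hubs xs = decl (length xs) 0 0 xs"

text \<open>The second components may decrease; one of the two truncated differences is \<open>0\<close>.\<close>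

definition enc3 :: "nat \<times> nat \<Rightarrow> nat \<times> nat \<Rightarrow> bool list" where
  "enc3 q x = enc (fst x - fst q) @ enc (snd x - snd q) @ enc (snd q - snd x)"

fun encl :: "nat \<times> nat \<Rightarrow> (nat \<times> nat) list \<Rightarrow> bool list" where
  "encl q [] = []"
| "encl q (x # xs) = enc3 q x @ encl x xs"

lemma encl_snoc: "encl q (xs @ [x]) = encl q xs @ enc3 (last (q # xs)) x"
  by (induction q xs rule: encl.induct) auto

lemma encl_length_ge: "length xs \<le> length (encl q xs)"
proof (induction q xs rule: encl.induct)
  case (2 q x xs)
  have "length (enc3 q x) \<ge> 1" using enc_length_pos[of "fst x - fst q"] by (simp add: enc3_def)
  then show ?case using 2 by simp
qed simp

lemma decl_encl:
  assumes "sorted (p # map fst xs)" "length xs \<le> f"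
  shows "decl f p v (encl (p, v) xs) = set xs"
  using assms
proof (induction xs arbitrary: p v f)
  case Nil
  then show ?case by (cases f) auto
next
  case (Cons x xs)
  obtain p' v' where x: "x = (p', v')" by force
  obtain f' where f: "f = Suc f'" using Cons.prems by (cases f) auto
  have pp: "p \<le> p'" using Cons.prems x by simp
  let ?l = "encl (p, v) (x # xs)"
  have l: "?l = enc (p' - p) @ enc (v' - v) @ enc (v - v') @ encl (p', v') xs"
    by (simp add: x enc3_def)
  have "?l \<noteq> []" using l enc_length_pos[of "p' - p"] by auto
  then obtain y ys where y: "?l = y # ys" by (meson neq_Nil_conv)
  have d: "dec (y # ys) = (p' - p, enc (v' - v) @ enc (v - v') @ encl (p', v') xs)"
    using l y dec_enc by metis
  have "decl f p v ?l = insert (p', v') (decl f' p' v' (encl (p', v') xs))"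
  proof -
    have "v + (v' - v) - (v - v') = v'" by simp
    then show ?thesis unfolding f y decl.simps d using pp by (simp add: dec_enc Let_def)
  qed
  then show ?case using Cons.IH[of p' f' v'] Cons.prems f x by simp
qed

lemma read_encl: "sorted (map fst xs) \<Longrightarrow> read_hubs (encl (0, 0) xs) = set xs"
  unfolding read_hubs_def by (rule decl_encl) (auto simp: encl_length_ge)

section \<open>Total variation along the numbering\<close>

fun tvl :: "nat \<Rightarrow> nat list \<Rightarrow> nat" where
  "tvl v [] = 0"
| "tvl v (x # xs) = (x - v) + (v - x) + tvl x xs"

text \<open>The first components increase, so their differences telescope; \<open>2 * fst q\<close>
  on the left carries the part already covered.\<close>

lemma encl_length:
  assumes "sorted (fst q # map fst xs)" "\<forall>x\<in>set (q # xs). fst x \<le> B"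
  shows "2 ^ m * length (encl q xs) + 2 * fst q \<le>
    2 ^ m * ((6 * m + 3) * length xs) + 2 * B + 2 * tvl (snd q) (map snd xs)"
  using assms
proof (induction q xs rule: encl.induct)
  case (2 q x xs)
  have "2 ^ m * length (encl x xs) + 2 * fst x \<le>
    2 ^ m * ((6 * m + 3) * length xs) + 2 * B + 2 * tvl (snd x) (map snd xs)"
    using 2 by simp
  moreover have "2 ^ m * length (enc3 q x) \<le> 2 ^ m * (6 * m + 3) + 2 * (fst x - fst q) + 2 * (snd x - snd q) + 2 * (snd q - snd x)"
    using enc_length[of m "fst x - fst q"] enc_length[of m "snd x - snd q"] enc_length[of m "snd q - snd x"]
    by (simp add: enc3_def algebra_simps)
  moreover have "fst q \<le> fst x" using 2(2) by simp
  ultimately show ?case by (simp add: algebra_simps)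
qed simp

text \<open>By the triangle inequality, passing over entries does not increase the variation, so the
  hubs of a node cost no more than the whole numbering.\<close>

lemma tvl_walk:
  assumes "\<And>i. Suc i < n \<Longrightarrow> (f (Suc i) - f i) + (f i - f (Suc i)) \<le> w i"
    and "sorted_wrt (<) (i0 # is)" "\<forall>i\<in>set (i0 # is). i < n"
  shows "tvl (f i0) (map f is) \<le> (\<Sum>i\<in>{i0..<n - 1}. w i)"
  using assms(2,3)
proof (induction "is" arbitrary: i0)
  case (Cons i1 "is")
  have st: "(f i - f i0) + (f i0 - f i) \<le> (\<Sum>i\<in>{i0..<i}. w i)" if "i0 \<le> i" "i < n" for i
    using that
  proof (induction rule: dec_induct)
    case (step i)
    then have "(f i - f i0) + (f i0 - f i) \<le> (\<Sum>i\<in>{i0..<i}. w i)" by simp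
    moreover have "(f (Suc i) - f i) + (f i - f (Suc i)) \<le> w i" using assms(1) step by simp
    ultimately show ?case using step by simp
  qed simp
  have i: "i0 < i1" "i1 < n" using Cons.prems by auto
  have "tvl (f i1) (map f is) \<le> (\<Sum>i\<in>{i1..<n - 1}. w i)" using Cons by simp
  moreover have "{i0..<n - 1} = {i0..<i1} \<union> {i1..<n - 1}" using i by auto
  then have "(\<Sum>i\<in>{i0..<n - 1}. w i) = (\<Sum>i\<in>{i0..<i1}. w i) + (\<Sum>i\<in>{i1..<n - 1}. w i)"
    by (simp add: sum.union_disjoint)
  ultimately show ?case using st[of i1] i by simp
qed simp

section \<open>A numbering of the nodes with short steps\<close>

context
  fixes n :: nat and E :: "(nat \<times> nat) set"
  assumes G: "connected_graph n E"
begin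

fun tv :: "nat list \<Rightarrow> nat" where
  "tv (x # y # r) = gdist E x y + tv (y # r)"
| "tv r = 0"

lemma tv_app: "tv (A @ x # B) = tv (A @ [x]) + tv (x # B)"
  by (induction A rule: tv.induct) auto

lemma tv_sum: "tv xs = (\<Sum>i<length xs - 1. gdist E (xs ! i) (xs ! Suc i))"
proof (induction xs rule: tv.induct)
  case (1 x y r)
  have "length (x # y # r) - 1 = Suc (length (y # r) - 1)" by simp
  then show ?case using 1 by (simp only: sum.lessThan_Suc_shift tv.simps) simp
qed auto

lemma gdist_edge: "(x, y) \<in> E \<Longrightarrow> gdist E x y \<le> 1"
proof -
  assume "(x, y) \<in> E"
  then have "(x, y) \<in> E ^^ 1" by simp
  then show ?thesis unfolding gdist_def by (rule Least_le)
qed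

text \<open>Inserting \<open>y\<close> right after its neighbour \<open>xs ! i\<close> increases the total distance \<open>tv\<close> of consecutive nodes by at most \<open>2\<close>.\<close>

inductive order_list :: "nat list \<Rightarrow> bool" where
  order_one: "order_list [0]"
| order_ins: "order_list xs \<Longrightarrow> i < length xs \<Longrightarrow> (xs ! i, y) \<in> E \<Longrightarrow> y \<notin> set xs \<Longrightarrow>
    order_list (take (Suc i) xs @ y # drop (Suc i) xs)"

lemma order_list_inv:
  "order_list xs \<Longrightarrow> distinct xs \<and> set xs \<subseteq> {..<n} \<and> xs \<noteq> [] \<and> tv xs + 2 \<le> 2 * length xs"
proof (induction rule: order_list.induct)
  case order_one
  then show ?case using G by (simp add: connected_graph_def)
next
  case (order_ins xs i y)
  let ?A = "take i xs" and ?B = "drop (Suc i) xs" and ?x = "xs ! i"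
  have xs: "xs = ?A @ ?x # ?B" using order_ins by (simp add: id_take_nth_drop)
  have new: "take (Suc i) xs @ y # drop (Suc i) xs = ?A @ ?x # y # ?B"
    using order_ins by (simp add: take_Suc_conv_app_nth)
  have s: "set (?A @ ?x # y # ?B) = insert y (set xs)" by (subst (3) xs) auto
  have dd: "distinct (?A @ ?x # y # ?B)"
  proof -
    have "distinct (?A @ ?x # ?B)" using order_ins xs by metis
    moreover have "y \<notin> set (?A @ ?x # ?B)" using order_ins xs by metis
    ultimately show ?thesis by auto
  qed
  have ed: "gdist E ?x y \<le> 1" "gdist E y ?x \<le> 1"
    using gdist_edge order_ins symE[OF G] by auto
  have l: "?x < n" "y < n" using E_less[OF G order_ins(3)] by auto
  \<comment> \<open>The way from \<open>y\<close> to the old successor of \<open>?x\<close> leads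
    back over the edge to \<open>?x\<close>.\<close>
  have "tv (y # ?B) \<le> 1 + tv (?x # ?B)"
  proof (cases ?B)
    case (Cons z r)
    have "z \<in> set xs" using Cons by (metis in_set_dropD list.set_intros(1))
    then have "z < n" using order_ins by auto
    then have "gdist E y z \<le> gdist E y ?x + gdist E ?x z" using gdist_tri[OF G] l by blast
    then show ?thesis using Cons ed by simp
  qed simp
  moreover have "tv xs = tv (?A @ [?x]) + tv (?x # ?B)" by (subst xs) (rule tv_app)
  moreover have "tv (?A @ ?x # y # ?B) = tv (?A @ [?x]) + (gdist E ?x y + tv (y # ?B))"
    by (subst tv_app) simp
  ultimately have "tv (?A @ ?x # y # ?B) \<le> tv xs + 2" using ed by simp
  moreover have "length (?A @ ?x # y # ?B) = Suc (length xs)" using order_ins by simp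
  ultimately show ?case unfolding new using order_ins s dd l by auto
qed

lemma order_ext:
  assumes "A \<subseteq> {..<n}" "0 \<in> A" "A \<noteq> {..<n}"
  shows "\<exists>x\<in>A. \<exists>y. y < n \<and> y \<notin> A \<and> (x, y) \<in> E"
proof (rule ccontr)
  assume no: "\<not> ?thesis"
  have "v \<in> A" if "v < n" for v
  proof -
    have "(0, v) \<in> E\<^sup>*" using G that by (auto simp: connected_graph_def)
    then show ?thesis
    proof (induction rule: rtrancl_induct)
      case (step y z)
      then show ?case using no E_less[OF G] by blast
    qed (rule assms(2))
  qed
  then show False using assms by auto
qed

lemma labels_correct:
  assumes ol: "order_list xs" and len: "length xs = n" and S: "\<And>u. u < n \<Longrightarrow> S u \<subseteq> {..<n}"
    and L: "\<And>u. u < n \<Longrightarrow> L u = encl (0, 0) (map (\<lambda>i. (i, gdist E u (xs ! i))) (filter (\<lambda>i. xs ! i \<in> S u) [0..<n]))"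
  shows "stores_hubs read_hubs n E S L"
    and "u < n \<Longrightarrow> 2 ^ m * length (L u) \<le> 2 ^ m * ((6 * m + 3) * card (S u)) + 8 * n"
proof -
  have inv: "distinct xs" "set xs \<subseteq> {..<n}" "tv xs + 2 \<le> 2 * length xs" using order_list_inv[OF ol] by auto
  have set: "set xs = {..<n}" using inv len distinct_card[of xs] by (intro card_subset_eq) auto
  have bij: "bij_betw (\<lambda>i. xs ! i) {..<n} {..<n}" by (rule bij_betw_nth) (simp_all add: inv(1) len set)
  let ?nu = "inv_into {..<n} (\<lambda>i. xs ! i)"
  have nu: "bij_betw ?nu {..<n} {..<n}" using bij_betw_inv_into[OF bij] .
  have nu1: "?nu (xs ! i) = i" if "i < n" for i
    using bij_betw_inv_into_left[OF bij, of i] that by simp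
  have nu2: "xs ! (?nu w) = w" "?nu w < n" if "w < n" for w
    using bij_betw_inv_into_right[OF bij, of w] bij_betw_apply[OF nu, of w] that by auto
  let ?is = "\<lambda>u. filter (\<lambda>i. xs ! i \<in> S u) [0..<n]"
  let ?ps = "\<lambda>u. map (\<lambda>i. (i, gdist E u (xs ! i))) (?is u)"
  have sorted: "sorted (map fst (?ps u))" for u
  proof -
    have "map fst (?ps u) = ?is u" by (simp add: comp_def)
    then show ?thesis using sorted_wrt_filter[of "(\<le>)" "[0..<n]"] by simp
  qed
  show "stores_hubs read_hubs n E S L"
    unfolding stores_hubs_def
  proof (intro exI[of _ ?nu] conjI nu allI impI)
    fix u assume u: "u < n"
    have "read_hubs (L u) = set (?ps u)" unfolding L[OF u] by (rule read_encl[OF sorted])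
    also have "\<dots> = hub_table E ?nu S u"
    proof (intro equalityI subsetI)
      fix z assume "z \<in> set (?ps u)"
      then show "z \<in> hub_table E ?nu S u" using nu1 by (auto simp: hub_table_def image_iff intro!: bexI)
    next
      fix z assume "z \<in> hub_table E ?nu S u"
      then obtain w where w: "w \<in> S u" "z = (?nu w, gdist E u w)" by (auto simp: hub_table_def)
      then have "w < n" using S[OF u] by auto
      then show "z \<in> set (?ps u)" using nu2 w by (auto simp: image_iff intro!: bexI[of _ "?nu w"])
    qed
    finally show "read_hubs (L u) = hub_table E ?nu S u" .
  qed
  assume u: "u < n"
  let ?f = "\<lambda>i. gdist E u (xs ! i)"
  have fn: "?f i < n" if "i < n" for i using gdist_less[OF G u] that set len by (metis lessThan_iff nth_mem)
  have step: "(?f (Suc i) - ?f i) + (?f i - ?f (Suc i)) \<le> gdist E (xs ! i) (xs ! Suc i)" if "Suc i < n" for i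
  proof -
    have x: "xs ! i < n" "xs ! Suc i < n" using that set len by (metis lessThan_iff nth_mem Suc_lessD)+
    have "gdist E (xs ! i) (xs ! Suc i) = gdist E (xs ! Suc i) (xs ! i)"
      using G by (intro gdist_commute) (simp add: connected_graph_def)
    then show ?thesis using gdist_tri[OF G u x(1,2)] gdist_tri[OF G u x(2,1)] by linarith
  qed
  \<comment> \<open>The first entry costs less than \<open>n\<close>, all further ones together at
    most the length \<open>2 * n\<close> of the numbering.\<close>
  have t: "tvl 0 (map ?f (?is u)) \<le> n + 2 * n"
  proof (cases "?is u")
    case (Cons i0 "is")
    have srt: "sorted_wrt (<) (i0 # is)" using sorted_wrt_filter[of "(<)" "[0..<n]"] Cons by (metis sorted_wrt_upt)
    have lt: "\<forall>i\<in>set (i0 # is). i < n" unfolding Cons[symmetric] by auto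
    have "tvl (?f i0) (map ?f is) \<le> (\<Sum>i\<in>{i0..<n - 1}. gdist E (xs ! i) (xs ! Suc i))"
      by (rule tvl_walk[where f = ?f and n = n and w = "\<lambda>i. gdist E (xs ! i) (xs ! Suc i)", OF _ srt lt]) (rule step)
    also have "\<dots> \<le> (\<Sum>i<n - 1. gdist E (xs ! i) (xs ! Suc i))" by (intro sum_mono2) auto
    also have "\<dots> = tv xs" using tv_sum[of xs] len by simp
    finally have "tvl (?f i0) (map ?f is) \<le> 2 * n" using inv len by simp
    moreover have "?f i0 < n" using fn lt by simp
    ultimately show ?thesis using Cons by simp
  qed simp
  have e: "2 ^ m * length (encl (0,0) (?ps u)) + 2 * fst (0::nat,0::nat) \<le>
      2 ^ m * ((6 * m + 3) * length (?ps u)) + 2 * n + 2 * tvl (snd (0::nat,0::nat)) (map snd (?ps u))"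
    by (rule encl_length) (use sorted in auto)
  have ms: "map snd (?ps u) = map ?f (?is u)" by simp
  have lc: "length (?ps u) = card (S u)"
  proof -
    have "card (set (?is u)) = length (?is u)" by (rule distinct_card) simp
    moreover have "bij_betw (\<lambda>i. xs ! i) (set (?is u)) (S u)"
      unfolding bij_betw_def
    proof
      show "inj_on ((!) xs) (set (?is u))"
        using bij_betw_imp_inj_on[OF bij] by (rule inj_on_subset) auto
      show "(!) xs ` set (?is u) = S u"
        using nu2 S[OF u] by (auto simp: image_iff) (metis lessThan_iff subsetD)
    qed
    ultimately show ?thesis using bij_betw_same_card by force
  qed
  \<comment> \<open>\<open>8 * n\<close> is \<open>2 * n\<close> for the identifiers and
    \<open>2 * (3 * n)\<close> for the distances.\<close>
  show "2 ^ m * length (L u) \<le> 2 ^ m * ((6 * m + 3) * card (S u)) + 8 * n"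
    using e[unfolded ms lc fst_conv snd_conv] t unfolding L[OF u] by linarith
qed

end

section \<open>Program building blocks\<close>

definition SUMP :: "vname \<Rightarrow> vname \<Rightarrow> vname \<Rightarrow> lp \<Rightarrow> vname \<Rightarrow> lp" where
  "SUMP acc i b p t = (acc ::= N 0 ;; For i b (p ;; acc ::= Plus (V acc) (V t)))"

definition FILL :: "vname \<Rightarrow> vname \<Rightarrow> vname \<Rightarrow> vname \<Rightarrow> vname \<Rightarrow> lp \<Rightarrow> vname \<Rightarrow> lp" where
  "FILL arr i bi j bj p t = For i bi (For j bj (p ;; Asg arr (V i) (V j) (V t)))"

definition MINP :: "vname \<Rightarrow> aexp \<Rightarrow> vname \<Rightarrow> vname \<Rightarrow> lp \<Rightarrow> vname \<Rightarrow> lp" where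
  "MINP best e0 i b p t =
     (best ::= e0 ;; For i b (p ;; Cnd (Less (V t) (V best)) (best ::= V t) Skp))"

text \<open>The flag \<open>fnd\<close> replaces an infinite start value for the minimum.\<close>

definition AMIN :: "vname \<Rightarrow> vname \<Rightarrow> vname \<Rightarrow> vname \<Rightarrow> vname \<Rightarrow> bexp \<Rightarrow> lp \<Rightarrow> vname \<Rightarrow> lp" where
  "AMIN res best fnd i b g p t =
     (fnd ::= N 0 ;; res ::= N 0 ;; For i b (p ;;
       Cnd (And g (Not (And (Less (N 0) (V fnd)) (Not (Less (V t) (V best))))))
         (best ::= V t ;; res ::= V i ;; fnd ::= N 1) Skp))"

definition IFE :: "vname \<Rightarrow> bexp \<Rightarrow> aexp \<Rightarrow> aexp \<Rightarrow> lp" where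
  "IFE t b e1 e2 = Cnd b (t ::= e1) (t ::= e2)"

definition SUMIF :: "vname \<Rightarrow> vname \<Rightarrow> vname \<Rightarrow> bexp \<Rightarrow> aexp \<Rightarrow> lp" where
  "SUMIF acc i b c e = SUMP acc i b (IFE ''_t'' c e (N 0)) ''_t''"

text \<open>Repeated addition in a fixed number of rounds. Only the first factor has to stay within
  \<open>N\<close>; the second one may be exponentially large.\<close>

definition MUL :: "vname \<Rightarrow> vname \<Rightarrow> aexp \<Rightarrow> aexp \<Rightarrow> lp" where
  "MUL t i a b = SUMIF t i ''N'' (Less (V i) a) b"

primrec mulc :: "nat \<Rightarrow> aexp \<Rightarrow> aexp" where
  "mulc 0 e = N 0" | "mulc (Suc m) e = Plus e (mulc m e)"

lemma upd_other2 [simp]: "x \<noteq> y \<Longrightarrow> upd s x i j k y = s y"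
  by simp

lemma aval_mulc [simp]: "aval (mulc m e) s = m * aval e s" by (induction m) auto

definition eqb :: "aexp \<Rightarrow> aexp \<Rightarrow> bexp" where "eqb a b = And (Not (Less a b)) (Not (Less b a))"
definition orb :: "bexp \<Rightarrow> bexp \<Rightarrow> bexp" where "orb a b = Not (And (Not a) (Not b))"
definition leb :: "aexp \<Rightarrow> aexp \<Rightarrow> bexp" where "leb a b = Not (Less b a)"
definition posb :: "aexp \<Rightarrow> bexp" where "posb a = Less (N 0) a"

lemma bval_eqb [simp]: "bval (eqb a b) s \<longleftrightarrow> aval a s = aval b s" by (auto simp: eqb_def)
lemma bval_orb [simp]: "bval (orb a b) s \<longleftrightarrow> bval a s \<or> bval b s" by (auto simp: orb_def)
lemma bval_leb [simp]: "bval (leb a b) s \<longleftrightarrow> aval a s \<le> aval b s" by (auto simp: leb_def)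
lemma bval_posb [simp]: "bval (posb a) s \<longleftrightarrow> aval a s > 0" by (auto simp: posb_def)

lemma exec_IFE [simp]: "exec (IFE t b e1 e2) s = setv s t (if bval b s then aval e1 s else aval e2 s)"
  by (simp add: IFE_def)

lemma mods_blocks [simp]:
  "mods (SUMP acc i b p t) = {acc, i} \<union> mods p"
  "mods (FILL arr i bi j bj p t) = {arr, i, j} \<union> mods p"
  "mods (MINP best e0 i b p t) = {best, i} \<union> mods p"
  "mods (AMIN res best fnd i b g p t) = {res, best, fnd, i} \<union> mods p"
  "mods (IFE t c e1 e2) = {t}"
  "mods (SUMIF acc i b c e) = {acc, i, ''_t''}"
  "mods (MUL t i a a') = {t, i, ''_t''}"
  by (auto simp: SUMP_def FILL_def MINP_def AMIN_def IFE_def SUMIF_def MUL_def)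

lemma bnds_blocks [simp]:
  "bnds (SUMP acc i b p t) = {b} \<union> bnds p"
  "bnds (FILL arr i bi j bj p t) = {bi, bj} \<union> bnds p"
  "bnds (MINP best e0 i b p t) = {b} \<union> bnds p"
  "bnds (AMIN res best fnd i b g p t) = {b} \<union> bnds p"
  "bnds (IFE t c e1 e2) = {}"
  "bnds (SUMIF acc i b c e) = {b}"
  "bnds (MUL t i a a') = {''N''}"
  by (auto simp: SUMP_def FILL_def MINP_def AMIN_def IFE_def SUMIF_def MUL_def)

lemma ok_blocks [simp]:
  "ok (SUMP acc i b p t) \<longleftrightarrow> ok (For i b p) \<and> i \<noteq> acc \<and> b \<noteq> acc"
  "ok (FILL arr i bi j bj p t) \<longleftrightarrow> ok (For i bi p) \<and> ok (For j bj p) \<and> i \<noteq> j \<and> i \<noteq> arr \<and> j \<noteq> arr \<and>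
     bi \<noteq> arr \<and> bj \<noteq> arr \<and> bi \<noteq> j"
  "ok (MINP best e0 i b p t) \<longleftrightarrow> ok (For i b p) \<and> i \<noteq> best \<and> b \<noteq> best"
  "ok (AMIN res best fnd i b g p t) \<longleftrightarrow> ok (For i b p) \<and> i \<notin> {res, best, fnd} \<and> b \<notin> {res, best, fnd}"
  "ok (IFE t c e1 e2)"
  "ok (SUMIF acc i b c e) \<longleftrightarrow> i \<noteq> acc \<and> b \<noteq> acc \<and> i \<noteq> ''_t'' \<and> b \<noteq> ''_t'' \<and> i \<noteq> b"
  "ok (MUL t i a a') \<longleftrightarrow> i \<noteq> t \<and> ''N'' \<noteq> t \<and> i \<noteq> ''_t'' \<and> i \<noteq> ''N''"
  by (auto simp: SUMP_def FILL_def MINP_def AMIN_def IFE_def SUMIF_def MUL_def)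

section \<open>Semantics of the building blocks\<close>

lemma exec_SUMP:
  assumes "ok (SUMP acc i b p t)" "acc \<notin> mods p"
    and val: "\<And>k s'. k < s b 0 0 \<Longrightarrow> s' i 0 0 = k \<Longrightarrow>
      (\<And>x. x \<notin> mods p \<Longrightarrow> x \<noteq> acc \<Longrightarrow> x \<noteq> i \<Longrightarrow> s' x = s x) \<Longrightarrow> exec p s' t 0 0 = g k"
  shows "exec (SUMP acc i b p t) s acc 0 0 = (\<Sum>k<s b 0 0. g k)"
proof -
  let ?p = "p ;; acc ::= Plus (V acc) (V t)"
  let ?s = "setv s acc 0"
  have b: "?s b 0 0 = s b 0 0" using assms(1) by simp
  let ?I = "\<lambda>k s'. s' acc 0 0 = (\<Sum>k<k. g k)"
  have "?I (?s b 0 0) (exec (For i b ?p) ?s)"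
  proof (rule For_inv[where I = ?I])
    show "ok (For i b ?p)" using assms(1,2) by simp
    show "setv ?s i 0 acc 0 0 = (\<Sum>k<0. g k)" using assms(1) by simp
    fix k s' assume k: "k < ?s b 0 0" "s' acc 0 0 = (\<Sum>k<k. g k)" "s' i 0 0 = k"
      "\<And>x. x \<noteq> i \<Longrightarrow> x \<notin> mods ?p \<Longrightarrow> s' x = ?s x"
    have "exec p s' t 0 0 = g k" by (rule val) (use k b in auto)
    then show "setv (exec ?p s') i (Suc k) acc 0 0 = (\<Sum>k<Suc k. g k)"
      using assms(1,2) k(2) by (simp add: exec_frame)
  qed
  then show ?thesis unfolding SUMP_def using b by simp
qed

lemma exec_SUMIF:
  assumes "ok (SUMIF acc i b c e)" "acc \<noteq> ''_t''"
    and val: "\<And>k s'. k < s b 0 0 \<Longrightarrow> s' i 0 0 = k \<Longrightarrow>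
      (\<And>x. x \<noteq> ''_t'' \<Longrightarrow> x \<noteq> acc \<Longrightarrow> x \<noteq> i \<Longrightarrow> s' x = s x) \<Longrightarrow>
      (if bval c s' then aval e s' else 0) = g k"
  shows "exec (SUMIF acc i b c e) s acc 0 0 = (\<Sum>k<s b 0 0. g k)"
  unfolding SUMIF_def
proof (rule exec_SUMP)
  show "ok (SUMP acc i b (IFE ''_t'' c e (N 0)) ''_t'')" using assms(1,2) by simp
  fix k s' assume "k < s b 0 0" "s' i 0 0 = k"
    "\<And>x. x \<notin> mods (IFE ''_t'' c e (N 0)) \<Longrightarrow> x \<noteq> acc \<Longrightarrow> x \<noteq> i \<Longrightarrow> s' x = s x"
  then show "exec (IFE ''_t'' c e (N 0)) s' ''_t'' 0 0 = g k"
    using val[of k s'] by (cases "bval c s'") simp_all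
qed (use assms(2) in simp)

lemma exec_MUL:
  assumes "ok (MUL t i a a')" "t \<noteq> ''_t''" "aval a s \<le> s ''N'' 0 0"
    and "\<And>s'. (\<And>x. x \<notin> {''_t'', t, i} \<Longrightarrow> s' x = s x) \<Longrightarrow> aval a s' = aval a s \<and> aval a' s' = aval a' s"
  shows "exec (MUL t i a a') s t 0 0 = aval a s * aval a' s"
proof -
  have "exec (MUL t i a a') s t 0 0 = (\<Sum>k<s ''N'' 0 0. if k < aval a s then aval a' s else 0)"
    unfolding MUL_def
  proof (rule exec_SUMIF)
    fix k s' assume "s' i 0 0 = k" "\<And>x. x \<noteq> ''_t'' \<Longrightarrow> x \<noteq> t \<Longrightarrow> x \<noteq> i \<Longrightarrow> s' x = s x"
    then show "(if bval (Less (V i) a) s' then aval a' s' else 0) = (if k < aval a s then aval a' s else 0)"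
      using assms(4)[of s'] by simp
  qed (use assms(1,2) in simp_all)
  also have "\<dots> = (\<Sum>k\<in>{..<s ''N'' 0 0} \<inter> {k. k < aval a s}. aval a' s)" by (simp add: sum.If_cases)
  also have "{..<s ''N'' 0 0} \<inter> {k. k < aval a s} = {..<aval a s}" using assms(3) by auto
  finally show ?thesis by simp
qed

text \<open>The body may read the old value of the entry under construction; this covers updates in
  place, such as those of the alive targets.\<close>

lemma exec_FILL:
  assumes "ok (FILL arr i bi j bj p t)" "arr \<notin> mods p" and bji: "bj \<noteq> i"
    and val: "\<And>a c s'. a < s bi 0 0 \<Longrightarrow> c < s bj 0 0 \<Longrightarrow> s' i 0 0 = a \<Longrightarrow> s' j 0 0 = c \<Longrightarrow>
      (\<And>x. x \<notin> mods p \<Longrightarrow> x \<noteq> arr \<Longrightarrow> x \<noteq> i \<Longrightarrow> x \<noteq> j \<Longrightarrow> s' x = s x) \<Longrightarrow> s' arr a c = s arr a c \<Longrightarrow>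
      exec p s' t 0 0 = g a c"
  shows "exec (FILL arr i bi j bj p t) s arr a c = (if a < s bi 0 0 \<and> c < s bj 0 0 then g a c else s arr a c)"
proof -
  let ?p = "p ;; Asg arr (V i) (V j) (V t)"
  let ?q = "For j bj ?p"
  have okq: "ok ?q" "ok (For i bi ?q)" using assms(1,2) by auto
  have ij: "i \<notin> mods p" "j \<notin> mods p" "i \<noteq> j" "i \<noteq> arr" "j \<noteq> arr" using assms(1) by auto
  have inner: "exec ?q s' arr a c = (if a = s' i 0 0 \<and> c < s bj 0 0 then g a c else s' arr a c)"
    if k: "s' i 0 0 < s bi 0 0" "\<And>x. x \<noteq> i \<Longrightarrow> x \<notin> mods ?q \<Longrightarrow> s' x = s x"
      "\<And>c. s' arr (s' i 0 0) c = s arr (s' i 0 0) c" for s' a c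
  proof -
    have b: "s' bj 0 0 = s bj 0 0"
      using k(2)[of bj] assms(1,2) bji by auto
    let ?I = "\<lambda>k s''. \<forall>a c. s'' arr a c = (if a = s' i 0 0 \<and> c < k then g a c else s' arr a c)"
    have "?I (s' bj 0 0) (exec ?q s')"
    proof (rule For_inv[where I = ?I])
      fix k s'' assume h: "k < s' bj 0 0"
        "\<forall>a c. s'' arr a c = (if a = s' i 0 0 \<and> c < k then g a c else s' arr a c)"
        "s'' j 0 0 = k" "\<And>x. x \<noteq> j \<Longrightarrow> x \<notin> mods ?p \<Longrightarrow> s'' x = s' x"
      have i'': "s'' i 0 0 = s' i 0 0" using h(4)[of i] ij by simp
      have "exec p s'' t 0 0 = g (s' i 0 0) k"
      proof (rule val)
        show "s'' x = s x" if "x \<notin> mods p" "x \<noteq> arr" "x \<noteq> i" "x \<noteq> j" for x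
          using h(4)[of x] k(2)[of x] that by simp
        show "s'' arr (s' i 0 0) k = s arr (s' i 0 0) k" using h(2) k(3) by simp
      qed (use h i'' k b in auto)
      moreover have "exec p s'' i 0 0 = s' i 0 0" "exec p s'' j 0 0 = k" "exec p s'' arr = s'' arr"
        using ij i'' h(3) assms(2) by (simp_all add: exec_frame)
      ultimately show "\<forall>a c. setv (exec ?p s'') j (Suc k) arr a c =
          (if a = s' i 0 0 \<and> c < Suc k then g a c else s' arr a c)"
        using h(2) ij by (auto simp: upd_apply less_Suc_eq)
    qed (use okq ij in simp_all)
    then show ?thesis using b by simp
  qed
  let ?I = "\<lambda>k s'. \<forall>a c. s' arr a c = (if a < k \<and> c < s bj 0 0 then g a c else s arr a c)"
  have "?I (s bi 0 0) (exec (For i bi ?q) s)"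
  proof (rule For_inv[where I = ?I, OF okq(2)])
    fix k s' assume h: "k < s bi 0 0"
      "\<forall>a c. s' arr a c = (if a < k \<and> c < s bj 0 0 then g a c else s arr a c)"
      "s' i 0 0 = k" "\<And>x. x \<noteq> i \<Longrightarrow> x \<notin> mods ?q \<Longrightarrow> s' x = s x"
    have "exec ?q s' arr a c = (if a = k \<and> c < s bj 0 0 then g a c else s' arr a c)" for a c
      using inner[of s' a c] h by simp
    then show "\<forall>a c. setv (exec ?q s') i (Suc k) arr a c =
        (if a < Suc k \<and> c < s bj 0 0 then g a c else s arr a c)"
      using h(2) ij by (auto simp: less_Suc_eq)
  qed (use ij in simp)
  then show ?thesis unfolding FILL_def by simp
qed

primrec minl :: "nat \<Rightarrow> (nat \<Rightarrow> nat) \<Rightarrow> nat \<Rightarrow> nat" where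
  "minl v f 0 = v" | "minl v f (Suc m) = min (minl v f m) (f m)"

lemma minl_le: "minl v f m \<le> v \<and> (\<forall>k<m. minl v f m \<le> f k)"
  by (induction m) (auto simp: less_Suc_eq min_le_iff_disj)

lemma minl_in: "minl v f m = v \<or> (\<exists>k<m. minl v f m = f k)"
  by (induction m) (auto simp: less_Suc_eq min_def)

lemma exec_MINP:
  assumes "ok (MINP best e0 i b p t)" "best \<notin> mods p"
    and val: "\<And>k s'. k < s b 0 0 \<Longrightarrow> s' i 0 0 = k \<Longrightarrow>
      (\<And>x. x \<notin> mods p \<Longrightarrow> x \<noteq> best \<Longrightarrow> x \<noteq> i \<Longrightarrow> s' x = s x) \<Longrightarrow> exec p s' t 0 0 = g k"
  shows "exec (MINP best e0 i b p t) s best 0 0 = minl (aval e0 s) g (s b 0 0)"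
proof -
  let ?p = "p ;; Cnd (Less (V t) (V best)) (best ::= V t) Skp"
  let ?s = "setv s best (aval e0 s)"
  have b: "?s b 0 0 = s b 0 0" using assms(1) by simp
  let ?I = "\<lambda>k s'. s' best 0 0 = minl (aval e0 s) g k"
  have "?I (?s b 0 0) (exec (For i b ?p) ?s)"
  proof (rule For_inv[where I = ?I])
    show "ok (For i b ?p)" using assms(1,2) by simp
    show "setv ?s i 0 best 0 0 = minl (aval e0 s) g 0" using assms(1) by simp
    fix k s' assume k: "k < ?s b 0 0" "s' best 0 0 = minl (aval e0 s) g k" "s' i 0 0 = k"
      "\<And>x. x \<noteq> i \<Longrightarrow> x \<notin> mods ?p \<Longrightarrow> s' x = ?s x"
    have "exec p s' t 0 0 = g k" by (rule val) (use k b in auto)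
    then show "setv (exec ?p s') i (Suc k) best 0 0 = minl (aval e0 s) g (Suc k)"
      using assms(1,2) k(2) by (auto simp: exec_frame min_def)
  qed
  then show ?thesis unfolding MINP_def using b by simp
qed

primrec amin :: "(nat \<Rightarrow> bool) \<Rightarrow> (nat \<Rightarrow> nat) \<Rightarrow> nat \<Rightarrow> nat option" where
  "amin G f 0 = None"
| "amin G f (Suc m) = (case amin G f m of None \<Rightarrow> if G m then Some m else None
     | Some r \<Rightarrow> if G m \<and> f m < f r then Some m else Some r)"

lemma amin_None: "amin G f m = None \<longleftrightarrow> (\<forall>k<m. \<not> G k)"
  by (induction m) (auto simp: less_Suc_eq split: option.splits)

lemma amin_Some: "amin G f m = Some r \<Longrightarrow> r < m \<and> G r \<and> (\<forall>k<m. G k \<longrightarrow> f r \<le> f k)"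
proof (induction m arbitrary: r)
  case (Suc m)
  show ?case
  proof (cases "amin G f m")
    case None
    then have "\<forall>k<m. \<not> G k" using amin_None by blast
    then show ?thesis using Suc.prems None by (auto simp: less_Suc_eq split: if_splits)
  next
    case (Some r')
    then show ?thesis using Suc.prems Suc.IH[OF Some] by (fastforce simp: less_Suc_eq split: if_splits)
  qed
qed simp

definition amin0 where "amin0 G f m = (case amin G f m of None \<Rightarrow> 0 | Some r \<Rightarrow> r)"

lemma amin0: "\<exists>k<m. G k \<Longrightarrow> amin0 G f m < m \<and> G (amin0 G f m) \<and> (\<forall>k<m. G k \<longrightarrow> f (amin0 G f m) \<le> f k)"
  unfolding amin0_def using amin_Some[of G f m] amin_None[of G f m]
  by (cases "amin G f m") auto

lemma exec_AMIN:
  assumes "ok (AMIN res best fnd i b g p t)" "{res, best, fnd} \<inter> mods p = {}" "distinct [res, best, fnd]"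
    "t \<noteq> i" "t \<notin> {res, best, fnd}"
    and val: "\<And>k s'. k < s b 0 0 \<Longrightarrow> s' i 0 0 = k \<Longrightarrow>
      (\<And>x. x \<notin> mods p \<Longrightarrow> x \<notin> {res, best, fnd, i} \<Longrightarrow> s' x = s x) \<Longrightarrow>
      exec p s' t 0 0 = f k \<and> bval g (exec p s') = G k"
  shows "exec (AMIN res best fnd i b g p t) s res 0 0 = amin0 G f (s b 0 0)"
    and "exec (AMIN res best fnd i b g p t) s fnd 0 0 = of_bool (\<exists>k<s b 0 0. G k)"
proof -
  let ?c = "Cnd (And g (Not (And (Less (N 0) (V fnd)) (Not (Less (V t) (V best))))))
         (best ::= V t ;; res ::= V i ;; fnd ::= N 1) Skp"
  let ?p = "p ;; ?c"
  let ?s = "setv (setv s fnd 0) res 0"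
  have b: "?s b 0 0 = s b 0 0" using assms(1) by auto
  let ?I = "\<lambda>k s'. case amin G f k of None \<Rightarrow> s' fnd 0 0 = 0 \<and> s' res 0 0 = 0
      | Some r \<Rightarrow> s' fnd 0 0 = 1 \<and> s' res 0 0 = r \<and> s' best 0 0 = f r"
  have "?I (?s b 0 0) (exec (For i b ?p) ?s)"
  proof (rule For_inv[where I = ?I])
    show "ok (For i b ?p)" using assms(1,2) by auto
    show "?I 0 (setv ?s i 0)" using assms(1,3) by auto
    fix k s' assume k: "k < ?s b 0 0" "?I k s'" "s' i 0 0 = k"
      "\<And>x. x \<noteq> i \<Longrightarrow> x \<notin> mods ?p \<Longrightarrow> s' x = ?s x"
    have v: "exec p s' t 0 0 = f k \<and> bval g (exec p s') = G k"
      by (rule val) (use k b in auto)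
    have fr: "exec p s' fnd = s' fnd" "exec p s' res = s' res" "exec p s' best = s' best" "exec p s' i = s' i"
      using assms(1,2) by (auto simp: exec_frame)
    have ne: "i \<noteq> res" "i \<noteq> best" "i \<noteq> fnd" using assms(1) by auto
    show "?I (Suc k) (setv (exec ?p s') i (Suc k))"
    proof (cases "amin G f k")
      case None
      then show ?thesis using k(2,3) v fr ne assms(3,4,5) by (auto simp: upd_apply)
    next
      case (Some r)
      then show ?thesis using k(2,3) v fr ne assms(3,4,5) by (auto simp: upd_apply)
    qed
  qed
  note I = this[unfolded b]
  have ex: "exec (AMIN res best fnd i b g p t) s = exec (For i b ?p) ?s"
    by (simp only: AMIN_def exec.simps aval.simps)
  show "exec (AMIN res best fnd i b g p t) s res 0 0 = amin0 G f (s b 0 0)"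
    unfolding ex amin0_def using I by (cases "amin G f (s b 0 0)") (simp_all del: exec.simps)
  show "exec (AMIN res best fnd i b g p t) s fnd 0 0 = of_bool (\<exists>k<s b 0 0. G k)"
  proof (cases "amin G f (s b 0 0)")
    case None
    then show ?thesis unfolding ex using I amin_None[of G f "s b 0 0"] by (simp del: exec.simps)
  next
    case (Some r)
    then have "\<exists>k<s b 0 0. G k" using amin_Some[OF Some] by blast
    then show ?thesis unfolding ex using I Some by (simp del: exec.simps)
  qed
qed

section \<open>All-pairs shortest paths\<close>

context
  fixes n :: nat and E :: "(nat \<times> nat) set" and ifv :: nat and w :: "nat \<Rightarrow> nat \<Rightarrow> nat"
begin

text \<open>The weights are a parameter, so that one correctness proof serves hop counts and
  tie-breaking weights.\<close>

inductive wk :: "nat \<Rightarrow> nat \<Rightarrow> nat \<Rightarrow> nat \<Rightarrow> bool" for u where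
  wk0: "wk u u 0 0"
| wkS: "wk u x k c \<Longrightarrow> (x, v) \<in> E \<Longrightarrow> wk u v (Suc k) (c + w x v)"

text \<open>Rounds of the Bellman-Ford algorithm, with the number \<open>ifv\<close> for
  infinity.\<close>

primrec bf :: "nat \<Rightarrow> nat \<Rightarrow> nat \<Rightarrow> nat" where
  "bf 0 = (\<lambda>u v. if u = v then 0 else ifv)"
| "bf (Suc t) = (\<lambda>u v. minl (bf t u v) (\<lambda>x. if (x, v) \<in> E then bf t u x + w x v else bf t u v) n)"

lemma bf_Suc_le: "bf (Suc t) u v \<le> bf t u v"
  using minl_le[of "bf t u v" _ n] by simp

lemma bf_self: "bf t u u = 0"
proof (induction t)
  case (Suc t)
  then show ?case using bf_Suc_le[of t u u] by (metis le_zero_eq)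
qed simp

lemma bf_le: "wk u v k c \<Longrightarrow> E \<subseteq> {..<n} \<times> {..<n} \<Longrightarrow> k \<le> t \<Longrightarrow> bf t u v \<le> c"
proof (induction arbitrary: t rule: wk.induct)
  case (wkS x k c v)
  then obtain t' where t: "t = Suc t'" by (cases t) auto
  have "x < n" using wkS by auto
  then have "bf t u v \<le> bf t' u x + w x v"
    using minl_le[of "bf t' u v" "\<lambda>x. if (x, v) \<in> E then bf t' u x + w x v else bf t' u v" n] wkS(2) t by auto
  moreover have "bf t' u x \<le> c" using wkS t by auto
  ultimately show ?case by linarith
qed (simp add: bf_self)

lemma bf_wk: "bf t u v < ifv \<Longrightarrow> \<exists>k. wk u v k (bf t u v)"
proof (induction t arbitrary: v)
  case 0
  then show ?case using wk0 by (auto split: if_splits)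
next
  case (Suc t)
  let ?f = "\<lambda>x. if (x, v) \<in> E then bf t u x + w x v else bf t u v"
  from minl_in[of "bf t u v" ?f n] consider "bf (Suc t) u v = bf t u v" |
    x where "(x, v) \<in> E" "bf (Suc t) u v = bf t u x + w x v"
    by (auto split: if_splits)
  then show ?case
  proof cases
    case 1
    then show ?thesis using Suc by (simp del: bf.simps)
  next
    case 2
    then have "bf t u x < ifv" using Suc.prems by linarith
    then obtain k where "wk u x k (bf t u x)" using Suc.IH by blast
    from wkS[OF this 2(1)] show ?thesis using 2(2) by (metis)
  qed
qed

text \<open>After \<open>n\<close> rounds all walks with up to \<open>n\<close> edges are taken into
  account, and every value below \<open>ifv\<close> belongs to a walk.\<close>

lemma bf_eq:
  assumes "E \<subseteq> {..<n} \<times> {..<n}" "wk u v k m" "k \<le> n" "\<And>k c. wk u v k c \<Longrightarrow> m \<le> c" "m < ifv"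
  shows "bf n u v = m"
proof -
  have "bf n u v \<le> m" using bf_le[OF assms(2,1,3)] .
  moreover from this obtain k' where "wk u v k' (bf n u v)" using bf_wk assms(5) by (meson le_less_trans)
  ultimately show ?thesis using assms(4) by (meson le_antisym)
qed

end

lemma wk_unit: "wk E (\<lambda>_ _. 1) u v k c \<Longrightarrow> c = k \<and> (u, v) \<in> E ^^ k"
  by (induction rule: wk.induct) auto

lemma relpow_wk: "(u, v) \<in> E ^^ k \<Longrightarrow> wk E (\<lambda>_ _. 1) u v k k"
proof (induction k arbitrary: v)
  case 0
  then show ?case using wk.wk0 by simp
next
  case (Suc k)
  then obtain x where "(u, x) \<in> E ^^ k" "(x, v) \<in> E" by auto
  then show ?case using wk.wkS[OF Suc.IH, of x v] by simp
qed

lemma wk_walk: "wk E (wt n) u v k c \<Longrightarrow> \<exists>A. walk n E u v k A c"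
proof (induction rule: wk.induct)
  case wk0
  show ?case using walk.walk0 by blast
next
  case (wkS x k c v)
  then show ?case using walk.walkS by blast
qed

lemma walk_wk: "walk n E u v k A c \<Longrightarrow> wk E (wt n) u v k c"
proof (induction rule: walk.induct)
  case walk0
  show ?case by (rule wk.wk0)
next
  case (walkS x k A c v)
  show ?case by (rule wk.wkS[OF walkS.IH walkS.hyps(2)])
qed

context
  fixes n :: nat and E :: "(nat \<times> nat) set"
  assumes G: "connected_graph n E"
begin

lemma E_sub: "E \<subseteq> {..<n} \<times> {..<n}" using G by (simp add: connected_graph_def)

lemma bf_gdist: assumes "u < n" "v < n" shows "bf n E n (\<lambda>_ _. 1) n u v = gdist E u v"
proof (rule bf_eq[OF E_sub])
  obtain A c where "walk n E u v (gdist E u v) A c" using gdist_walk[OF G assms] by blast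
  then have "(u, v) \<in> E ^^ gdist E u v" by (rule walk_relpow)
  then show "wk E (\<lambda>_ _. 1) u v (gdist E u v) (gdist E u v)" by (rule relpow_wk)
  show "gdist E u v \<le> n" "gdist E u v < n" using gdist_less[OF G assms] by auto
  show "gdist E u v \<le> c" if "wk E (\<lambda>_ _. 1) u v k c" for k c
    using wk_unit[OF that] unfolding gdist_def by (auto intro: Least_le)
qed

lemma bf_wdist: assumes "u < n" "v < n" shows "bf n E (n * 2 ^ (n + 3)) (wt n) n u v = wdist n E u v"
proof (rule bf_eq[OF E_sub])
  obtain A where "walk n E u v (gdist E u v) A (wdist n E u v)" using wdist_walk[OF G assms] by blast
  then show "wk E (wt n) u v (gdist E u v) (wdist n E u v)" by (rule walk_wk)
  show "gdist E u v \<le> n" using gdist_less[OF G assms] by simp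
  show "wdist n E u v < n * 2 ^ (n + 3)" by (rule wdist_bound[OF G assms])
  show "wdist n E u v \<le> c" if "wk E (wt n) u v k c" for k c
    using wk_walk[OF that] wdist_le[OF G] by blast
qed

end

section \<open>The program\<close>

abbreviation "tru \<equiv> leb (N 0) (N 0)"
abbreviation "G1 x a \<equiv> Get x a (N 0)"

text \<open>\<open>8 * n * n\<close> is one bound for several purposes: indices of powers of two,
  first factors of products, exponents of \<open>pw\<close>.\<close>

definition base :: "nat \<Rightarrow> nat \<Rightarrow> (nat \<times> nat) set \<Rightarrow> mem \<Rightarrow> bool" where
  "base n D E s \<longleftrightarrow> s ''n'' 0 0 = n \<and> s ''n2'' 0 0 = 2 * n \<and> s ''N'' 0 0 = 8 * n * n \<and> s ''one'' 0 0 = 1 \<and>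
     s ''D'' 0 0 = D \<and> (\<forall>i j. s ''adj'' i j = of_bool ((i, j) \<in> E))"

definition bvars :: "vname set" where "bvars = {''n'', ''n2'', ''N'', ''one'', ''D'', ''adj''}"

lemma base_cong: "base n D E s \<Longrightarrow> (\<And>x. x \<in> bvars \<Longrightarrow> s' x = s x) \<Longrightarrow> base n D E s'"
  by (auto simp: base_def bvars_def)

lemma base_frame: "base n D E s \<Longrightarrow> bvars \<inter> mods p = {} \<Longrightarrow> base n D E (exec p s)"
proof (rule base_cong)
  fix x assume "bvars \<inter> mods p = {}" "x \<in> bvars"
  then have "x \<notin> mods p" by blast
  then show "exec p s x = s x" by (rule exec_frame)
qed

section \<open>Powers of two, edge weights and distance tables\<close>

definition P_two :: lp where
  "P_two = (Asg ''two'' (N 0) (N 0) (N 1) ;;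
     For ''i'' ''N'' (Asg ''two'' (N 0) (Plus (V ''i'') (N 1))
       (Plus (Get ''two'' (N 0) (V ''i'')) (Get ''two'' (N 0) (V ''i'')))))"

lemma mods_two [simp]: "mods P_two = {''two'', ''i''}" by (auto simp: P_two_def)
lemma ok_two [simp]: "ok P_two" by (simp add: P_two_def)
lemma bnds_two [simp]: "bnds P_two = {''N''}" by (simp add: P_two_def)

lemma exec_two: assumes "k \<le> s ''N'' 0 0" shows "exec P_two s ''two'' 0 k = 2 ^ k"
proof -
  let ?p = "Asg ''two'' (N 0) (Plus (V ''i'') (N 1))
       (Plus (Get ''two'' (N 0) (V ''i'')) (Get ''two'' (N 0) (V ''i'')))"
  let ?s = "upd s ''two'' 0 0 1"
  let ?I = "\<lambda>m s'. \<forall>k\<le>m. s' ''two'' 0 k = 2 ^ k"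
  have "?I (?s ''N'' 0 0) (exec (For ''i'' ''N'' ?p) ?s)"
  proof (rule For_inv[where I = ?I])
    fix m and s' :: mem assume "m < ?s ''N'' 0 0" "?I m s'" "s' ''i'' 0 0 = m"
    then show "?I (Suc m) (setv (exec ?p s') ''i'' (Suc m))"
      by (auto simp: upd_apply le_Suc_eq)
  qed auto
  then show ?thesis using assms by (simp add: P_two_def)
qed

definition P_wt :: lp where
  "P_wt = (FILL ''w1'' ''u'' ''n'' ''v'' ''n'' (''t'' ::= N 1) ''t'' ;;
     FILL ''w2'' ''u'' ''n'' ''v'' ''n'' (''t'' ::= Plus (Get ''two'' (N 0) (Plus (V ''n'') (N 2)))
        (Plus (Get ''two'' (N 0) (V ''u'')) (Get ''two'' (N 0) (V ''v'')))) ''t'' ;;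
     ''f1'' ::= V ''n'' ;;
     SUMIF ''f2'' ''i'' ''n'' tru (Get ''two'' (N 0) (Plus (V ''n'') (N 3))))"

lemma mods_wt [simp]: "mods P_wt = {''w1'', ''w2'', ''u'', ''v'', ''t'', ''f1'', ''f2'', ''i'', ''_t''}"
  by (auto simp: P_wt_def)
lemma ok_wt [simp]: "ok P_wt" by (simp add: P_wt_def)
lemma bnds_wt [simp]: "bnds P_wt = {''n''}" by (simp add: P_wt_def)

lemma exec_wt:
  assumes b: "base n D E s" and two: "\<And>k. k \<le> n + 3 \<Longrightarrow> s ''two'' 0 k = 2 ^ k"
  shows "u < n \<Longrightarrow> v < n \<Longrightarrow> exec P_wt s ''w1'' u v = 1"
    and "u < n \<Longrightarrow> v < n \<Longrightarrow> exec P_wt s ''w2'' u v = wt n u v"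
    and "exec P_wt s ''f1'' 0 0 = n" and "exec P_wt s ''f2'' 0 0 = n * 2 ^ (n + 3)"
proof -
  have n: "s ''n'' 0 0 = n" using b by (simp add: base_def)
  let ?F1 = "FILL ''w1'' ''u'' ''n'' ''v'' ''n'' (''t'' ::= N 1) ''t''"
  let ?F2 = "FILL ''w2'' ''u'' ''n'' ''v'' ''n'' (''t'' ::= Plus (Get ''two'' (N 0) (Plus (V ''n'') (N 2)))
        (Plus (Get ''two'' (N 0) (V ''u'')) (Get ''two'' (N 0) (V ''v'')))) ''t''"
  let ?s = "exec ?F1 s" let ?s2 = "exec ?F2 ?s" let ?s3 = "setv ?s2 ''f1'' n"
  have 1: "?s ''w1'' u v = 1" if "u < n" "v < n" for u v
    by (subst exec_FILL[where g = "\<lambda>_ _. 1"]) (use that n in auto)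
  have 2: "?s2 ''w2'' u v = wt n u v" if "u < n" "v < n" for u v
    by (subst exec_FILL[where g = "wt n"]) (use that n two in \<open>auto simp: exec_frame wt_def\<close>)
  have 3: "exec (SUMIF ''f2'' ''i'' ''n'' tru (Get ''two'' (N 0) (Plus (V ''n'') (N 3)))) ?s3 ''f2'' 0 0 = (\<Sum>k<?s3 ''n'' 0 0. 2 ^ (n + 3))"
    by (rule exec_SUMIF) (use n two in \<open>auto simp: exec_frame\<close>)
  show "exec P_wt s ''w1'' u v = 1" if "u < n" "v < n"
    using 1[OF that] by (simp add: P_wt_def exec_frame)
  show "exec P_wt s ''w2'' u v = wt n u v" if "u < n" "v < n"
    using 2[OF that] by (simp add: P_wt_def exec_frame)
  show "exec P_wt s ''f1'' 0 0 = n" using n by (simp add: P_wt_def exec_frame)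
  show "exec P_wt s ''f2'' 0 0 = n * 2 ^ (n + 3)"
    using 3 n by (simp add: P_wt_def exec_frame)
qed

text \<open>A round goes to \<open>nw\<close> first, so that it reads only values of the previous
  round, as \<open>bf\<close> does.\<close>

definition P_apsp :: "vname \<Rightarrow> vname \<Rightarrow> vname \<Rightarrow> lp" where
  "P_apsp out w f = (FILL out ''u'' ''n'' ''v'' ''n'' (IFE ''t'' (eqb (V ''u'') (V ''v'')) (N 0) (V f)) ''t'' ;;
     For ''r_'' ''n'' (
       FILL ''nw'' ''u'' ''n'' ''v'' ''n''
         (MINP ''t'' (Get out (V ''u'') (V ''v'')) ''x'' ''n''
           (IFE ''tx'' (posb (Get ''adj'' (V ''x'') (V ''v'')))
              (Plus (Get out (V ''u'') (V ''x'')) (Get w (V ''x'') (V ''v'')))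
              (Get out (V ''u'') (V ''v''))) ''tx'') ''t'' ;;
       FILL out ''u'' ''n'' ''v'' ''n'' (''t'' ::= Get ''nw'' (V ''u'') (V ''v'')) ''t''))"

lemma mods_apsp [simp]: "mods (P_apsp out w f) = {out, ''u'', ''v'', ''t'', ''r_'', ''nw'', ''x'', ''tx''}"
  by (auto simp: P_apsp_def)
lemma bnds_apsp [simp]: "bnds (P_apsp out w f) = {''n''}" by (auto simp: P_apsp_def)

lemma ok_apsp [simp]: "out \<notin> {''u'', ''v'', ''t'', ''r_'', ''nw'', ''x'', ''tx'', ''n''} \<Longrightarrow> ok (P_apsp out w f)"
  by (auto simp: P_apsp_def)

lemma exec_apsp:
  assumes b: "base n D E s" and v: "out \<notin> {''u'', ''v'', ''t'', ''r_'', ''nw'', ''x'', ''tx'', ''n'', ''adj''}"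
    and wf: "w \<notin> {''u'', ''v'', ''t'', ''r_'', ''nw'', ''x'', ''tx'', out}" "f \<notin> {''u'', ''v'', ''t'', out}"
    and w: "\<And>u v. u < n \<Longrightarrow> v < n \<Longrightarrow> s w u v = W u v" and f: "s f 0 0 = ifv"
    and u: "u < n" "u' < n"
  shows "exec (P_apsp out w f) s out u u' = bf n E ifv W n u u'"
proof -
  have n: "s ''n'' 0 0 = n" and adj: "s ''adj'' i j = of_bool ((i, j) \<in> E)" for i j
    using b by (auto simp: base_def)
  let ?F0 = "FILL out ''u'' ''n'' ''v'' ''n'' (IFE ''t'' (eqb (V ''u'') (V ''v'')) (N 0) (V f)) ''t''"
  let ?M = "MINP ''t'' (Get out (V ''u'') (V ''v'')) ''x'' ''n''
           (IFE ''tx'' (posb (Get ''adj'' (V ''x'') (V ''v'')))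
              (Plus (Get out (V ''u'') (V ''x'')) (Get w (V ''x'') (V ''v'')))
              (Get out (V ''u'') (V ''v''))) ''tx''"
  let ?F1 = "FILL ''nw'' ''u'' ''n'' ''v'' ''n'' ?M ''t''"
  let ?F2 = "FILL out ''u'' ''n'' ''v'' ''n'' (''t'' ::= Get ''nw'' (V ''u'') (V ''v'')) ''t''"
  let ?p = "?F1 ;; ?F2"
  let ?s = "exec ?F0 s"
  let ?I = "\<lambda>m s'. \<forall>u<n. \<forall>v<n. s' out u v = bf n E ifv W m u v"
  have "?I (?s ''n'' 0 0) (exec (For ''r_'' ''n'' ?p) ?s)"
  proof (rule For_inv[where I = ?I])
    show "ok (For ''r_'' ''n'' ?p)" using v by auto
    show "?I 0 (setv ?s ''r_'' 0)"
    proof (intro allI impI)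
      fix a c assume ac: "a < n" "c < n"
      have "?s out a c = (if a < s ''n'' 0 0 \<and> c < s ''n'' 0 0 then (if a = c then 0 else ifv) else s out a c)"
        by (rule exec_FILL) (use v wf f in auto)
      then show "setv ?s ''r_'' 0 out a c = bf n E ifv W 0 a c" using ac n v by simp
    qed
    fix m s' assume h: "m < ?s ''n'' 0 0" "?I m s'" "s' ''r_'' 0 0 = m"
      "\<And>x. x \<noteq> ''r_'' \<Longrightarrow> x \<notin> mods ?p \<Longrightarrow> s' x = ?s x"
    have s': "s' x = s x" if "x \<notin> {out, ''u'', ''v'', ''t'', ''r_'', ''nw'', ''x'', ''tx''}" for x
      using h(4)[of x] that by (simp add: exec_frame)
    have n': "s' ''n'' 0 0 = n" "s' ''adj'' i j = of_bool ((i, j) \<in> E)" for i j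
      using s' v n adj by auto
    have w': "s' w a c = W a c" if "a < n" "c < n" for a c using s'[of w] wf w that by auto
    have nw: "exec ?F1 s' ''nw'' a c = bf n E ifv W (Suc m) a c" if ac: "a < n" "c < n" for a c
    proof -
      have "exec ?F1 s' ''nw'' a c = (if a < s' ''n'' 0 0 \<and> c < s' ''n'' 0 0 then bf n E ifv W (Suc m) a c else s' ''nw'' a c)"
      proof (rule exec_FILL)
        fix a c s2 assume g: "a < s' ''n'' 0 0" "c < s' ''n'' 0 0" "s2 ''u'' 0 0 = a" "s2 ''v'' 0 0 = c"
          "\<And>x. x \<notin> mods ?M \<Longrightarrow> x \<noteq> ''nw'' \<Longrightarrow> x \<noteq> ''u'' \<Longrightarrow> x \<noteq> ''v'' \<Longrightarrow> s2 x = s' x"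
        have s2: "s2 ''n'' 0 0 = n" "s2 ''adj'' = s' ''adj''" "s2 out = s' out" "s2 w = s' w"
          using g(5) v wf n' by auto
        have "exec ?M s2 ''t'' 0 0 = minl (aval (Get out (V ''u'') (V ''v'')) s2)
            (\<lambda>x. if (x, c) \<in> E then bf n E ifv W m a x + W x c else bf n E ifv W m a c) (s2 ''n'' 0 0)"
        proof (rule exec_MINP)
          fix k s3 assume k: "k < s2 ''n'' 0 0" "s3 ''x'' 0 0 = k"
            "\<And>x. x \<notin> mods (IFE ''tx'' (posb (Get ''adj'' (V ''x'') (V ''v'')))
              (Plus (Get out (V ''u'') (V ''x'')) (Get w (V ''x'') (V ''v'')))
              (Get out (V ''u'') (V ''v''))) \<Longrightarrow> x \<noteq> ''t'' \<Longrightarrow> x \<noteq> ''x'' \<Longrightarrow> s3 x = s2 x"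
          have s3: "s3 ''u'' 0 0 = a" "s3 ''v'' 0 0 = c" "s3 ''adj'' = s' ''adj''" "s3 out = s' out" "s3 w = s' w"
            using k(3) v wf g s2 by auto
          show "exec (IFE ''tx'' (posb (Get ''adj'' (V ''x'') (V ''v'')))
              (Plus (Get out (V ''u'') (V ''x'')) (Get w (V ''x'') (V ''v'')))
              (Get out (V ''u'') (V ''v''))) s3 ''tx'' 0 0 =
            (if (k, c) \<in> E then bf n E ifv W m a k + W k c else bf n E ifv W m a c)"
            using s3 k s2 n' w' h(2) g by auto
        qed (use v in auto)
        then show "exec ?M s2 ''t'' 0 0 = bf n E ifv W (Suc m) a c"
          using g s2 n' h(2) by simp
      qed (use v in auto)
      then show ?thesis using ac n' by simp
    qed
    have n1: "exec ?F1 s' ''n'' 0 0 = n" using n' by (simp add: exec_frame)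
    have "exec ?F2 (exec ?F1 s') out a c = bf n E ifv W (Suc m) a c" if ac: "a < n" "c < n" for a c
    proof -
      have "exec ?F2 (exec ?F1 s') out a c = (if a < exec ?F1 s' ''n'' 0 0 \<and> c < exec ?F1 s' ''n'' 0 0 then bf n E ifv W (Suc m) a c else exec ?F1 s' out a c)"
        by (rule exec_FILL) (use v nw n1 in auto)
      then show ?thesis using ac n1 by simp
    qed
    then show "?I (Suc m) (setv (exec ?p s') ''r_'' (Suc m))" using v by (auto simp del: bf.simps)
  qed
  moreover have "?s ''n'' 0 0 = n" by (subst exec_frame) (use v n in auto)
  ultimately show ?thesis using u by (simp add: P_apsp_def)
qed

section \<open>Parameters\<close>

locale setting =
  fixes n :: nat and E :: "(nat \<times> nat) set" and D :: nat
  assumes G: "connected_graph n E" and D_less: "D < n"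
begin

abbreviation "dd \<equiv> gdist E"
abbreviation "PP \<equiv> geo n E"

sublocale p: paths n dd PP by (rule paths_geo[OF G])

text \<open>The number of bits of \<open>n\<close>. Like \<open>k0\<close>, which is
  \<open>2 * n / l\<close> rounded up, it is written as a count because that is how a program
  without division obtains it.\<close>

definition l where "l = (\<Sum>i<n. if 2 ^ i \<le> n then 1 else 0 :: nat)"
definition j where "j = D div 32"
definition md where "md \<longleftrightarrow> (8 * j * l)\<^sup>2 \<le> n"
definition k0 where "k0 = (\<Sum>i<2*n. if l * i < 2 * n then 1 else 0 :: nat)"
definition k where "k = k0 + 8 * j"

lemma l_card: "l = card {i. i < n \<and> 2 ^ i \<le> n}"
proof -
  have "l = (\<Sum>i\<in>{..<n} \<inter> {i. 2 ^ i \<le> n}. 1)" unfolding l_def by (simp add: sum.If_cases)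
  also have "{..<n} \<inter> {i. 2 ^ i \<le> n} = {i. i < n \<and> 2 ^ i \<le> n}" by auto
  finally show ?thesis by simp
qed

lemma down_closed_card:
  assumes "\<And>i i'. i' \<le> i \<Longrightarrow> Q i \<Longrightarrow> Q i'"
  shows "{i. i < (m::nat) \<and> Q i} = {..<card {i. i < m \<and> Q i}}"
proof (induction m)
  case (Suc m)
  show ?case
  proof (cases "Q m")
    case True
    then have "{i. i < Suc m \<and> Q i} = {..<Suc m}" using assms by (auto simp: less_Suc_eq_le)
    then show ?thesis by simp
  next
    case False
    then have "{i. i < Suc m \<and> Q i} = {i. i < m \<and> Q i}" by (auto simp: less_Suc_eq)
    then show ?thesis using Suc by simp
  qed
qed simp

lemma l_iff: "i < l \<longleftrightarrow> 2 ^ i \<le> n"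
proof -
  have "{i. i < n \<and> 2 ^ i \<le> n} = {..<l}" unfolding l_card
  proof (rule down_closed_card)
    fix i i' :: nat assume "i' \<le> i" "2 ^ i \<le> n"
    moreover have "(2::nat) ^ i' \<le> 2 ^ i" using \<open>i' \<le> i\<close> by (rule power_increasing) simp
    ultimately show "2 ^ i' \<le> n" by linarith
  qed
  moreover have "i < n" if "2 ^ i \<le> n" using that less_exp[of i] by linarith
  ultimately show ?thesis by blast
qed

lemma l_pos: "l \<ge> 1" using l_iff[of 0] p.n_pos by simp
lemma l_up: "n < 2 ^ l" using l_iff[of l] by simp
lemma l_low: "2 ^ (l - 1) \<le> n" using l_iff[of "l - 1"] l_pos by simp
lemma l_le: "l \<le> n" unfolding l_card by (rule order.trans[OF card_mono[of "{..<n}"]]) auto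

lemma j_le: "32 * j \<le> D" "32 * j < n" using D_less by (auto simp: j_def)

lemma k0_eq: "{i. i < 2 * n \<and> l * i < 2 * n} = {..<k0}"
proof -
  have "k0 = (\<Sum>i\<in>{..<2*n} \<inter> {i. l * i < 2 * n}. 1)" unfolding k0_def by (simp add: sum.If_cases)
  also have "{..<2*n} \<inter> {i. l * i < 2 * n} = {i. i < 2 * n \<and> l * i < 2 * n}" by auto
  finally have k0: "k0 = card {i. i < 2 * n \<and> l * i < 2 * n}" by simp
  show ?thesis unfolding k0
  proof (rule down_closed_card)
    fix i i' assume "i' \<le> i" "l * i < 2 * n"
    moreover have "l * i' \<le> l * i" using \<open>i' \<le> i\<close> by simp
    ultimately show "l * i' < 2 * n" by linarith
  qed
qed

lemma k0_le: "k0 \<le> 2 * n"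
proof -
  have "{..<k0} \<subseteq> {..<2*n}" unfolding k0_eq[symmetric] by blast
  then show ?thesis by (simp add: lessThan_subset_iff)
qed

lemma k0_low: "2 * n \<le> k0 * l"
proof (cases "k0 < 2 * n")
  case True
  have "k0 \<notin> {i. i < 2 * n \<and> l * i < 2 * n}" unfolding k0_eq by simp
  then show ?thesis using True by (simp add: mult.commute)
next
  case False
  then have "2 * n \<le> k0" by simp
  also have "\<dots> \<le> k0 * l" using l_pos by simp
  finally show ?thesis .
qed

lemma k0_up: "k0 * l \<le> 2 * n + l"
proof (cases k0)
  case (Suc m)
  then have "m \<in> {..<k0}" by simp
  then have "l * m < 2 * n" using k0_eq by blast
  then show ?thesis using Suc by (simp add: mult.commute)
qed simp

lemma kl: "2 * n \<le> k * l" "k * l \<le> 2 * n + l + 8 * j * l" "8 * j \<le> k" "k < 3 * n"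
  using k0_low k0_up k0_le j_le by (auto simp: k_def distrib_right)

lemma N_ge: "n + j * (n + 1) < 8 * n * n" "3 * n + 1 \<le> 8 * n * n" "n * n + n \<le> 8 * n * n" "n + 3 \<le> 8 * n * n"
proof -
  have nn: "n \<le> n * n" "1 \<le> n" using p.n_pos by auto
  have "j * (n + 1) \<le> n * (n + 1)" using j_le by (intro mult_le_mono1) simp
  then show "n + j * (n + 1) < 8 * n * n" using nn unfolding distrib_left mult.assoc by linarith
  show "3 * n + 1 \<le> 8 * n * n" "n * n + n \<le> 8 * n * n" "n + 3 \<le> 8 * n * n"
    using nn unfolding mult.assoc by linarith+
qed

text \<open>Agrees with \<open>Lam\<close> but is available before \<open>X\<close>, which depends
  on it.\<close>

definition Lm where "Lm = (if md then 8 * j * l else 2 * j)"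

definition pars :: "mem \<Rightarrow> bool" where
  "pars s \<longleftrightarrow> s ''l'' 0 0 = l \<and> s ''j'' 0 0 = j \<and> s ''dl'' 0 0 = 8 * j \<and> s ''e'' 0 0 = 2 * j \<and>
     s ''md'' 0 0 = of_bool md \<and> s ''lam'' 0 0 = Lm \<and> s ''k'' 0 0 = k \<and> s ''Q'' 0 0 = l * l \<and>
     s ''A0'' 0 0 = n * (2 * j) \<and> s ''AQ'' 0 0 = n * (2 * j) * (l * l)"

definition pvars :: "vname set" where "pvars = {''l'', ''j'', ''dl'', ''e'', ''md'', ''lam'', ''k'', ''Q'', ''A0'', ''AQ''}"

lemma pars_cong: "pars s \<Longrightarrow> (\<And>x. x \<in> pvars \<Longrightarrow> s' x = s x) \<Longrightarrow> pars s'"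
  by (auto simp: pars_def pvars_def)

end

definition P_par1 :: lp where
  "P_par1 = (SUMIF ''l'' ''i'' ''n'' (leb (Get ''two'' (N 0) (V ''i'')) (V ''n'')) (N 1) ;;
    SUMIF ''j'' ''i'' ''n'' (leb (mulc 32 (Plus (V ''i'') (N 1))) (V ''D'')) (N 1) ;;
    ''dl'' ::= mulc 8 (V ''j'') ;; ''e'' ::= mulc 2 (V ''j''))"
definition P_par2 :: lp where
  "P_par2 = (MUL ''lm'' ''i'' (V ''l'') (V ''dl'') ;; MUL ''q'' ''i'' (V ''lm'') (V ''lm'') ;;
    IFE ''md'' (leb (V ''q'') (V ''n'')) (N 1) (N 0) ;;
    IFE ''lam'' (posb (V ''md'')) (V ''lm'') (V ''e''))"
definition P_par3 :: lp where
  "P_par3 = (SUMP ''k0'' ''h'' ''n2'' (MUL ''t'' ''i'' (V ''l'') (V ''h'') ;;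
      IFE ''t2'' (Less (V ''t'') (V ''n2'')) (N 1) (N 0)) ''t2'' ;;
    ''k'' ::= Plus (V ''k0'') (V ''dl'') ;; MUL ''Q'' ''i'' (V ''l'') (V ''l'') ;;
    MUL ''A0'' ''i'' (V ''n'') (V ''e'') ;; MUL ''AQ'' ''i'' (V ''Q'') (V ''A0''))"

definition "P_par = (P_par1 ;; P_par2 ;; P_par3)"

lemma mods_par [simp]: "mods P_par1 = {''l'', ''i'', ''_t'', ''j'', ''dl'', ''e''}"
  "mods P_par2 = {''lm'', ''i'', ''_t'', ''q'', ''md'', ''lam''}"
  "mods P_par3 = {''k0'', ''h'', ''t'', ''i'', ''_t'', ''t2'', ''k'', ''Q'', ''A0'', ''AQ''}"
  by (auto simp: P_par1_def P_par2_def P_par3_def)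
lemma mods_par' [simp]: "mods P_par = mods P_par1 \<union> mods P_par2 \<union> mods P_par3"
  by (simp add: P_par_def Un_assoc del: mods_par)
lemma ok_par [simp]: "ok P_par" by (simp add: P_par_def P_par1_def P_par2_def P_par3_def)
lemma bnds_par [simp]: "bnds P_par = {''n'', ''n2'', ''N''}"
  by (auto simp: P_par_def P_par1_def P_par2_def P_par3_def)

context setting
begin

lemma exec_par:
  assumes b: "base n D E s" and two: "\<And>k. k \<le> n \<Longrightarrow> s ''two'' 0 k = 2 ^ k"
  shows "pars (exec P_par s)"
proof -
  have n: "s ''n'' 0 0 = n" "s ''D'' 0 0 = D" "s ''N'' 0 0 = 8 * n * n" "s ''n2'' 0 0 = 2 * n"
    using b by (auto simp: base_def)
  let ?l = "SUMIF ''l'' ''i'' ''n'' (leb (Get ''two'' (N 0) (V ''i'')) (V ''n'')) (N 1)"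
  let ?j = "SUMIF ''j'' ''i'' ''n'' (leb (mulc 32 (Plus (V ''i'') (N 1))) (V ''D'')) (N 1)"
  let ?s1 = "exec ?l s" let ?s2 = "exec ?j ?s1"
  have "?s1 ''l'' 0 0 = (\<Sum>i<s ''n'' 0 0. if 2 ^ i \<le> n then 1 else 0)"
    by (rule exec_SUMIF) (use n two in auto)
  then have l: "?s1 ''l'' 0 0 = l" using n by (simp add: l_def)
  have "?s2 ''j'' 0 0 = (\<Sum>i<?s1 ''n'' 0 0. if 32 * (i + 1) \<le> D then 1 else 0)"
    by (rule exec_SUMIF) (use n in \<open>auto simp: exec_frame\<close>)
  also have "\<dots> = (\<Sum>i<n. if 32 * (i + 1) \<le> D then 1 else 0)" using n by (simp add: exec_frame)
  also have "\<dots> = (\<Sum>i\<in>{..<n} \<inter> {i. 32 * (i + 1) \<le> D}. 1)" by (simp only: sum.If_cases finite_lessThan) simp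
  also have "{..<n} \<inter> {i. 32 * (i + 1) \<le> D} = {..<j}"
  proof -
    \<comment> \<open>The quotient \<open>D div 32\<close> is the number of positive multiples of 32
      up to \<open>D\<close>.\<close>
    have e: "32 * (i + 1) \<le> D \<longleftrightarrow> i < j" for i
      unfolding j_def Suc_le_eq[symmetric] by (subst less_eq_div_iff_mult_less_eq) auto
    show ?thesis unfolding e using j_le by auto
  qed
  finally have j: "?s2 ''j'' 0 0 = j" by simp
  let ?s3 = "exec P_par1 s"
  have 3: "?s3 ''l'' 0 0 = l" "?s3 ''j'' 0 0 = j" "?s3 ''dl'' 0 0 = 8 * j" "?s3 ''e'' 0 0 = 2 * j"
    using l j by (simp_all add: P_par1_def exec_frame)
  have n3: "?s3 ''n'' 0 0 = n" "?s3 ''N'' 0 0 = 8 * n * n" "?s3 ''n2'' 0 0 = 2 * n"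
    using n by (simp_all add: exec_frame)
  let ?s4 = "exec (MUL ''lm'' ''i'' (V ''l'') (V ''dl'')) ?s3"
  have lm: "?s4 ''lm'' 0 0 = 8 * j * l"
    by (subst exec_MUL) (use 3 n3 l_le N_ge in auto)
  have lmn: "8 * j * l \<le> n * n" using j_le l_le by (intro mult_le_mono) auto
  let ?s5 = "exec (MUL ''q'' ''i'' (V ''lm'') (V ''lm'')) ?s4"
  have q: "?s5 ''q'' 0 0 = (8 * j * l) * (8 * j * l)"
    by (subst exec_MUL) (use lm n3 lmn N_ge in \<open>auto simp: exec_frame\<close>)
  let ?s6 = "exec P_par2 ?s3"
  have 6: "?s6 ''md'' 0 0 = of_bool md" "?s6 ''lam'' 0 0 = Lm"
    using q lm 3 n3 by (auto simp: P_par2_def exec_frame md_def Lm_def power2_eq_square)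
  have f6: "?s6 ''l'' 0 0 = l" "?s6 ''j'' 0 0 = j" "?s6 ''dl'' 0 0 = 8 * j" "?s6 ''e'' 0 0 = 2 * j"
     "?s6 ''n'' 0 0 = n" "?s6 ''N'' 0 0 = 8 * n * n" "?s6 ''n2'' 0 0 = 2 * n"
    using 3 n3 by (simp_all add: exec_frame)
  let ?k = "SUMP ''k0'' ''h'' ''n2'' (MUL ''t'' ''i'' (V ''l'') (V ''h'') ;;
      IFE ''t2'' (Less (V ''t'') (V ''n2'')) (N 1) (N 0)) ''t2''"
  let ?s7 = "exec ?k ?s6"
  have "?s7 ''k0'' 0 0 = (\<Sum>i<?s6 ''n2'' 0 0. if l * i < 2 * n then 1 else 0)"
  proof (rule exec_SUMP)
    fix a s' assume a: "a < ?s6 ''n2'' 0 0" "s' ''h'' 0 0 = a"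
      "\<And>x. x \<notin> mods (MUL ''t'' ''i'' (V ''l'') (V ''h'') ;;
           IFE ''t2'' (Less (V ''t'') (V ''n2'')) (N 1) (N 0)) \<Longrightarrow> x \<noteq> ''k0'' \<Longrightarrow> x \<noteq> ''h'' \<Longrightarrow> s' x = ?s6 x"
    have "exec (MUL ''t'' ''i'' (V ''l'') (V ''h'')) s' ''t'' 0 0 = l * a"
      by (subst exec_MUL) (use a f6 l_le N_ge in auto)
    then show "exec (MUL ''t'' ''i'' (V ''l'') (V ''h'') ;;
           IFE ''t2'' (Less (V ''t'') (V ''n2'')) (N 1) (N 0)) s' ''t2'' 0 0 = (if l * a < 2 * n then 1 else 0)"
      using a f6 by (simp add: exec_frame)
  qed simp_all
  then have 7: "?s7 ''k0'' 0 0 = k0" using f6 by (simp add: k0_def)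
  let ?s8 = "setv ?s7 ''k'' k"
  have 8: "?s8 ''l'' 0 0 = l" "?s8 ''e'' 0 0 = 2 * j" "?s8 ''n'' 0 0 = n" "?s8 ''N'' 0 0 = 8 * n * n" "?s7 ''dl'' 0 0 = 8 * j"
    using f6 by (simp_all add: exec_frame)
  let ?s9 = "exec (MUL ''Q'' ''i'' (V ''l'') (V ''l'')) ?s8"
  have 9: "?s9 ''Q'' 0 0 = l * l" by (subst exec_MUL) (use 8 l_le N_ge in auto)
  let ?s10 = "exec (MUL ''A0'' ''i'' (V ''n'') (V ''e'')) ?s9"
  have 10: "?s10 ''A0'' 0 0 = n * (2 * j)" by (subst exec_MUL) (use 8 N_ge in \<open>auto simp: exec_frame\<close>)
  let ?s11 = "exec (MUL ''AQ'' ''i'' (V ''Q'') (V ''A0'')) ?s10"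
  have ll: "l * l \<le> n * n" using l_le by (intro mult_le_mono) auto
  have 11: "?s11 ''AQ'' 0 0 = n * (2 * j) * (l * l)"
    by (subst exec_MUL) (use 8 9 10 ll N_ge in \<open>auto simp: exec_frame\<close>)
  have s11: "exec P_par3 ?s6 = ?s11"
    unfolding P_par3_def using 7 8(5) by (simp add: k_def)
  have "pars ?s11" unfolding pars_def
    using 6 f6 9 10 11 by (simp add: exec_frame)
  then show ?thesis unfolding P_par_def using s11 by simp
qed

end

definition P_pw :: lp where
  "P_pw = FILL ''pw'' ''z'' ''one'' ''x'' ''N'' (
     ''t'' ::= N 1 ;;
     For ''i'' ''N'' (IFE ''c0'' (Less (V ''i'') (V ''x'')) (Plus (V ''k'') (N 1)) (V ''k'') ;;
        MUL ''t3'' ''h'' (V ''c0'') (V ''t'') ;; ''t'' ::= V ''t3'')) ''t''"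

lemma mods_pw [simp]: "mods P_pw = {''pw'', ''z'', ''x'', ''t'', ''i'', ''c0'', ''t3'', ''h'', ''_t''}"
  by (auto simp: P_pw_def)
lemma ok_pw [simp]: "ok P_pw" by (simp add: P_pw_def)
lemma bnds_pw [simp]: "bnds P_pw = {''one'', ''N''}" by (auto simp: P_pw_def)

context setting
begin

text \<open>One product of \<open>N\<close> factors per exponent: the first \<open>x\<close> of them
  are \<open>k + 1\<close>, the others \<open>k\<close>.\<close>

lemma exec_pw:
  assumes b: "base n D E s" and k: "s ''k'' 0 0 = k" and x: "x < 8 * n * n"
  shows "exec P_pw s ''pw'' 0 x = (k + 1) ^ x * k ^ (8 * n * n - x)"
proof -
  have n: "s ''N'' 0 0 = 8 * n * n" "s ''one'' 0 0 = 1" using b by (auto simp: base_def)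
  let ?b = "IFE ''c0'' (Less (V ''i'') (V ''x'')) (Plus (V ''k'') (N 1)) (V ''k'') ;;
        MUL ''t3'' ''h'' (V ''c0'') (V ''t'') ;; ''t'' ::= V ''t3''"
  let ?p = "''t'' ::= N 1 ;; For ''i'' ''N'' ?b"
  have "exec P_pw s ''pw'' 0 x = (if 0 < s ''one'' 0 0 \<and> x < s ''N'' 0 0 then
      (k + 1) ^ x * k ^ (8 * n * n - x) else s ''pw'' 0 x)"
    unfolding P_pw_def
  proof (rule exec_FILL)
    fix a c s' assume h: "a < s ''one'' 0 0" "c < s ''N'' 0 0" "s' ''z'' 0 0 = a" "s' ''x'' 0 0 = c"
      "\<And>x. x \<notin> mods ?p \<Longrightarrow> x \<noteq> ''pw'' \<Longrightarrow> x \<noteq> ''z'' \<Longrightarrow> x \<noteq> ''x'' \<Longrightarrow> s' x = s x"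
    let ?s = "setv s' ''t'' 1"
    let ?I = "\<lambda>m s2. s2 ''t'' 0 0 = (k + 1) ^ (min m c) * k ^ (m - min m c)"
    have "?I (?s ''N'' 0 0) (exec (For ''i'' ''N'' ?b) ?s)"
    proof (rule For_inv[where I = ?I])
      fix m s2 assume m: "m < ?s ''N'' 0 0" "?I m s2" "s2 ''i'' 0 0 = m"
        "\<And>x. x \<noteq> ''i'' \<Longrightarrow> x \<notin> mods ?b \<Longrightarrow> s2 x = ?s x"
      have s2: "s2 ''k'' 0 0 = k" "s2 ''x'' 0 0 = c" "s2 ''N'' 0 0 = 8 * n * n"
        using m(4) h k n by simp_all
      let ?f = "if m < c then k + 1 else k"
      let ?s3 = "setv s2 ''c0'' ?f"
      have "exec (MUL ''t3'' ''h'' (V ''c0'') (V ''t'')) ?s3 ''t3'' 0 0 = ?f * s2 ''t'' 0 0"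
      proof (subst exec_MUL)
        have "?f \<le> 8 * n * n" using kl(4) N_ge(2) by auto
        then show "aval (V ''c0'') ?s3 \<le> ?s3 ''N'' 0 0" using s2 by simp
      qed auto
      then have e: "exec (MUL ''t3'' ''h'' (V ''c0'') (V ''t'')) ?s3 ''t3'' 0 0 = ?f * s2 ''t'' 0 0" .
      have r: "?f * s2 ''t'' 0 0 = (k + 1) ^ (min (Suc m) c) * k ^ (Suc m - min (Suc m) c)"
        using m(2) by (auto simp: min_def Suc_diff_le)
      show "?I (Suc m) (setv (exec ?b s2) ''i'' (Suc m))"
      proof -
        have "exec (IFE ''c0'' (Less (V ''i'') (V ''x'')) (Plus (V ''k'') (N 1)) (V ''k'')) s2 = ?s3"
          using s2 m(3) by simp
        then show ?thesis using r e by (simp del: exec_IFE)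
      qed
    qed simp_all
    moreover have "min (8 * n * n) c = c" using h n by simp
    ultimately show "exec ?p s' ''t'' 0 0 = (k + 1) ^ c * k ^ (8 * n * n - c)"
      using h n by simp
  qed simp_all
  then show ?thesis using n x by simp
qed

end

definition onP :: "aexp \<Rightarrow> aexp \<Rightarrow> aexp \<Rightarrow> bexp" where
  "onP u x w = eqb (Plus (Get ''r'' u x) (Get ''r'' x w)) (Get ''r'' u w)"

definition P_hv :: lp where
  "P_hv = FILL ''hv'' ''u'' ''n'' ''y'' ''n'' (
     SUMIF ''t'' ''w'' ''n'' (onP (V ''u'') (V ''y'') (V ''w'')) (V ''l'') ;;
     IFE ''t2'' (leb (V ''n'') (V ''t'')) (N 1) (N 0)) ''t2''"

lemma mods_hv [simp]: "mods P_hv = {''hv'', ''u'', ''y'', ''t'', ''w'', ''_t'', ''t2''}"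
  by (auto simp: P_hv_def)
lemma ok_hv [simp]: "ok P_hv" by (simp add: P_hv_def)
lemma bnds_hv [simp]: "bnds P_hv = {''n''}" by (auto simp: P_hv_def)

context setting
begin

definition rok :: "mem \<Rightarrow> bool" where
  "rok s \<longleftrightarrow> (\<forall>u<n. \<forall>v<n. s ''r'' u v = wdist n E u v)"

lemma bval_onP:
  "rok s \<Longrightarrow> aval u s < n \<Longrightarrow> aval x s < n \<Longrightarrow> aval w s < n \<Longrightarrow>
    bval (onP u x w) s \<longleftrightarrow> aval x s \<in> PP (aval u s) (aval w s)"
  by (simp add: onP_def rok_def geo_def)

lemma rok_cong: "rok s \<Longrightarrow> s' ''r'' = s ''r'' \<Longrightarrow> rok s'" by (simp add: rok_def)

lemma exec_hv:
  assumes b: "base n D E s" and r: "rok s" and ls: "s ''l'' 0 0 = l" and uy: "u < n" "y < n"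
  shows "exec P_hv s ''hv'' u y = of_bool (n \<le> p.mass u y * l)"
proof -
  have n: "s ''n'' 0 0 = n" using b by (auto simp: base_def)
  have "exec P_hv s ''hv'' u y = (if u < s ''n'' 0 0 \<and> y < s ''n'' 0 0 then
      of_bool (n \<le> p.mass u y * l) else s ''hv'' u y)"
    unfolding P_hv_def
  proof (rule exec_FILL)
    let ?S = "SUMIF ''t'' ''w'' ''n'' (onP (V ''u'') (V ''y'') (V ''w'')) (V ''l'')"
    fix a c s' assume h: "a < s ''n'' 0 0" "c < s ''n'' 0 0" "s' ''u'' 0 0 = a" "s' ''y'' 0 0 = c"
      "\<And>x. x \<notin> mods (?S ;; IFE ''t2'' (leb (V ''n'') (V ''t'')) (N 1) (N 0)) \<Longrightarrow>
          x \<noteq> ''hv'' \<Longrightarrow> x \<noteq> ''u'' \<Longrightarrow> x \<noteq> ''y'' \<Longrightarrow> s' x = s x"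
    have s': "s' ''n'' 0 0 = n" "s' ''l'' 0 0 = l" using h(5) n ls by auto
    have r': "rok s'" by (rule rok_cong[OF r]) (simp add: h(5))
    have "exec ?S s' ''t'' 0 0 = (\<Sum>w<s' ''n'' 0 0. if c \<in> PP a w then l else 0)"
    proof (rule exec_SUMIF)
      fix w s2 assume w: "w < s' ''n'' 0 0" "s2 ''w'' 0 0 = w"
        "\<And>x. x \<noteq> ''_t'' \<Longrightarrow> x \<noteq> ''t'' \<Longrightarrow> x \<noteq> ''w'' \<Longrightarrow> s2 x = s' x"
      have "rok s2" by (rule rok_cong[OF r']) (simp add: w(3))
      then show "(if bval (onP (V ''u'') (V ''y'') (V ''w'')) s2 then aval (V ''l'') s2 else 0) = (if c \<in> PP a w then l else 0)"
        using bval_onP[of s2 "V ''u''" "V ''y''" "V ''w''"] w h s' n by simp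
    qed simp_all
    also have "\<dots> = (\<Sum>w\<in>{..<n} \<inter> {w. c \<in> PP a w}. l)" using s' by (simp add: sum.If_cases)
    also have "{..<n} \<inter> {w. c \<in> PP a w} = {w. w < n \<and> c \<in> PP a w}" by auto
    finally have "exec ?S s' ''t'' 0 0 = p.mass a c * l" by (simp add: p.mass_def)
    then show "exec (?S ;; IFE ''t2'' (leb (V ''n'') (V ''t'')) (N 1) (N 0)) s' ''t2'' 0 0 =
        of_bool (n \<le> p.mass a c * l)"
      using s' by (simp add: exec_frame)
  qed simp_all
  then show ?thesis using n uy by simp
qed

end

section \<open>Counting pairs, and the greedy hitting set\<close>

definition CNT2 :: "vname \<Rightarrow> vname \<Rightarrow> vname \<Rightarrow> bexp \<Rightarrow> lp" where
  "CNT2 acc u v c = SUMP acc u ''n'' (SUMIF ''t1'' v ''n'' c (N 1)) ''t1''"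

lemma CNT2_simps [simp]:
  "mods (CNT2 acc u v c) = {acc, u, v, ''t1'', ''_t''}"
  "bnds (CNT2 acc u v c) = {''n''}"
  "distinct [acc, u, v, ''t1'', ''_t'', ''n''] \<Longrightarrow> ok (CNT2 acc u v c)"
  by (auto simp: CNT2_def)

lemma exec_CNT2:
  assumes d: "distinct [acc, u, v, ''t1'', ''_t'', ''n'']" and n: "s ''n'' 0 0 = n"
    and A: "A \<subseteq> {..<n} \<times> {..<n}"
    and c: "\<And>a b s'. a < n \<Longrightarrow> b < n \<Longrightarrow> s' u 0 0 = a \<Longrightarrow> s' v 0 0 = b \<Longrightarrow>
      (\<And>x. x \<notin> {acc, u, v, ''t1'', ''_t''} \<Longrightarrow> s' x = s x) \<Longrightarrow> bval c s' \<longleftrightarrow> (a, b) \<in> A"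
  shows "exec (CNT2 acc u v c) s acc 0 0 = card A"
proof -
  have "exec (CNT2 acc u v c) s acc 0 0 = (\<Sum>a<s ''n'' 0 0. \<Sum>b<n. if (a, b) \<in> A then 1 else 0)"
    unfolding CNT2_def
  proof (rule exec_SUMP)
    show "ok (SUMP acc u ''n'' (SUMIF ''t1'' v ''n'' c (N 1)) ''t1'')" using d by auto
    show "acc \<notin> mods (SUMIF ''t1'' v ''n'' c (N 1))" using d by auto
    fix a s1 assume 1: "a < s ''n'' 0 0" "s1 u 0 0 = a"
      "\<And>x. x \<notin> mods (SUMIF ''t1'' v ''n'' c (N 1)) \<Longrightarrow> x \<noteq> acc \<Longrightarrow> x \<noteq> u \<Longrightarrow> s1 x = s x"
    have n1: "s1 ''n'' 0 0 = n" using 1(3)[of "''n''"] d n by auto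
    have "exec (SUMIF ''t1'' v ''n'' c (N 1)) s1 ''t1'' 0 0 = (\<Sum>b<s1 ''n'' 0 0. if (a, b) \<in> A then 1 else 0)"
    proof (rule exec_SUMIF)
      show "ok (SUMIF ''t1'' v ''n'' c (N 1))" using d by auto
      fix b s2 assume 2: "b < s1 ''n'' 0 0" "s2 v 0 0 = b"
        "\<And>x. x \<noteq> ''_t'' \<Longrightarrow> x \<noteq> ''t1'' \<Longrightarrow> x \<noteq> v \<Longrightarrow> s2 x = s1 x"
      have u2: "s2 u 0 0 = a" using 2(3)[of u] 1(2) d by auto
      have "bval c s2 \<longleftrightarrow> (a, b) \<in> A"
        by (rule c) (use 1 2 u2 n n1 in auto)
      then show "(if bval c s2 then aval (N 1) s2 else 0) = (if (a, b) \<in> A then 1 else 0)" by simp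
    qed simp
    then show "exec (SUMIF ''t1'' v ''n'' c (N 1)) s1 ''t1'' 0 0 = (\<Sum>b<n. if (a, b) \<in> A then 1 else 0)"
      using n1 by simp
  qed
  also have "\<dots> = (\<Sum>(a, b)\<in>{..<n} \<times> {..<n}. if (a, b) \<in> A then 1 else 0)"
    using n by (simp add: sum.cartesian_product)
  also have "\<dots> = (\<Sum>z\<in>({..<n} \<times> {..<n}) \<inter> {z. z \<in> A}. 1)"
    by (subst sum.inter_restrict) (auto simp: case_prod_beta)
  also have "({..<n} \<times> {..<n}) \<inter> {z. z \<in> A} = A" using A by auto
  finally show ?thesis by simp
qed

definition P_X1 :: lp where
  "P_X1 = (FILL ''act'' ''u'' ''n'' ''v'' ''n''
       (IFE ''t'' (Less (Get ''d'' (V ''u'') (V ''v'')) (V ''lam'')) (N 0) (N 1)) ''t'' ;;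
     FILL ''X'' ''x'' ''n'' ''z'' ''one'' (''t'' ::= N 0) ''t'')"

definition P_X2 :: lp where
  "P_X2 = (CNT2 ''tot'' ''u'' ''v'' (posb (Get ''act'' (V ''u'') (V ''v''))) ;;
     Cnd (posb (V ''tot''))
       (AMIN ''bw'' ''best'' ''fnd'' ''w'' ''n'' tru
          (CNT2 ''cn'' ''u'' ''v'' (And (Not (onP (V ''u'') (V ''w'') (V ''v''))) (posb (Get ''act'' (V ''u'') (V ''v''))))) ''cn'' ;;
        Asg ''X'' (V ''bw'') (N 0) (N 1) ;;
        FILL ''act'' ''u'' ''n'' ''v'' ''n''
          (IFE ''t'' (onP (V ''u'') (V ''bw'') (V ''v'')) (N 0) (Get ''act'' (V ''u'') (V ''v''))) ''t'') Skp)"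

definition "P_X = (P_X1 ;; For ''t_'' ''n'' P_X2)"

lemma X2_simps [simp]:
  "mods P_X2 = {''tot'', ''u'', ''v'', ''t1'', ''_t'', ''bw'', ''best'', ''fnd'', ''w'', ''cn'', ''X'', ''act'', ''t''}"
  "bnds P_X2 = {''n''}" "ok P_X2"
  by (auto simp: P_X2_def)

lemma X_simps [simp]:
  "mods P_X = {''z'', ''x'', ''t_'', ''tot'', ''u'', ''v'', ''t1'', ''_t'', ''bw'', ''best'', ''fnd'', ''w'', ''cn'', ''X'', ''act'', ''t''}"
  "bnds P_X = {''n'', ''one''}" "ok P_X"
  by (auto simp: P_X_def P_X1_def)

context setting
begin

definition dok :: "mem \<Rightarrow> bool" where "dok s \<longleftrightarrow> (\<forall>u<n. \<forall>v<n. s ''d'' u v = dd u v)"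
definition xinv :: "nat \<Rightarrow> nat set \<Rightarrow> mem \<Rightarrow> bool" where
  "xinv m Xs s \<longleftrightarrow> (\<forall>x<n. s ''X'' x 0 = of_bool (x \<in> Xs)) \<and>
     (\<forall>u<n. \<forall>v<n. s ''act'' u v = of_bool ((u, v) \<in> p.far m Xs))"

lemma exec_X2:
  assumes n: "s ''n'' 0 0 = n" and r: "rok s" and inv: "xinv m Xs s"
  shows "\<exists>Xs'. xinv m Xs' (exec P_X2 s) \<and>
     (if p.far m Xs = {} then Xs' = Xs else \<exists>w<n. Xs' = insert w Xs \<and>
        (\<forall>x<n. card (p.far m (insert w Xs)) \<le> card (p.far m (insert x Xs))))"
proof -
  have fs: "p.far m Y \<subseteq> {..<n} \<times> {..<n}" for Y by (auto simp: p.far_def)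
  let ?C = "CNT2 ''tot'' ''u'' ''v'' (posb (Get ''act'' (V ''u'') (V ''v'')))"
  let ?s = "exec ?C s"
  have tot: "?s ''tot'' 0 0 = card (p.far m Xs)"
    by (rule exec_CNT2[where n = n]) (use n inv fs in \<open>auto simp: xinv_def\<close>)
  show ?thesis
  proof (cases "p.far m Xs = {}")
    case True
    then have "exec P_X2 s = ?s" using tot by (simp add: P_X2_def)
    moreover have "xinv m Xs ?s" using inv by (simp add: xinv_def exec_frame)
    ultimately show ?thesis using True by auto
  next
    case False
    let ?A = "AMIN ''bw'' ''best'' ''fnd'' ''w'' ''n'' tru
          (CNT2 ''cn'' ''u'' ''v'' (And (Not (onP (V ''u'') (V ''w'') (V ''v''))) (posb (Get ''act'' (V ''u'') (V ''v''))))) ''cn''"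
    let ?s2 = "exec ?A ?s"
    define w where "w = ?s2 ''bw'' 0 0"
    have "w = amin0 (\<lambda>_. True) (\<lambda>w. card (p.far m (insert w Xs))) (?s ''n'' 0 0)"
      unfolding w_def
    proof (rule exec_AMIN(1))
      fix k s' assume k: "k < ?s ''n'' 0 0" "s' ''w'' 0 0 = k"
        "\<And>x. x \<notin> mods (CNT2 ''cn'' ''u'' ''v'' (And (Not (onP (V ''u'') (V ''w'') (V ''v''))) (posb (Get ''act'' (V ''u'') (V ''v''))))) \<Longrightarrow>
          x \<notin> {''bw'', ''best'', ''fnd'', ''w''} \<Longrightarrow> s' x = ?s x"
      have s': "s' ''n'' 0 0 = n" "s' ''act'' = s ''act''" "s' ''r'' = s ''r''" using k(3) n by (simp_all add: exec_frame)
      have kn: "k < n" using k(1) n by (simp add: exec_frame)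
      have "exec (CNT2 ''cn'' ''u'' ''v'' (And (Not (onP (V ''u'') (V ''w'') (V ''v''))) (posb (Get ''act'' (V ''u'') (V ''v''))))) s' ''cn'' 0 0
          = card (p.far m (insert k Xs))"
      proof (rule exec_CNT2[where n = n])
        fix a b s3 assume h: "a < n" "b < n" "s3 ''u'' 0 0 = a" "s3 ''v'' 0 0 = b"
          "\<And>x. x \<notin> {''cn'', ''u'', ''v'', ''t1'', ''_t''} \<Longrightarrow> s3 x = s' x"
        have s3: "s3 ''w'' 0 0 = k" "s3 ''act'' = s ''act''" "s3 ''r'' = s ''r''" using h(5) s' k by simp_all
        have "rok s3" by (rule rok_cong[OF r]) (rule s3(3))
        then show "bval (And (Not (onP (V ''u'') (V ''w'') (V ''v''))) (posb (Get ''act'' (V ''u'') (V ''v'')))) s3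
            \<longleftrightarrow> (a, b) \<in> p.far m (insert k Xs)"
          using bval_onP[of s3 "V ''u''" "V ''w''" "V ''v''"] h s3 kn inv
          by (auto simp: xinv_def p.far_insert)
      qed (use s' fs in auto)
      then show "exec (CNT2 ''cn'' ''u'' ''v'' (And (Not (onP (V ''u'') (V ''w'') (V ''v''))) (posb (Get ''act'' (V ''u'') (V ''v''))))) s' ''cn'' 0 0
          = card (p.far m (insert k Xs)) \<and>
        bval tru (exec (CNT2 ''cn'' ''u'' ''v'' (And (Not (onP (V ''u'') (V ''w'') (V ''v''))) (posb (Get ''act'' (V ''u'') (V ''v''))))) s') = True"
        by simp
    qed simp_all
    then have w: "w < n \<and> (\<forall>x<n. card (p.far m (insert w Xs)) \<le> card (p.far m (insert x Xs)))"
      using amin0[of n "\<lambda>_. True" "\<lambda>w. card (p.far m (insert w Xs))"] n p.n_pos by (auto simp: exec_frame)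
    let ?s3 = "upd ?s2 ''X'' w 0 1"
    let ?F = "FILL ''act'' ''u'' ''n'' ''v'' ''n''
          (IFE ''t'' (onP (V ''u'') (V ''bw'') (V ''v'')) (N 0) (Get ''act'' (V ''u'') (V ''v''))) ''t''"
    have pos: "card (p.far m Xs) > 0" using False by (simp add: card_gt_0_iff)
    have ex: "exec P_X2 s = exec ?F ?s3" using tot pos by (simp add: P_X2_def w_def)
    have act: "exec ?F ?s3 ''act'' a b = of_bool ((a, b) \<in> p.far m (insert w Xs))" if ab: "a < n" "b < n" for a b
    proof -
      have n3: "?s3 ''n'' 0 0 = n" using n by (simp add: exec_frame)
      have "exec ?F ?s3 ''act'' a b = (if a < ?s3 ''n'' 0 0 \<and> b < ?s3 ''n'' 0 0
          then of_bool ((a, b) \<in> p.far m (insert w Xs)) else ?s3 ''act'' a b)"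
      proof (rule exec_FILL)
        fix a c s' assume h: "a < ?s3 ''n'' 0 0" "c < ?s3 ''n'' 0 0" "s' ''u'' 0 0 = a" "s' ''v'' 0 0 = c"
          "\<And>x. x \<notin> mods (IFE ''t'' (onP (V ''u'') (V ''bw'') (V ''v'')) (N 0) (Get ''act'' (V ''u'') (V ''v''))) \<Longrightarrow>
             x \<noteq> ''act'' \<Longrightarrow> x \<noteq> ''u'' \<Longrightarrow> x \<noteq> ''v'' \<Longrightarrow> s' x = ?s3 x" "s' ''act'' a c = ?s3 ''act'' a c"
        have s': "s' ''bw'' 0 0 = w" "s' ''r'' = s ''r''" "s' ''act'' a c = s ''act'' a c"
          using h(5,6) by (simp_all add: w_def exec_frame)
        have "rok s'" by (rule rok_cong[OF r]) (rule s'(2))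
        then show "exec (IFE ''t'' (onP (V ''u'') (V ''bw'') (V ''v'')) (N 0) (Get ''act'' (V ''u'') (V ''v''))) s' ''t'' 0 0
            = of_bool ((a, c) \<in> p.far m (insert w Xs))"
          using bval_onP[of s' "V ''u''" "V ''bw''" "V ''v''"] h(1-4) n3 s' inv w
          by (auto simp: xinv_def p.far_insert)
      qed simp_all
      then show ?thesis using ab n3 by simp
    qed
    have "exec ?F ?s3 ''X'' x 0 = of_bool (x \<in> insert w Xs)" if "x < n" for x
      using inv that by (simp add: xinv_def exec_frame upd_apply)
    then have "xinv m (insert w Xs) (exec P_X2 s)" unfolding ex using act by (auto simp: xinv_def)
    then show ?thesis using False w by auto
  qed
qed

lemma exec_X:
  assumes b: "base n D E s" and r: "rok s" and d: "dok s" and lam: "s ''lam'' 0 0 = m"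
  shows "\<exists>Xs. (\<forall>x<n. exec P_X s ''X'' x 0 = of_bool (x \<in> Xs)) \<and> p.hitr m Xs \<and> p.far m Xs = {}"
proof -
  have n: "s ''n'' 0 0 = n" "s ''one'' 0 0 = 1" using b by (auto simp: base_def)
  let ?s = "exec P_X1 s"
  let ?F = "FILL ''act'' ''u'' ''n'' ''v'' ''n''
       (IFE ''t'' (Less (Get ''d'' (V ''u'') (V ''v'')) (V ''lam'')) (N 0) (N 1)) ''t''"
  have 1: "exec ?F s ''act'' a c = of_bool ((a, c) \<in> p.far m {})" if "a < n" "c < n" for a c
    by (subst exec_FILL[where g = "\<lambda>a c. of_bool ((a, c) \<in> p.far m {})"])
      (use that n d lam in \<open>auto simp: p.far_def dok_def\<close>)
  have 2: "exec (FILL ''X'' ''x'' ''n'' ''z'' ''one'' (''t'' ::= N 0) ''t'') (exec ?F s) ''X'' x 0 = 0" if "x < n" for x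
    by (subst exec_FILL[where g = "\<lambda>_ _. 0"]) (use that n in \<open>auto simp: exec_frame\<close>)
  have x0: "xinv m {} ?s" using 1 2 by (simp add: xinv_def P_X1_def exec_frame)
  \<comment> \<open>As long as a pair is unhit, each round adds a new node. So after
    \<open>n\<close> rounds either nothing is left to hit or all nodes have been taken, which hits
    everything.\<close>
  let ?I = "\<lambda>t s'. \<exists>Xs. xinv m Xs s' \<and> p.hitr m Xs \<and> (p.far m Xs = {} \<or> card Xs = t)"
  have "?I (?s ''n'' 0 0) (exec (For ''t_'' ''n'' P_X2) ?s)"
  proof (rule For_inv[where I = ?I])
    have "xinv m {} (setv ?s ''t_'' 0)" using x0 by (simp add: xinv_def)
    then show "?I 0 (setv ?s ''t_'' 0)" using p.hitr_empty by (intro exI[of _ "{}"]) auto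
    fix t s' assume t: "t < ?s ''n'' 0 0" "?I t s'" "s' ''t_'' 0 0 = t"
      "\<And>x. x \<noteq> ''t_'' \<Longrightarrow> x \<notin> mods P_X2 \<Longrightarrow> s' x = ?s x"
    have s': "s' ''n'' 0 0 = n" "rok s'"
      using t(4)[of "''n''"] n apply (simp add: P_X1_def exec_frame)
      by (rule rok_cong[OF r]) (simp add: t(4) P_X1_def exec_frame)
    obtain Xs where Xs: "xinv m Xs s'" "p.hitr m Xs" "p.far m Xs = {} \<or> card Xs = t" using t(2) by blast
    obtain Ys where Ys: "xinv m Ys (exec P_X2 s')"
     "if p.far m Xs = {} then Ys = Xs else \<exists>w<n. Ys = insert w Xs \<and>
        (\<forall>x<n. card (p.far m (insert w Xs)) \<le> card (p.far m (insert x Xs)))"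
      using exec_X2[OF s' Xs(1)] by blast
    have Y: "xinv m Ys (setv (exec P_X2 s') ''t_'' (Suc t))" using Ys(1) by (simp add: xinv_def)
    show "?I (Suc t) (setv (exec P_X2 s') ''t_'' (Suc t))"
    proof (cases "p.far m Xs = {}")
      case True
      then show ?thesis using Xs Ys(2) Y by auto
    next
      case False
      then obtain w where w: "w < n" "Ys = insert w Xs"
        "\<And>x. x < n \<Longrightarrow> card (p.far m (insert w Xs)) \<le> card (p.far m (insert x Xs))" using Ys(2) by auto
      have h: "p.hitr m Ys" unfolding w(2) by (rule p.hitr_insert[OF Xs(2) False w(1,3)])
      have "card (p.far m (insert w Xs)) < card (p.far m Xs)" by (rule p.far_greedy(2)[OF False w(1,3)])
      then have "w \<notin> Xs" by (auto simp: insert_absorb)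
      moreover have "finite Xs" using p.hitr_inv[OF Xs(2)] finite_subset by blast
      ultimately have "card Ys = Suc t" using Xs(3) False w(2) by simp
      then show ?thesis using h Y by blast
    qed
  qed simp_all
  then obtain Xs where Xs: "xinv m Xs (exec P_X s)" "p.hitr m Xs" "p.far m Xs = {} \<or> card Xs = ?s ''n'' 0 0"
    by (auto simp: P_X_def)
  have "p.far m Xs = {}"
  proof (rule ccontr)
    assume ne: "p.far m Xs \<noteq> {}"
    have "?s ''n'' 0 0 = n" using n by (simp add: P_X1_def exec_frame)
    then have "card Xs = n" using Xs(3) ne by simp
    then have "Xs = {..<n}" using p.hitr_inv[OF Xs(2)] by (intro card_subset_eq) auto
    then have "p.far m Xs = {}" using p.P_end by (auto simp: p.far_def)
    then show False using ne by simp
  qed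
  then show ?thesis using Xs by (auto simp: xinv_def)
qed

end

section \<open>Tables of the observers\<close>

definition "vo \<equiv> G1 ''own'' (V ''o'')"
definition onS :: "aexp \<Rightarrow> aexp \<Rightarrow> bexp" where
  "onS w x = And (onP vo w x) (posb (Get ''zz'' (V ''o'') w))"

definition P_own :: lp where
  "P_own = FILL ''own'' ''o'' ''n2'' ''z'' ''one''
     (IFE ''t'' (Less (V ''o'') (V ''n'')) (V ''o'') (Minus (V ''o'') (V ''n''))) ''t''"
definition P_hh :: lp where
  "P_hh = FILL ''hh'' ''u'' ''n'' ''y'' ''n'' (IFE ''t'' (And (posb (V ''md''))
     (And (posb (Get ''hv'' (V ''u'') (V ''y''))) (Less (Get ''d'' (V ''u'') (V ''y'')) (V ''lam'')))) (N 1) (N 0)) ''t''"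
definition P_zz :: lp where
  "P_zz = FILL ''zz'' ''o'' ''n2'' ''x'' ''n'' (IFE ''t'' (And (Not (posb (Get ''hh'' vo (V ''x''))))
     (orb (Less (V ''o'') (V ''n'')) (leb (mulc 2 (V ''dl'')) (Get ''d'' vo (V ''x''))))) (N 1) (N 0)) ''t''"
definition P_zd :: lp where
  "P_zd = FILL ''zd'' ''o'' ''n2'' ''x'' ''n'' (SUMIF ''t'' ''y'' ''n'' (onS (V ''y'') (V ''x'')) (N 1)) ''t''"
definition P_al0 :: lp where
  "P_al0 = FILL ''al'' ''o'' ''n2'' ''x'' ''n''
     (SUMIF ''t'' ''y'' ''n'' (And (onP vo (V ''y'') (V ''x'')) (And (posb (G1 ''X'' (V ''y''))) (posb (V ''md'')))) (N 1) ;;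
      IFE ''t2'' (And (posb (Get ''zz'' (V ''o'') (V ''x''))) (And (leb (V ''dl'') (Get ''zd'' (V ''o'') (V ''x'')))
        (And (orb (Less (V ''o'') (V ''n'')) (posb (V ''md''))) (eqb (V ''t'') (N 0))))) (N 1) (N 0)) ''t2''"
definition P_lev :: lp where
  "P_lev = FILL ''lev'' ''o'' ''n2'' ''z'' ''one''
     (AMIN ''bw'' ''best'' ''fnd'' ''i'' ''n'' (Less (V ''i'') (V ''dl''))
        (SUMIF ''cn'' ''x'' ''n'' (And (posb (Get ''al'' (V ''o'') (V ''x'')))
           (eqb (Get ''zd'' (V ''o'') (V ''x'')) (Plus (V ''dl'') (V ''i'')))) (N 1)) ''cn'' ;;
      ''t'' ::= Plus (V ''dl'') (V ''bw'')) ''t''"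
definition P_mm0 :: lp where
  "P_mm0 = FILL ''mm'' ''q'' ''n'' ''y'' ''n'' (IFE ''t'' (And (Not (posb (V ''md''))) (And (posb (G1 ''X'' (V ''q'')))
     (And (eqb (Get ''d'' (V ''q'') (V ''y'')) (V ''e'')) (posb (Get ''hv'' (V ''q'') (V ''y'')))))) (N 1) (N 0)) ''t''"

lemma seg_progs [simp]:
  "mods P_own = {''own'', ''o'', ''z'', ''t''}" "ok P_own" "bnds P_own = {''n2'', ''one''}"
  "mods P_hh = {''hh'', ''u'', ''y'', ''t''}" "ok P_hh" "bnds P_hh = {''n''}"
  "mods P_zz = {''zz'', ''o'', ''x'', ''t''}" "ok P_zz" "bnds P_zz = {''n2'', ''n''}"
  "mods P_zd = {''zd'', ''o'', ''x'', ''t'', ''y'', ''_t''}" "ok P_zd" "bnds P_zd = {''n2'', ''n''}"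
  "mods P_al0 = {''al'', ''o'', ''x'', ''t'', ''y'', ''_t'', ''t2''}" "ok P_al0" "bnds P_al0 = {''n2'', ''n''}"
  "mods P_lev = {''lev'', ''o'', ''z'', ''bw'', ''best'', ''fnd'', ''i'', ''cn'', ''x'', ''_t'', ''t''}" "ok P_lev"
  "bnds P_lev = {''n2'', ''one'', ''n''}"
  "mods P_mm0 = {''mm'', ''q'', ''y'', ''t''}" "ok P_mm0" "bnds P_mm0 = {''n''}"
  by (auto simp: P_own_def P_hh_def P_zz_def P_zd_def P_al0_def P_lev_def P_mm0_def)

definition "P_seg = (P_own ;; P_hh ;; P_zz ;; P_zd ;; P_al0 ;; P_lev ;; P_mm0)"

text \<open>\<open>X\<close> is fixed abstractly, since the set computed by the program is known
  only through its properties.\<close>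

locale setting2 = setting +
  fixes X :: "nat set"
  assumes jp: "j \<ge> 1" and Xh: "p.hitr Lm X" and Xf: "p.far Lm X = {}"
begin

sublocale h: hub_alg_ok n dd PP j l md X k "8 * n * n"
proof
  show "1 \<le> j" by (rule jp)
  show "1 \<le> l" by (rule l_pos)
  show "8 * j \<le> k" "2 * n \<le> k * l" using kl by auto
  show "n + j * (n + 1) \<le> 8 * n * n" using N_ge by simp
  show "X \<subseteq> {..<n}" using p.hitr_inv[OF Xh] by blast
  show "p.far (hub_alg.Lam j l md) X = {}"
    using Xf by (simp add: hub_alg.Lam_def[OF hub_alg.intro[OF p.paths_axioms]] Lm_def)
qed

definition lev :: "nat \<Rightarrow> nat" where
  "lev r = 8 * j + amin0 (\<lambda>i. i < 8 * j) (\<lambda>i. card {x. h.W r x \<and> h.zd r x = 8 * j + i}) n"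

lemma j8: "8 * j \<le> n" using j_le by simp

lemma lev_range: "8 * j \<le> lev r \<and> lev r < 16 * j"
proof -
  have "\<exists>i<n. i < 8 * j" using jp p.n_pos by (intro exI[of _ 0]) auto
  from amin0[OF this, of "\<lambda>i. card {x. h.W r x \<and> h.zd r x = 8 * j + i}"]
  have "amin0 (\<lambda>i. i < 8 * j) (\<lambda>i. card {x. h.W r x \<and> h.zd r x = 8 * j + i}) n < 8 * j" by blast
  then show ?thesis by (simp add: lev_def)
qed

text \<open>The \<open>8 * j\<close> levels to choose from are disjoint, so the least populated one
  has at most \<open>n / (8 * j)\<close> targets.\<close>

lemma lev_card: "8 * j * card {x. h.W r x \<and> h.zd r x = lev r} \<le> n"
proof -
  let ?c = "\<lambda>i. card {x. h.W r x \<and> h.zd r x = 8 * j + i}"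
  let ?m = "amin0 (\<lambda>i. i < 8 * j) ?c n"
  have "\<exists>i<n. i < 8 * j" using jp p.n_pos by (intro exI[of _ 0]) auto
  then have m: "\<And>i. i < 8 * j \<Longrightarrow> ?c ?m \<le> ?c i"
    using amin0[of n "\<lambda>i. i < 8 * j" ?c] j8 by auto
  have "8 * j * ?c ?m = (\<Sum>i<8*j. ?c ?m)" by simp
  also have "\<dots> \<le> (\<Sum>i<8*j. ?c i)" by (intro sum_mono m) simp
  also have "\<dots> = card (\<Union>i<8*j. {x. h.W r x \<and> h.zd r x = 8 * j + i})"
  proof (rule card_UN_disjoint[symmetric])
    show "\<forall>i\<in>{..<8 * j}. finite {x. h.W r x \<and> h.zd r x = 8 * j + i}"
      by (auto intro: finite_subset[of _ "{..<n}"] simp: h.W_def)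
  qed auto
  also have "\<dots> \<le> card {..<n}" by (rule card_mono) (auto simp: h.W_def)
  finally show ?thesis by (simp add: lev_def)
qed

definition xok :: "mem \<Rightarrow> bool" where "xok s \<longleftrightarrow> (\<forall>x<n. s ''X'' x 0 = of_bool (x \<in> X))"
definition hvok :: "mem \<Rightarrow> bool" where "hvok s \<longleftrightarrow> (\<forall>u<n. \<forall>y<n. s ''hv'' u y = of_bool (n \<le> p.mass u y * l))"
definition ownok :: "mem \<Rightarrow> bool" where "ownok s \<longleftrightarrow> (\<forall>r<2*n. s ''own'' r 0 = h.own r)"
definition zzok :: "mem \<Rightarrow> bool" where "zzok s \<longleftrightarrow> (\<forall>r<2*n. \<forall>x<n. s ''zz'' r x = of_bool (h.zz r x))"
definition zdok :: "mem \<Rightarrow> bool" where "zdok s \<longleftrightarrow> (\<forall>r<2*n. \<forall>x<n. s ''zd'' r x = h.zd r x)"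
definition levok :: "mem \<Rightarrow> bool" where "levok s \<longleftrightarrow> (\<forall>r<2*n. s ''lev'' r 0 = lev r)"
definition alok :: "nat set \<Rightarrow> mem \<Rightarrow> bool" where
  "alok H s \<longleftrightarrow> (\<forall>r<2*n. \<forall>x<n. s ''al'' r x = of_bool (h.g.alive H r x))"
definition mmok :: "nat set \<Rightarrow> mem \<Rightarrow> bool" where
  "mmok H s \<longleftrightarrow> (\<forall>q<n. \<forall>y<n. s ''mm'' q y = of_bool ((q, y) \<in> h.Ms \<and> PP q y \<inter> H = {}))"
definition hhok :: "mem \<Rightarrow> bool" where "hhok s \<longleftrightarrow> (\<forall>u<n. \<forall>y<n. s ''hh'' u y = of_bool (h.Hv u y))"

lemmas oks = xok_def hvok_def ownok_def zzok_def zdok_def levok_def alok_def mmok_def hhok_def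

lemma Lam_Lm: "h.Lam = Lm" by (simp add: h.Lam_def Lm_def)

lemma bval_onS:
  assumes "rok s" "ownok s" "zzok s" "s ''o'' 0 0 = r" "r < 2 * n" "aval w s < n" "aval x s < n"
  shows "bval (onS w x) s \<longleftrightarrow> aval w s \<in> h.seg r (aval x s)"
  using bval_onP[OF assms(1), of vo w x] assms h.own_less[OF assms(5)]
  by (auto simp: onS_def vo_def oks h.seg_def)

lemma exec_own: "base n D E s \<Longrightarrow> ownok (exec P_own s)"
  unfolding ownok_def
proof (intro allI impI)
  fix r assume b: "base n D E s" and r: "r < 2 * n"
  have n: "s ''n'' 0 0 = n" "s ''n2'' 0 0 = 2 * n" "s ''one'' 0 0 = 1" using b by (auto simp: base_def)
  show "exec P_own s ''own'' r 0 = h.own r"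
    unfolding P_own_def by (subst exec_FILL[where g = "\<lambda>r _. h.own r"]) (use n r in \<open>auto simp: h.own_def\<close>)
qed

lemma exec_hh:
  assumes b: "base n D E s" and "pars s" "hvok s" "dok s" shows "hhok (exec P_hh s)"
  unfolding hhok_def
proof (intro allI impI)
  fix u y assume uy: "u < n" "y < n"
  have n: "s ''n'' 0 0 = n" using b by (auto simp: base_def)
  have "exec P_hh s ''hh'' u y = (if u < s ''n'' 0 0 \<and> y < s ''n'' 0 0 then of_bool (h.Hv u y) else s ''hh'' u y)"
    unfolding P_hh_def
    by (rule exec_FILL) (use assms n in \<open>auto simp: oks pars_def h.Hv_def Lam_Lm dok_def\<close>)
  then show "exec P_hh s ''hh'' u y = of_bool (h.Hv u y)" using n uy by simp
qed

lemma exec_zz: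
  assumes b: "base n D E s" and "pars s" "hhok s" "dok s" "ownok s" shows "zzok (exec P_zz s)"
  unfolding zzok_def
proof (intro allI impI)
  fix r x assume rx: "r < 2 * n" "x < n"
  have n: "s ''n'' 0 0 = n" "s ''n2'' 0 0 = 2 * n" using b by (auto simp: base_def)
  have "exec P_zz s ''zz'' r x = (if r < s ''n2'' 0 0 \<and> x < s ''n'' 0 0 then of_bool (h.zz r x) else s ''zz'' r x)"
    unfolding P_zz_def
  proof (rule exec_FILL)
    fix a c s' assume h: "a < s ''n2'' 0 0" "c < s ''n'' 0 0" "s' ''o'' 0 0 = a" "s' ''x'' 0 0 = c"
      "\<And>x. x \<notin> mods (IFE ''t'' (And (Not (posb (Get ''hh'' vo (V ''x''))))
     (orb (Less (V ''o'') (V ''n'')) (leb (mulc 2 (V ''dl'')) (Get ''d'' vo (V ''x''))))) (N 1) (N 0)) \<Longrightarrow>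
        x \<noteq> ''zz'' \<Longrightarrow> x \<noteq> ''o'' \<Longrightarrow> x \<noteq> ''x'' \<Longrightarrow> s' x = s x"
    have a: "a < 2 * n" "c < n" using h n by auto
    show "exec (IFE ''t'' (And (Not (posb (Get ''hh'' vo (V ''x''))))
     (orb (Less (V ''o'') (V ''n'')) (leb (mulc 2 (V ''dl'')) (Get ''d'' vo (V ''x''))))) (N 1) (N 0)) s' ''t'' 0 0 = of_bool (h.zz a c)"
    proof -
      have e: "s' ''hh'' = s ''hh''" "s' ''own'' = s ''own''" "s' ''n'' = s ''n''" "s' ''dl'' = s ''dl''" "s' ''d'' = s ''d''"
        using h(5) by simp_all
      have o: "h.own a < n" by (rule h.own_less[OF a(1)])
      have "s ''own'' a 0 = h.own a" "s ''hh'' (h.own a) c = of_bool (h.Hv (h.own a) c)"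
        "s ''d'' (h.own a) c = dd (h.own a) c" "s ''dl'' 0 0 = 8 * j"
        using assms a o by (simp_all add: oks pars_def dok_def)
      then show ?thesis using h(3,4) e n a by (simp add: h.zz_def vo_def)
    qed
  qed simp_all
  then show "exec P_zz s ''zz'' r x = of_bool (h.zz r x)" using n rx by simp
qed

lemma exec_zd:
  assumes b: "base n D E s" and r: "rok s" and o: "ownok s" and z: "zzok s" shows "zdok (exec P_zd s)"
  unfolding zdok_def
proof (intro allI impI)
  fix r x assume rx: "r < 2 * n" "x < n"
  have n: "s ''n'' 0 0 = n" "s ''n2'' 0 0 = 2 * n" using b by (auto simp: base_def)
  have "exec P_zd s ''zd'' r x = (if r < s ''n2'' 0 0 \<and> x < s ''n'' 0 0 then h.zd r x else s ''zd'' r x)"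
    unfolding P_zd_def
  proof (rule exec_FILL)
    fix a c s' assume h: "a < s ''n2'' 0 0" "c < s ''n'' 0 0" "s' ''o'' 0 0 = a" "s' ''x'' 0 0 = c"
      "\<And>x. x \<notin> mods (SUMIF ''t'' ''y'' ''n'' (onS (V ''y'') (V ''x'')) (N 1)) \<Longrightarrow>
        x \<noteq> ''zd'' \<Longrightarrow> x \<noteq> ''o'' \<Longrightarrow> x \<noteq> ''x'' \<Longrightarrow> s' x = s x"
    have "exec (SUMIF ''t'' ''y'' ''n'' (onS (V ''y'') (V ''x'')) (N 1)) s' ''t'' 0 0 =
        (\<Sum>y<s' ''n'' 0 0. if y \<in> h.seg a c then 1 else 0)"
    proof (rule exec_SUMIF)
      fix y s2 assume y: "y < s' ''n'' 0 0" "s2 ''y'' 0 0 = y"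
        "\<And>x. x \<noteq> ''_t'' \<Longrightarrow> x \<noteq> ''t'' \<Longrightarrow> x \<noteq> ''y'' \<Longrightarrow> s2 x = s' x"
      have e: "s2 x = s x" if "x \<in> {''r'', ''own'', ''zz'', ''n''}" for x using that y(3)[of x] h(5)[of x] by auto
      have "rok s2" "ownok s2" "zzok s2" using r o z e by (simp_all add: rok_def oks)
      from bval_onS[OF this, of a "V ''y''" "V ''x''"]
      show "(if bval (onS (V ''y'') (V ''x'')) s2 then aval (N 1) s2 else 0) = (if y \<in> h.seg a c then 1 else 0)"
        using y h n by simp
    qed simp_all
    also have "\<dots> = (\<Sum>y\<in>{..<n} \<inter> {y. y \<in> h.seg a c}. 1)" using h n by (simp add: sum.If_cases)
    also have "{..<n} \<inter> {y. y \<in> h.seg a c} = h.seg a c" using h.seg_sub by auto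
    finally show "exec (SUMIF ''t'' ''y'' ''n'' (onS (V ''y'') (V ''x'')) (N 1)) s' ''t'' 0 0 = h.zd a c"
      by (simp add: h.zd_def)
  qed simp_all
  then show "exec P_zd s ''zd'' r x = h.zd r x" using n rx by simp
qed

lemma exec_al0:
  assumes b: "base n D E s" and r: "rok s" and o: "ownok s" and z: "zzok s" and zd: "zdok s" and X: "xok s"
    and pr: "pars s"
  shows "alok {} (exec P_al0 s)"
  unfolding alok_def
proof (intro allI impI)
  fix r x assume rx: "r < 2 * n" "x < n"
  have n: "s ''n'' 0 0 = n" "s ''n2'' 0 0 = 2 * n" using b by (auto simp: base_def)
  let ?b = "And (onP vo (V ''y'') (V ''x'')) (And (posb (G1 ''X'' (V ''y''))) (posb (V ''md'')))"
  let ?S = "SUMIF ''t'' ''y'' ''n'' ?b (N 1)"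
  let ?T = "IFE ''t2'' (And (posb (Get ''zz'' (V ''o'') (V ''x''))) (And (leb (V ''dl'') (Get ''zd'' (V ''o'') (V ''x'')))
        (And (orb (Less (V ''o'') (V ''n'')) (posb (V ''md''))) (eqb (V ''t'') (N 0))))) (N 1) (N 0)"
  have "exec P_al0 s ''al'' r x = (if r < s ''n2'' 0 0 \<and> x < s ''n'' 0 0 then of_bool (h.W r x) else s ''al'' r x)"
    unfolding P_al0_def
  proof (rule exec_FILL)
    fix a c s' assume h: "a < s ''n2'' 0 0" "c < s ''n'' 0 0" "s' ''o'' 0 0 = a" "s' ''x'' 0 0 = c"
      "\<And>x. x \<notin> mods (?S ;; ?T) \<Longrightarrow> x \<noteq> ''al'' \<Longrightarrow> x \<noteq> ''o'' \<Longrightarrow> x \<noteq> ''x'' \<Longrightarrow> s' x = s x"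
    have a: "a < 2 * n" "c < n" using h n by auto
    have "exec ?S s' ''t'' 0 0 = (\<Sum>y<s' ''n'' 0 0. if y \<in> PP (h.own a) c \<inter> h.R then 1 else 0)"
    proof (rule exec_SUMIF)
      fix y s2 assume y: "y < s' ''n'' 0 0" "s2 ''y'' 0 0 = y"
        "\<And>x. x \<noteq> ''_t'' \<Longrightarrow> x \<noteq> ''t'' \<Longrightarrow> x \<noteq> ''y'' \<Longrightarrow> s2 x = s' x"
      have e: "s2 x = s x" if "x \<in> {''r'', ''own'', ''X'', ''md'', ''n''}" for x using that y(3)[of x] h(5)[of x] by auto
      have "rok s2" using r e by (simp add: rok_def)
      moreover have "aval vo s2 = h.own a" using o e y h a by (simp add: vo_def oks)
      moreover have "s2 ''X'' y 0 = of_bool (y \<in> X)" "s2 ''md'' 0 0 = of_bool md"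
        using X pr e y h n by (simp_all add: oks pars_def)
      ultimately show "(if bval ?b s2 then aval (N 1) s2 else 0) = (if y \<in> PP (h.own a) c \<inter> h.R then 1 else 0)"
        unfolding h.R_def using bval_onP[of s2 vo "V ''y''" "V ''x''"] y h n h.own_less[OF a(1)]
        by (cases md) simp_all
    qed simp_all
    also have "\<dots> = (\<Sum>y\<in>{..<n} \<inter> {y. y \<in> PP (h.own a) c \<inter> h.R}. 1)" using h n by (simp add: sum.If_cases)
    also have "{..<n} \<inter> {y. y \<in> PP (h.own a) c \<inter> h.R} = PP (h.own a) c \<inter> h.R" using p.P_sub by auto
    finally have t: "exec ?S s' ''t'' 0 0 = card (PP (h.own a) c \<inter> h.R)" by simp
    have fr: "exec ?S s' x = s x" if "x \<in> {''zz'', ''zd'', ''dl'', ''md'', ''n''}" for x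
      using that h(5)[of x] by (auto simp: exec_frame)
    have fo: "exec ?S s' ''o'' 0 0 = a" "exec ?S s' ''x'' 0 0 = c" using h by (simp_all add: exec_frame)
    show "exec (?S ;; ?T) s' ''t2'' 0 0 = of_bool (h.W a c)"
      using t fr fo n z zd pr a by (auto simp: oks pars_def h.W_def)
  qed simp_all
  then show "exec P_al0 s ''al'' r x = of_bool (h.g.alive {} r x)" using n rx by (simp add: h.g.alive_def)
qed

lemma exec_lev:
  assumes b: "base n D E s" and pr: "pars s" and zd: "zdok s" and al: "alok {} s"
  shows "levok (exec P_lev s)"
  unfolding levok_def
proof (intro allI impI)
  fix r assume r: "r < 2 * n"
  have n: "s ''n'' 0 0 = n" "s ''n2'' 0 0 = 2 * n" "s ''one'' 0 0 = 1" using b by (auto simp: base_def)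
  let ?b = "And (posb (Get ''al'' (V ''o'') (V ''x''))) (eqb (Get ''zd'' (V ''o'') (V ''x'')) (Plus (V ''dl'') (V ''i'')))"
  let ?S = "SUMIF ''cn'' ''x'' ''n'' ?b (N 1)"
  let ?A = "AMIN ''bw'' ''best'' ''fnd'' ''i'' ''n'' (Less (V ''i'') (V ''dl'')) ?S ''cn''"
  have "exec P_lev s ''lev'' r 0 = (if r < s ''n2'' 0 0 \<and> 0 < s ''one'' 0 0 then lev r else s ''lev'' r 0)"
    unfolding P_lev_def
  proof (rule exec_FILL)
    fix a c s' assume h: "a < s ''n2'' 0 0" "c < s ''one'' 0 0" "s' ''o'' 0 0 = a" "s' ''z'' 0 0 = c"
      "\<And>x. x \<notin> mods (?A ;; ''t'' ::= Plus (V ''dl'') (V ''bw'')) \<Longrightarrow> x \<noteq> ''lev'' \<Longrightarrow> x \<noteq> ''o'' \<Longrightarrow> x \<noteq> ''z'' \<Longrightarrow> s' x = s x"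
    have a: "a < 2 * n" using h n by auto
    have "exec ?A s' ''bw'' 0 0 = amin0 (\<lambda>i. i < 8 * j) (\<lambda>i. card {x. h.W a x \<and> h.zd a x = 8 * j + i}) (s' ''n'' 0 0)"
    proof (rule exec_AMIN(1))
      fix i s2 assume i: "i < s' ''n'' 0 0" "s2 ''i'' 0 0 = i"
        "\<And>x. x \<notin> mods ?S \<Longrightarrow> x \<notin> {''bw'', ''best'', ''fnd'', ''i''} \<Longrightarrow> s2 x = s' x"
      have e: "s2 x = s x" if "x \<in> {''al'', ''zd'', ''dl'', ''n''}" for x using that i(3)[of x] h(5)[of x] by auto
      have "exec ?S s2 ''cn'' 0 0 = (\<Sum>x<s2 ''n'' 0 0. if h.W a x \<and> h.zd a x = 8 * j + i then 1 else 0)"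
      proof (rule exec_SUMIF)
        fix x s3 assume x: "x < s2 ''n'' 0 0" "s3 ''x'' 0 0 = x"
          "\<And>y. y \<noteq> ''_t'' \<Longrightarrow> y \<noteq> ''cn'' \<Longrightarrow> y \<noteq> ''x'' \<Longrightarrow> s3 y = s2 y"
        have "s3 ''al'' a x = of_bool (h.W a x)" "s3 ''zd'' a x = h.zd a x" "s3 ''dl'' 0 0 = 8 * j"
          "s3 ''o'' 0 0 = a" "s3 ''i'' 0 0 = i"
          using x e al zd pr a n i h by (simp_all add: oks pars_def h.g.alive_def)
        then show "(if bval ?b s3 then aval (N 1) s3 else 0) = (if h.W a x \<and> h.zd a x = 8 * j + i then 1 else 0)"
          using x by auto
      qed simp_all
      also have "\<dots> = (\<Sum>x\<in>{..<n} \<inter> {x. h.W a x \<and> h.zd a x = 8 * j + i}. 1)" using e n by (simp add: sum.If_cases)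
      also have "{..<n} \<inter> {x. h.W a x \<and> h.zd a x = 8 * j + i} = {x. h.W a x \<and> h.zd a x = 8 * j + i}"
        by (auto simp: h.W_def)
      finally have "exec ?S s2 ''cn'' 0 0 = card {x. h.W a x \<and> h.zd a x = 8 * j + i}" by simp
      moreover have "s2 ''dl'' 0 0 = 8 * j" using e[of "''dl''"] pr by (simp add: pars_def)
      ultimately show "exec ?S s2 ''cn'' 0 0 = card {x. h.W a x \<and> h.zd a x = 8 * j + i} \<and>
          bval (Less (V ''i'') (V ''dl'')) (exec ?S s2) = (i < 8 * j)"
        using i(2) by (simp add: exec_frame)
    qed simp_all
    then show "exec (?A ;; ''t'' ::= Plus (V ''dl'') (V ''bw'')) s' ''t'' 0 0 = lev a"
      using h n pr by (simp add: exec_frame lev_def pars_def)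
  qed simp_all
  then show "exec P_lev s ''lev'' r 0 = lev r" using n r by simp
qed

lemma exec_mm0:
  assumes b: "base n D E s" and pr: "pars s" and X: "xok s" and d: "dok s" and hv: "hvok s"
  shows "mmok {} (exec P_mm0 s)"
  unfolding mmok_def
proof (intro allI impI)
  fix q y assume qy: "q < n" "y < n"
  have n: "s ''n'' 0 0 = n" using b by (auto simp: base_def)
  have "exec P_mm0 s ''mm'' q y = (if q < s ''n'' 0 0 \<and> y < s ''n'' 0 0 then of_bool ((q, y) \<in> h.Ms) else s ''mm'' q y)"
    unfolding P_mm0_def
    by (rule exec_FILL) (use assms n in \<open>auto simp: oks pars_def h.Ms_def dok_def\<close>)
  then show "exec P_mm0 s ''mm'' q y = of_bool ((q, y) \<in> h.Ms \<and> PP q y \<inter> {} = {})" using n qy by simp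
qed

definition tvars :: "vname set" where
  "tvars = bvars \<union> pvars \<union> {''d'', ''r'', ''X'', ''own'', ''zz'', ''zd'', ''lev'', ''hh'', ''pw''}"

text \<open>The tables that stay fixed while nodes are picked; \<open>dyn\<close> collects data that
  the picks change.\<close>

definition tab :: "mem \<Rightarrow> bool" where
  "tab s \<longleftrightarrow> base n D E s \<and> pars s \<and> dok s \<and> rok s \<and> xok s \<and> ownok s \<and> zzok s \<and> zdok s \<and> levok s \<and> hhok s \<and>
     (\<forall>x < 8 * n * n. s ''pw'' 0 x = h.g.pw x)"

lemma tab_cong: "tab s \<Longrightarrow> (\<And>x. x \<in> tvars \<Longrightarrow> s' x = s x) \<Longrightarrow> tab s'"
  unfolding tab_def using base_cong[of n D E s s'] pars_cong[of s s']
  by (simp add: oks dok_def rok_def tvars_def)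

lemma exec_seg:
  assumes b: "base n D E s" and pr: "pars s" and X: "xok s" and d: "dok s" and hv: "hvok s" and r: "rok s"
    and pw: "\<And>x. x < 8 * n * n \<Longrightarrow> s ''pw'' 0 x = h.g.pw x"
  shows "tab (exec P_seg s)" and "alok {} (exec P_seg s)" and "mmok {} (exec P_seg s)"
proof -
  define s1 where "s1 = exec P_own s"
  define s2 where "s2 = exec P_hh s1"
  define s3 where "s3 = exec P_zz s2"
  define s4 where "s4 = exec P_zd s3"
  define s5 where "s5 = exec P_al0 s4"
  define s6 where "s6 = exec P_lev s5"
  define s7 where "s7 = exec P_mm0 s6"
  note defs = s1_def s2_def s3_def s4_def s5_def s6_def s7_def
  let ?V = "bvars \<union> pvars \<union> {''d'', ''r'', ''X'', ''hv'', ''pw''}"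
  have fr: "s1 x = s x" "s2 x = s x" "s3 x = s x" "s4 x = s x" "s5 x = s x" "s6 x = s x" "s7 x = s x" if "x \<in> ?V" for x
    using that by (auto simp: defs exec_frame bvars_def pvars_def)
  have all: "base n D E s' \<and> pars s' \<and> xok s' \<and> dok s' \<and> hvok s' \<and> rok s' \<and> (\<forall>x < 8 * n * n. s' ''pw'' 0 x = h.g.pw x)"
    if "\<And>x. x \<in> ?V \<Longrightarrow> s' x = s x" for s'
    using base_cong[OF b, of s'] pars_cong[OF pr, of s'] that X d hv r pw by (simp add: oks dok_def rok_def)
  have a1: "ownok s1" unfolding s1_def by (rule exec_own[OF b])
  have a2: "hhok s2" unfolding s2_def by (rule exec_hh) (use all[of s1] fr in auto)
  have "ownok s2" using a1 by (simp add: s2_def oks exec_frame)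
  then have a3: "zzok s3" unfolding s3_def by (intro exec_zz) (use all[of s2] fr a2 in auto)
  have o3: "ownok s3" using a1 by (simp add: s2_def s3_def oks exec_frame)
  have a4: "zdok s4" unfolding s4_def by (rule exec_zd) (use all[of s3] fr a3 o3 in auto)
  have "ownok s4" "zzok s4" using o3 a3 by (simp_all add: s4_def oks exec_frame)
  then have a5: "alok {} s5" unfolding s5_def by (intro exec_al0) (use all[of s4] fr a4 in auto)
  have "zdok s5" using a4 by (simp add: s5_def oks exec_frame)
  then have a6: "levok s6" unfolding s6_def by (intro exec_lev) (use all[of s5] fr a5 in auto)
  have a7: "mmok {} s7" unfolding s7_def by (rule exec_mm0) (use all[of s6] fr in auto)
  have s7: "exec P_seg s = s7" by (simp add: P_seg_def defs)
  show "mmok {} (exec P_seg s)" using a7 s7 by simp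
  show "alok {} (exec P_seg s)" using a5 unfolding s7 by (simp add: s6_def s7_def oks exec_frame)
  have "ownok s7 \<and> zzok s7 \<and> zdok s7 \<and> levok s7 \<and> hhok s7"
    using a1 a2 a3 a4 a6 by (simp add: defs oks exec_frame)
  then show "tab (exec P_seg s)" unfolding s7 tab_def using all[of s7] fr by blast
qed

end

text \<open>All ingredients of both scores are computed, and the stage selects at the end. In each
  product a factor of polynomial size comes first; the scale \<open>k ^ N\<close> is read off as
  \<open>pw\<close> at 0.\<close>

definition P_score :: lp where
  "P_score = (
    CNT2 ''am2'' ''q'' ''y'' (And (Not (onP (V ''q'') (V ''w'') (V ''y''))) (posb (Get ''mm'' (V ''q'') (V ''y'')))) ;;
    SUMP ''ut'' ''o'' ''n2'' (SUMIF ''zc'' ''x'' ''n''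
       (And (posb (Get ''al'' (V ''o'') (V ''x''))) (Not (onS (V ''w'') (V ''x'')))) (N 1)) ''zc'' ;;
    SUMIF ''nw'' ''o'' ''n2'' (posb (Get ''al'' (V ''o'') (V ''w''))) (N 1) ;;
    SUMP ''ex'' ''o'' ''n2'' (SUMIF ''zc'' ''x'' ''n''
         (And (posb (Get ''al'' (V ''o'') (V ''x''))) (Not (onS (V ''w'') (V ''x'')))) (N 1) ;;
       MUL ''jc'' ''h'' (V ''j'') (Plus (G1 ''c'' (V ''o'')) (Get ''al'' (V ''o'') (V ''w''))) ;;
       ''t'' ::= Get ''pw'' (N 0) (Plus (V ''zc'') (V ''jc''))) ''t'' ;;
    MUL ''dn'' ''h'' (V ''dl'') (V ''nw'') ;;
    ''lt'' ::= Plus (V ''ut'') (V ''dn'') ;;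
    MUL ''a1'' ''h'' (V ''am2'') (V ''A'') ;;
    MUL ''a2'' ''h'' (V ''Q'') (V ''lt'') ;;
    MUL ''a3'' ''h'' (V ''lt'') (Get ''pw'' (N 0) (N 0)) ;;
    Cnd (posb (V ''am''))
      (IFE ''sc'' (leb (V ''AQ'') (V ''A'')) (V ''am2'') (Plus (V ''a1'') (V ''a2'')))
      (''sc'' ::= Plus (V ''a3'') (V ''ex'')))"

lemma score_simps [simp]:
  "mods P_score = {''am2'', ''q'', ''y'', ''t1'', ''_t'', ''ut'', ''o'', ''zc'', ''x'', ''nw'', ''ex'', ''jc'', ''h'', ''t'',
     ''dn'', ''lt'', ''a1'', ''a2'', ''a3'', ''sc''}"
  "bnds P_score = {''n'', ''n2'', ''N''}" "ok P_score"
  by (auto simp: P_score_def)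

context setting2
begin

lemma zc_prog:
  assumes n: "s ''n'' 0 0 = n" and o: "s ''o'' 0 0 = r" "r < 2 * n" and w: "s ''w'' 0 0 = w" "w < n"
    and rk: "rok s" and ow: "ownok s" and z: "zzok s" and al: "alok H s"
  shows "exec (SUMIF ''zc'' ''x'' ''n''
       (And (posb (Get ''al'' (V ''o'') (V ''x''))) (Not (onS (V ''w'') (V ''x'')))) (N 1)) s ''zc'' 0 0 = h.g.Zc (insert w H) r"
proof -
  let ?b = "And (posb (Get ''al'' (V ''o'') (V ''x''))) (Not (onS (V ''w'') (V ''x'')))"
  have "exec (SUMIF ''zc'' ''x'' ''n'' ?b (N 1)) s ''zc'' 0 0 = (\<Sum>x<s ''n'' 0 0. if h.g.alive (insert w H) r x then 1 else 0)"
  proof (rule exec_SUMIF)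
    fix x s2 assume x: "x < s ''n'' 0 0" "s2 ''x'' 0 0 = x"
      "\<And>y. y \<noteq> ''_t'' \<Longrightarrow> y \<noteq> ''zc'' \<Longrightarrow> y \<noteq> ''x'' \<Longrightarrow> s2 y = s y"
    have e: "s2 ''r'' = s ''r''" "s2 ''own'' = s ''own''" "s2 ''zz'' = s ''zz''" "s2 ''al'' = s ''al''"
      "s2 ''o'' = s ''o''" "s2 ''w'' = s ''w''" using x(3) by simp_all
    have ok2: "rok s2" "ownok s2" "zzok s2" using rk ow z e by (simp_all add: rok_def oks)
    have "bval (onS (V ''w'') (V ''x'')) s2 \<longleftrightarrow> w \<in> h.seg r x"
      using bval_onS[OF ok2, of r "V ''w''" "V ''x''"] e o w x n by simp
    moreover have "s2 ''al'' r x = of_bool (h.g.alive H r x)" using al e o x n by (simp add: oks)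
    moreover have "h.g.alive (insert w H) r x \<longleftrightarrow> h.g.alive H r x \<and> w \<notin> h.seg r x"
      by (auto simp: h.g.alive_def)
    ultimately show "(if bval ?b s2 then aval (N 1) s2 else 0) = (if h.g.alive (insert w H) r x then 1 else 0)"
      using e o x by simp
  qed simp_all
  also have "\<dots> = (\<Sum>x\<in>{..<n} \<inter> {x. h.g.alive (insert w H) r x}. 1)" using n by (simp add: sum.If_cases)
  also have "{..<n} \<inter> {x. h.g.alive (insert w H) r x} = {x. h.g.alive (insert w H) r x}"
    using h.g.alive_less by auto
  finally show ?thesis by (simp add: h.g.Zc_def)
qed

definition score :: "nat \<Rightarrow> (nat \<Rightarrow> nat) \<Rightarrow> nat set \<Rightarrow> nat \<Rightarrow> nat" where
  "score A c H w = (if h.g.am H > 0 then h.g.scoreY A H w else h.g.scoreZ c H w)"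

definition dyn :: "nat set \<Rightarrow> nat \<Rightarrow> (nat \<Rightarrow> nat) \<Rightarrow> mem \<Rightarrow> bool" where
  "dyn H A c s \<longleftrightarrow> alok H s \<and> mmok H s \<and> s ''A'' 0 0 = A \<and> (\<forall>r<2*n. s ''c'' r 0 = c r)"

lemma dyn_cong: "dyn H A c s \<Longrightarrow> (\<And>x. x \<in> {''al'', ''mm'', ''A'', ''c''} \<Longrightarrow> s' x = s x) \<Longrightarrow> dyn H A c s'"
  by (simp add: dyn_def oks)

lemma Ms_sub: "h.Ms \<subseteq> {..<n} \<times> {..<n}" by (auto simp: h.Ms_def)

lemma am_le: "h.g.am H \<le> n * n"
proof -
  have "h.g.am H \<le> card ({..<n} \<times> {..<n})" unfolding h.g.am_def using Ms_sub by (intro card_mono) auto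
  then show ?thesis by simp
qed

lemma exec_score:
  assumes tb: "tab s" and dy: "dyn H A c s" and am: "s ''am'' 0 0 = h.g.am H" and w: "s ''w'' 0 0 = w" "w < n"
    and c: "\<And>r. c r \<le> n"
  shows "exec P_score s ''sc'' 0 0 = score A c H w"
proof -
  have n: "s ''n'' 0 0 = n" "s ''n2'' 0 0 = 2 * n" "s ''N'' 0 0 = 8 * n * n"
    and par: "s ''j'' 0 0 = j" "s ''dl'' 0 0 = 8 * j" "s ''Q'' 0 0 = l * l" "s ''AQ'' 0 0 = n * (2 * j) * (l * l)"
    and rk: "rok s" and ow: "ownok s" and z: "zzok s" and pw: "\<And>x. x < 8 * n * n \<Longrightarrow> s ''pw'' 0 x = h.g.pw x"
    using tb by (auto simp: tab_def base_def pars_def)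
  have al: "alok H s" and mm: "mmok H s" and A: "s ''A'' 0 0 = A" and cc: "\<And>r. r < 2 * n \<Longrightarrow> s ''c'' r 0 = c r"
    using dy by (auto simp: dyn_def)
  let ?Z = "SUMIF ''zc'' ''x'' ''n''
       (And (posb (Get ''al'' (V ''o'') (V ''x''))) (Not (onS (V ''w'') (V ''x'')))) (N 1)"
  let ?p1 = "CNT2 ''am2'' ''q'' ''y'' (And (Not (onP (V ''q'') (V ''w'') (V ''y''))) (posb (Get ''mm'' (V ''q'') (V ''y''))))"
  let ?p2 = "SUMP ''ut'' ''o'' ''n2'' ?Z ''zc''"
  let ?p3 = "SUMIF ''nw'' ''o'' ''n2'' (posb (Get ''al'' (V ''o'') (V ''w''))) (N 1)"
  let ?e = "?Z ;; MUL ''jc'' ''h'' (V ''j'') (Plus (G1 ''c'' (V ''o'')) (Get ''al'' (V ''o'') (V ''w''))) ;;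
       ''t'' ::= Get ''pw'' (N 0) (Plus (V ''zc'') (V ''jc''))"
  let ?p4 = "SUMP ''ex'' ''o'' ''n2'' ?e ''t''"
  define s1 where "s1 = exec ?p1 s"
  define s2 where "s2 = exec ?p2 s1"
  define s3 where "s3 = exec ?p3 s2"
  define s4 where "s4 = exec ?p4 s3"
  let ?K = "{''n'', ''n2'', ''N'', ''j'', ''dl'', ''Q'', ''AQ'', ''r'', ''own'', ''zz'', ''pw'', ''al'', ''mm'', ''A'', ''c'', ''w'', ''am''}"
  have f1: "s1 x = s x" if "x \<in> ?K" for x using that unfolding s1_def by (auto simp: exec_frame)
  have f2: "s2 x = s x" if "x \<in> ?K" for x using that f1[OF that] unfolding s2_def by (auto simp: exec_frame)
  have f3: "s3 x = s x" if "x \<in> ?K" for x using that f2[OF that] unfolding s3_def by (auto simp: exec_frame)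
  have f4: "s4 x = s x" if "x \<in> ?K" for x using that f3[OF that] unfolding s4_def by (auto simp: exec_frame)
  have am2: "s1 ''am2'' 0 0 = h.g.am (insert w H)" unfolding s1_def h.g.am_def
  proof (rule exec_CNT2[where n = n])
    show "{a \<in> h.Ms. PP (fst a) (snd a) \<inter> insert w H = {}} \<subseteq> {..<n} \<times> {..<n}" using Ms_sub by auto
    fix a b s' assume h: "a < n" "b < n" "s' ''q'' 0 0 = a" "s' ''y'' 0 0 = b"
      "\<And>x. x \<notin> {''am2'', ''q'', ''y'', ''t1'', ''_t''} \<Longrightarrow> s' x = s x"
    have e: "s' ''r'' = s ''r''" "s' ''mm'' = s ''mm''" "s' ''w'' = s ''w''" using h(5) by simp_all
    have "rok s'" using rk e by (simp add: rok_def)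
    then have "bval (onP (V ''q'') (V ''w'') (V ''y'')) s' \<longleftrightarrow> w \<in> PP a b"
      using bval_onP[of s' "V ''q''" "V ''w''" "V ''y''"] h(1-4) e w by simp
    moreover have "s' ''mm'' a b = of_bool ((a, b) \<in> h.Ms \<and> PP a b \<inter> H = {})"
      using mm h(1,2) e by (simp add: oks)
    ultimately show "bval (And (Not (onP (V ''q'') (V ''w'') (V ''y''))) (posb (Get ''mm'' (V ''q'') (V ''y'')))) s' \<longleftrightarrow>
       (a, b) \<in> {a \<in> h.Ms. PP (fst a) (snd a) \<inter> insert w H = {}}"
      using h(3,4) by auto
  qed (use n in simp_all)
  have zc: "exec ?Z s' ''zc'' 0 0 = h.g.Zc (insert w H) r"
    if "\<And>x. x \<in> {''n'', ''r'', ''own'', ''zz'', ''al'', ''w''} \<Longrightarrow> s' x = s x" "s' ''o'' 0 0 = r" "r < 2 * n" for s' r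
  proof (rule zc_prog)
    have e: "s' ''n'' = s ''n''" "s' ''r'' = s ''r''" "s' ''own'' = s ''own''" "s' ''zz'' = s ''zz''" "s' ''al'' = s ''al''" "s' ''w'' = s ''w''"
      using that(1) by simp_all
    show "s' ''n'' 0 0 = n" "s' ''w'' 0 0 = w" using e n w by simp_all
    show "rok s'" "ownok s'" "zzok s'" "alok H s'" using e rk ow z al by (simp_all add: rok_def oks)
  qed (use that(2,3) w in simp_all)
  have ut: "s2 ''ut'' 0 0 = h.g.Ut (insert w H)"
  proof -
    have "s2 ''ut'' 0 0 = (\<Sum>r<s1 ''n2'' 0 0. h.g.Zc (insert w H) r)" unfolding s2_def
    proof (rule exec_SUMP)
      fix r s' assume h: "r < s1 ''n2'' 0 0" "s' ''o'' 0 0 = r"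
        "\<And>x. x \<notin> mods ?Z \<Longrightarrow> x \<noteq> ''ut'' \<Longrightarrow> x \<noteq> ''o'' \<Longrightarrow> s' x = s1 x"
      show "exec ?Z s' ''zc'' 0 0 = h.g.Zc (insert w H) r"
      proof (rule zc)
        show "s' x = s x" if "x \<in> {''n'', ''r'', ''own'', ''zz'', ''al'', ''w''}" for x
        proof -
          have "x \<notin> mods ?Z" "x \<noteq> ''ut''" "x \<noteq> ''o''" "x \<in> ?K" using that by auto
          then show ?thesis using h(3) f1 by (metis (no_types))
        qed
      qed (use h(1,2) f1[of "''n2''"] n in simp_all)
    qed simp_all
    then show ?thesis using f1[of "''n2''"] n by (simp add: h.g.Ut_def)
  qed
  have nw: "s3 ''nw'' 0 0 = h.g.new H w"
  proof -
    have "s3 ''nw'' 0 0 = (\<Sum>r<s2 ''n2'' 0 0. of_bool (h.g.alive H r w))" unfolding s3_def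
    proof (rule exec_SUMIF)
      fix r s' assume h: "r < s2 ''n2'' 0 0" "s' ''o'' 0 0 = r"
        "\<And>x. x \<noteq> ''_t'' \<Longrightarrow> x \<noteq> ''nw'' \<Longrightarrow> x \<noteq> ''o'' \<Longrightarrow> s' x = s2 x"
      have "s' ''al'' = s ''al''" "s' ''w'' = s ''w''" "r < 2 * n"
        using h(1) h(3)[of "''al''"] h(3)[of "''w''"] f2[of "''al''"] f2[of "''w''"] f2[of "''n2''"] n by simp_all
      then show "(if bval (posb (Get ''al'' (V ''o'') (V ''w''))) s' then aval (N 1) s' else 0) = of_bool (h.g.alive H r w)"
        using h(2) w al by (simp add: oks)
    qed simp_all
    then show ?thesis using f2[of "''n2''"] n by (simp add: h.g.new_sum)
  qed
  \<comment> \<open>The counters are at most \<open>n\<close>, so every exponent lies inside the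
    table.\<close>
  have idx: "h.g.Zc H' r + j * (c r + of_bool b) < 8 * n * n" for H' r b
  proof -
    have "j * (c r + of_bool b) \<le> j * (n + 1)" using c[of r] by (intro mult_le_mono2) auto
    then show ?thesis using h.g.Zc_le[of H' r] N_ge(1) by linarith
  qed
  have ex: "s4 ''ex'' 0 0 = (\<Sum>r<2*n. h.g.pw (h.g.Zc (insert w H) r + j * (c r + of_bool (h.g.alive H r w))))"
  proof -
    have "s4 ''ex'' 0 0 = (\<Sum>r<s3 ''n2'' 0 0. h.g.pw (h.g.Zc (insert w H) r + j * (c r + of_bool (h.g.alive H r w))))"
      unfolding s4_def
    proof (rule exec_SUMP)
      fix r s' assume h: "r < s3 ''n2'' 0 0" "s' ''o'' 0 0 = r"
        "\<And>x. x \<notin> mods ?e \<Longrightarrow> x \<noteq> ''ex'' \<Longrightarrow> x \<noteq> ''o'' \<Longrightarrow> s' x = s3 x"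
      have r: "r < 2 * n" using h(1) f3[of "''n2''"] n by simp
      have e: "s' x = s x" if "x \<in> ?K" for x
      proof -
        have "x \<notin> mods ?e" "x \<noteq> ''ex''" "x \<noteq> ''o''" using that by auto
        then show ?thesis using h(3) f3[OF that] by (metis (no_types))
      qed
      define t1 where "t1 = exec ?Z s'"
      have z1: "t1 ''zc'' 0 0 = h.g.Zc (insert w H) r" unfolding t1_def
      proof (rule zc)
        show "s' x = s x" if "x \<in> {''n'', ''r'', ''own'', ''zz'', ''al'', ''w''}" for x
        proof -
          have "x \<in> ?K" using that by auto
          then show ?thesis by (rule e)
        qed
      qed (use h(2) r in simp_all)
      have e1: "t1 x = s x" if "x \<in> ?K" for x using that e[OF that] unfolding t1_def by (auto simp: exec_frame)
      have o1: "t1 ''o'' 0 0 = r" using h(2) by (simp add: t1_def exec_frame)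
      define t2 where "t2 = exec (MUL ''jc'' ''h'' (V ''j'') (Plus (G1 ''c'' (V ''o'')) (Get ''al'' (V ''o'') (V ''w'')))) t1"
      have v: "t1 ''j'' 0 0 = j" "t1 ''c'' r 0 = c r" "t1 ''al'' r w = of_bool (h.g.alive H r w)" "t1 ''w'' 0 0 = w"
          "t1 ''N'' 0 0 = 8 * n * n"
        using e1[of "''j''"] e1[of "''c''"] e1[of "''al''"] e1[of "''w''"] e1[of "''N''"] par cc[OF r] al r w n
        by (simp_all add: oks)
      have jn: "j \<le> 8 * n * n" using j_le N_ge(2) by linarith
      have jc: "t2 ''jc'' 0 0 = j * (c r + of_bool (h.g.alive H r w))"
        unfolding t2_def by (subst exec_MUL) (use v o1 jn in simp_all)
      have z2: "t2 ''zc'' 0 0 = h.g.Zc (insert w H) r" using z1 by (simp add: t2_def exec_frame)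
      have p2: "t2 ''pw'' = s ''pw''" using e1[of "''pw''"] by (simp add: t2_def exec_frame)
      have "exec ?e s' ''t'' 0 0 = t2 ''pw'' 0 (t2 ''zc'' 0 0 + t2 ''jc'' 0 0)" by (simp add: t1_def t2_def)
      then show "exec ?e s' ''t'' 0 0 = h.g.pw (h.g.Zc (insert w H) r + j * (c r + of_bool (h.g.alive H r w)))"
        unfolding p2 z2 jc using pw[OF idx] by simp
    qed simp_all
    then show ?thesis using f3[of "''n2''"] n by simp
  qed
  define s5 where "s5 = exec (MUL ''dn'' ''h'' (V ''dl'') (V ''nw'')) s4"
  have nw4: "s4 ''nw'' 0 0 = h.g.new H w" "s4 ''ut'' 0 0 = h.g.Ut (insert w H)" "s4 ''am2'' 0 0 = h.g.am (insert w H)"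
    using nw ut am2 by (simp_all add: s4_def s3_def s2_def exec_frame)
  have v4: "s4 ''dl'' 0 0 = 8 * j" "s4 ''N'' 0 0 = 8 * n * n" using f4[of "''dl''"] f4[of "''N''"] par n by simp_all
  have dn: "s5 ''dn'' 0 0 = 8 * j * h.g.new H w"
    unfolding s5_def by (subst exec_MUL) (use nw4 v4 j8 N_ge(2) in simp_all)
  define LT where "LT = h.g.Ut (insert w H) + 8 * j * h.g.new H w"
  define s6 where "s6 = setv s5 ''lt'' LT"
  have s6: "exec (''lt'' ::= Plus (V ''ut'') (V ''dn'')) s5 = s6"
    using dn nw4 by (simp add: s6_def LT_def s5_def exec_frame)
  have f6: "s6 x = s x" if "x \<in> ?K" for x using that f4[OF that] by (auto simp: s6_def s5_def exec_frame)
  have v6: "s6 ''am2'' 0 0 = h.g.am (insert w H)" "s6 ''A'' 0 0 = A" "s6 ''Q'' 0 0 = l * l" "s6 ''lt'' 0 0 = LT" "s6 ''N'' 0 0 = 8 * n * n"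
      "s6 ''pw'' 0 0 = h.g.pw 0" "s6 ''am'' 0 0 = h.g.am H" "s6 ''AQ'' 0 0 = n * (2 * j) * (l * l)"
      "s6 ''ex'' 0 0 = (\<Sum>r<2*n. h.g.pw (h.g.Zc (insert w H) r + j * (c r + of_bool (h.g.alive H r w))))"
    using nw4 f6[of "''A''"] f6[of "''Q''"] f6[of "''N''"] f6[of "''pw''"] f6[of "''am''"] f6[of "''AQ''"] A par n am ex pw[of 0] p.n_pos
    by (simp_all add: s6_def s5_def exec_frame)
  have LTn: "LT \<le> 8 * n * n"
  proof -
    have "h.g.Ut (insert w H) \<le> (\<Sum>r<2*n. n)" unfolding h.g.Ut_def by (intro sum_mono h.g.Zc_le)
    moreover have "8 * j * h.g.new H w \<le> n * (2 * n)" using j8 h.g.new_le by (intro mult_le_mono) auto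
    ultimately show ?thesis unfolding LT_def by simp
  qed
  have ll: "l * l \<le> 8 * n * n"
  proof -
    have "l * l \<le> n * n" using l_le by (intro mult_le_mono) auto
    then show ?thesis using N_ge(3) by linarith
  qed
  have amn: "h.g.am (insert w H) \<le> 8 * n * n" using am_le[of "insert w H"] N_ge(3) by linarith
  define s7 where "s7 = exec (MUL ''a1'' ''h'' (V ''am2'') (V ''A'')) s6"
  have a1: "s7 ''a1'' 0 0 = A * h.g.am (insert w H)"
    unfolding s7_def mult.commute[of A] by (subst exec_MUL) (use v6 amn in simp_all)
  define s8 where "s8 = exec (MUL ''a2'' ''h'' (V ''Q'') (V ''lt'')) s7"
  have a2: "s8 ''a2'' 0 0 = l * l * LT"
    unfolding s8_def by (subst exec_MUL) (use v6 ll in \<open>simp_all add: s7_def exec_frame\<close>)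
  define s9 where "s9 = exec (MUL ''a3'' ''h'' (V ''lt'') (Get ''pw'' (N 0) (N 0))) s8"
  have a3: "s9 ''a3'' 0 0 = h.g.pw 0 * LT"
    unfolding s9_def mult.commute[of "h.g.pw 0"] by (subst exec_MUL) (use v6 LTn in \<open>simp_all add: s8_def s7_def exec_frame\<close>)
  have v9: "s9 ''am2'' 0 0 = h.g.am (insert w H)" "s9 ''A'' 0 0 = A" "s9 ''a1'' 0 0 = A * h.g.am (insert w H)"
     "s9 ''a2'' 0 0 = l * l * LT" "s9 ''am'' 0 0 = h.g.am H" "s9 ''AQ'' 0 0 = n * (2 * j) * (l * l)"
      "s9 ''ex'' 0 0 = (\<Sum>r<2*n. h.g.pw (h.g.Zc (insert w H) r + j * (c r + of_bool (h.g.alive H r w))))"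
    using v6 a1 a2 by (simp_all add: s9_def s8_def s7_def exec_frame)
  have ex_all: "exec P_score s = exec (Cnd (posb (V ''am''))
      (IFE ''sc'' (leb (V ''AQ'') (V ''A'')) (V ''am2'') (Plus (V ''a1'') (V ''a2'')))
      (''sc'' ::= Plus (V ''a3'') (V ''ex''))) s9"
    unfolding P_score_def exec.simps(3) s1_def[symmetric] s2_def[symmetric] s3_def[symmetric] s4_def[symmetric]
      s5_def[symmetric] s6 s7_def[symmetric] s8_def[symmetric] s9_def[symmetric] ..
  show ?thesis
  proof (cases "h.g.am H > 0")
    case True
    have "exec P_score s ''sc'' 0 0 = (if n * (2 * j) * (l * l) \<le> A then h.g.am (insert w H)
        else A * h.g.am (insert w H) + l * l * LT)"
      unfolding ex_all using v9 True by simp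
    then show ?thesis using True unfolding score_def h.g.scoreY_def h.g.AQ_def LT_def by simp
  next
    case False
    have p0: "h.g.pw 0 = k ^ (8 * n * n)" by (simp add: h.g.pw_def)
    have "exec P_score s ''sc'' 0 0 = k ^ (8 * n * n) * LT +
        (\<Sum>r<2*n. h.g.pw (h.g.Zc (insert w H) r + j * (c r + of_bool (h.g.alive H r w))))"
      unfolding ex_all using v9 a3 False unfolding p0 by simp
    then show ?thesis using False unfolding score_def h.g.scoreZ_def LT_def by simp
  qed
qed

end

section \<open>Computing the permutation and the hub sets\<close>

definition P_pick :: lp where
  "P_pick = (CNT2 ''am'' ''q'' ''y'' (posb (Get ''mm'' (V ''q'') (V ''y''))) ;;
     AMIN ''bw'' ''best'' ''fnd'' ''w'' ''n'' (Not (posb (G1 ''pk'' (V ''w'')))) P_score ''sc'')"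
definition P_acc1 :: lp where
  "P_acc1 = (SUMIF ''fl'' ''x'' ''n'' (And (posb (Get ''al'' (V ''o'') (V ''x''))) (And (onS (V ''bw'') (V ''x''))
       (orb (eqb (V ''x'') (V ''bw'')) (eqb (Get ''zd'' (V ''o'') (V ''x'')) (G1 ''lev'' (V ''o'')))))) (N 1) ;;
     Cnd (posb (V ''fl'')) (Asg ''S'' vo (V ''bw'') (N 1)) Skp)"
definition "P_acc = For ''o'' ''n2'' P_acc1"
definition P_c :: lp where
  "P_c = Cnd (posb (V ''am'')) Skp (FILL ''c'' ''o'' ''n2'' ''z'' ''one''
     (''t'' ::= Plus (G1 ''c'' (V ''o'')) (Get ''al'' (V ''o'') (V ''bw''))) ''t'')"
definition P_A :: lp where
  "P_A = Cnd (And (posb (V ''am'')) (Less (V ''A'') (V ''AQ'')))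
     (''pc'' ::= Plus (V ''pc'') (V ''e'') ;;
      Cnd (leb (V ''n'') (V ''pc'')) (''pc'' ::= N 0 ;; ''A'' ::= Plus (V ''A'') (V ''A'')) Skp) Skp"
definition P_al :: lp where
  "P_al = FILL ''al'' ''o'' ''n2'' ''x'' ''n'' (IFE ''t'' (onS (V ''bw'') (V ''x'')) (N 0) (Get ''al'' (V ''o'') (V ''x''))) ''t''"
definition P_mm :: lp where
  "P_mm = FILL ''mm'' ''q'' ''n'' ''y'' ''n'' (IFE ''t'' (onP (V ''q'') (V ''bw'') (V ''y'')) (N 0) (Get ''mm'' (V ''q'') (V ''y''))) ''t''"
text \<open>Hubs and counters refer to the targets alive before the pick, so they are updated ahead
  of \<open>al\<close>; \<open>am\<close> remembers the stage in which the pick was made.\<close>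

definition "P_body = (P_pick ;; P_acc ;; P_c ;; P_A ;; P_al ;; P_mm ;; Asg ''pk'' (V ''bw'') (N 0) (N 1))"
definition P_init :: lp where
  "P_init = (''A'' ::= V ''A0'' ;; ''pc'' ::= N 0 ;;
     FILL ''pk'' ''x'' ''n'' ''z'' ''one'' (''t'' ::= N 0) ''t'' ;;
     FILL ''c'' ''o'' ''n2'' ''z'' ''one'' (''t'' ::= N 0) ''t'' ;;
     FILL ''S'' ''u'' ''n'' ''y'' ''n'' (IFE ''t'' (orb (And (posb (V ''md'')) (posb (G1 ''X'' (V ''y''))))
       (posb (Get ''hh'' (V ''u'') (V ''y'')))) (N 1) (N 0)) ''t'')"
definition "P_main = (P_init ;; For ''t_'' ''n'' P_body)"

lemma main_progs [simp]:
  "mods P_pick = {''am'', ''bw'', ''best'', ''fnd'', ''w''} \<union> mods P_score" "ok P_pick" "bnds P_pick = {''n'', ''n2'', ''N''}"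
  "mods P_acc = {''o'', ''fl'', ''x'', ''_t'', ''S''}" "ok P_acc" "bnds P_acc = {''n'', ''n2''}" "ok (For ''o'' ''n2'' P_acc1)"
  "mods P_acc1 = {''fl'', ''x'', ''_t'', ''S''}" "ok P_acc1"
  "mods P_c = {''c'', ''o'', ''z'', ''t''}" "ok P_c" "bnds P_c = {''n2'', ''one''}"
  "mods P_A = {''pc'', ''A''}" "ok P_A" "bnds P_A = {}"
  "mods P_al = {''al'', ''o'', ''x'', ''t''}" "ok P_al" "bnds P_al = {''n'', ''n2''}"
  "mods P_mm = {''mm'', ''q'', ''y'', ''t''}" "ok P_mm" "bnds P_mm = {''n''}"
  by (auto simp: P_pick_def P_acc_def P_acc1_def P_c_def P_A_def P_al_def P_mm_def)

lemma main_progs2 [simp]: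
  "mods P_body = {''am'', ''bw'', ''best'', ''fnd'', ''w'', ''fl'', ''S'', ''c'', ''z'', ''pc'', ''A'', ''al'', ''mm'', ''pk''} \<union> mods P_score"
  "ok P_body" "bnds P_body = {''n'', ''n2'', ''N'', ''one''}"
  "mods P_init = {''A'', ''pc'', ''pk'', ''x'', ''z'', ''t'', ''c'', ''o'', ''S'', ''u'', ''y''}" "ok P_init" "bnds P_init = {''n'', ''n2'', ''one''}"
  by (auto simp: P_body_def P_init_def)

lemma main_progs3 [simp]:
  "mods P_main = {''t_'', ''u''} \<union> mods P_body" "ok P_main" "bnds P_main = {''n'', ''n2'', ''N'', ''one''}"
  by (auto simp: P_main_def)

context setting2
begin

definition dyn2 :: "nat list \<Rightarrow> nat \<Rightarrow> nat \<Rightarrow> (nat \<Rightarrow> nat) \<Rightarrow> mem \<Rightarrow> bool" where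
  "dyn2 hs A pc c s \<longleftrightarrow> tab s \<and> dyn (set hs) A c s \<and> s ''pc'' 0 0 = pc \<and>
     (\<forall>x<n. s ''pk'' x 0 = of_bool (x \<in> set hs)) \<and>
     (\<forall>u<n. \<forall>y<n. s ''S'' u y = of_bool (y \<in> h.hubs lev hs u))"

lemma tvars_frame: "tab s \<Longrightarrow> tvars \<inter> mods p = {} \<Longrightarrow> tab (exec p s)"
proof (rule tab_cong)
  fix x assume "tvars \<inter> mods p = {}" "x \<in> tvars"
  then have "x \<notin> mods p" by blast
  then show "exec p s x = s x" by (rule exec_frame)
qed

lemma disjD2: "A \<inter> B = {} \<Longrightarrow> x \<in> A \<Longrightarrow> x \<notin> B" by blast

lemma tv: "tvars \<inter> mods P_pick = {}" "tvars \<inter> mods P_acc = {}" "tvars \<inter> mods P_c = {}" "tvars \<inter> mods P_A = {}"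
  "tvars \<inter> mods P_al = {}" "tvars \<inter> mods P_mm = {}" "tvars \<inter> mods P_score = {}"
  "tvars \<inter> {''am'', ''q'', ''y'', ''t1'', ''_t'', ''pk'', ''bw'', ''best'', ''fnd'', ''w''} = {}"
  "tvars \<inter> {''bw'', ''best'', ''fnd'', ''w''} = {}"
  by (simp_all add: tvars_def bvars_def pvars_def)

lemma exec_pick:
  assumes tb: "tab s" and dy: "dyn H A c s" and c: "\<And>r. c r \<le> n"
    and pk: "\<And>x. x < n \<Longrightarrow> s ''pk'' x 0 = of_bool (x \<in> H)" and ex: "\<exists>x<n. x \<notin> H"
  shows "exec P_pick s ''am'' 0 0 = h.g.am H"
    and "exec P_pick s ''bw'' 0 0 < n \<and> exec P_pick s ''bw'' 0 0 \<notin> H \<and>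
      (\<forall>x<n. x \<notin> H \<longrightarrow> score A c H (exec P_pick s ''bw'' 0 0) \<le> score A c H x)"
proof -
  have n: "s ''n'' 0 0 = n" using tb by (auto simp: tab_def base_def)
  let ?C = "CNT2 ''am'' ''q'' ''y'' (posb (Get ''mm'' (V ''q'') (V ''y'')))"
  define s1 where "s1 = exec ?C s"
  have am: "s1 ''am'' 0 0 = h.g.am H" unfolding s1_def h.g.am_def
  proof (rule exec_CNT2[where n = n])
    show "{a \<in> h.Ms. PP (fst a) (snd a) \<inter> H = {}} \<subseteq> {..<n} \<times> {..<n}" using Ms_sub by auto
    fix a b s' assume h: "a < n" "b < n" "s' ''q'' 0 0 = a" "s' ''y'' 0 0 = b"
      "\<And>x. x \<notin> {''am'', ''q'', ''y'', ''t1'', ''_t''} \<Longrightarrow> s' x = s x"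
    have "s' ''mm'' = s ''mm''" using h(5) by simp
    then show "bval (posb (Get ''mm'' (V ''q'') (V ''y''))) s' \<longleftrightarrow> (a, b) \<in> {a \<in> h.Ms. PP (fst a) (snd a) \<inter> H = {}}"
      using dy h(1-4) by (simp add: dyn_def oks)
  qed (use n in simp_all)
  have t1: "tab s1" unfolding s1_def
    by (rule tvars_frame[OF tb]) (simp add: tvars_def bvars_def pvars_def)
  have d1: "dyn H A c s1" by (rule dyn_cong[OF dy]) (auto simp: s1_def exec_frame)
  let ?A = "AMIN ''bw'' ''best'' ''fnd'' ''w'' ''n'' (Not (posb (G1 ''pk'' (V ''w'')))) P_score ''sc''"
  have e: "exec P_pick s = exec ?A s1" by (simp add: P_pick_def s1_def)
  show "exec P_pick s ''am'' 0 0 = h.g.am H" unfolding e using am by (simp add: exec_frame)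
  have n1: "s1 ''n'' 0 0 = n" using n by (simp add: s1_def exec_frame)
  have pk1: "s1 ''pk'' = s ''pk''" by (simp add: s1_def exec_frame)
  have "exec ?A s1 ''bw'' 0 0 = amin0 (\<lambda>w. w \<notin> H) (score A c H) (s1 ''n'' 0 0)"
  proof (rule exec_AMIN(1))
    fix w s' assume h: "w < s1 ''n'' 0 0" "s' ''w'' 0 0 = w"
      "\<And>x. x \<notin> mods P_score \<Longrightarrow> x \<notin> {''bw'', ''best'', ''fnd'', ''w''} \<Longrightarrow> s' x = s1 x"
    have "tab s'"
    proof (rule tab_cong[OF t1])
      fix x assume x: "x \<in> tvars"
      have "x \<notin> mods P_score" using tv(7) x by (rule disjD2)
      moreover have "x \<notin> {''bw'', ''best'', ''fnd'', ''w''}" using tv(9) x by (rule disjD2)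
      ultimately
      show "s' x = s1 x" by (rule h(3))
    qed
    moreover have "dyn H A c s'"
    proof (rule dyn_cong[OF d1])
      fix x assume x: "x \<in> {''al'', ''mm'', ''A'', ''c''}"
      have "x \<notin> mods P_score" "x \<notin> {''bw'', ''best'', ''fnd'', ''w''}" using x by auto
      then show "s' x = s1 x" by (rule h(3))
    qed
    moreover have e: "s' ''am'' = s1 ''am''" "s' ''pk'' = s1 ''pk''" by (rule h(3); simp)+
    ultimately have "exec P_score s' ''sc'' 0 0 = score A c H w"
      using am h(1,2) n1 c by (intro exec_score) simp_all
    moreover have "bval (Not (posb (G1 ''pk'' (V ''w'')))) (exec P_score s') \<longleftrightarrow> w \<notin> H"
      using e(2) pk1 pk[of w] h(1,2) n1 by (simp add: exec_frame)
    ultimately show "exec P_score s' ''sc'' 0 0 = score A c H w \<and>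
        bval (Not (posb (G1 ''pk'' (V ''w'')))) (exec P_score s') = (w \<notin> H)" by simp
  qed simp_all
  then show "exec P_pick s ''bw'' 0 0 < n \<and> exec P_pick s ''bw'' 0 0 \<notin> H \<and>
      (\<forall>x<n. x \<notin> H \<longrightarrow> score A c H (exec P_pick s ''bw'' 0 0) \<le> score A c H x)"
    unfolding e using amin0[of n "\<lambda>w. w \<notin> H" "score A c H"] ex n1 by simp
qed

lemma exec_acc:
  assumes tb: "tab s" and al: "alok H s" and w: "s ''bw'' 0 0 = w" "w < n" and u: "u < n" "y < n"
  shows "exec P_acc s ''S'' u y = (if y = w \<and> (\<exists>r<2*n. h.own r = u \<and> h.acc lev H r w) then 1 else s ''S'' u y)"
proof -
  have n: "s ''n'' 0 0 = n" "s ''n2'' 0 0 = 2 * n" using tb by (auto simp: tab_def base_def)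
  let ?I = "\<lambda>m s'. \<forall>u<n. \<forall>y<n. s' ''S'' u y = (if y = w \<and> (\<exists>r<m. h.own r = u \<and> h.acc lev H r w) then 1 else s ''S'' u y)"
  have "?I (s ''n2'' 0 0) (exec (For ''o'' ''n2'' P_acc1) s)"
  proof (rule For_inv[where I = ?I])
    fix m s' assume m: "m < s ''n2'' 0 0" "?I m s'" "s' ''o'' 0 0 = m"
      "\<And>x. x \<noteq> ''o'' \<Longrightarrow> x \<notin> mods P_acc1 \<Longrightarrow> s' x = s x"
    have m2: "m < 2 * n" using m(1) n by simp
    let ?b = "And (posb (Get ''al'' (V ''o'') (V ''x''))) (And (onS (V ''bw'') (V ''x''))
       (orb (eqb (V ''x'') (V ''bw'')) (eqb (Get ''zd'' (V ''o'') (V ''x'')) (G1 ''lev'' (V ''o'')))))"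
    let ?S = "SUMIF ''fl'' ''x'' ''n'' ?b (N 1)"
    define B where "B x \<longleftrightarrow> h.g.alive H m x \<and> w \<in> h.seg m x \<and> (x = w \<or> h.zd m x = lev m)" for x
    have e': "s' x = s x" if "x \<in> {''n'', ''al'', ''r'', ''own'', ''zz'', ''zd'', ''lev'', ''bw''}" for x
      by (rule m(4)) (use that in auto)
    have "exec ?S s' ''fl'' 0 0 = (\<Sum>x<s' ''n'' 0 0. if B x then 1 else 0)"
    proof (rule exec_SUMIF)
      fix x s2 assume x: "x < s' ''n'' 0 0" "s2 ''x'' 0 0 = x"
        "\<And>y. y \<noteq> ''_t'' \<Longrightarrow> y \<noteq> ''fl'' \<Longrightarrow> y \<noteq> ''x'' \<Longrightarrow> s2 y = s' y"
      have e: "s2 ''al'' = s ''al''" "s2 ''r'' = s ''r''" "s2 ''own'' = s ''own''" "s2 ''zz'' = s ''zz''"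
        "s2 ''zd'' = s ''zd''" "s2 ''lev'' = s ''lev''" "s2 ''bw'' = s ''bw''"
        using x(3) e' by simp_all
      have o: "s2 ''o'' 0 0 = m" using x(3)[of "''o''"] m(3) by simp
      have xn: "x < n" using x(1) e'[of "''n''"] n by simp
      have ok2: "rok s2" "ownok s2" "zzok s2" using tb e by (simp_all add: tab_def rok_def oks)
      have "bval (onS (V ''bw'') (V ''x'')) s2 \<longleftrightarrow> w \<in> h.seg m x"
        using bval_onS[OF ok2 o m2, of "V ''bw''" "V ''x''"] e w x(2) xn by simp
      moreover have "s2 ''al'' m x = of_bool (h.g.alive H m x)" using al e m2 xn by (simp add: oks)
      moreover have "s2 ''zd'' m x = h.zd m x" "s2 ''lev'' m 0 = lev m" using tb e m2 xn by (simp_all add: tab_def oks)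
      ultimately show "(if bval ?b s2 then aval (N 1) s2 else 0) = (if B x then 1 else 0)"
        using e o x(2) w by (auto simp: B_def)
    qed simp_all
    also have "\<dots> = (\<Sum>x\<in>{..<n} \<inter> {x. B x}. 1)" using e'[of "''n''"] n by (simp add: sum.If_cases)
    also have "{..<n} \<inter> {x. B x} = {x. B x}" using h.g.alive_less by (auto simp: B_def)
    finally have fl: "exec ?S s' ''fl'' 0 0 = card {x. B x}" by simp
    have "finite {x. B x}" by (rule finite_subset[of _ "{..<n}"]) (auto simp: B_def dest: h.g.alive_less)
    then have pos: "card {x. B x} > 0 \<longleftrightarrow> h.acc lev H m w"
      by (auto simp: card_gt_0_iff B_def h.acc_def h.g.alive_def)
    have ow: "exec ?S s' ''own'' m 0 = h.own m" "exec ?S s' ''o'' 0 0 = m" "exec ?S s' ''bw'' 0 0 = w"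
      using e'[of "''own''"] e'[of "''bw''"] tb m2 m(3) w by (simp_all add: exec_frame tab_def oks)
    have S: "exec ?S s' ''S'' = s' ''S''" by (simp add: exec_frame)
    have "exec P_acc1 s' ''S'' u y = (if h.acc lev H m w \<and> u = h.own m \<and> y = w then 1 else s' ''S'' u y)" for u y
      using fl pos ow S by (auto simp: P_acc1_def upd_apply vo_def)
    then show "?I (Suc m) (setv (exec P_acc1 s') ''o'' (Suc m))"
      using m(2) by (auto simp: less_Suc_eq)
  qed simp_all
  then show ?thesis using u n by (simp add: P_acc_def)
qed

lemma hubs_snoc: "y \<in> h.hubs lev (hs @ [w]) u \<longleftrightarrow>
   y \<in> h.hubs lev hs u \<or> (y = w \<and> (\<exists>r<2*n. h.own r = u \<and> h.acc lev (set hs) r w))"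
proof -
  let ?Q = "\<lambda>xs i. \<exists>r<2*n. h.own r = u \<and> h.acc lev (set (take i xs)) r y"
  have "(\<exists>i<length (hs @ [w]). y = (hs @ [w]) ! i \<and> ?Q (hs @ [w]) i) \<longleftrightarrow>
      (\<exists>i<length hs. y = hs ! i \<and> ?Q hs i) \<or> (y = w \<and> ?Q hs (length hs))"
  proof -
    have "(\<exists>i<Suc m. P i) \<longleftrightarrow> (\<exists>i<m. P i) \<or> P m" for m and P :: "nat \<Rightarrow> bool" by (auto simp: less_Suc_eq)
    then have "(\<exists>i<length (hs @ [w]). y = (hs @ [w]) ! i \<and> ?Q (hs @ [w]) i) \<longleftrightarrow>
        (\<exists>i<length hs. y = (hs @ [w]) ! i \<and> ?Q (hs @ [w]) i) \<or>
        (y = (hs @ [w]) ! length hs \<and> ?Q (hs @ [w]) (length hs))"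
      by (simp only: length_append_singleton)
    also have "(\<exists>i<length hs. y = (hs @ [w]) ! i \<and> ?Q (hs @ [w]) i) \<longleftrightarrow> (\<exists>i<length hs. y = hs ! i \<and> ?Q hs i)"
      by (rule ex_cong1, rule conj_cong[OF refl]) (simp add: nth_append)
    finally show ?thesis by (simp only: nth_append_length take_append diff_self_eq_0 take_0 append_Nil2 take_all order_refl)
  qed
  then show ?thesis unfolding h.hubs_def Un_iff mem_Collect_eq
    by (simp only: disj_assoc take_all order_refl cong: conj_cong)
qed

lemma exec_body:
  assumes inv: "dyn2 hs A pc c s" and re: "h.g.reach hs A pc c" and len: "length hs < n"
  shows "\<exists>w A' pc' c'. dyn2 (hs @ [w]) A' pc' c' (exec P_body s) \<and> h.g.reach (hs @ [w]) A' pc' c'"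
proof -
  let ?H = "set hs"
  have tb: "tab s" and dy: "dyn ?H A c s" and pc: "s ''pc'' 0 0 = pc"
    and pk: "\<And>x. x < n \<Longrightarrow> s ''pk'' x 0 = of_bool (x \<in> ?H)"
    and S: "\<And>u y. u < n \<Longrightarrow> y < n \<Longrightarrow> s ''S'' u y = of_bool (y \<in> h.hubs lev hs u)"
    using inv by (auto simp: dyn2_def)
  have rb: "distinct hs" "?H \<subseteq> {..<n}" "\<And>r. c r \<le> length hs" using h.g.reach_basic[OF re] by auto
  have c: "c r \<le> n" for r using rb(3)[of r] len by simp
  have ex: "\<exists>x<n. x \<notin> ?H"
  proof (rule ccontr)
    assume "\<not> ?thesis"
    then have "{..<n} \<subseteq> ?H" by auto
    then have "n \<le> card ?H" using card_mono[of ?H "{..<n}"] by simp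
    then show False using len card_length[of hs] by simp
  qed
  define s1 where "s1 = exec P_pick s"
  define s2 where "s2 = exec P_acc s1"
  define s3 where "s3 = exec P_c s2"
  define s4 where "s4 = exec P_A s3"
  define s5 where "s5 = exec P_al s4"
  define s6 where "s6 = exec P_mm s5"
  define w where "w = s1 ''bw'' 0 0"
  have am: "s1 ''am'' 0 0 = h.g.am ?H" and w: "w < n" "w \<notin> ?H"
    and wmin: "\<And>x. x < n \<Longrightarrow> x \<notin> ?H \<Longrightarrow> score A c ?H w \<le> score A c ?H x"
    using exec_pick[OF tb dy c pk ex] by (auto simp: s1_def w_def)
  have tb1: "tab s1" unfolding s1_def by (rule tvars_frame[OF tb tv(1)])
  have tb2: "tab s2" unfolding s2_def by (rule tvars_frame[OF tb1 tv(2)])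
  have tb3: "tab s3" unfolding s3_def by (rule tvars_frame[OF tb2 tv(3)])
  have tb4: "tab s4" unfolding s4_def by (rule tvars_frame[OF tb3 tv(4)])
  have tb5: "tab s5" unfolding s5_def by (rule tvars_frame[OF tb4 tv(5)])
  have tb6: "tab s6" unfolding s6_def by (rule tvars_frame[OF tb5 tv(6)])
  have nn: "s' ''n'' 0 0 = n \<and> s' ''n2'' 0 0 = 2 * n \<and> s' ''one'' 0 0 = 1" if "tab s'" for s'
    using that by (auto simp: tab_def base_def)
  have s1e: "s1 ''al'' = s ''al''" "s1 ''mm'' = s ''mm''" "s1 ''A'' = s ''A''" "s1 ''c'' = s ''c''" "s1 ''pc'' = s ''pc''"
      "s1 ''pk'' = s ''pk''" "s1 ''S'' = s ''S''" by (simp_all add: s1_def exec_frame)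
  have al1: "alok ?H s1" and mm1: "mmok ?H s1" and A1: "s1 ''A'' 0 0 = A" and c1: "\<And>r. r < 2 * n \<Longrightarrow> s1 ''c'' r 0 = c r"
    using dy s1e by (auto simp: dyn_def oks)
  have S2: "s2 ''S'' u y = of_bool (y \<in> h.hubs lev (hs @ [w]) u)" if "u < n" "y < n" for u y
    unfolding s2_def hubs_snoc using exec_acc[OF tb1 al1 w_def[symmetric] w(1) that] S[OF that] s1e by auto
  have s2e: "s2 x = s1 x" if "x \<in> {''al'', ''mm'', ''A'', ''c'', ''pc'', ''pk'', ''bw'', ''am''}" for x
    using that by (auto simp: s2_def exec_frame)
  \<comment> \<open>\<open>am\<close> still holds its value from before the pick, so it decides
    which rule of \<open>reach\<close> applies.\<close>
  define c' where "c' = (if h.g.am ?H > 0 then c else (\<lambda>r. c r + of_bool (r < 2 * n \<and> h.g.alive ?H r w)))"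
  have c3: "s3 ''c'' r 0 = c' r" if r: "r < 2 * n" for r
  proof (cases "h.g.am ?H > 0")
    case True
    then show ?thesis using s2e[of "''c''"] s2e[of "''am''"] am c1[OF r] by (simp add: s3_def P_c_def c'_def)
  next
    case False
    let ?F = "FILL ''c'' ''o'' ''n2'' ''z'' ''one'' (''t'' ::= Plus (G1 ''c'' (V ''o'')) (Get ''al'' (V ''o'') (V ''bw''))) ''t''"
    have e: "s3 = exec ?F s2" using False s2e[of "''am''"] am by (simp add: s3_def P_c_def)
    have "exec ?F s2 ''c'' r 0 = (if r < s2 ''n2'' 0 0 \<and> 0 < s2 ''one'' 0 0 then c' r else s2 ''c'' r 0)"
    proof (rule exec_FILL[where g = "\<lambda>r _. c' r"])
      fix a z s' assume h: "a < s2 ''n2'' 0 0" "z < s2 ''one'' 0 0" "s' ''o'' 0 0 = a" "s' ''z'' 0 0 = z"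
        "\<And>x. x \<notin> mods (''t'' ::= Plus (G1 ''c'' (V ''o'')) (Get ''al'' (V ''o'') (V ''bw''))) \<Longrightarrow>
           x \<noteq> ''c'' \<Longrightarrow> x \<noteq> ''o'' \<Longrightarrow> x \<noteq> ''z'' \<Longrightarrow> s' x = s2 x" "s' ''c'' a z = s2 ''c'' a z"
      have z: "z = 0" "a < 2 * n" using h(1,2) nn[OF tb2] by auto
      have "s' ''al'' = s2 ''al''" "s' ''bw'' = s2 ''bw''" using h(5) by simp_all
      then have "s' ''al'' a w = of_bool (h.g.alive ?H a w)" "s' ''bw'' 0 0 = w" "s' ''c'' a 0 = c a"
        using s2e[of "''al''"] s2e[of "''bw''"] s2e[of "''c''"] al1 z w(1) h(6) c1[OF z(2)] by (simp_all add: oks w_def)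
      then show "exec (''t'' ::= Plus (G1 ''c'' (V ''o'')) (Get ''al'' (V ''o'') (V ''bw''))) s' ''t'' 0 0 = c' a"
        using z h(3) False by (simp add: c'_def)
    qed simp_all
    then show ?thesis unfolding e using r nn[OF tb2] by simp
  qed
  have s3e: "s3 x = s2 x" if "x \<in> {''al'', ''mm'', ''A'', ''pc'', ''pk'', ''bw'', ''am'', ''S''}" for x
    using that unfolding s3_def by (intro exec_frame) auto
  define A' where "A' = (if h.g.am ?H > 0 \<and> A < h.g.AQ \<and> n \<le> pc + 2 * j then 2 * A else A)"
  define pc' where "pc' = (if h.g.am ?H > 0 \<and> A < h.g.AQ then if n \<le> pc + 2 * j then 0 else pc + 2 * j else pc)"
  have A4: "s4 ''A'' 0 0 = A'" "s4 ''pc'' 0 0 = pc'"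
  proof -
    have "s3 ''A'' 0 0 = A" "s3 ''pc'' 0 0 = pc" "s3 ''am'' 0 0 = h.g.am ?H"
      using s3e[of "''A''"] s3e[of "''pc''"] s3e[of "''am''"] s2e[of "''A''"] s2e[of "''pc''"] s2e[of "''am''"] A1 am s1e pc
      by simp_all
    moreover have "s3 ''AQ'' 0 0 = h.g.AQ" "s3 ''e'' 0 0 = 2 * j" "s3 ''n'' 0 0 = n"
      using tb3 by (auto simp: tab_def pars_def base_def h.g.AQ_def)
    ultimately show "s4 ''A'' 0 0 = A'" "s4 ''pc'' 0 0 = pc'"
      unfolding s4_def P_A_def A'_def pc'_def by auto
  qed
  have s4e: "s4 x = s3 x" if "x \<in> {''al'', ''mm'', ''pk'', ''bw'', ''am'', ''S'', ''c''}" for x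
    using that unfolding s4_def by (intro exec_frame) auto
  have bw4: "s4 ''bw'' 0 0 = w" using s4e[of "''bw''"] s3e[of "''bw''"] s2e[of "''bw''"] by (simp add: w_def)
  have al4: "alok ?H s4" using s4e[of "''al''"] s3e[of "''al''"] s2e[of "''al''"] al1 by (simp add: oks)
  have al5: "alok (insert w ?H) s5"
    unfolding alok_def
  proof (intro allI impI)
    fix r x assume rx: "r < 2 * n" "x < n"
    have "s5 ''al'' r x = (if r < s4 ''n2'' 0 0 \<and> x < s4 ''n'' 0 0 then of_bool (h.g.alive (insert w ?H) r x) else s4 ''al'' r x)"
      unfolding s5_def P_al_def
    proof (rule exec_FILL)
      fix a b s' assume h: "a < s4 ''n2'' 0 0" "b < s4 ''n'' 0 0" "s' ''o'' 0 0 = a" "s' ''x'' 0 0 = b"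
        "\<And>x. x \<notin> mods (IFE ''t'' (onS (V ''bw'') (V ''x'')) (N 0) (Get ''al'' (V ''o'') (V ''x''))) \<Longrightarrow>
           x \<noteq> ''al'' \<Longrightarrow> x \<noteq> ''o'' \<Longrightarrow> x \<noteq> ''x'' \<Longrightarrow> s' x = s4 x" "s' ''al'' a b = s4 ''al'' a b"
      have ab: "a < 2 * n" "b < n" using h(1,2) nn[OF tb4] by auto
      have e: "s' ''r'' = s4 ''r''" "s' ''own'' = s4 ''own''" "s' ''zz'' = s4 ''zz''" "s' ''bw'' = s4 ''bw''" using h(5) by simp_all
      have ok': "rok s'" "ownok s'" "zzok s'" using tb4 e by (simp_all add: tab_def rok_def oks)
      have "bval (onS (V ''bw'') (V ''x'')) s' \<longleftrightarrow> w \<in> h.seg a b"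
        using bval_onS[OF ok' h(3) ab(1), of "V ''bw''" "V ''x''"] e bw4 w ab h(4) by simp
      moreover have "s' ''al'' a b = of_bool (h.g.alive ?H a b)" using h(6) al4 ab by (simp add: oks)
      ultimately show "exec (IFE ''t'' (onS (V ''bw'') (V ''x'')) (N 0) (Get ''al'' (V ''o'') (V ''x''))) s' ''t'' 0 0
          = of_bool (h.g.alive (insert w ?H) a b)"
        using h(3,4) by (auto simp: h.g.alive_def)
    qed simp_all
    then show "s5 ''al'' r x = of_bool (h.g.alive (insert w ?H) r x)" using rx nn[OF tb4] by simp
  qed
  have s5e: "s5 x = s4 x" if "x \<in> {''mm'', ''pk'', ''bw'', ''S'', ''c'', ''A'', ''pc''}" for x
    using that unfolding s5_def by (intro exec_frame) auto
  have mm5: "mmok ?H s5" using s5e[of "''mm''"] s4e[of "''mm''"] s3e[of "''mm''"] s2e[of "''mm''"] mm1 by (simp add: oks)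
  have mm6: "mmok (insert w ?H) s6"
    unfolding mmok_def
  proof (intro allI impI)
    fix q y assume qy: "q < n" "y < n"
    have "s6 ''mm'' q y = (if q < s5 ''n'' 0 0 \<and> y < s5 ''n'' 0 0 then of_bool ((q, y) \<in> h.Ms \<and> PP q y \<inter> insert w ?H = {}) else s5 ''mm'' q y)"
      unfolding s6_def P_mm_def
    proof (rule exec_FILL)
      fix a b s' assume h: "a < s5 ''n'' 0 0" "b < s5 ''n'' 0 0" "s' ''q'' 0 0 = a" "s' ''y'' 0 0 = b"
        "\<And>x. x \<notin> mods (IFE ''t'' (onP (V ''q'') (V ''bw'') (V ''y'')) (N 0) (Get ''mm'' (V ''q'') (V ''y''))) \<Longrightarrow>
           x \<noteq> ''mm'' \<Longrightarrow> x \<noteq> ''q'' \<Longrightarrow> x \<noteq> ''y'' \<Longrightarrow> s' x = s5 x" "s' ''mm'' a b = s5 ''mm'' a b"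
      have ab: "a < n" "b < n" using h(1,2) nn[OF tb5] by auto
      have e: "s' ''r'' = s5 ''r''" "s' ''bw'' = s5 ''bw''" using h(5) by simp_all
      have "rok s'" using tb5 e by (simp add: tab_def rok_def)
      then have "bval (onP (V ''q'') (V ''bw'') (V ''y'')) s' \<longleftrightarrow> w \<in> PP a b"
        using bval_onP[of s' "V ''q''" "V ''bw''" "V ''y''"] e bw4 s5e[of "''bw''"] w ab h(3,4) by simp
      moreover have "s' ''mm'' a b = of_bool ((a, b) \<in> h.Ms \<and> PP a b \<inter> ?H = {})" using h(6) mm5 ab by (simp add: oks)
      ultimately show "exec (IFE ''t'' (onP (V ''q'') (V ''bw'') (V ''y'')) (N 0) (Get ''mm'' (V ''q'') (V ''y''))) s' ''t'' 0 0
          = of_bool ((a, b) \<in> h.Ms \<and> PP a b \<inter> insert w ?H = {})"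
        using h(3,4) by auto
    qed simp_all
    then show "s6 ''mm'' q y = of_bool ((q, y) \<in> h.Ms \<and> PP q y \<inter> insert w ?H = {})" using qy nn[OF tb5] by simp
  qed
  have s6e: "s6 x = s5 x" if "x \<in> {''al'', ''pk'', ''bw'', ''S'', ''c'', ''A'', ''pc''}" for x
    using that unfolding s6_def by (intro exec_frame) auto
  define s7 where "s7 = upd s6 ''pk'' w 0 1"
  have bw6: "s6 ''bw'' 0 0 = w" using s6e[of "''bw''"] s5e[of "''bw''"] bw4 by simp
  have ex7: "exec P_body s = s7"
    unfolding P_body_def exec.simps(2,3) s1_def[symmetric] s2_def[symmetric] s3_def[symmetric] s4_def[symmetric]
      s5_def[symmetric] s6_def[symmetric] using bw6 by (simp add: s7_def)
  have d7: "dyn2 (hs @ [w]) A' pc' c' s7"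
    unfolding dyn2_def
  proof (intro conjI allI impI)
    show "tab s7" by (rule tab_cong[OF tb6]) (auto simp: s7_def tvars_def bvars_def pvars_def)
    show "dyn (set (hs @ [w])) A' c' s7"
      unfolding dyn_def using al5 mm6 A4 c3 s6e[of "''al''"] s6e[of "''A''"] s5e[of "''A''"] s6e[of "''c''"] s5e[of "''c''"] s4e[of "''c''"]
      by (simp add: oks s7_def)
    show "s7 ''pc'' 0 0 = pc'" using A4 s6e[of "''pc''"] s5e[of "''pc''"] by (simp add: s7_def)
    show "s7 ''pk'' x 0 = of_bool (x \<in> set (hs @ [w]))" if "x < n" for x
      using pk[OF that] s1e s2e[of "''pk''"] s3e[of "''pk''"] s4e[of "''pk''"] s5e[of "''pk''"] s6e[of "''pk''"]
      by (simp add: s7_def upd_apply)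
    show "s7 ''S'' u y = of_bool (y \<in> h.hubs lev (hs @ [w]) u)" if "u < n" "y < n" for u y
      using S2[OF that] s3e[of "''S''"] s4e[of "''S''"] s5e[of "''S''"] s6e[of "''S''"] by (simp add: s7_def)
  qed
  moreover have "h.g.reach (hs @ [w]) A' pc' c'"
  proof (cases "h.g.am ?H > 0")
    case True
    have "h.g.reach (hs @ [w]) A' pc' c"
    proof (rule h.g.reach_Y[OF re w True])
      show "h.g.scoreY A ?H w \<le> h.g.scoreY A ?H x" if "x < n" "x \<notin> ?H" for x
        using wmin[OF that] True by (simp add: score_def)
    qed (use True in \<open>simp_all add: A'_def pc'_def\<close>)
    then show ?thesis using True by (simp add: c'_def)
  next
    case False
    have "h.g.reach (hs @ [w]) A pc c'"
    proof (rule h.g.reach_Z[OF re w])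
      show "h.g.scoreZ c ?H w \<le> h.g.scoreZ c ?H x" if "x < n" "x \<notin> ?H" for x
        using wmin[OF that] False by (simp add: score_def)
    qed (use False in \<open>simp_all add: c'_def\<close>)
    then show ?thesis using False by (simp add: A'_def pc'_def)
  qed
  ultimately show ?thesis unfolding ex7 by blast
qed

lemma exec_main:
  assumes tb: "tab s" and al: "alok {} s" and mm: "mmok {} s"
  shows "\<exists>hs A pc c. dyn2 hs A pc c (exec P_main s) \<and> h.g.reach hs A pc c \<and> length hs = n"
proof -
  define s0 where "s0 = exec P_init s"
  have n: "s ''n'' 0 0 = n" "s ''n2'' 0 0 = 2 * n" "s ''one'' 0 0 = 1" using tb by (auto simp: tab_def base_def)
  have tb0: "tab s0" unfolding s0_def by (rule tvars_frame[OF tb]) (simp add: tvars_def bvars_def pvars_def)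
  let ?s1 = "setv (setv s ''A'' (s ''A0'' 0 0)) ''pc'' 0"
  let ?F1 = "FILL ''pk'' ''x'' ''n'' ''z'' ''one'' (''t'' ::= N 0) ''t''"
  let ?F2 = "FILL ''c'' ''o'' ''n2'' ''z'' ''one'' (''t'' ::= N 0) ''t''"
  let ?b = "orb (And (posb (V ''md'')) (posb (G1 ''X'' (V ''y'')))) (posb (Get ''hh'' (V ''u'') (V ''y'')))"
  let ?F3 = "FILL ''S'' ''u'' ''n'' ''y'' ''n'' (IFE ''t'' ?b (N 1) (N 0)) ''t''"
  have s0: "s0 = exec ?F3 (exec ?F2 (exec ?F1 ?s1))" by (simp add: s0_def P_init_def)
  have 1: "exec ?F1 ?s1 ''pk'' x 0 = 0" if "x < n" for x
    by (subst exec_FILL[where g = "\<lambda>_ _. 0"]) (use that n in simp_all)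
  have 2: "exec ?F2 (exec ?F1 ?s1) ''c'' r 0 = 0" if "r < 2 * n" for r
    by (subst exec_FILL[where g = "\<lambda>_ _. 0"]) (use that n in \<open>simp_all add: exec_frame\<close>)
  let ?s3 = "exec ?F2 (exec ?F1 ?s1)"
  have n3: "?s3 ''n'' 0 0 = n" using n by (simp add: exec_frame)
  have 3: "s0 ''S'' u y = of_bool (y \<in> h.hubs lev [] u)" if uy: "u < n" "y < n" for u y
  proof -
    have "exec ?F3 ?s3 ''S'' u y = (if u < ?s3 ''n'' 0 0 \<and> y < ?s3 ''n'' 0 0 then of_bool (y \<in> h.hubs lev [] u) else ?s3 ''S'' u y)"
    proof (rule exec_FILL)
      fix a b s' assume h: "a < ?s3 ''n'' 0 0" "b < ?s3 ''n'' 0 0" "s' ''u'' 0 0 = a" "s' ''y'' 0 0 = b"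
        "\<And>x. x \<notin> mods (IFE ''t'' ?b (N 1) (N 0)) \<Longrightarrow> x \<noteq> ''S'' \<Longrightarrow> x \<noteq> ''u'' \<Longrightarrow> x \<noteq> ''y'' \<Longrightarrow> s' x = ?s3 x"
      have ab: "a < n" "b < n" using h(1,2) n3 by auto
      have "s' ''md'' = s ''md''" "s' ''X'' = s ''X''" "s' ''hh'' = s ''hh''" using h(5) by (simp_all add: exec_frame)
      then have v: "s' ''md'' 0 0 = of_bool md" "s' ''X'' b 0 = of_bool (b \<in> X)" "s' ''hh'' a b = of_bool (h.Hv a b)"
        using tb ab by (simp_all add: tab_def pars_def oks)
      have "b \<in> h.hubs lev [] a \<longleftrightarrow> (md \<and> b \<in> X) \<or> h.Hv a b"
        using ab unfolding h.hubs_def h.R_def by auto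
      then show "exec (IFE ''t'' ?b (N 1) (N 0)) s' ''t'' 0 0 = of_bool (b \<in> h.hubs lev [] a)"
        using v h(3,4) by simp
    qed simp_all
    then show ?thesis unfolding s0 using uy n3 by simp
  qed
  have e0: "s0 ''al'' = s ''al''" "s0 ''mm'' = s ''mm''" "s0 ''A'' 0 0 = s ''A0'' 0 0" "s0 ''pc'' 0 0 = 0"
    by (simp_all add: s0 exec_frame)
  have pk0: "s0 ''pk'' x 0 = 0" if "x < n" for x using 1[OF that] by (simp add: s0 exec_frame)
  have c0: "s0 ''c'' r 0 = 0" if "r < 2 * n" for r using 2[OF that] by (simp add: s0 exec_frame)
  have A0: "s ''A0'' 0 0 = n * (2 * j)" using tb by (simp add: tab_def pars_def)
  have d0: "dyn2 [] (n * (2 * j)) 0 (\<lambda>_. 0) s0"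
    unfolding dyn2_def dyn_def using tb0 al mm e0 A0 pk0 c0 3 by (simp add: oks)
  let ?I = "\<lambda>m s'. \<exists>hs A pc c. dyn2 hs A pc c s' \<and> h.g.reach hs A pc c \<and> length hs = m"
  have d_t: "dyn2 hs A pc c (setv s' ''t_'' m)" if "dyn2 hs A pc c s'" for hs A pc c s' m
  proof -
    have "tab (setv s' ''t_'' m)"
      by (rule tab_cong[of s']) (use that in \<open>auto simp: dyn2_def tvars_def bvars_def pvars_def\<close>)
    moreover have "dyn (set hs) A c (setv s' ''t_'' m)"
      by (rule dyn_cong[of "set hs" A c s']) (use that in \<open>auto simp: dyn2_def\<close>)
    ultimately show ?thesis using that by (simp add: dyn2_def)
  qed
  have "?I (s0 ''n'' 0 0) (exec (For ''t_'' ''n'' P_body) s0)"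
  proof (rule For_inv[where I = ?I])
    show "?I 0 (setv s0 ''t_'' 0)" using d_t[OF d0] h.g.reach_init by auto
    fix m s' assume m: "m < s0 ''n'' 0 0" "?I m s'"
    then obtain hs A pc c where h: "dyn2 hs A pc c s'" "h.g.reach hs A pc c" "length hs = m" by blast
    have "length hs < n" using m(1) h(3) tb0 by (simp add: tab_def base_def)
    from exec_body[OF h(1,2) this] obtain w A' pc' c' where
      "dyn2 (hs @ [w]) A' pc' c' (exec P_body s')" "h.g.reach (hs @ [w]) A' pc' c'" by blast
    with d_t[OF this(1), of "Suc m"] h(3) have "dyn2 (hs @ [w]) A' pc' c' (setv (exec P_body s') ''t_'' (Suc m)) \<and>
        h.g.reach (hs @ [w]) A' pc' c' \<and> length (hs @ [w]) = Suc m" by simp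
    then show "?I (Suc m) (setv (exec P_body s') ''t_'' (Suc m))" by blast
  qed simp_all
  moreover have "s0 ''n'' 0 0 = n" using tb0 by (simp add: tab_def base_def)
  ultimately show ?thesis by (simp add: P_main_def s0_def)
qed

end

section \<open>Writing the labels\<close>

definition P_app :: "aexp \<Rightarrow> lp" where
  "P_app e = (Asg ''bit'' (V ''u'') (G1 ''len'' (V ''u'')) e ;;
     Asg ''len'' (V ''u'') (N 0) (Plus (G1 ''len'' (V ''u'')) (N 1)))"
definition P_emit1 :: lp where
  "P_emit1 = Cnd (posb (V ''g'')) (SUMIF ''hf'' ''x'' ''n'' (leb (mulc 2 (Plus (V ''x'') (N 1))) (V ''g'')) (N 1) ;;
     P_app (N 1) ;; P_app (Minus (V ''g'') (mulc 2 (V ''hf''))) ;; ''g'' ::= V ''hf'') Skp"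
definition P_emit :: "aexp \<Rightarrow> lp" where
  "P_emit e = (''g'' ::= e ;; For ''h'' ''n'' P_emit1 ;; P_app (N 0))"
definition P_ent :: lp where
  "P_ent = (P_emit (Minus (V ''i'') (V ''lp'')) ;;
     P_emit (Minus (Get ''d'' (V ''u'') (V ''v'')) (V ''ld'')) ;;
     P_emit (Minus (V ''ld'') (Get ''d'' (V ''u'') (V ''v''))) ;;
     ''lp'' ::= V ''i'' ;; ''ld'' ::= Get ''d'' (V ''u'') (V ''v''))"
text \<open>The node with number \<open>i\<close> is found by search, so the entries appear in
  increasing order of identifiers.\<close>

definition P_lab1 :: lp where
  "P_lab1 = Cnd (And (eqb (G1 ''pos'' (V ''v'')) (V ''i'')) (posb (Get ''S'' (V ''u'') (V ''v'')))) P_ent Skp"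
definition P_lab2 :: lp where
  "P_lab2 = (Asg ''len'' (V ''u'') (N 0) (N 0) ;; ''lp'' ::= N 0 ;; ''ld'' ::= N 0 ;;
     For ''i'' ''n'' (For ''v'' ''n'' P_lab1))"
definition P_lab :: lp where "P_lab = For ''u'' ''n'' P_lab2"

lemma lab_progs [simp]:
  "mods (P_app e) = {''bit'', ''len''}" "ok (P_app e)" "bnds (P_app e) = {}"
  "mods P_emit1 = {''bit'', ''len'', ''hf'', ''x'', ''_t'', ''g''}" "ok P_emit1" "bnds P_emit1 = {''n''}"
  "mods (P_emit e) = {''bit'', ''len'', ''hf'', ''x'', ''_t'', ''g'', ''h''}" "ok (P_emit e)" "bnds (P_emit e) = {''n''}"
  by (auto simp: P_app_def P_emit1_def P_emit_def)
lemma lab_progs2 [simp]: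
  "mods P_ent = {''bit'', ''len'', ''hf'', ''x'', ''_t'', ''g'', ''h'', ''lp'', ''ld''}" "ok P_ent" "bnds P_ent = {''n''}"
  "mods P_lab1 = mods P_ent" "ok P_lab1" "bnds P_lab1 = {''n''}"
  by (auto simp: P_ent_def P_lab1_def)
lemma lab_progs3 [simp]:
  "mods P_lab2 = {''i'', ''v''} \<union> mods P_ent" "ok P_lab2" "bnds P_lab2 = {''n''}"
  by (auto simp: P_lab2_def)
lemma lab_progs4 [simp]:
  "mods P_lab = {''u''} \<union> mods P_lab2" "ok P_lab" "bnds P_lab = {''n''}"
  by (auto simp: P_lab_def)

lemma exec_app:
  "out_labels (exec (P_app e) s) u = out_labels s u @ (if u = s ''u'' 0 0 then [aval e s \<noteq> 0] else [])"
  by (auto simp: P_app_def out_labels_def upd_apply)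

lemma out_cong: "s' ''bit'' = s ''bit'' \<Longrightarrow> s' ''len'' = s ''len'' \<Longrightarrow> out_labels s' u = out_labels s u"
  by (simp add: out_labels_def)

text \<open>The half is found by counting. The code of the number still to be written is appended on
  both sides, so that the equation is an invariant of the rounds.\<close>

lemma exec_emit1:
  assumes n: "s ''g'' 0 0 \<le> s ''n'' 0 0"
  shows "exec P_emit1 s ''g'' 0 0 = s ''g'' 0 0 div 2"
    and "out_labels (exec P_emit1 s) u @ (if u = s ''u'' 0 0 then enc (s ''g'' 0 0 div 2) else []) =
      out_labels s u @ (if u = s ''u'' 0 0 then if s ''g'' 0 0 = 0 then enc 0 else enc (s ''g'' 0 0) else [])"
proof -
  let ?g = "s ''g'' 0 0"
  let ?S = "SUMIF ''hf'' ''x'' ''n'' (leb (mulc 2 (Plus (V ''x'') (N 1))) (V ''g'')) (N 1)"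
  have "exec ?S s ''hf'' 0 0 = (\<Sum>x<s ''n'' 0 0. if 2 * (x + 1) \<le> ?g then 1 else 0)"
    by (rule exec_SUMIF) auto
  also have "\<dots> = (\<Sum>x\<in>{..<s ''n'' 0 0} \<inter> {x. 2 * (x + 1) \<le> ?g}. 1)" by (simp only: sum.If_cases finite_lessThan) simp
  also have "{..<s ''n'' 0 0} \<inter> {x. 2 * (x + 1) \<le> ?g} = {..<?g div 2}" using n by auto
  finally have hf: "exec ?S s ''hf'' 0 0 = ?g div 2" by simp
  have fr: "exec ?S s ''g'' = s ''g''" "exec ?S s ''u'' = s ''u''" "exec ?S s ''bit'' = s ''bit''" "exec ?S s ''len'' = s ''len''"
    by (simp_all add: exec_frame)
  let ?s1 = "exec ?S s" let ?s2 = "exec (P_app (N 1)) ?s1" let ?e = "Minus (V ''g'') (mulc 2 (V ''hf''))"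
  have m: "aval ?e ?s2 = ?g mod 2" using hf fr by (simp add: exec_frame minus_mult_div_eq_mod)
  have "odd ?g \<longleftrightarrow> ?g mod 2 \<noteq> 0" by presburger
  then have o: "out_labels (exec P_emit1 s) u = out_labels s u @ (if u = s ''u'' 0 0 then [True, odd ?g] else [])" if "?g > 0"
    using that m fr out_cong[of ?s1 s u] by (simp add: P_emit1_def exec_app exec_frame out_cong[of "setv _ ''g'' _"])
  show "exec P_emit1 s ''g'' 0 0 = ?g div 2" using hf by (simp add: P_emit1_def exec_frame)
  show "out_labels (exec P_emit1 s) u @ (if u = s ''u'' 0 0 then enc (?g div 2) else []) =
      out_labels s u @ (if u = s ''u'' 0 0 then if ?g = 0 then enc 0 else enc ?g else [])"
  proof (cases "?g = 0")
    case True
    then show ?thesis by (simp add: P_emit1_def)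
  next
    case False
    then show ?thesis using o by (simp add: enc.simps[of ?g])
  qed
qed

lemma exec_emit:
  assumes n: "aval e s \<le> s ''n'' 0 0"
  shows "out_labels (exec (P_emit e) s) u = out_labels s u @ (if u = s ''u'' 0 0 then enc (aval e s) else [])"
proof -
  let ?g = "aval e s" let ?s = "setv s ''g'' ?g" let ?N = "s ''n'' 0 0" let ?b = "u = s ''u'' 0 0"
  let ?I = "\<lambda>m s'. s' ''g'' 0 0 \<le> ?g div 2 ^ m \<and>
     out_labels s' u @ (if ?b then enc (s' ''g'' 0 0) else []) = out_labels s u @ (if ?b then enc ?g else [])"
  have "?I (?s ''n'' 0 0) (exec (For ''h'' ''n'' P_emit1) ?s)"
  proof (rule For_inv[where I = ?I])
    show "?I 0 (setv ?s ''h'' 0)" using out_cong[of "setv ?s ''h'' 0" s u] by simp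
    fix m s' assume h: "m < ?s ''n'' 0 0" "?I m s'" "s' ''h'' 0 0 = m"
      "\<And>x. x \<noteq> ''h'' \<Longrightarrow> x \<notin> mods P_emit1 \<Longrightarrow> s' x = ?s x"
    have e: "s' ''u'' = s ''u''" "s' ''n'' = s ''n''" using h(4)[of "''u''"] h(4)[of "''n''"] by simp_all
    have "s' ''g'' 0 0 \<le> ?g" using h(2) by (meson div_le_dividend le_trans)
    then have le: "s' ''g'' 0 0 \<le> s' ''n'' 0 0" using n e by simp
    have "s' ''g'' 0 0 div 2 \<le> ?g div 2 ^ m div 2" using h(2) by (simp add: div_le_mono)
    also have "\<dots> = ?g div 2 ^ Suc m" by (simp only: power_Suc2 div_mult2_eq)
    finally have "exec P_emit1 s' ''g'' 0 0 \<le> ?g div 2 ^ Suc m" using exec_emit1(1)[of s', OF le] by simp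
    then show "?I (Suc m) (setv (exec P_emit1 s') ''h'' (Suc m))"
      using exec_emit1(1)[of s', OF le] exec_emit1(2)[of s', OF le, of u] h(2) e out_cong[of "setv (exec P_emit1 s') ''h'' (Suc m)" "exec P_emit1 s'" u]
      by (cases ?b) auto
  qed simp_all
  note I = this
  let ?s3 = "exec (For ''h'' ''n'' P_emit1) ?s"
  \<comment> \<open>There are at least as many rounds as bits; surplus rounds find
    \<open>g = 0\<close> and do nothing.\<close>
  have "?g < 2 ^ ?N" using n less_exp[of ?N] by linarith
  then have "?s3 ''g'' 0 0 = 0" using I by simp
  moreover have "?s3 ''u'' = s ''u''" by (simp add: exec_frame del: exec.simps)
  moreover have "exec (P_emit e) s = exec (P_app (N 0)) ?s3" by (simp add: P_emit_def)
  ultimately show ?thesis using I by (auto simp: exec_app enc.simps[of 0] simp del: exec.simps)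
qed

lemma exec_ent:
  assumes u: "s ''u'' 0 0 = u" and x: "s ''i'' 0 0 = i" "s ''v'' 0 0 = v" "s ''d'' u v = dv" "s ''lp'' 0 0 = p" "s ''ld'' 0 0 = q"
    and le: "i \<le> s ''n'' 0 0" "dv \<le> s ''n'' 0 0" "q \<le> s ''n'' 0 0"
  shows "out_labels (exec P_ent s) u' = out_labels s u' @ (if u' = u then enc3 (p, q) (i, dv) else [])"
    and "exec P_ent s ''lp'' 0 0 = i" and "exec P_ent s ''ld'' 0 0 = dv"
proof -
  let ?e1 = "Minus (V ''i'') (V ''lp'')" let ?e2 = "Minus (Get ''d'' (V ''u'') (V ''v'')) (V ''ld'')"
  let ?e3 = "Minus (V ''ld'') (Get ''d'' (V ''u'') (V ''v''))"
  let ?s1 = "exec (P_emit ?e1) s" let ?s2 = "exec (P_emit ?e2) ?s1" let ?s3 = "exec (P_emit ?e3) ?s2"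
  have f: "?s1 x = s x" "?s2 x = s x" "?s3 x = s x" if "x \<in> {''u'', ''i'', ''v'', ''d'', ''lp'', ''ld'', ''n''}" for x
    using that by (auto simp: exec_frame)
  have 1: "aval ?e1 s = i - p" "aval ?e2 ?s1 = dv - q" "aval ?e3 ?s2 = q - dv" using u x by (simp_all add: f)
  have 2: "out_labels ?s1 u' = out_labels s u' @ (if u' = u then enc (i - p) else [])"
    "out_labels ?s2 u' = out_labels ?s1 u' @ (if u' = u then enc (dv - q) else [])"
    "out_labels ?s3 u' = out_labels ?s2 u' @ (if u' = u then enc (q - dv) else [])"
    by (subst exec_emit; use 1 u le in \<open>simp add: f\<close>)+
  have e: "exec P_ent s = setv (setv ?s3 ''lp'' i) ''ld'' dv"
    unfolding P_ent_def using u x by (simp add: f)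
  show "exec P_ent s ''lp'' 0 0 = i" "exec P_ent s ''ld'' 0 0 = dv" unfolding e by simp_all
  have "out_labels (exec P_ent s) u' = out_labels ?s3 u'" unfolding e by (rule out_cong) simp_all
  then show "out_labels (exec P_ent s) u' = out_labels s u' @ (if u' = u then enc3 (p, q) (i, dv) else [])"
    using 2 by (simp add: enc3_def)
qed

lemma exec_lab:
  fixes S :: "nat \<Rightarrow> nat set" and xs :: "nat list" and dist :: "nat \<Rightarrow> nat \<Rightarrow> nat"
  assumes n: "s ''n'' 0 0 = n" "length xs = n" "set xs = {..<n}"
    and pos: "\<And>i. i < n \<Longrightarrow> s ''pos'' (xs ! i) 0 = i"
    and S: "\<And>u v. u < n \<Longrightarrow> v < n \<Longrightarrow> s ''S'' u v = of_bool (v \<in> S u)"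
    and d: "\<And>u v. u < n \<Longrightarrow> v < n \<Longrightarrow> s ''d'' u v = dist u v" "\<And>u v. u < n \<Longrightarrow> v < n \<Longrightarrow> dist u v \<le> n"
    and u: "u < n"
  shows "out_labels (exec P_lab s) u = encl (0, 0) (map (\<lambda>i. (i, dist u (xs ! i))) (filter (\<lambda>i. xs ! i \<in> S u) [0..<n]))"
proof -
  define lst where "lst u m = map (\<lambda>i. (i, dist u (xs ! i))) (filter (\<lambda>i. xs ! i \<in> S u) [0..<m])" for u m
  have lst_Suc: "lst u (Suc m) = (if xs ! m \<in> S u then lst u m @ [(m, dist u (xs ! m))] else lst u m)" for u m
    by (simp add: lst_def)
  have xn: "xs ! i < n" if "i < n" for i using n(2,3) that nth_mem[of i xs] by auto
  have posv: "s ''pos'' v 0 = i \<longleftrightarrow> v = xs ! i" if vi: "v < n" "i < n" for v i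
  proof
    assume "s ''pos'' v 0 = i"
    moreover obtain j where "j < n" "v = xs ! j" using n(2,3) vi in_set_conv_nth[of v xs] by auto
    ultimately show "v = xs ! i" using pos by auto
  qed (use pos vi in auto)
  have last_le: "snd (last ((0, 0) # lst u m)) \<le> n" if "u < n" "m \<le> n" for u m
  proof -
    have "last ((0, 0) # lst u m) \<in> set ((0, 0) # lst u m)" by (rule last_in_set) simp
    then show ?thesis using that d(2) xn by (auto simp: lst_def)
  qed
  let ?J = "\<lambda>m s'. \<forall>u<n. u < m \<longrightarrow> out_labels s' u = encl (0, 0) (lst u n)"
  have "?J (s ''n'' 0 0) (exec (For ''u'' ''n'' P_lab2) s)"
  proof (rule For_inv[where I = ?J])
    fix a s0 assume h: "a < s ''n'' 0 0" "?J a s0" "s0 ''u'' 0 0 = a" "\<And>x. x \<noteq> ''u'' \<Longrightarrow> x \<notin> mods P_lab2 \<Longrightarrow> s0 x = s x"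
    have a: "a < n" using h n by simp
    let ?s1 = "setv (setv (upd s0 ''len'' a 0 0) ''lp'' 0) ''ld'' 0"
    have f1: "?s1 ''n'' = s ''n''" "?s1 ''pos'' = s ''pos''" "?s1 ''S'' = s ''S''" "?s1 ''d'' = s ''d''" "?s1 ''u'' 0 0 = a"
      using h(4)[of "''n''"] h(4)[of "''pos''"] h(4)[of "''S''"] h(4)[of "''d''"] h(3) by simp_all
    define K where "K m s' \<longleftrightarrow> out_labels s' a = encl (0, 0) (lst a m) \<and> (s' ''lp'' 0 0, s' ''ld'' 0 0) = last ((0, 0) # lst a m) \<and>
       (\<forall>u. u \<noteq> a \<longrightarrow> out_labels s' u = out_labels s0 u)" for m s'
    have Kset: "K m (setv s' x k) \<longleftrightarrow> K m s'" if "x \<notin> {''bit'', ''len'', ''lp'', ''ld''}" for m s' x k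
    proof -
      have "out_labels (setv s' x k) u = out_labels s' u" for u by (rule out_cong) (use that in auto)
      moreover have "setv s' x k ''lp'' = s' ''lp''" "setv s' x k ''ld'' = s' ''ld''" using that by auto
      ultimately show ?thesis by (simp add: K_def)
    qed
    have "K (?s1 ''n'' 0 0) (exec (For ''i'' ''n'' (For ''v'' ''n'' P_lab1)) ?s1)"
    proof (rule For_inv[where I = K])
      have "out_labels ?s1 a = []" by (simp add: out_labels_def)
      moreover have "out_labels ?s1 u = out_labels s0 u" if "u \<noteq> a" for u
        using that by (simp add: out_labels_def upd_apply)
      moreover have "lst a 0 = []" by (simp add: lst_def)
      ultimately have "K 0 ?s1" by (simp add: K_def)
      then show "K 0 (setv ?s1 ''i'' 0)" by (subst Kset) simp_all
      fix i s2 assume g: "i < ?s1 ''n'' 0 0" "K i s2" "s2 ''i'' 0 0 = i"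
        "\<And>x. x \<noteq> ''i'' \<Longrightarrow> x \<notin> mods (For ''v'' ''n'' P_lab1) \<Longrightarrow> s2 x = ?s1 x"
      have i: "i < n" using g(1) f1 n by simp
      have f2: "s2 ''n'' = s ''n''" "s2 ''pos'' = s ''pos''" "s2 ''S'' = s ''S''" "s2 ''d'' = s ''d''" "s2 ''u'' 0 0 = a"
        using g(4)[of "''n''"] g(4)[of "''pos''"] g(4)[of "''S''"] g(4)[of "''d''"] g(4)[of "''u''"] f1 by simp_all
      \<comment> \<open>The entry of \<open>i\<close> is complete once the search has passed
        \<open>xs ! i\<close>.\<close>
      let ?K = "\<lambda>m. K (if xs ! i < m then Suc i else i)"
      have "?K (s2 ''n'' 0 0) (exec (For ''v'' ''n'' P_lab1) s2)"
      proof (rule For_inv[where I = ?K])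
        show "?K 0 (setv s2 ''v'' 0)" using g(2) by (simp add: Kset)
        fix v s3 assume k: "v < s2 ''n'' 0 0" "?K v s3" "s3 ''v'' 0 0 = v" "\<And>x. x \<noteq> ''v'' \<Longrightarrow> x \<notin> mods P_lab1 \<Longrightarrow> s3 x = s2 x"
        have v: "v < n" using k(1) f2 n by simp
        have f3: "s3 ''n'' = s ''n''" "s3 ''pos'' = s ''pos''" "s3 ''S'' = s ''S''" "s3 ''d'' = s ''d''" "s3 ''u'' 0 0 = a" "s3 ''i'' 0 0 = i"
          using k(4)[of "''n''"] k(4)[of "''pos''"] k(4)[of "''S''"] k(4)[of "''d''"] k(4)[of "''u''"] k(4)[of "''i''"] f2 g(3) by simp_all
        let ?B = "And (eqb (G1 ''pos'' (V ''v'')) (V ''i'')) (posb (Get ''S'' (V ''u'') (V ''v'')))"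
        have c: "bval (And (eqb (G1 ''pos'' (V ''v'')) (V ''i'')) (posb (Get ''S'' (V ''u'') (V ''v'')))) s3 \<longleftrightarrow> v = xs ! i \<and> v \<in> S a"
          using f3 k(3) posv[OF v i] S[OF a v] by simp
        have "?K (Suc v) (exec P_lab1 s3)"
        proof (cases "v = xs ! i")
          case False
          then have "\<not> bval ?B s3" using c by blast
          then have "exec P_lab1 s3 = s3" by (simp only: P_lab1_def exec.simps if_False)
          moreover have "xs ! i < Suc v \<longleftrightarrow> xs ! i < v" using False by auto
          ultimately show ?thesis using k(2) by simp
        next
          case True
          have Ki: "K i s3" using k(2) True by simp
          show ?thesis
          proof (cases "v \<in> S a")
            case False
            then have "\<not> bval ?B s3" using c by blast
            then have "exec P_lab1 s3 = s3" by (simp only: P_lab1_def exec.simps if_False)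
            moreover have "lst a (Suc i) = lst a i" using False True by (simp add: lst_Suc)
            ultimately show ?thesis using Ki True by (simp add: K_def)
          next
            case Sa: True
            have "bval ?B s3" using c Sa True by blast
            then have e: "exec P_lab1 s3 = exec P_ent s3" by (simp only: P_lab1_def exec.simps if_True)
            have ls: "lst a (Suc i) = lst a i @ [(i, dist a v)]" using Sa True by (simp add: lst_Suc)
            define p q where "p = s3 ''lp'' 0 0" and "q = s3 ''ld'' 0 0"
            have pq: "(p, q) = last ((0, 0) # lst a i)" using Ki by (simp add: K_def p_def q_def)
            have q: "q \<le> n" using last_le[of a i] a i pq by (metis less_imp_le snd_conv)
            have pr: "s3 ''d'' a v = dist a v" "i \<le> s3 ''n'' 0 0" "dist a v \<le> s3 ''n'' 0 0" "q \<le> s3 ''n'' 0 0"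
              using f3 d a v i n(1) q by simp_all
            note ent = exec_ent[OF f3(5,6) k(3) pr(1) p_def[symmetric] q_def[symmetric] pr(2-4)]
            have "K (Suc i) (exec P_ent s3)"
              unfolding K_def ls encl_snoc ent pq using Ki by (simp add: K_def)
            then show ?thesis unfolding e using True by simp
          qed
        qed
        then show "?K (Suc v) (setv (exec P_lab1 s3) ''v'' (Suc v))" by (simp add: Kset)
      qed simp_all
      moreover have "xs ! i < s2 ''n'' 0 0" using xn[OF i] f2 n by simp
      ultimately have "K (Suc i) (exec (For ''v'' ''n'' P_lab1) s2)" by simp
      then show "K (Suc i) (setv (exec (For ''v'' ''n'' P_lab1) s2) ''i'' (Suc i))" by (subst Kset) simp_all
    qed simp_all
    then have K: "K n (exec P_lab2 s0)" using f1 n h(3) by (simp add: P_lab2_def)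
    have "out_labels (setv (exec P_lab2 s0) ''u'' (Suc a)) u = out_labels (exec P_lab2 s0) u" for u
      by (rule out_cong) simp_all
    then show "?J (Suc a) (setv (exec P_lab2 s0) ''u'' (Suc a))"
      using K h(2) by (simp add: K_def less_Suc_eq)
  qed simp_all
  then show ?thesis using u n by (simp add: P_lab_def lst_def)
qed

section \<open>Numbering the nodes\<close>

definition "b_ext = And (posb (G1 ''in'' (V ''x''))) (And (Not (posb (G1 ''in'' (V ''y'')))) (posb (Get ''adj'' (V ''x'') (V ''y''))))"
definition P_ext1 :: lp where
  "P_ext1 = Cnd b_ext (''fx'' ::= V ''x'' ;; ''fy'' ::= V ''y'' ;; ''fl'' ::= N 1) Skp"
definition P_ext :: lp where
  "P_ext = (''fl'' ::= N 0 ;; For ''y'' ''n'' (For ''x'' ''n'' P_ext1))"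
definition P_shift :: lp where
  "P_shift = FILL ''pos'' ''v'' ''n'' ''z'' ''one'' (IFE ''t'' (Less (V ''px'') (G1 ''pos'' (V ''v'')))
     (Plus (G1 ''pos'' (V ''v'')) (N 1)) (G1 ''pos'' (V ''v''))) ''t''"
definition P_ins :: lp where
  "P_ins = (''px'' ::= G1 ''pos'' (V ''fx'') ;; P_shift ;;
     Asg ''pos'' (V ''fy'') (N 0) (Plus (V ''px'') (N 1)) ;; Asg ''in'' (V ''fy'') (N 0) (N 1))"
definition P_ord0 :: lp where
  "P_ord0 = (FILL ''pos'' ''v'' ''n'' ''z'' ''one'' (''t'' ::= N 0) ''t'' ;;
     FILL ''in'' ''v'' ''n'' ''z'' ''one'' (IFE ''t'' (posb (V ''v'')) (N 0) (N 1)) ''t'')"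
definition P_ord1 :: lp where "P_ord1 = (P_ext ;; Cnd (posb (V ''fl'')) P_ins Skp)"
definition P_ord :: lp where "P_ord = (P_ord0 ;; For ''i'' ''n'' P_ord1)"

lemma ord_progs [simp]:
  "mods P_ext1 = {''fx'', ''fy'', ''fl''}" "ok P_ext1" "bnds P_ext1 = {}"
  "mods P_ext = {''fx'', ''fy'', ''fl'', ''x'', ''y''}" "ok P_ext" "bnds P_ext = {''n''}"
  "mods P_shift = {''pos'', ''v'', ''z'', ''t''}" "ok P_shift" "bnds P_shift = {''n'', ''one''}"
  "mods P_ord0 = {''pos'', ''in'', ''v'', ''z'', ''t''}" "ok P_ord0" "bnds P_ord0 = {''n'', ''one''}"
  by (auto simp: P_ext1_def P_ext_def P_shift_def P_ord0_def)
lemma ord_progs2 [simp]: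
  "mods P_ins = {''px'', ''pos'', ''in'', ''v'', ''z'', ''t''}" "ok P_ins" "bnds P_ins = {''n'', ''one''}"
  by (auto simp: P_ins_def)
lemma ord_progs3 [simp]:
  "mods P_ord1 = {''fx'', ''fy'', ''fl'', ''x'', ''y''} \<union> mods P_ins" "ok P_ord1" "bnds P_ord1 = {''n'', ''one''}"
  by (auto simp: P_ord1_def)
lemma ord_progs4 [simp]:
  "mods P_ord = {''i''} \<union> mods P_ord1" "ok P_ord" "bnds P_ord = {''n'', ''one''}"
  by (auto simp: P_ord_def)

text \<open>The scan does not stop at a hit: the last leaving edge found is reported, and any
  leaving edge will do.\<close>

lemma exec_ext:
  assumes n: "s ''n'' 0 0 = n" and Q: "\<And>x y. x < n \<Longrightarrow> y < n \<Longrightarrow>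
      s ''in'' x 0 > 0 \<and> s ''in'' y 0 = 0 \<and> s ''adj'' x y > 0 \<longleftrightarrow> Q x y"
  shows "(exec P_ext s ''fl'' 0 0 = 0 \<and> (\<forall>x<n. \<forall>y<n. \<not> Q x y)) \<or>
    (exec P_ext s ''fl'' 0 0 > 0 \<and> exec P_ext s ''fx'' 0 0 < n \<and> exec P_ext s ''fy'' 0 0 < n \<and>
      Q (exec P_ext s ''fx'' 0 0) (exec P_ext s ''fy'' 0 0))"
proof -
  define J where "J R s' \<longleftrightarrow> (s' ''fl'' 0 0 = 0 \<and> (\<forall>x y. R x y \<longrightarrow> \<not> Q x y)) \<or>
    (s' ''fl'' 0 0 > 0 \<and> s' ''fx'' 0 0 < n \<and> s' ''fy'' 0 0 < n \<and> Q (s' ''fx'' 0 0) (s' ''fy'' 0 0))" for R and s' :: mem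
  have Jset: "J R (setv s' x k) \<longleftrightarrow> J R s'" if "x \<notin> {''fl'', ''fx'', ''fy''}" for R s' x k
  proof -
    have "setv s' x k ''fl'' = s' ''fl''" "setv s' x k ''fx'' = s' ''fx''" "setv s' x k ''fy'' = s' ''fy''" using that by auto
    then show ?thesis by (simp only: J_def)
  qed
  have Jcong: "(\<And>x y. R x y \<longleftrightarrow> R' x y) \<Longrightarrow> J R s' \<longleftrightarrow> J R' s'" for R R' s' by (simp add: J_def)
  let ?s = "setv s ''fl'' 0"
  let ?I = "\<lambda>m. J (\<lambda>x y. x < n \<and> y < m)"
  have "?I (?s ''n'' 0 0) (exec (For ''y'' ''n'' (For ''x'' ''n'' P_ext1)) ?s)"
  proof (rule For_inv[where I = ?I])
    show "?I 0 (setv ?s ''y'' 0)" by (simp add: J_def)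
    fix m s1 assume h: "m < ?s ''n'' 0 0" "?I m s1" "s1 ''y'' 0 0 = m"
      "\<And>x. x \<noteq> ''y'' \<Longrightarrow> x \<notin> mods (For ''x'' ''n'' P_ext1) \<Longrightarrow> s1 x = ?s x"
    have m: "m < n" using h(1) n by simp
    have f1: "s1 ''n'' = s ''n''" "s1 ''in'' = s ''in''" "s1 ''adj'' = s ''adj''"
      using h(4)[of "''n''"] h(4)[of "''in''"] h(4)[of "''adj''"] by simp_all
    let ?K = "\<lambda>a. J (\<lambda>x y. x < n \<and> y < m \<or> x < a \<and> y = m)"
    have "?K (s1 ''n'' 0 0) (exec (For ''x'' ''n'' P_ext1) s1)"
    proof (rule For_inv[where I = ?K])
      show "?K 0 (setv s1 ''x'' 0)" using h(2) by (simp add: Jset)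
      fix a s2 assume g: "a < s1 ''n'' 0 0" "?K a s2" "s2 ''x'' 0 0 = a" "\<And>x. x \<noteq> ''x'' \<Longrightarrow> x \<notin> mods P_ext1 \<Longrightarrow> s2 x = s1 x"
      have a: "a < n" using g(1) f1 n by simp
      have f2: "s2 ''in'' = s ''in''" "s2 ''adj'' = s ''adj''" "s2 ''y'' 0 0 = m"
        using g(4)[of "''y''"] g(4)[of "''in''"] g(4)[of "''adj''"] f1 h(3) by simp_all
      have b: "bval b_ext s2 \<longleftrightarrow> Q a m" using f2 g(3) Q[OF a m] by (simp add: b_ext_def)
      have "?K (Suc a) (exec P_ext1 s2)"
      proof (cases "Q a m")
        case True
        then show ?thesis using b a m f2 g(3) by (simp add: P_ext1_def J_def)
      next
        case False
        then have "exec P_ext1 s2 = s2" using b by (simp add: P_ext1_def)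
        then show ?thesis using g(2) False by (auto simp: J_def less_Suc_eq)
      qed
      then show "?K (Suc a) (setv (exec P_ext1 s2) ''x'' (Suc a))" by (subst Jset) simp_all
    qed simp_all
    then have "?K n (exec (For ''x'' ''n'' P_ext1) s1)" using f1 n by simp
    then have "?I (Suc m) (exec (For ''x'' ''n'' P_ext1) s1)"
      by (subst Jcong[where R' = "\<lambda>x y. x < n \<and> y < m \<or> x < n \<and> y = m"]) (auto simp: less_Suc_eq)
    then show "?I (Suc m) (setv (exec (For ''x'' ''n'' P_ext1) s1) ''y'' (Suc m))" by (subst Jset) simp_all
  qed simp_all
  then have "?I n (exec P_ext s)" using n by (simp add: P_ext_def)
  then show ?thesis by (auto simp: J_def)
qed

text \<open>The list is stored through its inverse, as positions indexed by nodes; an insertion then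
  only increments the positions behind it.\<close>

definition pord :: "nat list \<Rightarrow> nat \<Rightarrow> mem \<Rightarrow> bool" where
  "pord xs n s \<longleftrightarrow> (\<forall>v<n. s ''in'' v 0 = of_bool (v \<in> set xs)) \<and> (\<forall>i<length xs. s ''pos'' (xs ! i) 0 = i)"

lemma exec_ins:
  assumes n: "s ''n'' 0 0 = n" "s ''one'' 0 0 = 1" and xs: "set xs \<subseteq> {..<n}" and p: "pord xs n s"
    and i: "i < length xs" "s ''fx'' 0 0 = xs ! i" and y: "s ''fy'' 0 0 = y" "y < n" "y \<notin> set xs"
  shows "pord (take (Suc i) xs @ y # drop (Suc i) xs) n (exec P_ins s)"
proof -
  let ?s1 = "setv s ''px'' i" let ?s2 = "exec P_shift ?s1"
  have px: "s ''pos'' (xs ! i) 0 = i" using p i by (simp add: pord_def)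
  have e: "exec P_ins s = upd (upd ?s2 ''pos'' y 0 (Suc i)) ''in'' y 0 1"
    unfolding P_ins_def using px i(2) y(1) by (simp add: exec_frame)
  have 2: "?s2 ''pos'' v 0 = (if i < s ''pos'' v 0 then s ''pos'' v 0 + 1 else s ''pos'' v 0)" if v: "v < n" for v
  proof -
    let ?g = "\<lambda>v (z::nat). if i < s ''pos'' v z then s ''pos'' v z + 1 else s ''pos'' v z"
    have "?s2 ''pos'' v 0 = (if v < ?s1 ''n'' 0 0 \<and> 0 < ?s1 ''one'' 0 0 then ?g v 0 else ?s1 ''pos'' v 0)"
      unfolding P_shift_def
    proof (rule exec_FILL)
      fix a z s' assume h: "a < ?s1 ''n'' 0 0" "z < ?s1 ''one'' 0 0" "s' ''v'' 0 0 = a"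
        "\<And>x. x \<notin> mods (IFE ''t'' (Less (V ''px'') (G1 ''pos'' (V ''v'')))
     (Plus (G1 ''pos'' (V ''v'')) (N 1)) (G1 ''pos'' (V ''v''))) \<Longrightarrow> x \<noteq> ''pos'' \<Longrightarrow> x \<noteq> ''v'' \<Longrightarrow> x \<noteq> ''z'' \<Longrightarrow> s' x = ?s1 x"
        "s' ''pos'' a z = ?s1 ''pos'' a z"
      have "s' ''px'' 0 0 = i" using h(4)[of "''px''"] by simp
      moreover have "z = 0" using h(2) n by simp
      ultimately show "exec (IFE ''t'' (Less (V ''px'') (G1 ''pos'' (V ''v'')))
     (Plus (G1 ''pos'' (V ''v'')) (N 1)) (G1 ''pos'' (V ''v''))) s' ''t'' 0 0 = ?g a z"
        using h(3,5) by simp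
    qed simp_all
    then show ?thesis using v n by simp
  qed
  let ?ys = "take (Suc i) xs @ y # drop (Suc i) xs"
  have sy: "set ?ys = insert y (set xs)" using set_append[of "take (Suc i) xs" "drop (Suc i) xs"] by auto
  have "exec P_ins s ''in'' v 0 = of_bool (v \<in> set ?ys)" if "v < n" for v
    unfolding sy e using p that by (auto simp: pord_def upd_apply exec_frame)
  moreover have "exec P_ins s ''pos'' (?ys ! k) 0 = k" if k: "k < length ?ys" for k
  proof -
    have ne: "xs ! m \<noteq> y" "xs ! m < n" "s ''pos'' (xs ! m) 0 = m" if "m < length xs" for m
    proof -
      have m: "xs ! m \<in> set xs" using that by (rule nth_mem)
      show "xs ! m \<noteq> y" "xs ! m < n" using m xs y(3) by blast+
      show "s ''pos'' (xs ! m) 0 = m" using p that by (simp add: pord_def)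
    qed
    have z: "exec P_ins s ''pos'' v 0 = (if v = y then Suc i else ?s2 ''pos'' v 0)" for v
      unfolding e by (simp add: upd_apply)
    consider "k \<le> i" | "k = Suc i" | m where "k = Suc m" "i < m" by (metis Suc_leI leI not_less_eq old.nat.exhaust le_neq_implies_less less_Suc_eq_0_disj not_less_zero)
    then show ?thesis
    proof cases
      case 1
      then have "?ys ! k = xs ! k" using i by (simp add: nth_append)
      then show ?thesis using z 2 ne[of k] 1 i by simp
    next
      case 2
      then show ?thesis using z i by (simp add: nth_append)
    next
      case 3
      have m: "m < length xs" using k 3 i by simp
      have "?ys ! k = drop (Suc i) xs ! (k - Suc (Suc i))" using 3 i by (simp add: nth_append)
      also have "\<dots> = xs ! m" using 3 m by (simp add: nth_drop)
      finally show ?thesis using z 2[of "xs ! m"] ne[OF m] 3 by simp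
    qed
  qed
  ultimately show ?thesis by (simp add: pord_def)
qed

lemma exec_ord:
  assumes G: "connected_graph n E" and n: "s ''n'' 0 0 = n" "s ''one'' 0 0 = 1"
    and adj: "\<And>i j. s ''adj'' i j = of_bool ((i, j) \<in> E)"
  shows "\<exists>xs. order_list E xs \<and> length xs = n \<and> set xs = {..<n} \<and> (\<forall>i<n. exec P_ord s ''pos'' (xs ! i) 0 = i)"
proof -
  have n0: "0 < n" using G by (simp add: connected_graph_def)
  define s0 where "s0 = exec P_ord0 s"
  let ?F1 = "FILL ''pos'' ''v'' ''n'' ''z'' ''one'' (''t'' ::= N 0) ''t''"
  let ?F2 = "FILL ''in'' ''v'' ''n'' ''z'' ''one'' (IFE ''t'' (posb (V ''v'')) (N 0) (N 1)) ''t''"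
  have "exec ?F1 s ''pos'' 0 0 = 0"
    by (subst exec_FILL[where g = "\<lambda>_ _. 0"]) (use n n0 in simp_all)
  then have p0: "s0 ''pos'' 0 0 = 0" by (simp add: s0_def P_ord0_def exec_frame)
  have i0: "s0 ''in'' v 0 = of_bool (v = 0)" if "v < n" for v
    unfolding s0_def P_ord0_def exec.simps
    by (subst exec_FILL[where g = "\<lambda>v _. of_bool (v = 0)"]) (use n that in \<open>simp_all add: exec_frame\<close>)
  have f0: "s0 ''n'' 0 0 = n" "s0 ''one'' 0 0 = 1" "s0 ''adj'' = s ''adj''"
    using n by (simp_all add: s0_def exec_frame)
  \<comment> \<open>By connectedness, a round that finds no leaving edge shows that all nodes are
    listed.\<close>
  let ?I = "\<lambda>m s'. \<exists>xs. order_list E xs \<and> pord xs n s' \<and> (length xs = Suc m \<or> set xs = {..<n})"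
  have pset: "pord xs n (setv s' x k) \<longleftrightarrow> pord xs n s'" if "x \<notin> {''in'', ''pos''}" for xs s' x k
  proof -
    have "setv s' x k ''in'' = s' ''in''" "setv s' x k ''pos'' = s' ''pos''" using that by auto
    then show ?thesis by (simp only: pord_def)
  qed
  have "?I (s0 ''n'' 0 0) (exec (For ''i'' ''n'' P_ord1) s0)"
  proof (rule For_inv[where I = ?I])
    have "pord [0] n s0" using p0 i0 by (simp add: pord_def)
    then have "pord [0] n (setv s0 ''i'' 0)" by (subst pset) simp_all
    then show "?I 0 (setv s0 ''i'' 0)" by (intro exI[of _ "[0]"]) (simp add: order_list.order_one[OF G])
    fix m s' assume h: "m < s0 ''n'' 0 0" "?I m s'" "s' ''i'' 0 0 = m"
      "\<And>x. x \<noteq> ''i'' \<Longrightarrow> x \<notin> mods P_ord1 \<Longrightarrow> s' x = s0 x"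
    obtain xs where xs: "order_list E xs" "pord xs n s'" "length xs = Suc m \<or> set xs = {..<n}" using h(2) by blast
    have inv: "distinct xs" "set xs \<subseteq> {..<n}" "xs \<noteq> []" using order_list_inv[OF G xs(1)] by auto
    have f1: "s' ''n'' 0 0 = n" "s' ''one'' 0 0 = 1" "s' ''adj'' = s ''adj''"
      using h(4)[of "''n''"] h(4)[of "''one''"] h(4)[of "''adj''"] f0 by simp_all
    let ?Q = "\<lambda>x y. x \<in> set xs \<and> y \<notin> set xs \<and> (x, y) \<in> E"
    have Q: "s' ''in'' x 0 > 0 \<and> s' ''in'' y 0 = 0 \<and> s' ''adj'' x y > 0 \<longleftrightarrow> ?Q x y" if "x < n" "y < n" for x y
      using xs(2) that f1 adj by (simp add: pord_def)
    let ?s1 = "exec P_ext s'"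
    have p1: "pord xs n ?s1" using xs(2) by (simp add: pord_def exec_frame)
    have f2: "?s1 ''n'' 0 0 = n" "?s1 ''one'' 0 0 = 1" using f1 by (simp_all add: exec_frame)
    have "(?s1 ''fl'' 0 0 = 0 \<and> (\<forall>x<n. \<forall>y<n. \<not> ?Q x y)) \<or>
        (?s1 ''fl'' 0 0 > 0 \<and> ?s1 ''fx'' 0 0 < n \<and> ?s1 ''fy'' 0 0 < n \<and> ?Q (?s1 ''fx'' 0 0) (?s1 ''fy'' 0 0))"
      by (rule exec_ext[of s' n ?Q, OF f1(1)]) (rule Q)
    then have "?I (Suc m) (exec P_ord1 s')"
    proof (elim disjE conjE)
      assume a: "?s1 ''fl'' 0 0 = 0" "\<forall>x<n. \<forall>y<n. \<not> ?Q x y"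
      have "0 \<in> set xs" using G xs(1)
      proof (induction rule: order_list.induct)
        case (order_ins xs i y)
        then have "0 \<in> set (take (Suc i) xs) \<union> set (drop (Suc i) xs)" by (simp only: set_append[symmetric] append_take_drop_id)
        then show ?case by auto
      qed simp
      have "set xs = {..<n}"
      proof (rule ccontr)
        assume "set xs \<noteq> {..<n}"
        from order_ext[OF G inv(2) \<open>0 \<in> set xs\<close> this] a(2) inv(2) show False by blast
      qed
      moreover have "exec P_ord1 s' = ?s1" using a(1) by (simp add: P_ord1_def)
      ultimately show ?thesis using xs(1) p1 by auto
    next
      assume a: "0 < ?s1 ''fl'' 0 0" "?s1 ''fx'' 0 0 < n" "?s1 ''fy'' 0 0 < n" "?s1 ''fx'' 0 0 \<in> set xs"
        "?s1 ''fy'' 0 0 \<notin> set xs" "(?s1 ''fx'' 0 0, ?s1 ''fy'' 0 0) \<in> E"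
      define y where "y = ?s1 ''fy'' 0 0"
      obtain i where i: "i < length xs" "?s1 ''fx'' 0 0 = xs ! i" using a(4) by (metis in_set_conv_nth)
      let ?ys = "take (Suc i) xs @ y # drop (Suc i) xs"
      have e: "exec P_ord1 s' = exec P_ins ?s1" using a(1) by (simp add: P_ord1_def)
      have "pord ?ys n (exec P_ins ?s1)"
        by (rule exec_ins[OF f2 inv(2) p1 i y_def[symmetric]]) (use a y_def in simp_all)
      moreover have "order_list E ?ys" by (rule order_list.order_ins[OF G xs(1) i(1)]) (use a i y_def in simp_all)
      moreover have "length ?ys = Suc (Suc m)"
      proof -
        have "set xs \<noteq> {..<n}" using a(3,5) by auto
        then show ?thesis using xs(3) i(1) by simp
      qed
      ultimately show ?thesis unfolding e by blast
    qed
    then show "?I (Suc m) (setv (exec P_ord1 s') ''i'' (Suc m))" by (simp add: pset)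
  qed simp_all
  then obtain xs where xs: "order_list E xs" "pord xs n (exec P_ord s)" "length xs = Suc n \<or> set xs = {..<n}"
    using f0 by (auto simp: P_ord_def s0_def)
  have inv: "distinct xs" "set xs \<subseteq> {..<n}" using order_list_inv[OF G xs(1)] by auto
  have "length xs \<le> n" using card_mono[OF _ inv(2)] distinct_card[OF inv(1)] by simp
  then have "set xs = {..<n}" using xs(3) by simp
  moreover from this have "length xs = n" using distinct_card[OF inv(1)] by simp
  ultimately show ?thesis using xs(1,2) by (auto simp: pord_def)
qed

section \<open>The whole program\<close>

text \<open>The exponent \<open>q\<close> is left open: it belongs to the analysis and not to the
  program, so its choice can wait until the logarithms are estimated.\<close>

definition sized :: "nat \<Rightarrow> nat \<Rightarrow> (nat \<Rightarrow> nat set) \<Rightarrow> bool" where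
  "sized n D S \<longleftrightarrow> (\<exists>j l. j = D div 32 \<and> 1 \<le> l \<and> 2 ^ (l - 1) \<le> n \<and> n < 2 ^ l \<and>
     ((8 * j * l)\<^sup>2 \<le> n \<longrightarrow> (\<forall>u<n. real (card (S u)) \<le> 200 * (real n / real j))) \<and>
     (\<forall>q. l * l \<le> 2 ^ q \<longrightarrow> (\<forall>u<n. real (card (S u)) \<le> 200 * (real l + real n / real j * (real q + 1)))) \<and>
     (\<Sum>u<n. real (card (S u))) \<le> 200 * (real n * (real n / real j)))"

definition meets :: "nat \<Rightarrow> (nat \<times> nat) set \<Rightarrow> nat \<Rightarrow> (nat \<Rightarrow> nat set) \<Rightarrow> bool" where
  "meets n E D S \<longleftrightarrow> (\<forall>u<n. \<forall>v<n. D < gdist E u v \<longrightarrow>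
     (\<exists>w\<in>S u \<inter> S v. w < n \<and> gdist E u w + gdist E w v = gdist E u v))"

text \<open>For \<open>D < 32\<close> the parameter \<open>j\<close> would be 0; taking all nodes as
  hubs is then within \<open>O(n / D)\<close>.\<close>

definition P_hubs :: lp where
  "P_hubs = Cnd (Less (V ''D'') (N 32)) (FILL ''S'' ''u'' ''n'' ''y'' ''n'' (''t'' ::= N 1) ''t'')
     (P_par ;; P_pw ;; P_hv ;; P_X ;; P_seg ;; P_main)"

lemma seg_mods [simp]:
  "mods P_seg = mods P_own \<union> mods P_hh \<union> mods P_zz \<union> mods P_zd \<union> mods P_al0 \<union> mods P_lev \<union> mods P_mm0"
  "ok P_seg" "bnds P_seg = {''n'', ''n2'', ''one''}"
  by (auto simp: P_seg_def simp del: seg_progs(1,4,7,10,13,16,19))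

lemma hubs_progs:
  "ok P_hubs" "bnds P_hubs = {''n'', ''n2'', ''one'', ''N''}" "''n'' \<notin> mods P_hubs" "''n2'' \<notin> mods P_hubs"
  "''one'' \<notin> mods P_hubs" "''N'' \<notin> mods P_hubs" "''adj'' \<notin> mods P_hubs" "''d'' \<notin> mods P_hubs"
  by (auto simp: P_hubs_def)

context setting2
begin

lemma fin:
  assumes "h.g.reach hs A pc c" "length hs = n" "l * l \<le> 2 ^ q"
  shows "hub_alg_fin n dd PP j l md X k (8 * n * n) hs A pc c lev (n div (8 * j)) q"
proof unfold_locales
  show "2 ^ (l - 1) \<le> n" "n < 2 ^ l" by (rule l_low, rule l_up)
  show "k * l \<le> 2 * n + l + 8 * j * l" by (rule kl)
  show "2 * j \<le> n" using j8 by simp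
  show "p.hitr h.Lam X" using Xh unfolding Lam_Lm .
  show "md \<longleftrightarrow> (8 * j * l)\<^sup>2 \<le> n" by (rule md_def)
  show "h.g.reach hs A pc c" "length hs = n" "l * l \<le> 2 ^ q" by (rule assms)+
  fix r
  have "8 * j > 0" using jp by simp
  then show "card {x. h.W r x \<and> h.zd r x = lev r} \<le> n div (8 * j)"
    using lev_card[of r] by (simp add: less_eq_div_iff_mult_less_eq mult.commute)
next
  show "8 * j * (n div (8 * j)) \<le> n" by simp
qed

lemma hubs_ok:
  assumes re: "h.g.reach hs A pc c" "length hs = n"
  shows "h.hubs lev hs u \<subseteq> {..<n}" and "meets n E D (h.hubs lev hs)" and "sized n D (h.hubs lev hs)"
proof -
  \<comment> \<open>An extravagant exponent; the facts drawn from this instance do not contain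
    it.\<close>
  have ex: "l * l \<le> 2 ^ (l * l)" using less_exp[of "l * l"] by simp
  interpret f: hub_alg_fin n dd PP j l md X k "8 * n * n" hs A pc c lev "n div (8 * j)" "l * l"
    by (rule fin[OF re ex])
  have hs: "set hs = {..<n}" by (rule f.hs_set)
  have Xn: "X \<subseteq> {..<n}" using p.hitr_inv[OF Xh] by blast
  show "h.hubs lev hs u \<subseteq> {..<n}"
  proof
    fix w assume "w \<in> h.hubs lev hs u"
    then consider "w \<in> X" | "w < n" | i where "i < length hs" "w = hs ! i"
      unfolding h.hubs_def h.R_def by (auto split: if_splits)
    then show "w \<in> {..<n}" using Xn hs nth_mem by cases auto
  qed
  show "meets n E D (h.hubs lev hs)" unfolding meets_def
  proof (intro allI impI)
    fix u v assume uv: "u < n" "v < n" "D < dd u v"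
    have "\<exists>w\<in>PP u v. w \<in> h.hubs lev hs u \<and> w \<in> h.hubs lev hs v"
    proof (rule h.common_hub[OF uv(1,2) _ hs])
      show "32 * j \<le> dd u v + 1" using j_le(1) uv(3) by simp
      show "8 * j \<le> lev r \<and> lev r < 16 * j" for r by (rule lev_range)
      show "p.far h.Lam X = {}" using Xf unfolding Lam_Lm .
      show "j = 0 \<Longrightarrow> md" using jp by simp
    qed
    then obtain w where w: "w \<in> PP u v" "w \<in> h.hubs lev hs u" "w \<in> h.hubs lev hs v" by blast
    then show "\<exists>w\<in>h.hubs lev hs u \<inter> h.hubs lev hs v. w < n \<and> dd u w + dd w v = dd u v"
      using p.P_sub p.P_d[OF uv(1,2) w(1)] by blast
  qed
  show "sized n D (h.hubs lev hs)" unfolding sized_def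
  proof (rule exI[of _ j], rule exI[of _ l], intro conjI)
    show "j = D div 32" by (rule j_def)
    show "1 \<le> l" "2 ^ (l - 1) \<le> n" "n < 2 ^ l" by (rule l_pos, rule l_low, rule l_up)
    show "(8 * j * l)\<^sup>2 \<le> n \<longrightarrow> (\<forall>u<n. real (card (h.hubs lev hs u)) \<le> 200 * (real n / real j))"
      using f.size_md unfolding md_def f.rj_def by blast
    show "(\<Sum>u<n. real (card (h.hubs lev hs u))) \<le> 200 * (real n * (real n / real j))"
      using f.size_sum unfolding f.rj_def .
    show "\<forall>q. l * l \<le> 2 ^ q \<longrightarrow> (\<forall>u<n. real (card (h.hubs lev hs u)) \<le> 200 * (real l + real n / real j * (real q + 1)))"
    proof (intro allI impI)
      fix q u assume q: "l * l \<le> 2 ^ q" and u: "u < n"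
      interpret f2: hub_alg_fin n dd PP j l md X k "8 * n * n" hs A pc c lev "n div (8 * j)" q
        by (rule fin[OF re q])
      show "real (card (h.hubs lev hs u)) \<le> 200 * (real l + real n / real j * (real q + 1))"
        using f2.size_all[OF u] unfolding f2.rj_def .
    qed
  qed
qed

end

context setting
begin

lemma exec_hubs:
  assumes b: "base n D E s" and two: "\<And>k. k \<le> n \<Longrightarrow> s ''two'' 0 k = 2 ^ k" and d: "dok s" and r: "rok s"
  shows "\<exists>S. (\<forall>u<n. \<forall>y<n. exec P_hubs s ''S'' u y = of_bool (y \<in> S u)) \<and> (\<forall>u<n. S u \<subseteq> {..<n}) \<and> meets n E D S \<and>
    (D < 32 \<or> sized n D S)"
proof (cases "D < 32")
  case True
  have n: "s ''n'' 0 0 = n" "s ''D'' 0 0 = D" using b by (auto simp: base_def)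
  let ?F = "FILL ''S'' ''u'' ''n'' ''y'' ''n'' (''t'' ::= N 1) ''t''"
  have e: "exec P_hubs s = exec ?F s" using True n by (simp add: P_hubs_def)
  have "exec ?F s ''S'' u y = 1" if "u < n" "y < n" for u y
    by (subst exec_FILL[where g = "\<lambda>_ _. 1"]) (use that n in simp_all)
  moreover have "meets n E D (\<lambda>_. {..<n})" unfolding meets_def
  proof (intro allI impI)
    fix u v assume "u < n" "v < n"
    then show "\<exists>w\<in>{..<n} \<inter> {..<n}. w < n \<and> dd u w + dd w v = dd u v"
      using p.d_self[of u] by (intro bexI[of _ u]) auto
  qed
  ultimately show ?thesis unfolding e using True by (intro exI[of _ "\<lambda>_. {..<n}"]) simp
next
  case False
  then have jp: "j \<ge> 1" by (simp add: j_def)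
  have n: "s ''D'' 0 0 = D" using b by (auto simp: base_def)
  define s1 where "s1 = exec P_par s"
  define s2 where "s2 = exec P_pw s1"
  define s3 where "s3 = exec P_hv s2"
  define s4 where "s4 = exec P_X s3"
  have e: "exec P_hubs s = exec P_main (exec P_seg s4)"
    using False n by (simp add: P_hubs_def s1_def s2_def s3_def s4_def)
  have b1: "base n D E s1" unfolding s1_def by (rule base_frame[OF b]) (simp add: bvars_def)
  have b2: "base n D E s2" unfolding s2_def by (rule base_frame[OF b1]) (simp add: bvars_def)
  have b3: "base n D E s3" unfolding s3_def by (rule base_frame[OF b2]) (simp add: bvars_def)
  have b4: "base n D E s4" unfolding s4_def by (rule base_frame[OF b3]) (simp add: bvars_def)
  have pr1: "pars s1" unfolding s1_def by (rule exec_par[OF b two])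
  have pvf: "pars (exec q t)" if "pars t" "pvars \<inter> mods q = {}" for q t
  proof (rule pars_cong[OF that(1)])
    fix x assume "x \<in> pvars"
    then have "x \<notin> mods q" using that(2) by blast
    then show "exec q t x = t x" by (rule exec_frame)
  qed
  have pr2: "pars s2" unfolding s2_def by (rule pvf[OF pr1]) (simp add: pvars_def)
  have pr3: "pars s3" unfolding s3_def by (rule pvf[OF pr2]) (simp add: pvars_def)
  have pr4: "pars s4" unfolding s4_def by (rule pvf[OF pr3]) (simp add: pvars_def)
  have dr: "s1 ''d'' = s ''d''" "s2 ''d'' = s ''d''" "s3 ''d'' = s ''d''" "s4 ''d'' = s ''d''"
     "s1 ''r'' = s ''r''" "s2 ''r'' = s ''r''" "s3 ''r'' = s ''r''" "s4 ''r'' = s ''r''"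
     "s4 ''hv'' = s3 ''hv''" "s4 ''pw'' = s2 ''pw''"
    by (simp_all add: s1_def s2_def s3_def s4_def exec_frame)
  have d3: "dok s3" "dok s4" using d dr by (simp_all add: dok_def)
  have r3: "rok s2" "rok s3" "rok s4" using r dr by (simp_all add: rok_def)
  have pw: "s4 ''pw'' 0 x = (k + 1) ^ x * k ^ (8 * n * n - x)" if "x < 8 * n * n" for x
    unfolding dr s2_def by (rule exec_pw[OF b1 _ that]) (use pr1 in \<open>simp add: pars_def\<close>)
  have hv: "s4 ''hv'' u y = of_bool (n \<le> p.mass u y * l)" if "u < n" "y < n" for u y
    unfolding dr s3_def by (rule exec_hv[OF b2 r3(1) _ that]) (use pr2 in \<open>simp add: pars_def\<close>)
  have lm: "s3 ''lam'' 0 0 = Lm" using pr3 by (simp add: pars_def)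
  from exec_X[OF b3 r3(2) d3(1) lm] obtain X where
    X: "\<And>x. x < n \<Longrightarrow> s4 ''X'' x 0 = of_bool (x \<in> X)" "p.hitr Lm X" "p.far Lm X = {}"
    unfolding s4_def by blast
  interpret t: setting2 n E D X by unfold_locales (rule jp X)+
  have pw': "s4 ''pw'' 0 x = t.h.g.pw x" if "x < 8 * n * n" for x
    using pw[OF that] by (simp add: t.h.g.pw_def)
  have hv': "t.hvok s4" using hv by (simp add: t.hvok_def)
  have xo: "t.xok s4" using X(1) by (simp add: t.xok_def)
  note sg = t.exec_seg[OF b4 pr4 xo d3(2) hv' r3(3) pw']
  from t.exec_main[OF sg] obtain hs A pc c where
    m: "t.dyn2 hs A pc c (exec P_main (exec P_seg s4))" "t.h.g.reach hs A pc c" "length hs = n" by blast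
  note ho = t.hubs_ok[OF m(2,3)]
  have "\<forall>u<n. \<forall>y<n. exec P_hubs s ''S'' u y = of_bool (y \<in> t.h.hubs t.lev hs u)"
    using m(1) unfolding e t.dyn2_def by blast
  then show ?thesis using ho by blast
qed

end

text \<open>A program must not write the bounds of its own loops, so those of \<open>P_rest\<close>
  are prepared in a separate part.\<close>

definition P_head :: lp where
  "P_head = (''one'' ::= N 1 ;; ''n2'' ::= Plus (V ''n'') (V ''n'') ;; ''N'' ::= N 0 ;;
     For ''i'' ''n'' (For ''h'' ''n'' (''N'' ::= Plus (V ''N'') (N 8))))"
definition P_rest :: lp where
  "P_rest = (P_two ;; P_wt ;; P_apsp ''d'' ''w1'' ''f1'' ;; P_apsp ''r'' ''w2'' ''f2'' ;; P_hubs ;; P_ord ;; P_lab)"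
text \<open>For \<open>D\<close> at least \<open>n\<close> no pair of nodes is concerned and empty
  labels do; so the running time is bounded in terms of \<open>n\<close> alone.\<close>

definition prg :: com where
  "prg = If (Less (V ''D'') (V ''n'')) (Seq (cpl P_head) (cpl P_rest)) Skip"

lemma rest_progs:
  "mods P_head = {''one'', ''n2'', ''N'', ''i'', ''h''}" "ok P_head" "bnds P_head = {''n''}"
  "ok P_rest" "bnds P_rest = {''n'', ''n2'', ''one'', ''N''}" "bnds P_rest \<inter> mods P_rest = {}"
  using hubs_progs by (auto simp: P_head_def P_rest_def)

lemma exec_head:
  assumes n: "s ''n'' 0 0 = n" "s ''D'' 0 0 = D" "\<And>i j. s ''adj'' i j = of_bool ((i, j) \<in> E)"
  shows "base n D E (exec P_head s)"
proof -
  let ?s = "setv (setv (setv s ''one'' 1) ''n2'' (n + n)) ''N'' 0"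
  let ?p = "''N'' ::= Plus (V ''N'') (N 8)"
  let ?q = "For ''h'' ''n'' ?p"
  let ?I = "\<lambda>m s'. s' ''N'' 0 0 = 8 * n * m"
  have "?I (?s ''n'' 0 0) (exec (For ''i'' ''n'' ?q) ?s)"
  proof (rule For_inv[where I = ?I])
    fix m s1 assume h: "m < ?s ''n'' 0 0" "?I m s1" "\<And>x. x \<noteq> ''i'' \<Longrightarrow> x \<notin> mods ?q \<Longrightarrow> s1 x = ?s x"
    have n1: "s1 ''n'' 0 0 = n" using h(3)[of "''n''"] n by simp
    let ?J = "\<lambda>a s'. s' ''N'' 0 0 = 8 * n * m + 8 * a"
    have "?J (s1 ''n'' 0 0) (exec ?q s1)"
      by (rule For_inv[where I = ?J]) (use h(2) in simp_all)
    then show "?I (Suc m) (setv (exec ?q s1) ''i'' (Suc m))" using n1 by (simp add: algebra_simps)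
  qed simp_all
  moreover have "exec P_head s = exec (For ''i'' ''n'' ?q) ?s" using n by (simp add: P_head_def)
  ultimately have "exec P_head s ''N'' 0 0 = 8 * n * n" using n by simp
  moreover have "exec P_head s ''one'' 0 0 = 1" "exec P_head s ''n2'' 0 0 = 2 * n"
    using n by (simp_all add: P_head_def exec_frame del: exec.simps(5))
  ultimately show ?thesis using n by (simp add: base_def exec_frame rest_progs)
qed

lemma exec_rest:
  assumes G: "connected_graph n E" and D: "D < n" and b: "base n D E s"
  shows "\<exists>S. (\<forall>u<n. S u \<subseteq> {..<n}) \<and> meets n E D S \<and> (D < 32 \<or> sized n D S) \<and>
    stores_hubs read_hubs n E S (out_labels (exec P_rest s)) \<and>
    (\<forall>m. \<forall>u<n. 2 ^ m * length (out_labels (exec P_rest s) u) \<le> 2 ^ m * ((6 * m + 3) * card (S u)) + 8 * n)"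
proof -
  interpret t: setting n E D by unfold_locales (rule G D)+
  define s1 where "s1 = exec P_two s"
  define s2 where "s2 = exec P_wt s1"
  define s3 where "s3 = exec (P_apsp ''d'' ''w1'' ''f1'') s2"
  define s4 where "s4 = exec (P_apsp ''r'' ''w2'' ''f2'') s3"
  define s5 where "s5 = exec P_hubs s4"
  define s6 where "s6 = exec P_ord s5"
  have e: "exec P_rest s = exec P_lab s6"
    by (simp add: P_rest_def s1_def s2_def s3_def s4_def s5_def s6_def)
  have b1: "base n D E s1" unfolding s1_def by (rule base_frame[OF b]) (simp add: bvars_def)
  have b2: "base n D E s2" unfolding s2_def by (rule base_frame[OF b1]) (simp add: bvars_def)
  have b3: "base n D E s3" unfolding s3_def by (rule base_frame[OF b2]) (simp add: bvars_def)
  have b4: "base n D E s4" unfolding s4_def by (rule base_frame[OF b3]) (simp add: bvars_def)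
  have sn: "s ''N'' 0 0 = 8 * n * n" using b by (simp add: base_def)
  have two: "s1 ''two'' 0 k = 2 ^ k" if "k \<le> n + 3" for k
    unfolding s1_def by (rule exec_two) (use that t.N_ge(4) sn in linarith)
  note wt = exec_wt[OF b1 two]
  have d3: "s3 ''d'' u v = gdist E u v" if "u < n" "v < n" for u v
  proof -
    have "s3 ''d'' u v = bf n E n (\<lambda>_ _. 1) n u v"
      unfolding s3_def by (rule exec_apsp[OF b2]) (use that wt(1,3) in \<open>simp_all add: s2_def\<close>)
    then show ?thesis using bf_gdist[OF G that] by simp
  qed
  have w2: "s3 ''w2'' = s2 ''w2''" "s3 ''f2'' = s2 ''f2''" "s4 ''d'' = s3 ''d''" "s4 ''two'' = s1 ''two''"
    by (simp_all add: s2_def s3_def s4_def exec_frame)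
  have r4: "s4 ''r'' u v = wdist n E u v" if "u < n" "v < n" for u v
  proof -
    have "s4 ''r'' u v = bf n E (n * 2 ^ (n + 3)) (wt n) n u v"
      unfolding s4_def by (rule exec_apsp[OF b3]) (use that wt(2,4) w2 in \<open>simp_all add: s2_def\<close>)
    then show ?thesis using bf_wdist[OF G that] by simp
  qed
  have "t.dok s4" "t.rok s4" using d3 r4 w2 by (simp_all add: t.dok_def t.rok_def)
  moreover have "s4 ''two'' 0 k = 2 ^ k" if "k \<le> n" for k using two[of k] that w2 by simp
  ultimately obtain S where S: "\<And>u y. u < n \<Longrightarrow> y < n \<Longrightarrow> s5 ''S'' u y = of_bool (y \<in> S u)" "\<And>u. u < n \<Longrightarrow> S u \<subseteq> {..<n}"
    "meets n E D S" "D < 32 \<or> sized n D S"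
    using t.exec_hubs[OF b4] unfolding s5_def by blast
  have f5: "s5 ''n'' = s4 ''n''" "s5 ''one'' = s4 ''one''" "s5 ''adj'' = s4 ''adj''" "s5 ''d'' = s4 ''d''"
    unfolding s5_def by (rule exec_frame, rule hubs_progs)+
  have n5: "s5 ''n'' 0 0 = n" "s5 ''one'' 0 0 = 1" "\<And>i j. s5 ''adj'' i j = of_bool ((i, j) \<in> E)"
    using b4 f5 by (simp_all add: base_def)
  from exec_ord[OF G n5] obtain xs where xs: "order_list E xs" "length xs = n" "set xs = {..<n}"
    "\<And>i. i < n \<Longrightarrow> s6 ''pos'' (xs ! i) 0 = i" unfolding s6_def by blast
  have f6: "s6 ''n'' 0 0 = n" "s6 ''S'' = s5 ''S''" "s6 ''d'' = s3 ''d''"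
    using n5 f5 w2 by (simp_all add: s6_def exec_frame)
  have L: "out_labels (exec P_rest s) u = encl (0, 0) (map (\<lambda>i. (i, gdist E u (xs ! i))) (filter (\<lambda>i. xs ! i \<in> S u) [0..<n]))"
    if u: "u < n" for u
    unfolding e
  proof (rule exec_lab[where s = s6 and n = n, OF f6(1) xs(2,3)])
    show "s6 ''pos'' (xs ! i) 0 = i" if "i < n" for i by (rule xs(4)[OF that])
    show "s6 ''S'' u v = of_bool (v \<in> S u)" if "u < n" "v < n" for u v using S(1)[OF that] f6 by simp
    show "s6 ''d'' u v = gdist E u v" if "u < n" "v < n" for u v using d3[OF that] f6 by simp
    show "gdist E u v \<le> n" if "u < n" "v < n" for u v using gdist_less[OF G that] by simp
  qed (rule u)
  note lc = labels_correct[OF G xs(1,2) S(2) L]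
  show ?thesis using S(2,3,4) lc by (intro exI[of _ S]) blast
qed

definition good :: "nat \<Rightarrow> (nat \<times> nat) set \<Rightarrow> nat \<Rightarrow> (nat \<Rightarrow> nat set) \<Rightarrow> (nat \<Rightarrow> bool list) \<Rightarrow> bool" where
  "good n E D S L \<longleftrightarrow> (\<forall>u<n. S u \<subseteq> {..<n}) \<and> meets n E D S \<and> stores_hubs read_hubs n E S L \<and>
     (if n \<le> D then \<forall>u<n. S u = {} \<and> L u = [] else (D < 32 \<or> sized n D S) \<and>
       (\<forall>m. \<forall>u<n. 2 ^ m * length (L u) \<le> 2 ^ m * ((6 * m + 3) * card (S u)) + 8 * n))"

lemma run_prg:
  "\<exists>c k. \<forall>n E D. connected_graph n E \<longrightarrow> (\<exists>s t. run prg (input n E D) = return_spmf (s, t) \<and>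
     t \<le> c * n ^ k \<and> (\<exists>S. good n E (nat \<lfloor>D\<rfloor>) S (out_labels s)))"
proof -
  obtain c1 k1 where 1: "\<And>M. tmb P_head M \<le> c1 * (M + 1) ^ k1" using tmb_poly by metis
  obtain c2 k2 where 2: "\<And>M. tmb P_rest M \<le> c2 * (M + 1) ^ k2" using tmb_poly by metis
  let ?c = "c1 * 2 ^ k1 + c2 * 9 ^ k2 + 2" let ?k = "k1 + 2 * k2"
  have "\<exists>s t. run prg (input n E D) = return_spmf (s, t) \<and>
     t \<le> ?c * n ^ ?k \<and> (\<exists>S. good n E (nat \<lfloor>D\<rfloor>) S (out_labels s))" if G: "connected_graph n E" for n E D
  proof -
    let ?s = "input n E D" let ?D = "nat \<lfloor>D\<rfloor>"
    have i: "?s ''n'' 0 0 = n" "?s ''D'' 0 0 = ?D" "\<And>i j. ?s ''adj'' i j = of_bool ((i, j) \<in> E)"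
      by (simp_all add: input_def)
    have n0: "n \<ge> 1" using G by (simp add: connected_graph_def)
    have nk: "1 \<le> n ^ ?k" using n0 by simp
    show ?thesis
    proof (cases "?D < n")
      case False
      have "run prg ?s = return_spmf (?s, 2)" using False i by (simp add: prg_def)
      moreover have "2 \<le> ?c * n ^ ?k" using mult_le_mono[of 2 ?c 1 "n ^ ?k"] nk by simp
      moreover have "good n E ?D (\<lambda>_. {}) (out_labels ?s)" unfolding good_def
      proof (intro conjI)
        have "out_labels ?s u = []" for u by (simp add: out_labels_def input_def)
        then show "if n \<le> ?D then \<forall>u<n. {} = {} \<and> out_labels ?s u = [] else (?D < 32 \<or> sized n ?D (\<lambda>_. {})) \<and>
           (\<forall>m. \<forall>u<n. 2 ^ m * length (out_labels ?s u) \<le> 2 ^ m * ((6 * m + 3) * card ({} :: nat set)) + 8 * n)"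
          using False by simp
        show "meets n E ?D (\<lambda>_. {})" unfolding meets_def using gdist_less[OF G] False by force
        have "read_hubs [] = {}" by (simp add: read_hubs_def)
        then show "stores_hubs read_hubs n E (\<lambda>_. {}) (out_labels ?s)"
          unfolding stores_hubs_def by (intro exI[of _ id]) (simp add: hub_table_def out_labels_def input_def)
      qed simp
      ultimately show ?thesis by blast
    next
      case True
      obtain t1 where t1: "t1 \<le> tmb P_head n" "run (cpl P_head) ?s = return_spmf (exec P_head ?s, t1)"
        using run_cpl[of P_head ?s n] rest_progs i by auto
      let ?s1 = "exec P_head ?s"
      have b: "base n ?D E ?s1" by (rule exec_head[OF i])
      have "?s1 b 0 0 \<le> 8 * (n * n)" if "b \<in> bnds P_rest" for b
      proof -
        have "n \<le> n * n" using n0 by simp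
        then show ?thesis using b that n0 by (auto simp: base_def rest_progs)
      qed
      then obtain t2 where t2: "t2 \<le> tmb P_rest (8 * (n * n))" "run (cpl P_rest) ?s1 = return_spmf (exec P_rest ?s1, t2)"
        using run_cpl[of P_rest ?s1 "8 * (n * n)"] rest_progs by blast
      have "run prg ?s = return_spmf (exec P_rest ?s1, Suc (t1 + t2))"
        using True i t1 t2 by (simp add: prg_def)
      moreover have "Suc (t1 + t2) \<le> ?c * n ^ ?k"
      proof -
        have "(n + 1) ^ k1 \<le> (2 * n) ^ k1" using n0 by (intro power_mono) auto
        also have "\<dots> = 2 ^ k1 * n ^ k1" by (rule power_mult_distrib)
        also have "\<dots> \<le> 2 ^ k1 * n ^ ?k" using n0 by (intro mult_le_mono2 power_increasing) auto
        finally have "c1 * (n + 1) ^ k1 \<le> c1 * 2 ^ k1 * n ^ ?k" unfolding mult.assoc by (rule mult_le_mono2)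
        then have a: "t1 \<le> c1 * 2 ^ k1 * n ^ ?k" using t1(1) 1[of n] by linarith
        have "(8 * (n * n) + 1) ^ k2 \<le> (9 * (n * n)) ^ k2" using n0 by (intro power_mono) auto
        also have "\<dots> = 9 ^ k2 * n ^ (2 * k2)" by (simp add: power_mult_distrib power_mult power2_eq_square)
        also have "\<dots> \<le> 9 ^ k2 * n ^ ?k" using n0 by (intro mult_le_mono2 power_increasing) auto
        finally have "c2 * (8 * (n * n) + 1) ^ k2 \<le> c2 * 9 ^ k2 * n ^ ?k" unfolding mult.assoc by (rule mult_le_mono2)
        then have "t2 \<le> c2 * 9 ^ k2 * n ^ ?k" using t2(1) 2[of "8 * (n * n)"] by linarith
        then show ?thesis using a nk unfolding distrib_right by linarith
      qed
      moreover have "\<exists>S. good n E ?D S (out_labels (exec P_rest ?s1))"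
        using exec_rest[OF G True b] True unfolding good_def by auto
      ultimately show ?thesis by blast
    qed
  qed
  then show ?thesis by blast
qed

section \<open>The size bounds\<close>

lemma lg_ge: "1 \<le> lg x" "log 2 x \<le> lg x" by (auto simp: lg_def)

lemma ex_exponent:
  assumes "1 \<le> l" shows "\<exists>q. l * l \<le> 2 ^ q \<and> real q \<le> 2 + 2 * log 2 (real l)"
proof -
  define q where "q = nat \<lceil>log 2 (real l)\<rceil>"
  have l0: "0 \<le> log 2 (real l)" using assms by simp
  then have q: "log 2 (real l) \<le> real q" "real q \<le> log 2 (real l) + 1" unfolding q_def by linarith+
  have "real l = 2 powr (log 2 (real l))" using assms by simp
  also have "\<dots> \<le> 2 powr real q" using q(1) by simp
  also have "\<dots> = real (2 ^ q)" by (simp add: powr_realpow)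
  finally have "l \<le> 2 ^ q" by (simp only: of_nat_le_iff)
  then have "l * l \<le> 2 ^ (2 * q)" using mult_le_mono[of l "2 ^ q" l "2 ^ q"] by (simp add: mult_2 power_add)
  moreover have "real (2 * q) \<le> 2 + 2 * log 2 (real l)" using q(2) by simp
  ultimately show ?thesis by blast
qed

lemma ln2_half: "1 / 2 \<le> ln (2::real)"
  using ln_add_one_self_le_self2[of "-(1/2) :: real"] ln_div[of 1 "2::real"] by simp

text \<open>The linear bound on the logarithm is applied to \<open>l / 8\<close>, which makes the
  slope small enough for \<open>2 * log 2 l\<close> to be absorbed by \<open>l\<close> in
  \<open>bits_le\<close>.\<close>

lemma log_le_quarter: assumes "1 \<le> l" shows "log 2 (real l) \<le> real l / 4 + 3"
proof -
  have l: "real l > 0" using assms by simp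
  have "ln (real l / 8) \<le> real l / 8" using ln_le_minus_one[of "real l / 8"] l by simp
  moreover have "ln (real l / 8) = ln (real l) - ln 8" using l by (simp add: ln_div)
  moreover have "ln 8 = 3 * ln (2::real)" using ln_realpow[of "2::real" 3] by simp
  ultimately have "ln (real l) \<le> 3 * ln 2 + real l / 8" by linarith
  also have "real l / 8 \<le> real l / 4 * ln 2" using mult_left_mono[OF ln2_half, of "real l / 4"] by simp
  finally have "ln (real l) \<le> (real l / 4 + 3) * ln 2" by (simp add: algebra_simps)
  then show ?thesis by (simp add: log_def divide_le_eq)
qed

text \<open>Outside the mode \<open>md\<close>, \<open>n\<close> is less than the square of
  \<open>D * l\<close>; hence \<open>log n\<close> is at most \<open>2 * log D + 2 * log l\<close>,
  and \<open>log l\<close> is small against \<open>l\<close>.\<close>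

lemma bits_le:
  assumes l: "1 \<le> l" "2 ^ (l - 1) \<le> n" and n: "n < (8 * j * l)\<^sup>2" and D: "real (32 * j) \<le> D" and j: "1 \<le> j"
  shows "real l \<le> 10 * lg D"
proof -
  have D0: "0 < D" using D j by linarith
  have l0: "0 < real l" using l by simp
  have "(2::real) ^ (l - 1) = real (2 ^ (l - 1))" by simp
  also have "\<dots> < real ((8 * j * l)\<^sup>2)" using l(2) n by (simp only: of_nat_less_iff)
  also have "\<dots> = (real (8 * j) * real l)\<^sup>2" by simp
  also have "\<dots> \<le> (D / 4 * real l)\<^sup>2" using D l0 by (intro power_mono mult_right_mono) auto
  finally have "log 2 (2 ^ (l - 1)) < log 2 ((D / 4 * real l)\<^sup>2)" using D0 l0 by (subst log_less_cancel_iff) auto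
  moreover have "log 2 (2 ^ (l - 1)) = real (l - 1)" by simp
  moreover have "log 2 ((D / 4 * real l)\<^sup>2) = 2 * (log 2 D - 2 + log 2 (real l))"
  proof -
    have "log 2 4 = (2::real)" using log_pow_cancel[of "2::real" 2] by simp
    then show ?thesis using D0 l0 by (simp add: log_nat_power log_mult log_divide)
  qed
  moreover have "log 2 (real l) \<le> real l / 4 + 3" by (rule log_le_quarter[OF l(1)])
  moreover have "real (l - 1) = real l - 1" using l(1) by simp
  ultimately have "real l \<le> 4 * log 2 D + 6" by (simp add: algebra_simps)
  then show ?thesis using lg_ge[of D] by linarith
qed

text \<open>Since \<open>ln (ln n)\<close> is at least 1 for \<open>n\<close> from 33 on, the
  threshold gives \<open>D * ln n \<le> sqrt n\<close>. With \<open>8 * j \<le> D / 4\<close> and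
  \<open>l \<le> 4 * ln n\<close> the condition of the mode follows.\<close>

lemma mode_of_threshold:
  assumes l: "1 \<le> l" "2 ^ (l - 1) \<le> n" and n: "33 \<le> n" and D: "real (32 * j) \<le> D"
    and th: "D \<le> sqrt (real n) / (ln (real n) * ln (ln (real n)))"
  shows "(8 * j * l)\<^sup>2 \<le> n"
proof -
  have "exp 3 = exp (1::real) ^ 3" by (simp flip: exp_of_nat_mult)
  also have "\<dots> \<le> 3 ^ 3" using exp_le by (intro power_mono) auto
  also have "\<dots> \<le> real n" using n by simp
  finally have ln3: "3 \<le> ln (real n)" using n by (simp add: ln_ge_iff)
  have "exp 1 \<le> ln (real n)" using exp_le ln3 by linarith
  then have lnln: "1 \<le> ln (ln (real n))" using ln3 by (simp add: ln_ge_iff)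
  have s0: "0 \<le> sqrt (real n)" by simp
  have "real l - 1 = log 2 (2 ^ (l - 1))" using l(1) by simp
  also have "\<dots> \<le> log 2 (real n)"
  proof -
    have "(2::real) ^ (l - 1) = real (2 ^ (l - 1))" by simp
    also have "\<dots> \<le> real n" using l(2) by (simp only: of_nat_le_iff)
    finally have le: "(2::real) ^ (l - 1) \<le> real n" .
    show ?thesis by (rule log_le_cancel_iff[THEN iffD2, OF _ _ _ le]) (use n in simp_all)
  qed
  also have "\<dots> \<le> 2 * ln (real n)"
    using mult_left_mono[OF ln2_half, of "2 * ln (real n)"] ln3 by (simp add: log_def divide_le_eq)
  finally have lb: "real l \<le> 4 * ln (real n)" using ln3 by linarith
  have "D \<le> sqrt (real n) / ln (real n)"
  proof -
    have "ln (real n) * 1 \<le> ln (real n) * ln (ln (real n))" using ln3 lnln by (intro mult_left_mono) auto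
    then have "sqrt (real n) / (ln (real n) * ln (ln (real n))) \<le> sqrt (real n) / ln (real n)"
      using ln3 by (intro divide_left_mono) auto
    then show ?thesis using th by linarith
  qed
  then have "D * ln (real n) \<le> sqrt (real n)" using ln3 by (simp add: le_divide_eq)
  moreover have "real (8 * j) * real l \<le> D / 4 * (4 * ln (real n))"
    using D lb by (intro mult_mono) auto
  ultimately have "real (8 * j * l) \<le> sqrt (real n)" by simp
  then have "(real (8 * j * l))\<^sup>2 \<le> (sqrt (real n))\<^sup>2" by (intro power_mono) auto
  then have "real ((8 * j * l)\<^sup>2) \<le> real n" by (simp only: of_nat_power real_sqrt_pow2 of_nat_0_le_iff)
  then show ?thesis by (simp only: of_nat_le_iff)
qed

text \<open>\<open>166400\<close> is \<open>200 * 64 * 13\<close>: 64 converts \<open>n / j\<close>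
  into \<open>n / D\<close>, as \<open>D \<le> 64 * j\<close>, and 13 compares \<open>q + 1\<close>
  with \<open>lg (lg D)\<close>.\<close>

lemma card_bounds:
  assumes D: "0 < D" "nat \<lfloor>D\<rfloor> < n" and S: "\<And>u. u < n \<Longrightarrow> S u \<subseteq> {..<n}" and sz: "nat \<lfloor>D\<rfloor> < 32 \<or> sized n (nat \<lfloor>D\<rfloor>) S"
  shows "(\<Sum>u<n. real (card (S u))) \<le> real n * (166400 * (real n / D))"
    and "u < n \<Longrightarrow> real (card (S u)) \<le> 166400 * (lg D + real n * lg (lg D) / D)"
    and "D \<le> sqrt (real n) / (ln (real n) * ln (ln (real n))) \<Longrightarrow> u < n \<Longrightarrow> real (card (S u)) \<le> 166400 * (real n / D)"
proof -
  let ?D = "nat \<lfloor>D\<rfloor>" let ?r = "real n / D"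
  have D1: "real ?D \<le> D" "D < real ?D + 1" using D(1) by linarith+
  have r0: "0 \<le> ?r" using D by simp
  have ll: "?r \<le> real n * lg (lg D) / D"
    using mult_left_mono[OF lg_ge(1)[of "lg D"] r0] by simp
  have "(\<Sum>u<n. real (card (S u))) \<le> real n * (166400 * ?r) \<and>
    (\<forall>u<n. real (card (S u)) \<le> 166400 * (lg D + real n * lg (lg D) / D)) \<and>
    (D \<le> sqrt (real n) / (ln (real n) * ln (ln (real n))) \<longrightarrow> (\<forall>u<n. real (card (S u)) \<le> 166400 * ?r))"
  proof (cases "?D < 32")
    case True
    then have "D \<le> 32" using D1 by linarith
    then have "real n \<le> 32 * ?r" using D(1) mult_right_mono[of D 32 "real n"] by (simp add: le_divide_eq mult.commute)
    moreover have "real (card (S u)) \<le> real n" if "u < n" for u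
      using card_mono[OF _ S[OF that]] by simp
    ultimately have c: "real (card (S u)) \<le> 32 * ?r" if "u < n" for u using that by fastforce
    then have c': "real (card (S u)) \<le> 166400 * ?r" if "u < n" for u using that r0 by fastforce
    have "(\<Sum>u<n. real (card (S u))) \<le> (\<Sum>u<n. 166400 * ?r)" by (intro sum_mono c') simp
    moreover have "166400 * ?r \<le> 166400 * (lg D + real n * lg (lg D) / D)"
      using ll lg_ge(1)[of D] by simp
    ultimately show ?thesis using c' by fastforce
  next
    case False
    then obtain j l where h: "j = ?D div 32" "1 \<le> l" "2 ^ (l - 1) \<le> n"
      "(8 * j * l)\<^sup>2 \<le> n \<longrightarrow> (\<forall>u<n. real (card (S u)) \<le> 200 * (real n / real j))"
      "\<And>q u. l * l \<le> 2 ^ q \<Longrightarrow> u < n \<Longrightarrow> real (card (S u)) \<le> 200 * (real l + real n / real j * (real q + 1))"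
      "(\<Sum>u<n. real (card (S u))) \<le> 200 * (real n * (real n / real j))"
      using sz unfolding sized_def by blast
    have j1: "1 \<le> j" using False h(1) by simp
    have "32 * j \<le> ?D" "?D < 32 * j + 32" using h(1) by simp_all
    then have jD: "real (32 * j) \<le> D" "D \<le> 64 * real j" using D1 j1 by linarith+
    have "D * (real n * real j) \<le> 64 * real j * (real n * real j)" using jD by (intro mult_right_mono) auto
    then have nj: "real n / real j \<le> 64 * ?r" using D(1) j1 jD(2)
      by (simp add: field_simps)
    have md: "real (card (S u)) \<le> 12800 * ?r" if "(8 * j * l)\<^sup>2 \<le> n" "u < n" for u
      using h(4) that nj by fastforce
    have "real n * (real n / real j) \<le> real n * (64 * ?r)" by (rule mult_left_mono[OF nj]) simp
    then have "(\<Sum>u<n. real (card (S u))) \<le> 12800 * (real n * ?r)" using h(6) by simp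
    also have "\<dots> \<le> 166400 * (real n * ?r)" using r0 by (intro mult_right_mono mult_nonneg_nonneg) simp_all
    finally have s: "(\<Sum>u<n. real (card (S u))) \<le> real n * (166400 * ?r)" by (simp only: mult.left_commute)
    have t: "\<forall>u<n. real (card (S u)) \<le> 166400 * ?r" if "D \<le> sqrt (real n) / (ln (real n) * ln (ln (real n)))"
    proof -
      have "33 \<le> n" using D(2) False by linarith
      from mode_of_threshold[OF h(2,3) this jD(1) that] md r0 show ?thesis by fastforce
    qed
    have a: "real (card (S u)) \<le> 166400 * (lg D + real n * lg (lg D) / D)" if u: "u < n" for u
    proof (cases "(8 * j * l)\<^sup>2 \<le> n")
      case True
      then show ?thesis using md[OF _ u] r0 ll lg_ge(1)[of D] by fastforce
    next
      case nm: False
      have lb: "real l \<le> 10 * lg D" by (rule bits_le[OF h(2,3) _ jD(1) j1]) (use nm in simp)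
      obtain q where q: "l * l \<le> 2 ^ q" "real q \<le> 2 + 2 * log 2 (real l)" using ex_exponent[OF h(2)] by blast
      have "log 2 (real l) \<le> log 2 (16 * lg D)" using lb h(2) lg_ge(1)[of D] by simp
      also have "\<dots> = 4 + log 2 (lg D)"
      proof -
        have "log 2 16 = (4::real)" using log_pow_cancel[of "2::real" 4] by simp
        then show ?thesis using lg_ge(1)[of D] by (simp add: log_mult)
      qed
      \<comment> \<open>\<open>q + 1\<close> is at most
        \<open>11 + 2 * log 2 (lg D)\<close>.\<close>
      finally have "real q + 1 \<le> 13 * lg (lg D)" using q(2) lg_ge[of "lg D"] by linarith
      then have "real n / real j * (real q + 1) \<le> 64 * ?r * (13 * lg (lg D))"
        using nj r0 by (intro mult_mono) auto
      then have "real n / real j * (real q + 1) \<le> 832 * (real n * lg (lg D) / D)" by simp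
      then show ?thesis using h(5)[OF q(1) u] lb lg_ge(1)[of D] by argo
    qed
    show ?thesis using s t a by blast
  qed
  then show "(\<Sum>u<n. real (card (S u))) \<le> real n * (166400 * ?r)"
    and "u < n \<Longrightarrow> real (card (S u)) \<le> 166400 * (lg D + real n * lg (lg D) / D)"
    and "D \<le> sqrt (real n) / (ln (real n) * ln (ln (real n))) \<Longrightarrow> u < n \<Longrightarrow> real (card (S u)) \<le> 166400 * ?r"
    by blast+
qed

text \<open>\<open>m\<close> is taken about \<open>log 2 D\<close>, so that \<open>2 ^ m\<close> is
  at least \<open>D\<close>; with \<open>m \<le> 2 * lg D\<close> the factor
  \<open>6 * m + 3\<close> becomes \<open>15 * lg D\<close>.\<close>

lemma length_bound:
  assumes D: "0 < D" and L: "\<And>m. 2 ^ m * len \<le> 2 ^ m * ((6 * m + 3) * c) + 8 * n"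
  shows "real len \<le> 15 * lg D * real c + 8 * (real n / D)"
proof -
  let ?D = "nat \<lfloor>D\<rfloor>"
  have D1: "real ?D \<le> D" "D < real ?D + 1" using D by linarith+
  obtain m where m: "D \<le> 2 ^ m" "real m \<le> 2 * lg D"
  proof (cases "?D = 0")
    \<comment> \<open>Here \<open>D < 1\<close>, and \<open>m = 0\<close> does.\<close>
    case True
    then show ?thesis using D1 lg_ge(1)[of D] by (intro that[of 0]) auto
  next
    case False
    define m where "m = nat \<lceil>log 2 D\<rceil>"
    have D2: "1 \<le> D" using False D1 by linarith
    then have "0 \<le> log 2 D" by simp
    then have m: "log 2 D \<le> real m" "real m \<le> log 2 D + 1" unfolding m_def by linarith+
    have "D = 2 powr log 2 D" using D by simp
    also have "\<dots> \<le> 2 powr real m" using m(1) by simp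
    also have "\<dots> = 2 ^ m" by (simp add: powr_realpow)
    finally have "D \<le> 2 ^ m" .
    moreover have "real m \<le> 2 * lg D" using m(2) lg_ge[of D] by linarith
    ultimately show ?thesis by (rule that)
  qed
  have "real (2 ^ m * len) \<le> real (2 ^ m * ((6 * m + 3) * c) + 8 * n)" using L[of m] by (simp only: of_nat_le_iff)
  then have "2 ^ m * real len \<le> 2 ^ m * ((6 * real m + 3) * real c + 8 * real n / 2 ^ m)"
    by (simp add: distrib_left)
  then have "real len \<le> (6 * real m + 3) * real c + 8 * real n / 2 ^ m" by simp
  also have "(6 * real m + 3) * real c \<le> 15 * lg D * real c"
    using m(2) lg_ge(1)[of D] by (intro mult_right_mono) auto
  also have "8 * real n / 2 ^ m \<le> 8 * real n / D" using m(1) D by (intro divide_left_mono) auto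
  finally show ?thesis by simp
qed

lemma sizes_small_zero: "0 < D \<Longrightarrow> \<forall>u<n. S u = {} \<and> L u = [] \<Longrightarrow> 0 \<le> C \<Longrightarrow> sizes_small C n D S L"
  using lg_ge(1)[of D] lg_ge(1)[of "lg D"] unfolding sizes_small_def by auto

text \<open>\<open>2500000\<close> leaves room for \<open>15 * 166400 + 8\<close>, where 8 comes
  from the bits that are not charged to single hubs.\<close>

lemma sizes_small_good:
  assumes D: "0 < D" "nat \<lfloor>D\<rfloor> < n" and S: "\<And>u. u < n \<Longrightarrow> S u \<subseteq> {..<n}" and sz: "nat \<lfloor>D\<rfloor> < 32 \<or> sized n (nat \<lfloor>D\<rfloor>) S"
    and L: "\<And>m u. u < n \<Longrightarrow> 2 ^ m * length (L u) \<le> 2 ^ m * ((6 * m + 3) * card (S u)) + 8 * n"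
  shows "sizes_small 2500000 n D S L"
proof -
  let ?r = "real n / D"
  have cb: "(\<Sum>u<n. real (card (S u))) \<le> real n * (166400 * ?r)"
    "\<And>u. u < n \<Longrightarrow> real (card (S u)) \<le> 166400 * (lg D + real n * lg (lg D) / D)"
    "\<And>u. D \<le> sqrt (real n) / (ln (real n) * ln (ln (real n))) \<Longrightarrow> u < n \<Longrightarrow> real (card (S u)) \<le> 166400 * ?r"
    using card_bounds[OF D S sz] by blast+
  have lb: "real (length (L u)) \<le> 15 * lg D * real (card (S u)) + 8 * ?r" if "u < n" for u
    by (rule length_bound[OF D(1) L[OF that]])
  have r0: "0 \<le> ?r" using D by simp
  have lg1: "1 \<le> lg D" by (rule lg_ge)
  have lg0: "0 \<le> 15 * lg D" using lg1 by simp
  have rl: "?r \<le> ?r * lg D" using mult_left_mono[OF lg1 r0] by simp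
  have n0: "0 < real n" using D(2) by simp
  have gen: "2496000 * b + 8 * r \<le> 2500000 * b" if "r \<le> b" "0 \<le> r" for b r :: real using that by argo
  have len: "real (length (L u)) \<le> 15 * lg D * (166400 * x) + 8 * ?r"
    if "u < n" "real (card (S u)) \<le> 166400 * x" for u x
    using lb[OF that(1)] mult_left_mono[OF that(2) lg0] by linarith
  let ?x = "lg D + real n * lg (lg D) / D"
  have ll: "?r * lg D \<le> real n * lg D * lg (lg D) / D"
  proof -
    have "0 \<le> ?r * lg D" using rl r0 by linarith
    from mult_left_mono[OF lg_ge(1)[of "lg D"] this] show ?thesis by (simp add: mult_ac)
  qed
  have xx: "15 * lg D * (166400 * ?x) + 8 * ?r \<le> 2500000 * ((lg D)\<^sup>2 + real n * lg D * lg (lg D) / D)"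
  proof -
    have eq: "15 * lg D * (166400 * ?x) = 2496000 * ((lg D)\<^sup>2 + real n * lg D * lg (lg D) / D)"
      by (simp add: power2_eq_square algebra_simps)
    have "2496000 * (a + b) + 8 * r \<le> 2500000 * (a + b)" if "0 \<le> a" "r \<le> s" "s \<le> b" "0 \<le> r" for a b r s :: real
      using that by argo
    from this[OF _ rl ll r0] show ?thesis unfolding eq by simp
  qed
  have i: "real (card (S u)) \<le> 2500000 * ?r \<and> real (length (L u)) \<le> 2500000 * (real n * lg D / D)"
    if "D \<le> sqrt (real n) / (ln (real n) * ln (ln (real n)))" "u < n" for u
  proof -
    have "real (length (L u)) \<le> 15 * lg D * (166400 * ?r) + 8 * ?r" by (rule len[OF that(2) cb(3)[OF that]])
    also have "\<dots> = 2496000 * (?r * lg D) + 8 * ?r" by simp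
    also have "\<dots> \<le> 2500000 * (?r * lg D)" by (rule gen[OF rl r0])
    finally have "real (length (L u)) \<le> 2500000 * (real n * lg D / D)" by simp
    then show ?thesis using cb(3)[OF that] r0 by linarith
  qed
  have ii: "real (card (S u)) \<le> 2500000 * ?x \<and> real (length (L u)) \<le> 2500000 * ((lg D)\<^sup>2 + real n * lg D * lg (lg D) / D)"
    if "u < n" for u
  proof -
    have "0 \<le> real n * lg (lg D) / D" using lg_ge(1)[of "lg D"] D(1) by simp
    then have "166400 * ?x \<le> 2500000 * ?x" using lg1 by (intro mult_right_mono add_nonneg_nonneg) simp_all
    then show ?thesis using cb(2)[OF that] len[OF that cb(2)[OF that]] xx by linarith
  qed
  have "(\<Sum>u<n. real (length (L u))) \<le> (\<Sum>u<n. 15 * lg D * real (card (S u)) + 8 * ?r)" by (intro sum_mono lb) simp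
  also have "\<dots> = 15 * lg D * (\<Sum>u<n. real (card (S u))) + real n * (8 * ?r)" by (simp add: sum.distrib sum_distrib_left)
  also have "\<dots> \<le> 15 * lg D * (real n * (166400 * ?r)) + real n * (8 * ?r)"
    using mult_left_mono[OF cb(1) lg0] by linarith
  also have "\<dots> = real n * (2496000 * (?r * lg D) + 8 * ?r)" by (simp add: algebra_simps)
  also have "\<dots> \<le> real n * (2500000 * (?r * lg D))" using n0 by (intro mult_left_mono gen[OF rl r0]) simp
  finally have iii: "(\<Sum>u<n. real (length (L u))) / real n \<le> 2500000 * (real n * lg D / D)"
    using n0 by (simp add: divide_le_eq mult_ac)
  have "real n * (166400 * ?r) \<le> real n * (2500000 * ?r)" using r0 n0 by (intro mult_left_mono) linarith+
  then have "(\<Sum>u<n. real (card (S u))) \<le> 2500000 * ?r * real n" using cb(1) by (simp add: mult_ac)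
  then have iv: "(\<Sum>u<n. real (card (S u))) / real n \<le> 2500000 * ?r" using n0 by (simp add: pos_divide_le_eq)
  show ?thesis unfolding sizes_small_def using i ii iii iv by blast
qed

text \<open>A common hub on a shortest path bounds the infimum from above, the triangle inequality
  bounds it from below. Passing from \<open>D\<close> to its floor is harmless, as distances are
  integers.\<close>

lemma D_preserving_meets:
  assumes G: "connected_graph n E" and S: "\<And>u. u < n \<Longrightarrow> S u \<subseteq> {..<n}" and m: "meets n E (nat \<lfloor>D\<rfloor>) S" and D: "0 < D"
  shows "D_preserving n E D S"
  unfolding D_preserving_def
proof (intro allI impI)
  fix u v assume uv: "u < n" "v < n" and far: "D < real (gdist E u v)"
  have "nat \<lfloor>D\<rfloor> < gdist E u v" using far D by linarith
  then obtain w where w: "w \<in> S u \<inter> S v" "gdist E u w + gdist E w v = gdist E u v"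
    using m uv unfolding meets_def by blast
  show "hub_dist E S u v = enat (gdist E u v)"
    unfolding hub_dist_def
  proof (rule antisym)
    show "(INF w\<in>S u \<inter> S v. enat (gdist E u w + gdist E w v)) \<le> enat (gdist E u v)"
      using INF_lower[OF w(1), of "\<lambda>w. enat (gdist E u w + gdist E w v)"] w(2) by simp
    show "enat (gdist E u v) \<le> (INF w\<in>S u \<inter> S v. enat (gdist E u w + gdist E w v))"
    proof (rule INF_greatest)
      fix x assume "x \<in> S u \<inter> S v"
      then have "x < n" using S[OF uv(1)] by auto
      from gdist_tri[OF G uv this] show "enat (gdist E u v) \<le> enat (gdist E u x + gdist E x v)" by simp
    qed
  qed
qed

lemma sizes_small_mono:
  assumes "sizes_small C n D S L" "C \<le> C'" "0 < D" shows "sizes_small C' n D S L"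
proof -
  have le: "x \<le> C' * y" if "x \<le> C * y" "0 \<le> y" for x y
    using that mult_right_mono[OF assms(2) that(2)] by linarith
  have "0 \<le> lg D" "0 \<le> lg (lg D)" using lg_ge(1)[of D] lg_ge(1)[of "lg D"] by linarith+
  then have "0 \<le> real n / D" "0 \<le> real n * lg D / D" "0 \<le> lg D + real n * lg (lg D) / D"
    "0 \<le> (lg D)\<^sup>2 + real n * lg D * lg (lg D) / D"
    using assms(3) by simp_all
  then show ?thesis using assms(1) le unfolding sizes_small_def by blast
qed

lemma good_hub_labeling:
  assumes G: "connected_graph n E" and D: "0 < D" and g: "good n E (nat \<lfloor>D\<rfloor>) S L" and C: "2500000 \<le> C"
  shows "hub_labeling C read_hubs n E D S L"
proof -
  have S: "\<And>u. u < n \<Longrightarrow> S u \<subseteq> {..<n}" and m: "meets n E (nat \<lfloor>D\<rfloor>) S" and st: "stores_hubs read_hubs n E S L"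
    using g unfolding good_def by auto
  have "sizes_small C n D S L"
  proof (cases "nat \<lfloor>D\<rfloor> < n")
    case True
    then have "sizes_small 2500000 n D S L"
      using g unfolding good_def by (intro sizes_small_good[OF D]) auto
    then show ?thesis by (rule sizes_small_mono[OF _ C D])
  next
    case False
    then show ?thesis using g C unfolding good_def by (intro sizes_small_zero[OF D]) auto
  qed
  then show ?thesis using S st D_preserving_meets[OF G S m D] unfolding hub_labeling_def by blast
qed

theorem mainTheorem1:
  shows "\<exists>(C :: real) (rd :: bool list \<Rightarrow> (nat \<times> nat) set) (prog :: com) (k :: nat).
    \<forall>(n :: nat) (E :: (nat \<times> nat) set) (D :: real).
      connected_graph n E \<and> D > 0 \<longrightarrow>
        (\<exists>S L. hub_labeling C rd n E D S L) \<and>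
        expected_time prog (input n E D) \<le> ennreal (C * real n ^ k) \<and>
        (\<forall>(s, t) \<in> set_spmf (run prog (input n E D)).
           \<exists>S. hub_labeling C rd n E D S (out_labels s))"
proof -
  obtain c k where run: "\<And>n E D. connected_graph n E \<Longrightarrow> \<exists>s t. run prg (input n E D) = return_spmf (s, t) \<and>
     t \<le> c * n ^ k \<and> (\<exists>S. good n E (nat \<lfloor>D\<rfloor>) S (out_labels s))"
    using run_prg by blast
  \<comment> \<open>One constant has to serve the sizes and the running time.\<close>
  define C :: real where "C = max 2500000 (real c)"
  have "(\<exists>S L. hub_labeling C read_hubs n E D S L) \<and>
        expected_time prg (input n E D) \<le> ennreal (C * real n ^ k) \<and>
        (\<forall>(s, t) \<in> set_spmf (run prg (input n E D)). \<exists>S. hub_labeling C read_hubs n E D S (out_labels s))"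
    if G: "connected_graph n E" and D: "D > 0" for n E D
  proof -
    obtain s t S where r: "run prg (input n E D) = return_spmf (s, t)" "t \<le> c * n ^ k"
      "good n E (nat \<lfloor>D\<rfloor>) S (out_labels s)" using run[OF G] by blast
    have h: "hub_labeling C read_hubs n E D S (out_labels s)"
      by (rule good_hub_labeling[OF G D r(3)]) (simp add: C_def)
    have "real t \<le> real (c * n ^ k)" using r(2) by (simp only: of_nat_le_iff)
    also have "\<dots> = real c * real n ^ k" by simp
    also have "\<dots> \<le> C * real n ^ k" by (intro mult_right_mono) (simp_all add: C_def)
    finally have "ennreal (real t) \<le> ennreal (C * real n ^ k)" by (rule ennreal_leI)
    \<comment> \<open>The run is a point mass, so the expectation is its single value.\<close>
    moreover have "expected_time prg (input n E D) = ennreal (real t)"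
      unfolding expected_time_def r(1) by (simp add: measure_spmf_return_spmf nn_integral_return)
    ultimately show ?thesis using h r(1) by auto
  qed
  then show ?thesis by blast
qed

end
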